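(* Let $Q=(-10,10)^n\times(0,10]$, $J_2=(-1,1)^n\times(9,10]$ and $J_3=(-\tfrac12,\tfrac12)^n\times(\tfrac14,\tfrac12]$. Let $q>n+2$, $p_1<p\le q$, $f\in L^p(Q)$ and $\mu\in L^q(Q)$. There is a constant $C_4=C_4(n,\Lambda,\lambda,p,q,\|\mu\|_{L^q(Q)})>0$ such that the following holds. Let $G:Q\times\mathbb R^n\times\mathbb S^n\to\mathbb R$ be measurable and satisfy $$\mathcal P^-(X-Y)\le G(x,t,\xi,X)-G(x,t,\xi,Y)\le\mathcal P^+(X-Y),\qquad |G(x,t,\xi,O)|\le\mu(x,t)|\xi|$$ for all $(x,t)\in Q$, $\xi\in\mathbb R^n$, $X,Y\in\mathbb S^n$. Then every nonnegative $L^p$-viscosity solution $u\in C(\overline Q)$ of $$u_t+G(x,t,Du,D^2u)-f(x,t)=0\quad\text{in }Q$$ satisfies $$\sup_{J_3}u\le C_4\left(\inf_{J_2}u+\|f\|_{L^p(Q)}\right).$$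
   Context: Fix $n\in\mathbb N$ and constants $0<\lambda\le\Lambda<\infty$. $\mathbb S^n$ is the set of real symmetric $n\times n$ matrices with the usual order, and $O$ is the zero matrix. The Pucci operators are $\mathcal P^+(X)=\max\{-\mathrm{Tr}(AX): A\in\mathbb S^n,\ \lambda I\le A\le\Lambda I\}$ and $\mathcal P^-(X)=\min\{-\mathrm{Tr}(AX): A\in\mathbb S^n,\ \lambda I\le A\le\Lambda I\}$ for $X\in\mathbb S^n$. $Du$, $D^2u$ are the first and second derivatives in the space variable $x$, and $u_t$ is the time derivative. For $Q=\Omega\times(0,T]$ the parabolic boundary is $\partial_pQ=(\Omega\times\{0\})\cup(\partial\Omega\times[0,T))$. The parabolic distance is $d((x,t),(y,s))=\sqrt{|x-y|^2+|t-s|}$, and $Q'\Subset Q$ means that the parabolic distance from $Q'$ to $\partial_pQ$ is positive. $W^{2,1}_p(Q)$ is the set of $f\in L^p(Q)$ with weak derivatives $f_t,f_{x_k},f_{x_kx_\ell}\in L^p(Q)$, with norm the sum of the $L^p$ norms of $f$ and of these derivatives; $W^{2,1}_{p,\mathrm{loc}}(Q)$ consists of functions in $W^{2,1}_p(Q')$ for all $Q'\Subset Q$. Set $Q_r(x,t)=(x,t)+(-r,r)^n\times(-r^2,0]$. $L^p$-viscosity solutions: $u\in C(Q)$ is an $L^p$-viscosity subsolution (resp. supersolution) of $u_t+F(x,t,Du,D^2u)=0$ in $Q$ if for every $\phi\in W^{2,1}_{p,\mathrm{loc}}(Q)$ and every $(x,t)\in Q$ such that $u-\phi$ attains a maximum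 (resp. minimum) at $(x,t)$ over some cylinder $Q_r(x,t)\subset Q$, one has $\lim_{\varepsilon\to0}\operatorname{ess\,inf}_{(y,s)\in Q_\varepsilon(x,t)}\{\phi_t+F(y,s,D\phi,D^2\phi)\}\le0$ (resp. $\lim_{\varepsilon\to0}\operatorname{ess\,sup}_{(y,s)\in Q_\varepsilon(x,t)}\{\phi_t+F(y,s,D\phi,D^2\phi)\}\ge0$). It is an $L^p$-viscosity solution if it is both. $p_1=p_1(n,\Lambda/\lambda)\in[\frac{n+2}2,n+1)$ is the constant giving the range $p>p_1$ of exponents for which the Aleksandrov-Bakelman-Pucci maximum principle holds, i.e. for every $p>p_1$ there is $C=C(n,\Lambda,\lambda,p)$ such that, with $Q^*=\{|x|<1\}\times(0,1]$, for every $f\in L^p(Q^* )$ there is $u\in C(\overline{Q^*})\cap W^{2,1}_{p,\mathrm{loc}}(Q^* )$ with $u_t+\mathcal P^+(D^2u)=f$ a.e. in $Q^*$, $u=0$ on $\partial_pQ^*$, $-C\|f^-\|_{L^p(Q^* )}\le u\le C\|f^+\|_{L^p(Q^* )}$, and $\|u\|_{W^{2,1}_p(Q')}\le C'\|f\|_{L^p(Q^* )}$ for every $Q'\Subset Q^*$, where $C'$ depends only on $n,\Lambda,\lambda,p$ and the distance of $Q'$ to $\partial_pQ^*$. *)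

theory Defs
  imports "HOL-Analysis.Analysis"
begin

definition Sym :: "(real^'n^'n) set" where
  "Sym = {X. transpose X = X}"

definition mat_le :: "real^'n^'n \<Rightarrow> real^'n^'n \<Rightarrow> bool" where
  "mat_le A B \<longleftrightarrow> (\<forall>\<xi>. \<xi> \<bullet> (A *v \<xi>) \<le> \<xi> \<bullet> (B *v \<xi>))"

definition ellipticity_set :: "real \<Rightarrow> real \<Rightarrow> (real^'n^'n) set" where
  "ellipticity_set lam Lam = {A \<in> Sym. mat_le (mat lam) A \<and> mat_le A (mat Lam)}"

text \<open>For \<open>lam \<le> Lam\<close> the index set is compact and nonempty, so supremum and infimum
  are a maximum and a minimum.\<close>

definition pucci_plus :: "real \<Rightarrow> real \<Rightarrow> real^'n^'n \<Rightarrow> real" where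
  "pucci_plus lam Lam X = (SUP A\<in>ellipticity_set lam Lam. - trace (A ** X))"

definition pucci_minus :: "real \<Rightarrow> real \<Rightarrow> real^'n^'n \<Rightarrow> real" where
  "pucci_minus lam Lam X = (INF A\<in>ellipticity_set lam Lam. - trace (A ** X))"

definition sym_part :: "real^'n^'n \<Rightarrow> real^'n^'n" where
  "sym_part X = (1/2) *\<^sub>R (X + transpose X)"

text \<open>Space-time points are pairs \<open>(x, t)\<close>.\<close>

definition cyl :: "(real^'n) set \<Rightarrow> real \<Rightarrow> ((real^'n) \<times> real) set" where
  "cyl \<Omega> T = \<Omega> \<times> {0<..T}"

definition pbdry :: "(real^'n) set \<Rightarrow> real \<Rightarrow> ((real^'n) \<times> real) set" where
  "pbdry \<Omega> T = (\<Omega> \<times> {0}) \<union> (frontier \<Omega> \<times> {0..<T})"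

definition pdist :: "(real^'n) \<times> real \<Rightarrow> (real^'n) \<times> real \<Rightarrow> real" where
  "pdist z w = sqrt ((norm (fst z - fst w))\<^sup>2 + \<bar>snd z - snd w\<bar>)"

definition set_pdist :: "((real^'n) \<times> real) set \<Rightarrow> ((real^'n) \<times> real) set \<Rightarrow> real" where
  "set_pdist A B = (INF (z, w)\<in>A \<times> B. pdist z w)"

text \<open>The set \<open>Q'\<close> is strictly inside the cylinder over \<open>\<Omega>\<close> of height \<open>T\<close>; it may touch the
  top \<open>t = T\<close>. It is nonempty because the real-valued infimum over the empty set is unspecified.\<close>

definition strictly_inside ::
    "((real^'n) \<times> real) set \<Rightarrow> (real^'n) set \<Rightarrow> real \<Rightarrow> bool" where
  "strictly_inside Q' \<Omega> T \<longleftrightarrow>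
     Q' \<noteq> {} \<and> Q' \<in> sets lebesgue \<and> Q' \<subseteq> cyl \<Omega> T \<and> 0 < set_pdist Q' (pbdry \<Omega> T)"

definition pcyl :: "real \<Rightarrow> (real^'n) \<times> real \<Rightarrow> ((real^'n) \<times> real) set" where
  "pcyl r z = box (fst z - vec r) (fst z + vec r) \<times> {snd z - r\<^sup>2 <.. snd z}"

definition Lp :: "real \<Rightarrow> 'a::euclidean_space set \<Rightarrow> ('a \<Rightarrow> real) set" where
  "Lp p S = {f. f \<in> borel_measurable (lebesgue_on S) \<and>
                integrable (lebesgue_on S) (\<lambda>z. \<bar>f z\<bar> powr p)}"

definition Lp_norm :: "real \<Rightarrow> 'a::euclidean_space set \<Rightarrow> ('a \<Rightarrow> real) \<Rightarrow> real" where
  "Lp_norm p S f = (LINT z|lebesgue_on S. \<bar>f z\<bar> powr p) powr (1/p)"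

primrec Ck :: "nat \<Rightarrow> ('a::euclidean_space \<Rightarrow> real) \<Rightarrow> bool" where
  "Ck 0 f \<longleftrightarrow> continuous_on UNIV f"
| "Ck (Suc k) f \<longleftrightarrow> (\<forall>z. f differentiable (at z)) \<and>
     (\<forall>v. Ck k (\<lambda>z. frechet_derivative f (at z) v))"

definition test_functions :: "'a::euclidean_space set \<Rightarrow> ('a \<Rightarrow> real) set" where
  "test_functions U =
     {\<psi>. (\<forall>k. Ck k \<psi>) \<and> compact (closure {z. \<psi> z \<noteq> 0}) \<and> closure {z. \<psi> z \<noteq> 0} \<subseteq> U}"

text \<open>Only used for open \<open>U\<close>. Local integrability is required explicitly because the Bochner
  integral of a nonintegrable function is \<open>0\<close>.\<close>

definition has_weak_derivative ::
    "'a::euclidean_space set \<Rightarrow> 'a \<Rightarrow> ('a \<Rightarrow> real) \<Rightarrow> ('a \<Rightarrow> real) \<Rightarrow> bool" where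
  "has_weak_derivative U v f g \<longleftrightarrow>
     (\<forall>K. compact K \<and> K \<subseteq> U \<longrightarrow> f absolutely_integrable_on K \<and> g absolutely_integrable_on K) \<and>
     (\<forall>\<psi>\<in>test_functions U.
        (LINT z|lebesgue_on U. f z * frechet_derivative \<psi> (at z) v)
          = - (LINT z|lebesgue_on U. g z * \<psi> z))"

text \<open>The functions \<open>ft\<close>, \<open>Df\<close>, \<open>D2f\<close> are weak derivatives \<open>f\<^sub>t\<close>, \<open>Df\<close>, \<open>D\<^sup>2f\<close> of \<open>f\<close>. Sets such as
  \<open>\<Omega> \<times> (0,T]\<close> are not open, so test functions are supported in the interior; for these
  cylinders only a null set is lost. The derivatives are unique up to null sets there, which is why
  they are handled as a relation; in particular \<open>D2f\<close> is symmetric only almost everywhere.\<close>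

definition has_weak_derivs ::
    "((real^'n) \<times> real) set \<Rightarrow> ((real^'n) \<times> real \<Rightarrow> real) \<Rightarrow> ((real^'n) \<times> real \<Rightarrow> real)
      \<Rightarrow> ((real^'n) \<times> real \<Rightarrow> real^'n) \<Rightarrow> ((real^'n) \<times> real \<Rightarrow> real^'n^'n) \<Rightarrow> bool" where
  "has_weak_derivs Q f ft Df D2f \<longleftrightarrow>
     has_weak_derivative (interior Q) (0, 1) f ft \<and>
     (\<forall>k. has_weak_derivative (interior Q) (axis k 1, 0) f (\<lambda>z. Df z $ k)) \<and>
     (\<forall>k l. has_weak_derivative (interior Q) (axis l 1, 0) (\<lambda>z. Df z $ k) (\<lambda>z. D2f z $ k $ l))"

definition W21p :: "real \<Rightarrow> ((real^'n) \<times> real) set \<Rightarrow> ((real^'n) \<times> real \<Rightarrow> real) set" where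
  "W21p p Q = {f. f \<in> Lp p Q \<and> (\<exists>ft Df D2f. has_weak_derivs Q f ft Df D2f \<and>
     ft \<in> Lp p Q \<and> (\<forall>k. (\<lambda>z. Df z $ k) \<in> Lp p Q) \<and> (\<forall>k l. (\<lambda>z. D2f z $ k $ l) \<in> Lp p Q))}"

definition W21p_norm ::
    "real \<Rightarrow> ((real^'n) \<times> real) set \<Rightarrow> ((real^'n) \<times> real \<Rightarrow> real) \<Rightarrow> ((real^'n) \<times> real \<Rightarrow> real)
      \<Rightarrow> ((real^'n) \<times> real \<Rightarrow> real^'n) \<Rightarrow> ((real^'n) \<times> real \<Rightarrow> real^'n^'n) \<Rightarrow> real" where
  "W21p_norm p Q f ft Df D2f =
     Lp_norm p Q f + Lp_norm p Q ft + (\<Sum>k\<in>UNIV. Lp_norm p Q (\<lambda>z. Df z $ k))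
       + (\<Sum>k\<in>UNIV. \<Sum>l\<in>UNIV. Lp_norm p Q (\<lambda>z. D2f z $ k $ l))"

definition W21p_loc :: "real \<Rightarrow> (real^'n) set \<Rightarrow> real \<Rightarrow> ((real^'n) \<times> real \<Rightarrow> real) set" where
  "W21p_loc p \<Omega> T = {f. \<forall>Q'. strictly_inside Q' \<Omega> T \<longrightarrow> f \<in> W21p p Q'}"

text \<open>Essential bounds are taken along the almost-everywhere filter, as in the library's \<open>esssup\<close>
  (theory \<open>Essential_Supremum\<close>), but without its convention for nonmeasurable functions.\<close>

definition ess_inf :: "'a::euclidean_space set \<Rightarrow> ('a \<Rightarrow> real) \<Rightarrow> ereal" where
  "ess_inf S g = Liminf (ae_filter (lebesgue_on S)) (\<lambda>z. ereal (g z))"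

definition ess_sup :: "'a::euclidean_space set \<Rightarrow> ('a \<Rightarrow> real) \<Rightarrow> ereal" where
  "ess_sup S g = Limsup (ae_filter (lebesgue_on S)) (\<lambda>z. ereal (g z))"

text \<open>A test function \<open>\<phi>\<close> has to be its continuous representative, which exists for
  \<open>p > (n+2)/2\<close>: for arbitrary representatives the condition that \<open>u - \<phi>\<close> attains an extremum at
  a point would be meaningless.\<close>

definition Lp_visc_subsolution ::
    "real \<Rightarrow> (real^'n) set \<Rightarrow> real \<Rightarrow>
     ((real^'n) \<times> real \<Rightarrow> real^'n \<Rightarrow> real^'n^'n \<Rightarrow> real) \<Rightarrow> ((real^'n) \<times> real \<Rightarrow> real) \<Rightarrow> bool" where
  "Lp_visc_subsolution p \<Omega> T F u \<longleftrightarrow>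
     continuous_on (cyl \<Omega> T) u \<and>
     (\<forall>\<phi> \<phi>t D\<phi> D2\<phi>. \<phi> \<in> W21p_loc p \<Omega> T \<and> continuous_on (cyl \<Omega> T) \<phi> \<and>
        has_weak_derivs (cyl \<Omega> T) \<phi> \<phi>t D\<phi> D2\<phi> \<longrightarrow>
        (\<forall>z\<in>cyl \<Omega> T.
           (\<exists>r>0. pcyl r z \<subseteq> cyl \<Omega> T \<and> (\<forall>w\<in>pcyl r z. u w - \<phi> w \<le> u z - \<phi> z)) \<longrightarrow>
           Lim (at_right 0) (\<lambda>\<epsilon>. ess_inf (pcyl \<epsilon> z) (\<lambda>w. \<phi>t w + F w (D\<phi> w) (D2\<phi> w))) \<le> 0))"

definition Lp_visc_supersolution ::
    "real \<Rightarrow> (real^'n) set \<Rightarrow> real \<Rightarrow>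
     ((real^'n) \<times> real \<Rightarrow> real^'n \<Rightarrow> real^'n^'n \<Rightarrow> real) \<Rightarrow> ((real^'n) \<times> real \<Rightarrow> real) \<Rightarrow> bool" where
  "Lp_visc_supersolution p \<Omega> T F u \<longleftrightarrow>
     continuous_on (cyl \<Omega> T) u \<and>
     (\<forall>\<phi> \<phi>t D\<phi> D2\<phi>. \<phi> \<in> W21p_loc p \<Omega> T \<and> continuous_on (cyl \<Omega> T) \<phi> \<and>
        has_weak_derivs (cyl \<Omega> T) \<phi> \<phi>t D\<phi> D2\<phi> \<longrightarrow>
        (\<forall>z\<in>cyl \<Omega> T.
           (\<exists>r>0. pcyl r z \<subseteq> cyl \<Omega> T \<and> (\<forall>w\<in>pcyl r z. u z - \<phi> z \<le> u w - \<phi> w)) \<longrightarrow>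
           Lim (at_right 0) (\<lambda>\<epsilon>. ess_sup (pcyl \<epsilon> z) (\<lambda>w. \<phi>t w + F w (D\<phi> w) (D2\<phi> w))) \<ge> 0))"

definition Lp_visc_solution ::
    "real \<Rightarrow> (real^'n) set \<Rightarrow> real \<Rightarrow>
     ((real^'n) \<times> real \<Rightarrow> real^'n \<Rightarrow> real^'n^'n \<Rightarrow> real) \<Rightarrow> ((real^'n) \<times> real \<Rightarrow> real) \<Rightarrow> bool" where
  "Lp_visc_solution p \<Omega> T F u \<longleftrightarrow>
     Lp_visc_subsolution p \<Omega> T F u \<and> Lp_visc_supersolution p \<Omega> T F u"

text \<open>The type argument fixes the dimension. The constant \<open>C\<close> and the function \<open>C'\<close> (of the distance
  to the parabolic boundary) depend on the dimension, \<open>lam\<close>, \<open>Lam\<close> and \<open>p\<close> only.\<close>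

definition ABP_solvable :: "'n::finite itself \<Rightarrow> real \<Rightarrow> real \<Rightarrow> real \<Rightarrow> bool" where
  "ABP_solvable n lam Lam p \<longleftrightarrow>
     (let \<Omega> = ball (0::real^'n) 1; Q = cyl \<Omega> 1 in
      \<exists>(C::real) (C'::real \<Rightarrow> real). \<forall>f\<in>Lp p Q. \<exists>u ut Du D2u.
        continuous_on (closure Q) u \<and> u \<in> W21p_loc p \<Omega> 1 \<and> has_weak_derivs Q u ut Du D2u \<and>
        (AE z in lebesgue_on Q. ut z + pucci_plus lam Lam (D2u z) = f z) \<and>
        (\<forall>z\<in>pbdry \<Omega> 1. u z = 0) \<and>
        (\<forall>z\<in>Q. - C * Lp_norm p Q (\<lambda>w. max (- f w) 0) \<le> u z \<and>
                u z \<le> C * Lp_norm p Q (\<lambda>w. max (f w) 0)) \<and>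
        (\<forall>Q'. strictly_inside Q' \<Omega> 1 \<longrightarrow>
           W21p_norm p Q' u ut Du D2u \<le> C' (set_pdist Q' (pbdry \<Omega> 1)) * Lp_norm p Q f))"

definition ABP_threshold :: "'n::finite itself \<Rightarrow> real \<Rightarrow> real \<Rightarrow> real \<Rightarrow> bool" where
  "ABP_threshold n lam Lam p1 \<longleftrightarrow>
     (real CARD('n) + 2) / 2 \<le> p1 \<and> p1 < real CARD('n) + 1 \<and>
     (\<forall>p>p1. ABP_solvable n lam Lam p)"

definition cube :: "real \<Rightarrow> (real^'n) set" where
  "cube r = box (vec (- r)) (vec r)"

definition Q_dom :: "((real^'n) \<times> real) set" where
  "Q_dom = cyl (cube 10) 10"

definition J2 :: "((real^'n) \<times> real) set" where
  "J2 = cube 1 \<times> {9<..10}"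

definition J3 :: "((real^'n) \<times> real) set" where
  "J3 = cube (1/2) \<times> {1/4<..1/2}"

text \<open>A function on \<open>Q \<times> \<real>\<^sup>n \<times> Sym\<close> is represented by a function \<open>G\<close> whose values at nonsymmetric
  matrices are irrelevant. Since \<open>Sym\<close> is a null set in the space of all matrices, Lebesgue measurability
  on \<open>Q \<times> \<real>\<^sup>n \<times> Sym\<close> (with the Lebesgue measure of the vector space \<open>Sym\<close>) is expressed by composing
  with the linear projection \<open>sym_part\<close> onto \<open>Sym\<close>, which is equivalent by Fubini.\<close>

definition measurable_nonlinearity ::
    "((real^'n) \<times> real) set \<Rightarrow> ((real^'n) \<times> real \<Rightarrow> real^'n \<Rightarrow> real^'n^'n \<Rightarrow> real) \<Rightarrow> bool" where
  "measurable_nonlinearity Q G \<longleftrightarrow>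
     (\<lambda>(z, \<xi>, X). G z \<xi> (sym_part X)) \<in> borel_measurable (lebesgue_on (Q \<times> UNIV \<times> UNIV))"

definition structure_conditions ::
    "real \<Rightarrow> real \<Rightarrow> ((real^'n) \<times> real) set \<Rightarrow> ((real^'n) \<times> real \<Rightarrow> real) \<Rightarrow>
     ((real^'n) \<times> real \<Rightarrow> real^'n \<Rightarrow> real^'n^'n \<Rightarrow> real) \<Rightarrow> bool" where
  "structure_conditions lam Lam Q \<mu> G \<longleftrightarrow>
     (\<forall>z\<in>Q. \<forall>\<xi>. \<forall>X\<in>Sym. \<forall>Y\<in>Sym.
        pucci_minus lam Lam (X - Y) \<le> G z \<xi> X - G z \<xi> Y \<and>
        G z \<xi> X - G z \<xi> Y \<le> pucci_plus lam Lam (X - Y)) \<and>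
     (\<forall>z\<in>Q. \<forall>\<xi>. \<bar>G z \<xi> 0\<bar> \<le> \<mu> z * norm \<xi>)"

end

theory Submission
  imports Defs
begin

text \<open>The argument of Krylov and Safonov, run on functions that cannot be touched from below by a strict subsolution
  in \<open>W\<^sup>2\<^sup>,\<^sup>1\<^sub>p\<close>; for a solution \<open>u\<close> both \<open>u\<close> and \<open>K - u\<close> have this property. A Gaussian barrier, corrected by a solution of the
  extremal equation whose right-hand side lives where \<open>u\<close> is small, shows: if \<open>u\<close> is large on most of a box, then \<open>u\<close> is
  bounded below on a wider and later box. The drift is absorbed by a Neumann series, because for \<open>q > n + 2\<close> a potential
  estimate bounds \<open>\<mu> |Dw|\<close> in \<open>L\<^sup>p\<close> by the second derivatives of \<open>w\<close>. A covering by dyadic boxes upgrades positive density of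
  \<open>{u > H}\<close> to almost full density, and chains of boxes carry the lower bound to \<open>J2\<close>, losing a power \<open>\<gamma>\<close> of the initial radius.
  Finally, at a maximum point of \<open>u \<psi>\<^sup>\<gamma>\<close>, where \<open>\<psi>\<close> is the distance to the boundary of a cylinder containing \<open>J3\<close>, the same lemma
  applied to \<open>K - u\<close> shows that \<open>u\<close> is comparable to its value there on a set of positive density.\<close>

text \<open>The only analytic input is \<open>ABP_solvable\<close>: solutions of the extremal
  equation without drift on one cylinder, with bounds and interior estimates. A viscosity solution
  is never differentiated; it is compared with test functions built from that input. Three losses
  shape the argument. The estimates are interior, so solutions are cut off and keep the equation on
  the inner box \<open>reg\<close> only. The Pucci operator is sublinear but not linear, so summing
  corrections yields an inequality, which is all that comparison needs. The source \<open>f\<close>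
  does not scale with the height of \<open>u\<close>, so lower bounds are claimed only above a
  threshold \<open>omega\<close> that dominates the norm of \<open>f\<close>; if the height in
  question does not dominate that norm, the final estimate is immediate. Both exponent conditions
  come from scaling to radius \<open>r\<close>: the q-th power integral of the drift gains a factor
  \<open>r powr (q - (n+2))\<close> and the p-th power integral of the source a factor
  \<open>r powr (2*p - (n+2))\<close>, so the drift becomes small on small boxes and the source does
  not grow.\<close>

abbreviation LInt :: "('a::euclidean_space \<Rightarrow> real) \<Rightarrow> real" (binder "LI " 10) where "LInt f \<equiv> integral\<^sup>L lborel f"
abbreviation NInt :: "('a::euclidean_space \<Rightarrow> ennreal) \<Rightarrow> ennreal" (binder "NL " 10) where "NInt f \<equiv> integral\<^sup>N lborel f"
abbreviation AEl :: "('a::euclidean_space \<Rightarrow> bool) \<Rightarrow> bool" (binder "AEL " 10) where "AEl P \<equiv> almost_everywhere lborel P"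
abbreviation "Bor \<equiv> borel_measurable borel"
abbreviation "intl \<equiv> integrable lborel"
abbreviation "meas \<equiv> measure lborel"
abbreviation "emeas \<equiv> emeasure lborel"
abbreviation "fder \<equiv> frechet_derivative"
notation scaleR (infixr "*R" 75) and LIMSEQ (infixr "---->" 60)
lemmas int_nonneg = Bochner_Integration.integral_nonneg

section \<open>Smooth cut-offs and product test functions\<close>

text \<open>Trades \<open>frechet_derivative\<close> for any derivative at hand, so that the closure
  rules below can be proved with the derivative that the calculus rules produce.\<close>

lemma Ck_Suc_iff:
 "Ck (Suc k) f \<longleftrightarrow> (EX f'. (ALL z. (f has_derivative f' z) (at z)) & (ALL v. Ck k (%z. f' z v)))"
proof
 assume "Ck (Suc k) f"
 thus "EX f'. (ALL z. (f has_derivative f' z) (at z)) & (ALL v. Ck k (%z. f' z v))"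
  by (intro exI[of _ "%z. fder f (at z)"]) (auto simp: Ck.simps(2) frechet_derivative_works)
next
 assume "EX f'. (ALL z. (f has_derivative f' z) (at z)) & (ALL v. Ck k (%z. f' z v))"
 then obtain f' where f': "!!z. (f has_derivative f' z) (at z)" "!!v. Ck k (%z. f' z v)" by blast
 have "fder f (at z) = f' z" for z
  using frechet_derivative_at[OF f'(1)] by simp
 thus "Ck (Suc k) f"
  using f' by (auto simp: Ck.simps(2) differentiable_def)
qed

declare Ck.simps(2) [simp del]

lemma Ck_SucD: "Ck (Suc k) f ==> Ck k f"
proof (induction k arbitrary: f)
 case 0
 thus ?case
  by (auto simp: Ck.simps(2) continuous_on_eq_continuous_within dest: differentiable_imp_continuous_within)
next
 case (Suc k)
 obtain f' where f': "!!z. (f has_derivative f' z) (at z)" "!!v. Ck (Suc k) (%z. f' z v)"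
  using Suc.prems unfolding Ck_Suc_iff[of "Suc k"] by blast
 have "Ck k (%z. f' z v)" for v using Suc.IH f'(2) by blast
 thus ?case unfolding Ck_Suc_iff[of k] using f'(1) by blast
qed

lemma Ck_const: "Ck k (%z. c)"
proof (induction k arbitrary: c)
 case 0 thus ?case by simp
next
 case (Suc k)
 have "((%z. c) has_derivative (%v. 0)) (at z)" for z :: 'a by simp
 thus ?case using Suc[of 0] unfolding Ck_Suc_iff by (intro exI[of _ "%z v. 0"]) auto
qed

lemma Ck_add: "Ck k f ==> Ck k g ==> Ck k (%z. f z + g z)"
proof (induction k arbitrary: f g)
 case 0 thus ?case by (simp add: continuous_on_add)
next
 case (Suc k)
 obtain f' where f': "!!z. (f has_derivative f' z) (at z)" "!!v. Ck k (%z. f' z v)"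
  using Suc.prems(1) unfolding Ck_Suc_iff by blast
 obtain g' where g': "!!z. (g has_derivative g' z) (at z)" "!!v. Ck k (%z. g' z v)"
  using Suc.prems(2) unfolding Ck_Suc_iff by blast
 show ?case unfolding Ck_Suc_iff
  using f' g' Suc.IH by (intro exI[of _ "%z v. f' z v + g' z v"]) (auto intro!: has_derivative_add)
qed

lemma Ck_mult: "Ck k f ==> Ck k g ==> Ck k (%z. f z * g z)"
proof (induction k arbitrary: f g)
 case 0 thus ?case by (simp add: continuous_on_mult)
next
 case (Suc k)
 obtain f' where f': "!!z. (f has_derivative f' z) (at z)" "!!v. Ck k (%z. f' z v)"
  using Suc.prems(1) unfolding Ck_Suc_iff by blast
 obtain g' where g': "!!z. (g has_derivative g' z) (at z)" "!!v. Ck k (%z. g' z v)"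
  using Suc.prems(2) unfolding Ck_Suc_iff by blast
 show ?case unfolding Ck_Suc_iff
  using f' g' Suc.IH Suc.prems[THEN Ck_SucD]
  by (intro exI[of _ "%z v. f z * g' z v + f' z v * g z"]) (auto intro!: has_derivative_mult Ck_add)
qed

lemma Ck_prod: "(!!i. i : I ==> Ck k (f i)) ==> Ck k (%z. PROD i:I. f i z)"
 by (induction I rule: infinite_finite_induct) (auto intro: Ck_const Ck_mult)

lemma Ck_affine:
 assumes L: "bounded_linear L"
 shows "Ck k f ==> Ck k (%z. f (c + L z))"
proof (induction k arbitrary: f)
 case 0
 thus ?case
  using linear_continuous_on[OF L, of UNIV]
  by (auto intro!: continuous_on_add continuous_on_const continuous_on_compose2[of UNIV f])
next
 case (Suc k)
 obtain f' where f': "!!z. (f has_derivative f' z) (at z)" "!!v. Ck k (%z. f' z v)"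
  using Suc.prems(1) unfolding Ck_Suc_iff by blast
 have "((%z. f (c + L z)) has_derivative (%v. f' (c + L z) (L v))) (at z)" for z
  by (rule has_derivative_compose[OF _ f'(1)])
   (auto intro!: derivative_eq_intros bounded_linear_imp_has_derivative[OF L])
 thus ?case unfolding Ck_Suc_iff
  using f' Suc.IH by (intro exI[of _ "%z v. f' (c + L z) (L v)"]) auto
qed

definition smooth :: "('a::euclidean_space => real) => bool" where
 "smooth f \<longleftrightarrow> (ALL k. Ck k f)"

lemma smooth_const [intro, simp]: "smooth (%z. c)" by (simp add: smooth_def Ck_const)
lemma smooth_add [intro]: "smooth f ==> smooth g ==> smooth (%z. f z + g z)"
 by (simp add: smooth_def Ck_add)
lemma smooth_mult [intro]: "smooth f ==> smooth g ==> smooth (%z. f z * g z)"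
 by (simp add: smooth_def Ck_mult)
lemma smooth_prod [intro]: "(!!i. i : I ==> smooth (f i)) ==> smooth (%z. PROD i:I. f i z)"
 by (simp add: smooth_def Ck_prod)
lemma smooth_minus: "smooth f ==> smooth (%z. - f z)"
 using smooth_mult[of "%_. -1" f] by simp
lemma smooth_diff [intro]: "smooth f ==> smooth g ==> smooth (%z. f z - g z)"
 using smooth_add[of f "%z. - g z"] smooth_minus[of g] by simp
lemma smooth_affine: "bounded_linear L ==> smooth f ==> smooth (%z. f (c + L z))"
 by (simp add: smooth_def Ck_affine)

lemma smooth_has_derivative:
 "smooth f ==> (f has_derivative fder f (at z)) (at z)"
 unfolding smooth_def by (metis Ck.simps(2) frechet_derivative_works)

lemma smooth_frechet: "smooth f ==> smooth (%z. fder f (at z) v)"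
 unfolding smooth_def by (metis Ck.simps(2))

lemma smooth_continuous: "smooth f ==> continuous_on UNIV f"
 unfolding smooth_def using Ck.simps(1) by blast

lemma smooth_borel: "smooth f ==> f : Bor"
 using smooth_continuous borel_measurable_continuous_onI by blast

lemma frechet_mult:
 assumes "smooth f" "smooth g"
 shows "fder (%z. f z * g z) (at z) v =
  f z * fder g (at z) v + fder f (at z) v * g z"
proof -
 have "((%z. f z * g z) has_derivative
   (%v. f z * fder g (at z) v + fder f (at z) v * g z)) (at z)"
  using assms by (intro has_derivative_mult smooth_has_derivative)
 from frechet_derivative_at[OF this] show ?thesis by metis
qed

lemma smooth_real_antideriv:
 fixes B b :: "real => real"
 assumes "!!x. (B has_real_derivative b x) (at x)" "smooth b"
 shows "smooth B"
proof -
 have "Ck (Suc k) B" for k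
 proof -
  have "(B has_derivative (%v. b z * v)) (at z)" for z
   using assms(1)[of z] by (simp add: has_field_derivative_def)
  moreover have "Ck k (%z. b z * v)" for v
   using Ck_mult[OF _ Ck_const[of k v]] assms(2) by (auto simp: smooth_def)
  ultimately show ?thesis unfolding Ck_Suc_iff by (intro exI[of _ "%z v. b z * v"]) auto
 qed
 hence "Ck k B" for k by (rule Ck_SucD)
 thus ?thesis by (simp add: smooth_def)
qed

text \<open>The classical flat function \<open>exp (-1/x)\<close> with polynomial weights. The power
  \<open>m\<close> is carried because differentiation maps the linear span of the family into
  itself, which gives smoothness by induction for all \<open>m\<close> at once.\<close>

definition flat :: "nat => real => real" where
 "flat m x = (if x > 0 then (1/x) ^ m * exp (- 1 / x) else 0)"

text \<open>One term of the exponential series, the one of degree \<open>m + 2\<close>, already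
  dominates. Quadratic decay is what makes the derivative at \<open>0\<close> exist and
  vanish.\<close>

lemma flat_le: "x > 0 ==> flat m x <= fact (m + 2) * x^2"
proof -
 assume x: "x > 0"
 have "(1/x) ^ (m+2) / fact (m+2) <= exp (1/x)"
 proof -
  have "(%n. (1/x) ^ n / fact n) sums exp (1/x)"
   using exp_converges[of "1/x"] by (simp add: field_simps scaleR_conv_of_real)
  from sum_le_suminf[OF sums_summable[OF this], of "{m+2}"] sums_unique[OF this] show ?thesis
   using x by simp
 qed
 hence "(1/x)^m * (1/x)^2 <= fact (m+2) * exp (1/x)"
  unfolding power_add by (metis fact_gt_zero mult.commute pos_divide_le_eq)
 hence "(1/x)^m * (1/x)^2 * x^2 * exp (-1/x) <= fact (m+2) * exp (1/x) * x^2 * exp (-1/x)"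
  by (intro mult_right_mono) auto
 moreover have "(1/x)^2 * x^2 = 1" using x by (simp add: power_one_over)
 moreover have "exp (1/x) * exp (-1/x) = 1" by (simp add: exp_add[symmetric])
 moreover have "(1/x)^m * (1/x)^2 * x^2 * exp (-1/x) = (1/x)^m * exp (-1/x) * ((1/x)^2 * x^2)"
  "fact (m+2) * exp (1/x) * x^2 * exp (-1/x) = fact (m+2) * x^2 * (exp (1/x) * exp (-1/x))" by auto
 ultimately show ?thesis using x by (simp only: flat_def if_True mult_1_right)
qed

lemma flat_DERIV: "(flat m has_real_derivative flat (m + 2) x - m * flat (m + 1) x) (at x)"
proof -
 consider "x > 0" | "x < 0" | "x = 0" by linarith
 thus ?thesis
 proof cases
  case 1
  have h1: "((%x. 1/x) has_real_derivative - (1/x^2)) (at x)"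
   using 1 by (auto intro!: derivative_eq_intros simp: power2_eq_square)
  have h2: "((%x. exp (- 1 / x)) has_real_derivative exp (-1/x) * (1/x^2)) (at x)"
   using 1 by (auto intro!: derivative_eq_intros simp: power2_eq_square)
  have "((%x. (1/x) ^ m * exp (- 1 / x)) has_real_derivative flat (m + 2) x - m * flat (m + 1) x) (at x)"
   using 1 by (intro DERIV_cong[OF DERIV_mult[OF DERIV_power[OF h1] h2]], cases m)
    (simp_all add: flat_def power_add power2_eq_square algebra_simps)
  thus ?thesis
   by (rule has_field_derivative_transform_within_open[where S="{0<..}"]) (use 1 in \<open>auto simp: flat_def\<close>)
 next
  case 2
  have "((%x. 0) has_real_derivative 0) (at x)" by simp
  hence "(flat m has_real_derivative 0) (at x)"
   by (rule has_field_derivative_transform_within_open[where S="{..<0}"]) (use 2 in \<open>auto simp: flat_def\<close>)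
  thus ?thesis using 2 by (simp add: flat_def)
 next
  case 3
  have "((%h. flat m h / h) \<longlongrightarrow> 0) (at 0)"
  proof (rule Lim_null_comparison)
   show "\<forall>\<^sub>F h in at 0. norm (flat m h / h) <= fact (m+2) * abs h"
   proof (rule always_eventually, rule)
    fix h :: real
    show "norm (flat m h / h) <= fact (m+2) * abs h"
    proof (cases "h > 0")
     case True
     have "flat m h >= 0" using True by (simp add: flat_def)
     thus ?thesis using flat_le[OF True, of m] True
      by (simp add: divide_le_eq power2_eq_square mult.assoc)
    next
     case False
     hence "flat m h = 0" by (simp add: flat_def)
     thus ?thesis by simp
    qed
   qed
   have "((%h. fact (m+2) * abs h) \<longlongrightarrow> fact (m+2) * abs 0) (at (0::real))"
    by (intro tendsto_intros)
   thus "((%h. fact (m+2) * abs h) \<longlongrightarrow> 0) (at (0::real))" by simp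
  qed
  hence "(flat m has_real_derivative 0) (at 0)"
   by (simp add: DERIV_def flat_def[of m 0])
  thus ?thesis using 3 by (simp add: flat_def[of _ 0])
 qed
qed

lemma smooth_flat: "smooth (flat m)"
proof -
 have "Ck k (flat m)" for k
 proof (induction k arbitrary: m)
  case 0
  thus ?case using flat_DERIV
   by (auto simp: continuous_on_eq_continuous_within intro!: DERIV_isCont)
 next
  case (Suc k)
  have "(flat m has_derivative (%v. (flat (m+2) z - m * flat (m+1) z) * v)) (at z)" for z
   using flat_DERIV[of m z] by (simp add: has_field_derivative_def)
  moreover have "Ck k (%z. (flat (m+2) z + (- real m) * flat (m+1) z) * v)" for v
   by (intro Ck_mult Ck_add Ck_const Suc)
  ultimately show ?case unfolding Ck_Suc_iff
   by (intro exI[of _ "%z v. (flat (m+2) z - m * flat (m+1) z) * v"]) auto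
 qed
 thus ?thesis by (simp add: smooth_def)
qed

text \<open>A normalised antiderivative of a two-sided bump. Its derivative is exported with it,
  because the step serves as cut-off and the derivative as mollifier.\<close>

lemma smooth_step_exists:
 "EX S. smooth S & (EX et. smooth et & (ALL x. (S has_real_derivative et x) (at x)) & (ALL x. 0 <= et x)
  & (ALL x. 1 <= abs x --> et x = 0))
  & (ALL x<=-1. S x = 0) & (ALL x>=1. S x = (1::real))"
proof -
 define b where "b x = flat 0 (1 + 1 * x) * flat 0 (1 + (-1) * x)" for x :: real
 have sb: "smooth b" unfolding b_def
  by (intro smooth_mult smooth_affine smooth_flat bounded_linear_mult_right)
 have "EX F. ALL x::real. -\<infinity> < ereal x --> ereal x < \<infinity> --> (F has_vector_derivative b x) (at x)"
  using smooth_continuous[OF sb]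
  by (intro einterval_antiderivative) (auto simp: continuous_on_eq_continuous_at)
 then obtain B where "!!x. (B has_vector_derivative b x) (at x)" by auto
 hence B: "(B has_real_derivative b x) (at x)" for x
  by (simp add: has_real_derivative_iff_has_vector_derivative)
 have b0: "b x >= 0" for x by (simp add: b_def flat_def)
 have bz: "b x = 0" if "1 <= abs x" for x using that by (auto simp: b_def flat_def)
 have "B (-1) < B 1"
 proof -
  have mono: "B s <= B t" if "s <= t" for s t
   using B b0 that by (intro DERIV_nonneg_imp_nondecreasing[of s t B]) auto
  have "b 0 > 0" by (simp add: b_def flat_def)
  then obtain d where d: "d > 0" "!!h. 0 < h ==> h < d ==> B 0 < B (0 + h)"
   using DERIV_pos_inc_right[OF B[of 0]] by auto
  define h where "h = min (d/2) 1"
  have "h > 0" "h < d" "h <= 1" using d(1) by (auto simp: h_def)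
  hence "B 0 < B h" using d(2)[of h] by simp
  thus ?thesis using mono[of "-1" 0] mono[of h 1] \<open>h <= 1\<close> by linarith
 qed
 have L: "B x = B (-1)" if "x <= -1" for x
 proof (cases "x = -1")
  case False
  have "ALL y. x <= y & y <= -1 --> (B has_real_derivative 0) (at y)"
  proof (intro allI impI)
   fix y assume "x <= y & y <= -1"
   hence "b y = 0" by (intro bz) auto
   thus "(B has_real_derivative 0) (at y)" using B[of y] by simp
  qed
  moreover have "continuous_on {x..-1} B"
   using B by (intro DERIV_atLeastAtMost_imp_continuous_on) auto
  ultimately show ?thesis using DERIV_isconst_end[of x "-1" B] that False by auto
 qed simp
 have R: "B x = B 1" if "x >= 1" for x
 proof (cases "x = 1")
  case False
  have "ALL y. 1 <= y & y <= x --> (B has_real_derivative 0) (at y)"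
  proof (intro allI impI)
   fix y assume "1 <= y & y <= x"
   hence "b y = 0" by (intro bz) auto
   thus "(B has_real_derivative 0) (at y)" using B[of y] by simp
  qed
  moreover have "continuous_on {1..x} B"
   using B by (intro DERIV_atLeastAtMost_imp_continuous_on) auto
  ultimately show ?thesis using DERIV_isconst_end[of 1 x B] that False by auto
 qed simp
 define c where "c = 1 / (B 1 - B (-1))"
 have c: "c > 0" using \<open>B (-1) < B 1\<close> by (simp add: c_def)
 show ?thesis
 proof (rule exI[of _ "%x. c * (B x - B (-1))"], intro conjI allI impI)
  show "smooth (%x. c * (B x - B (-1)))"
   by (intro smooth_mult smooth_diff smooth_const smooth_real_antideriv[OF B sb])
  have "smooth (%x. c * b x)" by (intro smooth_mult smooth_const sb)
  moreover have "((%x. c * (B x - B (-1))) has_real_derivative c * b x) (at x)" for x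
   using DERIV_cmult[OF DERIV_diff[OF B DERIV_const]] by simp
  moreover have "0 <= c * b x" for x using b0[of x] c by simp
  moreover have "c * b x = 0" if "1 <= abs x" for x using bz[OF that] by simp
  ultimately show "EX et. smooth et & (ALL x. ((%x. c * (B x - B (-1))) has_real_derivative et x) (at x))
    & (ALL x. 0 <= et x) & (ALL x. 1 <= abs x --> et x = 0)"
   by (intro exI[of _ "%x. c * b x"]) simp
  show "c * (B x - B (-1)) = 0" if "x <= -1" for x using L[OF that] by simp
  show "c * (B x - B (-1)) = 1" if "x >= 1" for x
   using R[OF that] \<open>B (-1) < B 1\<close> by (simp add: c_def)
 qed
qed

definition stp :: "real => real" where
 "stp = (SOME S. smooth S & (EX et. smooth et & (ALL x. (S has_real_derivative et x) (at x)) & (ALL x. 0 <= et x)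
  & (ALL x. 1 <= abs x --> et x = 0))
  & (ALL x<=-1. S x = 0) & (ALL x>=1. S x = (1::real)))"

text \<open>A bump of total mass one on [-1,1]: the one-dimensional factor of the mollifier in the
  potential estimate.\<close>

definition eta :: "real => real" where "eta x = deriv stp x"

lemma stp_props:
 shows smooth_stp: "smooth stp" and stp_DERIV: "(stp has_real_derivative eta x) (at x)"
  and smooth_eta: "smooth eta"
  and eta_nonneg: "0 <= eta x" and eta_0: "1 <= abs x ==> eta x = 0"
  and stp_0: "x <= -1 ==> stp x = 0" and stp_1: "x >= 1 ==> stp x = 1"
proof -
 note * = someI_ex[OF smooth_step_exists, folded stp_def]
 then obtain et where et: "smooth et" "!!x. (stp has_real_derivative et x) (at x)"
  "!!x. 0 <= et x" "!!x. 1 <= abs x ==> et x = 0" by blast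
 have "eta = et" using et(2) by (auto simp: eta_def DERIV_imp_deriv)
 thus "smooth stp" "(stp has_real_derivative eta x) (at x)" "smooth eta" "0 <= eta x"
  "1 <= abs x ==> eta x = 0" "x <= -1 ==> stp x = 0" "x >= 1 ==> stp x = 1"
  using * et by auto
qed

lemma stp_mono: "x <= y ==> stp x <= stp y"
 using stp_DERIV eta_nonneg by (intro DERIV_nonneg_imp_nondecreasing[of x y stp]) auto

lemma stp_bounds: "0 <= stp x" "stp x <= 1"
 using stp_mono[of x "max x 1"] stp_mono[of "min x (-1)" x] stp_0[of "min x (-1)"] stp_1[of "max x 1"]
 by auto

lemma frechet_directional:
 fixes f :: "'a::euclidean_space => real"
 assumes "smooth f" "((%s. f (z + s *R v)) has_real_derivative D) (at 0)"
 shows "fder f (at z) v = D"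
proof -
 let ?F = "fder f (at z)"
 have "((%s. f (z + s *R v)) has_derivative (%s. ?F (s *R v))) (at 0)"
  by (rule has_derivative_compose[of "%s. z + s *R v" _ 0])
   (auto intro!: derivative_eq_intros smooth_has_derivative assms)
 moreover have "?F (s *R v) = ?F v * s" for s
  using linear_cmul[OF has_derivative_linear[OF smooth_has_derivative[OF assms(1), of z]], of s v] by simp
 ultimately have "((%s. f (z + s *R v)) has_real_derivative ?F v) (at 0)"
  by (simp add: has_field_derivative_def)
 thus ?thesis using assms(2) DERIV_unique by blast
qed

lemma directional_DERIV:
 fixes f :: "'a::euclidean_space => real"
 assumes "smooth f"
 shows "((%s. f (z + s *R v)) has_real_derivative fder f (at (z + s *R v)) v) (at s)"
proof -
 let ?F = "fder f (at (z + s *R v))"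
 have "((%s. f (z + s *R v)) has_derivative (%t. ?F (t *R v))) (at s)"
  by (rule has_derivative_compose[of "%s. z + s *R v" _ s])
   (auto intro!: derivative_eq_intros smooth_has_derivative assms)
 moreover have "?F (t *R v) = ?F v * t" for t
  using linear_cmul[OF has_derivative_linear[OF smooth_has_derivative[OF assms(1), of "z + s *R v"]], of t v] by simp
 ultimately show ?thesis by (simp add: has_field_derivative_def)
qed

section \<open>Test functions on the whole space and their product form\<close>

definition tfun :: "('a::euclidean_space => real) => bool" where
 "tfun psi \<longleftrightarrow> psi : test_functions UNIV"

lemma tfun_iff: "tfun psi \<longleftrightarrow> smooth psi & bounded {z. psi z ~= 0}"
 by (auto simp: tfun_def test_functions_def smooth_def compact_closure)

lemma tfun_smooth: "tfun psi ==> smooth psi" by (simp add: tfun_iff)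

lemma support_frechet: "closure {z. fder f (at z) v ~= 0} <= closure {z. f z ~= 0}"
proof (rule closure_minimal)
 show "{z. fder f (at z) v ~= 0} <= closure {z. f z ~= 0}"
 proof (rule subsetI, rule ccontr)
  fix z assume z: "z : {z. fder f (at z) v ~= 0}" "z ~: closure {z. f z ~= 0}"
  let ?S = "- closure {z. f z ~= 0}"
  have *: "f w = 0" if "w : ?S" for w
   using that closure_subset[of "{z. f z ~= 0}"] by blast
  have zS: "z : ?S" using z(2) by blast
  have oS: "open ?S" by blast
  have "((%z. 0) has_derivative (%v. 0)) (at z)" by (rule has_derivative_const)
  from has_derivative_transform_within_open[OF this oS zS, of f] *
  have "(f has_derivative (%v. 0)) (at z)" by presburger
  from fun_cong[OF frechet_derivative_at[OF this], of v] have "fder f (at z) v = 0" by simp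
  thus False using z(1) by simp
 qed
qed simp

lemma tfun_frechet:
 assumes "tfun psi" shows "tfun (%z. fder psi (at z) v)"
proof -
 have "{z. fder psi (at z) v ~= 0} <= closure {z. psi z ~= 0}"
  by (rule order_trans[OF closure_subset support_frechet])
 moreover have "bounded (closure {z. psi z ~= 0})" using assms by (simp add: tfun_iff bounded_closure)
 ultimately show ?thesis using smooth_frechet[OF tfun_smooth[OF assms], of v]
  by (simp add: tfun_iff bounded_subset)
qed

lemma tfun_mult: "smooth et ==> tfun psi ==> tfun (%z. et z * psi z)"
 by (auto simp: tfun_iff intro: bounded_subset)

lemma tfun_bounded: assumes "tfun psi" obtains B where "!!z. abs (psi z) <= B" "B >= 0"
proof -
 have "compact (closure {z. psi z ~= 0})" using assms by (simp add: tfun_iff compact_closure)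
 moreover have "continuous_on (closure {z. psi z ~= 0}) psi"
  using assms smooth_continuous continuous_on_subset unfolding tfun_iff by blast
 ultimately have "bounded (psi ` closure {z. psi z ~= 0})"
  using compact_continuous_image compact_imp_bounded by blast
 then obtain B where B: "!!z. z : closure {z. psi z ~= 0} ==> abs (psi z) <= B"
  by (auto simp: bounded_iff)
 have "abs (psi z) <= max B 0" for z
  using B[of z] closure_subset[of "{z. psi z ~= 0}"] by (cases "psi z = 0") auto
 thus ?thesis by (intro that[of "max B 0"]) auto
qed

lemma smooth_inner_comp: "smooth g ==> smooth (%z. g (z \<bullet> b))"
 using smooth_affine[of "%z. z \<bullet> b" g 0] by (simp add: bounded_linear_inner_left)

text \<open>Products are used because a derivative along a basis vector changes exactly one factor,
  and because boxes and dyadic rescalings act on the factors separately.\<close>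

definition ptest :: "('a::euclidean_space => real => real) => 'a => real" where
 "ptest g z = (PROD b:Basis. g b (z \<bullet> b))"

lemma smooth_ptest: "(!!b. b : Basis ==> smooth (g b)) ==> smooth (ptest g)"
 unfolding ptest_def[abs_def] by (intro smooth_prod smooth_inner_comp)

lemma ptest_support:
 assumes "!!b x. b : Basis ==> g b x ~= 0 ==> l \<bullet> b <= x & x <= u \<bullet> b"
 shows "{z. ptest g z ~= 0} <= cbox l u"
 using assms by (auto simp: ptest_def mem_box)

lemma tfun_ptest:
 assumes "!!b. b : Basis ==> smooth (g b)"
  and "!!b x. b : Basis ==> g b x ~= 0 ==> l \<bullet> b <= x & x <= u \<bullet> b"
 shows "tfun (ptest g)"
 using smooth_ptest[of g] ptest_support[of g l u] assms bounded_subset[OF bounded_cbox]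
 by (auto simp: tfun_iff)

lemma frechet_ptest:
 assumes "!!b. b : Basis ==> smooth (g b)" and i: "i : Basis"
  and g': "!!x. (g i has_real_derivative g' x) (at x)"
 shows "fder (ptest g) (at z) i = ptest (g(i := g')) z"
proof (rule frechet_directional)
 show "smooth (ptest g)" by (rule smooth_ptest) (use assms in auto)
 have split: "ptest h w = h i (w \<bullet> i) * (PROD b:Basis-{i}. h b (w \<bullet> b))" for h :: "'a => real => real" and w
  unfolding ptest_def using i by (simp add: prod.remove)
 have "ptest g (z + s *R i) = g i (z \<bullet> i + s) * (PROD b:Basis-{i}. g b (z \<bullet> b))" for s
 proof -
  have "(PROD b:Basis-{i}. g b ((z + s *R i) \<bullet> b)) = (PROD b:Basis-{i}. g b (z \<bullet> b))"
   by (rule prod.cong) (use i in \<open>auto simp: inner_add_left inner_Basis\<close>)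
  thus ?thesis unfolding split using i by (simp add: inner_add_left)
 qed
 moreover have "((%s. g i (z \<bullet> i + s) * (PROD b:Basis-{i}. g b (z \<bullet> b))) has_real_derivative
  g' (z \<bullet> i) * (PROD b:Basis-{i}. g b (z \<bullet> b))) (at 0)"
 proof -
  have "((%s. g i (s + z \<bullet> i)) has_real_derivative g' (z \<bullet> i)) (at 0)"
   using g'[of "0 + z \<bullet> i"] unfolding DERIV_shift by simp
  from DERIV_cmult_right[OF this] show ?thesis by (simp only: add.commute)
 qed
 moreover have "ptest (g(i := g')) z = g' (z \<bullet> i) * (PROD b:Basis-{i}. g b (z \<bullet> b))"
  unfolding split by (auto intro!: prod.cong)
 ultimately show "((%s. ptest g (z + s *R i)) has_real_derivative ptest (g(i := g')) z) (at 0)"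
  by simp
qed

section \<open>Weak derivatives on the whole space\<close>

text \<open>The second difference over a parallelogram is symmetric in the two directions, and the
  mean value theorem used in either order turns it into either mixed derivative at a nearby
  point.\<close>

lemma frechet_second_symmetric:
 fixes f :: "'a::euclidean_space => real"
 assumes f: "smooth f"
 shows "fder (%z. fder f (at z) v) (at z) w
   = fder (%z. fder f (at z) w) (at z) v"
proof -
 define d where "d u x = fder f (at x) u" for u x
 define dd where "dd u u' x = fder (d u) (at x) u'" for u u' x
 have sd: "smooth (d u)" for u unfolding d_def by (rule smooth_frechet[OF f])
 have sdd: "smooth (dd u u')" for u u' unfolding dd_def by (rule smooth_frechet[OF sd])
 have key: "EX xi zeta. 0 < xi & xi < h & 0 < zeta & zeta < h &
   f (z + h *R u + h *R u') - f (z + h *R u) - f (z + h *R u') + f z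
    = h * (h * dd u u' (z + xi *R u + zeta *R u'))" if h: "h > 0" for h u u'
 proof -
  have "((%s. f ((z + h *R u') + s *R u) - f (z + s *R u)) has_real_derivative
    d u ((z + h *R u') + s *R u) - d u (z + s *R u)) (at s)" for s
   unfolding d_def by (intro DERIV_diff directional_DERIV f)
  from MVT2[OF h this] obtain xi where xi: "0 < xi" "xi < h"
   "f ((z + h *R u') + h *R u) - f (z + h *R u) - (f (z + h *R u') - f z)
    = h * (d u ((z + h *R u') + xi *R u) - d u (z + xi *R u))"
   by auto
  have "((%s. d u (z + xi *R u + s *R u')) has_real_derivative dd u u' (z + xi *R u + s *R u')) (at s)" for s
   unfolding dd_def by (intro directional_DERIV sd)
  from MVT2[OF h this] obtain zeta where zeta: "0 < zeta" "zeta < h"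
   "d u (z + xi *R u + h *R u') - d u (z + xi *R u) = h * dd u u' (z + xi *R u + zeta *R u')"
   by auto
  show ?thesis using xi zeta by (intro exI[of _ xi] exI[of _ zeta]) (simp add: algebra_simps)
 qed
 define h where "h n = inverse (real (Suc n))" for n
 have hpos: "h n > 0" for n by (simp add: h_def)
 have hlim: "h ----> 0" unfolding h_def by (rule LIMSEQ_inverse_real_of_nat)
 have conv: "EX g. g ----> dd u u' z & (ALL n. f (z + h n *R u + h n *R u') - f (z + h n *R u) - f (z + h n *R u') + f z
    = h n * (h n * g n))" for u u'
 proof -
  obtain xi zeta where xi: "!!n. 0 < xi n" "!!n. xi n < h n" and zeta: "!!n. 0 < zeta n" "!!n. zeta n < h n"
   and eq: "!!n. f (z + h n *R u + h n *R u') - f (z + h n *R u) - f (z + h n *R u') + f z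
    = h n * (h n * dd u u' (z + xi n *R u + zeta n *R u'))"
   using key[OF hpos, of _ u u'] by metis
  have "xi ----> 0" "zeta ----> 0"
   using xi zeta by (auto intro!: tendsto_sandwich[OF _ _ tendsto_const hlim] always_eventually less_imp_le)
  hence "(%n. z + xi n *R u + zeta n *R u') ----> z + 0 *R u + 0 *R u'"
   by (intro tendsto_intros)
  hence "(%n. dd u u' (z + xi n *R u + zeta n *R u')) ----> dd u u' (z + 0 *R u + 0 *R u')"
   by (rule continuous_on_tendsto_compose[OF smooth_continuous[OF sdd]]) auto
  thus ?thesis using eq by (intro exI[of _ "%n. dd u u' (z + xi n *R u + zeta n *R u')"]) simp
 qed
 obtain g1 where g1: "g1 ----> dd v w z"
  "!!n. f (z + h n *R v + h n *R w) - f (z + h n *R v) - f (z + h n *R w) + f z = h n * (h n * g1 n)"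
  using conv by blast
 obtain g2 where g2: "g2 ----> dd w v z"
  "!!n. f (z + h n *R w + h n *R v) - f (z + h n *R w) - f (z + h n *R v) + f z = h n * (h n * g2 n)"
  using conv by blast
 have "g1 n = g2 n" for n
 proof -
  have "h n * (h n * g1 n) = h n * (h n * g2 n)"
   unfolding g1(2)[symmetric] g2(2)[symmetric] by (simp add: algebra_simps)
  thus ?thesis using hpos[of n] by simp
 qed
 hence "g1 = g2" by auto
 hence "dd v w z = dd w v z" using g1(1) g2(1) LIMSEQ_unique by blast
 thus ?thesis unfolding dd_def d_def .
qed

lemma integral_lborel_translate:
 fixes F :: "'a::euclidean_space => real"
 assumes "F : Bor"
 shows "(LI z. F (c + z)) = (LI z. F z)"
  "intl F ==> intl (%z. F (c + z))"
proof -
 have "(LI z. F z) = (\<integral>z. F z \<partial>distr lborel borel ((+) c))" by (simp add: lborel_distr_plus)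
 also have "... = (LI z. F (c + z))" using assms by (subst integral_distr) auto
 finally show "(LI z. F (c + z)) = (LI z. F z)" by simp
 assume "intl F"
 hence "integrable (distr lborel borel ((+) c)) F" by (simp add: lborel_distr_plus)
 thus "intl (%z. F (c + z))" using assms by (subst (asm) integrable_distr_eq) auto
qed

text \<open>Borel measurability on the whole space is demanded on purpose: all computations then run
  over \<open>lborel\<close>, and the completed measure of the definitions appears only where data
  enter or test functions leave.\<close>

definition locint :: "('a::euclidean_space => real) => bool" where
 "locint f \<longleftrightarrow> f : Bor & (ALL a b. intl (%z. indicator (cbox a b) z * f z))"

lemma locintD: "locint f ==> f : Bor" "locint f ==> intl (%z. indicator (cbox a b) z * f z)"
 by (auto simp: locint_def)

lemma integrable_bounded_support:
 fixes f :: "'a::euclidean_space => real"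
 assumes f: "locint f" and c: "c : Bor" "!!z. abs (c z) <= B" "bounded {z. c z ~= 0}"
 shows "intl (%z. f z * c z)"
proof -
 obtain a where a: "{z. c z ~= 0} <= cbox (-a) a"
  using bounded_subset_cbox_symmetric[OF c(3)] by blast
 have "intl (%z. B * (indicator (cbox (-a) a) z * f z))"
  using locintD(2)[OF f] by simp
 thus ?thesis
 proof (rule Bochner_Integration.integrable_bound)
  show "(%z. f z * c z) : borel_measurable lborel" using locintD(1)[OF f] c(1) by simp
  show "AEL z. norm (f z * c z) <= norm (B * (indicator (cbox (-a) a) z * f z))"
  proof (rule AE_I2)
   fix z
   have "abs (c z) <= abs B * indicator (cbox (-a) a) z"
    using c(2)[of z] a by (cases "c z = 0") (auto split: split_indicator)
   from mult_left_mono[OF this, of "abs (f z)"]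
   show "norm (f z * c z) <= norm (B * (indicator (cbox (-a) a) z * f z))"
    by (simp add: abs_mult mult_ac)
  qed
 qed
qed

lemma integrable_tfun:
 assumes "locint f" "tfun psi" shows "intl (%z. f z * psi z)"
proof -
 obtain B where B: "!!z. abs (psi z) <= B" using tfun_bounded[OF assms(2)] by blast
 show ?thesis
  by (rule integrable_bounded_support[OF assms(1) smooth_borel[OF tfun_smooth[OF assms(2)]] B])
   (use assms(2) in \<open>simp add: tfun_iff\<close>)
qed

lemma locint_continuous: assumes "continuous_on UNIV f" shows "locint f"
 unfolding locint_def
proof (intro conjI allI)
 show "f : Bor" using assms by (rule borel_measurable_continuous_onI)
 fix a b
 have "intl (%z. indicator (cbox a b) z *R f z)"
  using continuous_on_subset[OF assms] by (intro borel_integrable_compact) auto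
 thus "intl (%z. indicator (cbox a b) z * f z)" by simp
qed

lemma locint_add: "locint f ==> locint g ==> locint (%z. f z + g z)"
 by (auto simp: locint_def distrib_left)

lemma locint_mult_continuous:
 assumes f: "locint f" and c: "continuous_on UNIV c" shows "locint (%z. f z * c z)"
 unfolding locint_def
proof (intro conjI allI)
 have cm: "c : Bor" using c by (rule borel_measurable_continuous_onI)
 show "(%z. f z * c z) : Bor" using locintD(1)[OF f] cm by simp
 fix a b :: 'a
 have "bounded (c ` cbox a b)"
  by (intro compact_imp_bounded compact_continuous_image continuous_on_subset[OF c]) auto
 then obtain B where B: "!!z. z : cbox a b ==> abs (c z) <= B" by (auto simp: bounded_iff)
 have "intl (%z. f z * (indicator (cbox a b) z * c z))"
  by (rule integrable_bounded_support[OF f, of _ "abs B"])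
   (use cm B in \<open>auto split: split_indicator intro: bounded_subset[OF bounded_cbox[of a b]] order_trans[OF B abs_ge_self]\<close>)
 thus "intl (%z. indicator (cbox a b) z * (f z * c z))" by (simp add: mult_ac)
qed

lemma locint_cmult: "locint f ==> locint (%z. c * f z)"
 using locint_mult_continuous[of f "%_. c"] by (simp add: mult.commute)

definition wder :: "'a::euclidean_space => ('a => real) => ('a => real) => bool" where
 "wder v f g \<longleftrightarrow> locint f & locint g &
  (ALL psi. tfun psi --> (LI z. f z * fder psi (at z) v) = - (LI z. g z * psi z))"

lemma wderD:
 "wder v f g ==> locint f" "wder v f g ==> locint g"
 "wder v f g ==> tfun psi ==> (LI z. f z * fder psi (at z) v) = - (LI z. g z * psi z)"
 by (auto simp: wder_def)

lemma wder_add: assumes "wder v f g" "wder v f' g'" shows "wder v (%z. f z + f' z) (%z. g z + g' z)"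
 unfolding wder_def
proof (intro conjI allI impI)
 fix psi :: "'a => real" assume psi: "tfun psi"
 note i = integrable_tfun[OF _ tfun_frechet[OF psi, of v]] integrable_tfun[OF _ psi]
 show "(LI z. (f z + f' z) * fder psi (at z) v) = - (LI z. (g z + g' z) * psi z)"
  using wderD[OF assms(1)] wderD[OF assms(2)] psi by (simp add: distrib_right i)
qed (intro locint_add wderD(1)[OF assms(1)] wderD(1)[OF assms(2)] wderD(2)[OF assms(1)] wderD(2)[OF assms(2)])+

lemma wder_cmult: assumes "wder v f g" shows "wder v (%z. c * f z) (%z. c * g z)"
 unfolding wder_def
 using wderD[OF assms] locint_cmult by (auto simp: mult.assoc)

lemma wder_AE_cong:
 assumes "wder v f g" "AEL z. g' z = g z" "g' : Bor"
 shows "wder v f g'"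
proof -
 have m: "g : Bor" using assms(1) wderD locintD by blast
 have "locint g'"
  unfolding locint_def
 proof (intro conjI allI)
  fix a b :: 'a
  have "intl (%z. indicator (cbox a b) z * g z)"
   using wderD(2)[OF assms(1)] by (simp add: locint_def)
  thus "intl (%z. indicator (cbox a b) z * g' z)"
   by (rule integrable_cong_AE_imp) (use assms(2,3) m in \<open>auto\<close>)
 qed (fact assms(3))
 moreover have "(LI z. g' z * psi z) = (LI z. g z * psi z)" if "tfun psi" for psi
  using assms(2,3) m smooth_borel[OF tfun_smooth[OF that]] by (intro integral_cong_AE) auto
 ultimately show ?thesis using assms(1) unfolding wder_def by simp
qed

text \<open>The directional derivative of \<open>f * psi\<close> is a dominated limit of difference
  quotients whose integrals vanish by translation invariance, so no iterated integration occurs.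
  Differentiability is asked only along \<open>v\<close>, which suits a barrier that is checked one
  direction at a time.\<close>

lemma wder_classical:
 fixes f g :: "'a::euclidean_space => real"
 assumes f: "continuous_on UNIV f" and g: "continuous_on UNIV g"
  and d: "!!z s. ((%s. f (z + s *R v)) has_real_derivative g (z + s *R v)) (at s)"
 shows "wder v f g"
 unfolding wder_def
proof (intro conjI allI impI locint_continuous f g)
 fix psi :: "'a => real" assume psi: "tfun psi"
 define F where "F z = f z * psi z" for z
 define H where "H z = g z * psi z + f z * fder psi (at z) v" for z
 note contpsi = smooth_continuous[OF tfun_smooth[OF psi]]
 have Fc: "continuous_on UNIV F" unfolding F_def by (intro continuous_on_mult f contpsi)
 have Hc: "continuous_on UNIV H" unfolding H_def
  by (intro continuous_on_mult continuous_on_add f g contpsi smooth_continuous smooth_frechet tfun_smooth psi)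
 have Fm: "F : Bor" using Fc by (rule borel_measurable_continuous_onI)
 have Hm: "H : Bor" using Hc by (rule borel_measurable_continuous_onI)
 have DF: "((%s. F (z + s *R v)) has_real_derivative H (z + s *R v)) (at s)" for z s
  unfolding F_def H_def
  using DERIV_mult[OF d[of z s] directional_DERIV[OF tfun_smooth[OF psi], of z v s]] by (simp add: algebra_simps)
 obtain r where r: "r > 0" "!!z. norm z >= r ==> z ~: closure {z. psi z ~= 0}"
 proof -
  have "bounded (closure {z. psi z ~= 0})" using psi by (simp add: tfun_iff bounded_closure)
  then obtain B where "B > 0" "!!z. z : closure {z. psi z ~= 0} ==> norm z <= B"
   unfolding bounded_pos by blast
  thus ?thesis by (intro that[of "B + 1"]) fastforce+
 qed
 have psi0: "psi z = 0" "fder psi (at z) v = 0" if "norm z >= r" for z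
  using r(2)[OF that] closure_subset[of "{z. psi z ~= 0}"]
   closure_subset[of "{z. fder psi (at z) v ~= 0}"] support_frechet[of psi v] by blast+
 have F0: "F z = 0" and H0: "H z = 0" if "norm z >= r" for z using psi0[OF that] by (auto simp: F_def H_def)
 have "bounded (H ` cball 0 r)"
  by (intro compact_imp_bounded compact_continuous_image continuous_on_subset[OF Hc]) auto
 then obtain B0 where B0: "!!z. z : cball 0 r ==> abs (H z) <= B0"
  unfolding bounded_iff by (metis imageI real_norm_def)
 have B: "abs (H z) <= max B0 0" for z using B0[of z] H0[of z] by (cases "norm z <= r") fastforce+
 define h where "h n = inverse (real (Suc n))" for n
 have hpos: "h n > 0" and hle: "h n <= 1" for n by (auto simp: h_def field_simps)
 have hlim: "h ----> 0" unfolding h_def by (rule LIMSEQ_inverse_real_of_nat)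
 define D where "D n z = (F (h n *R v + z) - F z) / h n" for n z
 have Dlim: "(%n. D n z) ----> H z" for z
 proof -
  have "((%t. (F (z + t *R v) - F z) / t) \<longlongrightarrow> H z) (at 0)"
   using DF[of z 0] by (simp add: DERIV_def)
  thus ?thesis
   unfolding D_def using hlim hpos
   by (auto simp: tendsto_at_iff_sequentially o_def add.commute less_imp_neq[symmetric]
     dest!: spec[of _ h])
 qed
 define R where "R = r + norm v"
 have Dbd: "abs (D n z) <= max B0 0 * indicator (cball 0 R) z" for n z
 proof (cases "norm z <= R")
  case True
  from MVT2[of 0 "h n" "%s. F (z + s *R v)" "%s. H (z + s *R v)"] DF hpos[of n]
  obtain xi where "F (z + h n *R v) - F z = h n * H (z + xi *R v)" by auto
  hence "D n z = H (z + xi *R v)" using hpos[of n] by (simp add: D_def add.commute field_simps)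
  thus ?thesis using B[of "z + xi *R v"] True by simp
 next
  case False
  have "norm z - norm (h n *R v) <= norm (h n *R v + z)"
   by (metis add.commute norm_diff_ineq)
  moreover have "norm (h n *R v) <= norm v"
   using hpos[of n] hle[of n] mult_right_mono[of "h n" 1 "norm v"] by simp
  ultimately have "norm (h n *R v + z) >= r" "norm z >= r" using False norm_ge_zero[of v] unfolding R_def by linarith+
  hence "D n z = 0" by (simp add: D_def F0)
  thus ?thesis by simp
 qed
 have "(%n. LI z. D n z) ----> (LI z. H z)"
 proof (rule integral_dominated_convergence[where w="%z. max B0 0 * indicator (cball 0 R) z"])
  show "intl (%z. max B0 0 * indicator (cball 0 R) z :: real)"
   by (intro integrable_mult_right integrable_real_indicator emeasure_bounded_finite bounded_cball) auto
  show "D n : borel_measurable lborel" for n unfolding D_def using Fm by simp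
 qed (use Hm Dlim Dbd in auto)
 moreover have "(LI z. D n z) = 0" for n
 proof -
  have "intl F"
   unfolding F_def by (rule integrable_tfun[OF locint_continuous[OF f] psi])
  thus ?thesis
   using integral_lborel_translate[OF Fm, of "h n *R v"] unfolding D_def by simp
 qed
 ultimately have "(LI z. H z) = 0" by (simp add: LIMSEQ_const_iff)
 thus "(LI z. f z * fder psi (at z) v) = - (LI z. g z * psi z)"
  unfolding H_def
  using integrable_tfun[OF locint_continuous[OF f] tfun_frechet[OF psi, of v]]
   integrable_tfun[OF locint_continuous[OF g] psi] by simp
qed

text \<open>The positive and negative parts define two finite measures that agree on boxes, an
  intersection-stable generator of the Borel sets; densities are unique.\<close>

lemma AE_zero_if_box_integrals_zero:
 fixes g :: "'a::euclidean_space => real"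
 assumes g: "intl g"
  and z: "!!c d. (LI z. indicator (box c d) z * g z) = 0"
 shows "AEL z. g z = 0"
proof -
 have gm[measurable]: "g : Bor" using g by auto
 let ?P = "density lborel (%z. ennreal (max (g z) 0))"
 let ?N = "density lborel (%z. ennreal (max (- g z) 0))"
 have gp: "intl (%z. max (g z) 0)" and gn: "intl (%z. max (- g z) 0)"
  using g by (auto intro!: integrable_max)
 have em: "emeasure (density lborel (%z. ennreal (h z))) A = ennreal (LI z. indicator A z * h z)"
  if "intl h" "!!z. h z >= 0" "A : sets borel" for h :: "'a => real" and A
 proof -
  have "intl (%z. indicator A z * h z)"
   using integrable_mult_indicator[of A lborel h] that by simp
  thus ?thesis using that
   by (subst emeasure_density) (auto simp: nn_integral_eq_integral[symmetric] ennreal_mult'[symmetric] mult.commute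
     ennreal_indicator[symmetric] intro!: nn_integral_cong split: split_indicator)
 qed
 have "?P = ?N"
 proof (rule measure_eqI_generator_eq[where \<Omega>=UNIV and E="range (%(a, b). box a b)"
    and A="%n::nat. box (- (real n *R One)) (real n *R One)"])
  show "Int_stable (range (%(a, b). box a b :: 'a set))"
   by (auto simp: Int_stable_def box_Int_box)
  show "range (%(a, b). box a b :: 'a set) <= Pow UNIV"
   "sets ?P = sigma_sets UNIV (range (%(a, b). box a b :: 'a set))"
   "sets ?N = sigma_sets UNIV (range (%(a, b). box a b :: 'a set))"
   by (simp_all add: borel_eq_box)
  show "range (%n::nat. box (- (real n *R One)) (real n *R One)) <= range (%(a, b). box a b :: 'a set)"
   by auto
  show "(UN n::nat. box (- (real n *R One)) (real n *R One)) = (UNIV :: 'a set)"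
   by (rule UN_box_eq_UNIV)
  show "emeasure ?P (box (- (real n *R One)) (real n *R One)) ~= \<infinity>" for n
   using em[OF gp] by simp
  fix X :: "'a set" assume "X : range (%(a, b). box a b)"
  then obtain c d where X: "X = box c d" by auto
  have i1: "intl (%z. indicator X z * max (g z) 0)"
   "intl (%z. indicator X z * max (- g z) 0)"
   using integrable_mult_indicator[OF _ gp, of X] integrable_mult_indicator[OF _ gn, of X] X by simp_all
  have "(LI z. indicator X z * max (g z) 0 - indicator X z * max (- g z) 0)
    = (LI z. indicator (box c d) z * g z)"
   unfolding X by (intro Bochner_Integration.integral_cong) (auto simp: max_def)
  hence "0 = (LI z. indicator X z * max (g z) 0 - indicator X z * max (- g z) 0)"
   by (simp add: z)
  also have "... = (LI z. indicator X z * max (g z) 0) - (LI z. indicator X z * max (- g z) 0)"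
   using i1 by simp
  finally show "emeasure ?P X = emeasure ?N X"
   using em[OF gp, of X] em[OF gn, of X] X by simp
 qed
 hence "AEL z. ennreal (max (g z) 0) = ennreal (max (- g z) 0)"
  by (subst (asm) sigma_finite_measure.density_unique_iff[OF sigma_finite_lborel]) auto
 thus ?thesis
  by eventually_elim (auto simp: max_def split: if_splits)
qed

lemma fundamental_lemma_box:
 fixes g :: "'a::euclidean_space => real"
 assumes g: "intl (%z. indicator (box a b) z * g z)"
  and t: "!!psi. psi : test_functions (box a b) ==> (LI z. indicator (box a b) z * g z * psi z) = 0"
 shows "AEL z. z : box a b --> g z = 0"
proof -
 define G where "G z = indicator (box a b) z * g z" for z
 have Gi: "intl G" using g by (simp add: G_def[abs_def])
 have "AEL z. G z = 0"
 proof (rule AE_zero_if_box_integrals_zero[OF Gi])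
  fix c d :: 'a
  \<comment> \<open>Corners of the intersection of the two boxes. The products below vanish near its
    boundary, so they are test functions in \<open>box a b\<close> even where \<open>box c d\<close>
    sticks out of it, and they converge to the indicator of the intersection.\<close>
  define l u where "l i = max (a \<bullet> i) (c \<bullet> i)" and "u i = min (b \<bullet> i) (d \<bullet> i)" for i
  define psi where "psi (j::nat) = ptest (%i x. stp (real (Suc j) * (x - l i) - 2) * stp (real (Suc j) * (u i - x) - 2))" for j
  have sm: "smooth (%x. stp (r * (x - l i) - 2) * stp (r * (u i - x) - 2))" for r i
  proof -
   have "smooth (%x. stp ((- r * l i - 2) + r * x))" "smooth (%x. stp ((r * u i - 2) + (- r) * x))"
    using smooth_affine[OF bounded_linear_mult_right smooth_stp] by blast+
   from smooth_mult[OF this] show ?thesis by (simp add: algebra_simps)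
  qed
  have nz: "l i + 1 / Suc j <= x & x <= u i - 1 / Suc j"
   if "stp (real (Suc j) * (x - l i) - 2) * stp (real (Suc j) * (u i - x) - 2) ~= 0" for i x j
  proof -
   have "real (Suc j) * (x - l i) - 2 > -1" "real (Suc j) * (u i - x) - 2 > -1"
    using that stp_0[of "real (Suc j) * (x - l i) - 2"] stp_0[of "real (Suc j) * (u i - x) - 2"]
    by (force simp: not_le[symmetric])+
   thus ?thesis by (simp add: field_simps)
  qed
  have psit: "psi j : test_functions (box a b)" for j
  proof -
   define L U where "L = (SUM i:Basis. (l i + 1 / Suc j) *R i)" and "U = (SUM i:Basis. (u i - 1 / Suc j) *R i)"
   have LU: "L \<bullet> i = l i + 1 / Suc j" "U \<bullet> i = u i - 1 / Suc j" if "i : Basis" for i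
    using that by (auto simp: L_def U_def)
   have sub: "{z. psi j z ~= 0} <= cbox L U"
    unfolding psi_def by (rule ptest_support) (use nz LU in auto)
   hence "closure {z. psi j z ~= 0} <= cbox L U" by (intro closure_minimal) auto
   moreover have "cbox L U <= box a b"
   proof
    fix z assume z: "z : cbox L U"
    show "z : box a b"
     unfolding mem_box
    proof
     fix i :: 'a assume i: "i : Basis"
     hence "l i + 1 / Suc j <= z \<bullet> i" "z \<bullet> i <= u i - 1 / Suc j" using z LU by (auto simp: mem_box)
     moreover have "0 < 1 / real (Suc j)" by simp
     ultimately have "l i < z \<bullet> i" "z \<bullet> i < u i" by linarith+
     thus "a \<bullet> i < z \<bullet> i & z \<bullet> i < b \<bullet> i" by (simp add: l_def u_def)
    qed
   qed
   moreover have "tfun (psi j)"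
    unfolding psi_def by (rule tfun_ptest[where l=L and u=U]) (use sm nz LU in auto)
   ultimately show ?thesis by (auto simp: tfun_def test_functions_def)
  qed
  have lim: "(%j. psi j z) ----> indicator {z. ALL i:Basis. l i < z \<bullet> i & z \<bullet> i < u i} z" for z
  proof (cases "ALL i:Basis. l i < z \<bullet> i & z \<bullet> i < u i")
   case True
   have ev: "\<forall>\<^sub>F j in sequentially. stp (real (Suc j) * e - 2) = 1" if "e > 0" for e
   proof -
    obtain N where N: "3 / e < real N" using reals_Archimedean2 by blast
    have "stp (real (Suc j) * e - 2) = 1" if "j >= N" for j
    proof (rule stp_1)
     have "3 / e <= real (Suc j)" using N that by simp
     thus "1 <= real (Suc j) * e - 2" using \<open>e > 0\<close> by (simp add: field_simps)
    qed
    thus ?thesis by (auto simp: eventually_sequentially)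
   qed
   have "(%j. psi j z) ----> (PROD i:(Basis::'a set). 1)"
    unfolding psi_def ptest_def
   proof (rule tendsto_prod)
    fix i :: 'a assume i: "i : Basis"
    have "\<forall>\<^sub>F j in sequentially. stp (real (Suc j) * (z \<bullet> i - l i) - 2) * stp (real (Suc j) * (u i - z \<bullet> i) - 2) = 1"
     using ev[of "z \<bullet> i - l i"] ev[of "u i - z \<bullet> i"] True i by (auto elim: eventually_elim2)
    thus "(%j. stp (real (Suc j) * (z \<bullet> i - l i) - 2) * stp (real (Suc j) * (u i - z \<bullet> i) - 2)) ----> 1"
     by (rule tendsto_eventually)
   qed
   thus ?thesis using True by simp
  next
   case False
   then obtain i where i: "i : Basis" "~ (l i < z \<bullet> i & z \<bullet> i < u i)" by blast
   have "psi j z = 0" for j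
   proof -
    have "stp (real (Suc j) * (z \<bullet> i - l i) - 2) * stp (real (Suc j) * (u i - z \<bullet> i) - 2) = 0"
    proof (rule ccontr)
     assume "~ ?thesis"
     from nz[OF this] have "l i + 1 / Suc j <= z \<bullet> i & z \<bullet> i <= u i - 1 / Suc j" .
     moreover have "0 < 1 / real (Suc j)" by simp
     ultimately show False using i(2) by linarith
    qed
    thus ?thesis unfolding psi_def ptest_def using i(1) by (auto simp: prod_zero_iff)
   qed
   thus ?thesis using False by simp
  qed
  have eqs: "(%z. G z * indicator {z. ALL i:Basis. l i < z \<bullet> i & z \<bullet> i < u i} z) = (%z. indicator (box c d) z * G z)"
   by (rule ext) (auto simp: G_def l_def u_def mem_box split: split_indicator)
  have bd: "abs (psi j z) <= 1" for j z
   unfolding psi_def ptest_def using stp_bounds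
   by (subst abs_prod, intro prod_le_1) (auto simp: abs_mult intro!: mult_le_one)
  have "(%j. LI z. G z * psi j z) ----> (LI z. G z * indicator {z. ALL i:Basis. l i < z \<bullet> i & z \<bullet> i < u i} z)"
  proof (rule integral_dominated_convergence[where w="%z. abs (G z)"])
   show "intl (%z. abs (G z))" using Gi by auto
   show "AEL z. (%j. G z * psi j z) ----> G z * indicator {z. ALL i:Basis. l i < z \<bullet> i & z \<bullet> i < u i} z"
    by (intro AE_I2 tendsto_mult_left lim)
   have "tfun (psi j)" for j using psit[of j] by (auto simp: tfun_def test_functions_def)
   hence m: "psi j : Bor" for j using smooth_borel tfun_smooth by blast
   show "(%z. G z * psi j z) : borel_measurable lborel" for j using Gi m by auto
   show "AEL z. norm (G z * psi j z) <= abs (G z)" for j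
    by (intro AE_I2) (use bd in \<open>auto simp: abs_mult intro!: mult_left_le\<close>)
   have "(%z. indicator (box c d) z * G z) : borel_measurable lborel" using Gi by auto
   thus "(%z. G z * indicator {z. ALL i:Basis. l i < z \<bullet> i & z \<bullet> i < u i} z) : borel_measurable lborel"
    unfolding eqs .
  qed
  moreover have "(LI z. G z * psi j z) = 0" for j
   using t[OF psit] by (simp add: G_def)
  ultimately have "(LI z. G z * indicator {z. ALL i:Basis. l i < z \<bullet> i & z \<bullet> i < u i} z) = 0"
   by (simp add: LIMSEQ_const_iff)
  thus "(LI z. indicator (box c d) z * G z) = 0"
   unfolding eqs .
 qed
 thus ?thesis by eventually_elim (auto simp: G_def)
qed

section \<open>Jensen's inequality for powers\<close>

lemma bernoulli_powr:
 fixes x p :: real assumes "x >= 0" "p >= 1" shows "1 + p * (x - 1) <= x powr p"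
proof (cases "x = 0")
 case False
 hence x: "x > 0" using assms by simp
 have "x powr p - 1 powr p >= (p * 1 powr (p - 1)) * (x - 1)"
  using x assms
  by (intro convex_on_imp_above_tangent[OF powr_convex[OF assms(2)]])
   (auto intro!: derivative_eq_intros simp: interior_open)
 thus ?thesis by simp
qed (use assms in simp)

text \<open>Bernoulli's inequality for \<open>y / a\<close>, with \<open>a\<close> the average of
  \<open>y\<close>, is integrated: this is Jensen by the tangent at the mean. Zero mean and zero
  total mass are split off because \<open>a\<close> could not be used as a divisor.\<close>

lemma power_mean:
 fixes y :: "'a => real"
 assumes M: "finite_measure M" and p: "p >= 1" and y: "y : borel_measurable M" "!!x. y x >= 0"
  and i: "integrable M (%x. y x powr p)"
 shows "integrable M y" "(\<integral>x. y x \<partial>M) powr p <= measure M (space M) powr (p - 1) * (\<integral>x. y x powr p \<partial>M)"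
proof -
 interpret finite_measure M by fact
 have le: "y x <= 1 + y x powr p" for x
  using bernoulli_powr[OF y(2) p, of x] p y(2)[of x] mult_right_mono[of 1 p "y x"]
  by (cases "y x <= 1") (smt (verit) powr_ge_zero, smt (verit) powr_mono powr_one)
 show iy: "integrable M y"
 proof (rule Bochner_Integration.integrable_bound[where f="%x. 1 + y x powr p"])
  show "AE x in M. norm (y x) <= norm (1 + y x powr p)"
   using le y(2) by (intro AE_I2) (simp add: order_trans[OF le])
 qed (use i y in auto)
 define m where "m = measure M (space M)"
 define I where "I = (\<integral>x. y x \<partial>M)"
 have I0: "I >= 0" unfolding I_def using y(2) by (intro integral_nonneg_AE) auto
 have m0: "m >= 0" by (simp add: m_def)
 have J0: "(\<integral>x. y x powr p \<partial>M) >= 0" by (intro integral_nonneg_AE) auto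
 show "(\<integral>x. y x \<partial>M) powr p <= measure M (space M) powr (p - 1) * (\<integral>x. y x powr p \<partial>M)"
 proof (cases "I = 0 | m = 0")
  case True
  have "I = 0"
  proof (cases "m = 0")
   case True
   hence "emeasure M (space M) = 0" by (simp add: m_def emeasure_eq_measure)
   hence "AE x in M. y x = 0" by (intro AE_I[where N="space M"]) auto
   thus ?thesis unfolding I_def using y by (simp add: integral_eq_zero_AE)
  qed (use True in auto)
  thus ?thesis unfolding I_def[symmetric] m_def[symmetric] using J0 by simp
 next
  case False
  hence pos: "I > 0" "m > 0" using I0 m0 by auto
  define a where "a = I / m"
  have a: "a > 0" using pos by (simp add: a_def)
  have "(\<integral>x. a powr p * (1 + p * (y x / a - 1)) \<partial>M) <= (\<integral>x. y x powr p \<partial>M)"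
  proof (rule integral_mono)
   show "integrable M (%x. a powr p * (1 + p * (y x / a - 1)))" using iy by auto
   fix x
   have "1 + p * (y x / a - 1) <= (y x / a) powr p" using y(2)[of x] a p by (intro bernoulli_powr) auto
   also have "... = y x powr p / a powr p" using y(2)[of x] a by (simp add: powr_divide)
   finally show "a powr p * (1 + p * (y x / a - 1)) <= y x powr p"
    using a by (simp add: field_simps)
  qed (fact i)
  also have "(\<integral>x. a powr p * (1 + p * (y x / a - 1)) \<partial>M) = a powr p * (m + p * (I / a - m))"
   using iy by (simp add: I_def m_def algebra_simps)
  also have "... = a powr p * m" using pos by (simp add: a_def)
  finally have "a powr p * m * m powr (p-1) <= (\<integral>x. y x powr p \<partial>M) * m powr (p-1)"
   by (intro mult_right_mono) auto
  moreover have "a powr p * m * m powr (p-1) = I powr p"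
   using pos by (simp add: a_def powr_divide powr_diff)
  ultimately show ?thesis by (simp add: I_def m_def mult.commute)
 qed
qed

section \<open>Parabolic scaling\<close>

text \<open>The parabolic dilation followed by the shift to \<open>z0\<close>: lengths scale by
  \<open>r\<close>, times by \<open>r^2\<close>.\<close>

definition psc :: "real => (real^'n)*real => (real^'n)*real => (real^'n)*real" where
 "psc r z0 z = z0 + (r *R fst z, r^2 * snd z)"

lemma psc_simps [simp]: "fst (psc r z0 z) = fst z0 + r *R fst z" "snd (psc r z0 z) = snd z0 + r^2 * snd z"
 by (auto simp: psc_def)

text \<open>The inverse dilation is written as another \<open>psc\<close>, so that every scaling
  lemma applies to it as well.\<close>

definition psci :: "real => (real^'n)*real => (real^'n)*real => (real^'n)*real" where
 "psci r z0 = psc (1/r) (- (1/r) *R fst z0, - (1/r)\<^sup>2 * snd z0)"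

lemma psci_psc [simp]: "r ~= 0 ==> psci r z0 (psc r z0 z) = z" "r ~= 0 ==> psc r z0 (psci r z0 z) = z"
 by (auto simp: psci_def prod_eq_iff algebra_simps power2_eq_square)

lemma psc_bounded_linear: "bounded_linear (%z::(real^'n)*real. (r *R fst z, r^2 * snd z))"
 by (intro bounded_linear_Pair bounded_linear_scaleR_right[THEN bounded_linear_compose]
   bounded_linear_mult_right[THEN bounded_linear_compose] bounded_linear_fst bounded_linear_snd)

lemma smooth_psc: "smooth f ==> smooth (%z. f (psc r z0 z))"
 unfolding psc_def by (rule smooth_affine[OF psc_bounded_linear])

lemma continuous_psc [continuous_intros]: "continuous_on S (psc r z0)"
 unfolding psc_def[abs_def]
 by (intro continuous_on_add continuous_on_const linear_continuous_on psc_bounded_linear)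

lemma measurable_psc [measurable]: "psc r z0 : Bor"
 by (intro borel_measurable_continuous_onI continuous_psc)

text \<open>The homogeneous dimension: \<open>psc r\<close> multiplies volume by \<open>r\<close> to
  this power, which is the source of the exponent conditions.\<close>

definition hdim :: "'n::finite itself => nat" where "hdim _ = CARD('n) + 2"

lemma lborel_psc:
 fixes z0 :: "(real^'n)*real"
 assumes "r > 0"
 shows "lborel = density (distr lborel borel (psc r z0)) (%_. ennreal (r ^ hdim TYPE('n)))"
proof -
 let ?c = "%j::(real^'n)*real. if fst j = 0 then r\<^sup>2 else r"
 have B: "(Basis :: ((real^'n)*real) set) = (%u. (u, 0)) ` Basis \<union> {(0, 1)}"
  by (auto simp: Basis_prod_def)
 have dis: "(%u. (u, 0)) ` (Basis :: (real^'n) set) \<inter> {(0, 1::real)} = {}" by auto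
 have inj: "inj_on (%u. (u, 0::real)) (Basis :: (real^'n) set)" by (auto simp: inj_on_def)
 have nz: "u ~= 0" if "u : Basis" for u :: "real^'n" using that by auto
 have "(%x::(real^'n)*real. z0 + (SUM j:Basis. (?c j * (x \<bullet> j)) *R j)) = psc r z0"
 proof
  fix x :: "(real^'n)*real"
  have "(SUM j:Basis. (?c j * (x \<bullet> j)) *R j) = (SUM u:Basis. (r * (fst x \<bullet> u)) *R (u, 0)) + (r^2 * snd x) *R (0, 1)"
   unfolding B
   by (subst sum.union_disjoint) (use dis inj nz in \<open>auto simp: sum.reindex inner_prod_def intro!: sum.cong\<close>)
  also have "(SUM u:Basis. (r * (fst x \<bullet> u)) *R (u, 0::real)) = (SUM u:Basis. (r * (fst x \<bullet> u)) *R u, 0)"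
   by (simp add: sum_prod)
  also have "(SUM u:Basis. (r * (fst x \<bullet> u)) *R u) = r *R fst x"
   by (simp add: scaleR_scaleR[symmetric] scaleR_sum_right[symmetric] euclidean_representation del: scaleR_scaleR)
  finally show "z0 + (SUM j:Basis. (?c j * (x \<bullet> j)) *R j) = psc r z0 x" by (simp add: psc_def)
 qed
 moreover have "(PROD j:(Basis :: ((real^'n)*real) set). abs (?c j)) = r ^ hdim TYPE('n)"
 proof -
  have "(PROD j:(Basis :: ((real^'n)*real) set). abs (?c j)) = (PROD u:(Basis::(real^'n) set). r) * r^2"
   unfolding B
   by (subst prod.union_disjoint) (use dis inj nz assms in \<open>auto simp: prod.reindex intro!: prod.cong\<close>)
  thus ?thesis by (simp add: hdim_def power_add power2_eq_square)
 qed
 ultimately show ?thesis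
  using lborel_affine_euclidean[of ?c z0] assms by auto
qed

lemma nn_integral_psc:
 fixes z0 :: "(real^'n)*real"
 assumes "r > 0" "f : Bor"
 shows "(NL z. f z) = ennreal (r ^ hdim TYPE('n)) * (NL z. f (psc r z0 z))"
 using assms by (subst lborel_psc[OF assms(1), of z0]) (simp add: nn_integral_density nn_integral_distr nn_integral_cmult)

lemma integrable_psc:
 fixes z0 :: "(real^'n)*real" and f :: "_ => real"
 assumes r: "r > 0" and f: "intl f"
 shows "intl (%z. f (psc r z0 z))"
proof -
 have m: "f : Bor" using f by auto
 have "(NL z. ennreal (norm (f z))) < \<infinity>" using f by (simp add: integrable_iff_bounded)
 hence "(NL z. ennreal (norm (f (psc r z0 z)))) < \<infinity>"
  using r m by (subst (asm) nn_integral_psc[OF r, of _ z0]) (auto simp: ennreal_mult_less_top)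
 thus ?thesis using m by (simp add: integrable_iff_bounded)
qed

lemma integral_psc:
 fixes z0 :: "(real^'n)*real" and f :: "_ => real"
 assumes r: "r > 0" and f: "intl f"
 shows "(LI z. f z) = r ^ hdim TYPE('n) * (LI z. f (psc r z0 z))"
proof -
 have m[measurable]: "f : Bor" using f by auto
 have "(LI z. f z) = (\<integral>z. f z \<partial>density (distr lborel borel (psc r z0)) (%_. ennreal (r ^ hdim TYPE('n))))"
  using lborel_psc[OF r, of z0] by simp
 also have "... = r ^ hdim TYPE('n) * (LI z. f (psc r z0 z))"
  using r by (subst integral_density) (auto simp: integral_distr)
 finally show ?thesis .
qed

lemma AE_psc:
 fixes z0 :: "(real^'n)*real"
 assumes r: "r > 0" and P: "AEL z. P z"
 shows "AEL z. P (psc r z0 z)"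
proof -
 obtain N where N: "{z. ~ P z} <= N" "N : sets borel" "emeas N = 0"
  using P by (auto elim!: AE_E)
 have "(NL z. indicator N z) = 0" using N by simp
 hence "(NL z. indicator N (psc r z0 z)) = 0"
  using N r by (subst (asm) nn_integral_psc[OF r, of _ z0]) auto
 hence "AEL z. indicator N (psc r z0 z) = (0::ennreal)"
  using N by (subst (asm) nn_integral_0_iff_AE) auto
 thus ?thesis by eventually_elim (use N(1) in \<open>auto simp: indicator_def split: if_splits\<close>)
qed

lemma locint_psc:
 fixes z0 :: "(real^'n)*real"
 assumes r: "r > 0" and f: "locint f"
 shows "locint (%z. f (psc r z0 z))"
 unfolding locint_def
proof (intro conjI allI)
 have m[measurable]: "f : Bor" using locintD(1)[OF f] .
 show "(%z. f (psc r z0 z)) : Bor" by simp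
 fix a b :: "(real^'n)*real"
 have "bounded (psc r z0 ` cbox a b)"
  by (intro compact_imp_bounded compact_continuous_image continuous_psc) auto
 then obtain c where c: "psc r z0 ` cbox a b <= cbox (-c) c" using bounded_subset_cbox_symmetric by blast
 have "intl (%z. indicator (cbox (-c) c) (psc r z0 z) * f (psc r z0 z))"
  using integrable_psc[OF r locintD(2)[OF f, of "-c" c]] by simp
 thus "intl (%z. indicator (cbox a b) z * f (psc r z0 z))"
  by (rule Bochner_Integration.integrable_bound)
   (use c in \<open>auto intro!: AE_I2 split: split_indicator simp: image_subset_iff\<close>)
qed

lemma frechet_psc:
 fixes z0 :: "(real^'n)*real"
 assumes "smooth f" and v: "(r *R fst v, r^2 * snd v) = c *R v"
 shows "fder (%z. f (psc r z0 z)) (at z) v = c * fder f (at (psc r z0 z)) v"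
proof (rule frechet_directional[OF smooth_psc[OF assms(1)]])
 have eq: "psc r z0 (z + s *R v) = psc r z0 z + (s * c) *R v" for s
  using v by (auto simp: prod_eq_iff algebra_simps)
 have "((%s. f (psc r z0 z + (s * c) *R v)) has_real_derivative
   fder f (at (psc r z0 z + (0 * c) *R v)) v * c) (at 0)"
  by (rule DERIV_chain2[where g="%s. s * c"], rule directional_DERIV[OF assms(1)])
   (auto intro!: derivative_eq_intros)
 thus "((%s. f (psc r z0 (z + s *R v))) has_real_derivative
   c * fder f (at (psc r z0 z)) v) (at 0)"
  unfolding eq by (simp add: mult.commute)
qed

lemma tfun_psc:
 fixes z0 :: "(real^'n)*real"
 assumes "r ~= 0" "tfun psi" shows "tfun (%z. psi (psc r z0 z))"
proof -
 have "{z. psi (psc r z0 z) ~= 0} <= psci r z0 ` closure {z. psi z ~= 0}"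
 proof
  fix z assume "z : {z. psi (psc r z0 z) ~= 0}"
  hence "psc r z0 z : closure {z. psi z ~= 0}" by (intro subsetD[OF closure_subset]) simp
  hence "psci r z0 (psc r z0 z) : psci r z0 ` closure {z. psi z ~= 0}" by (rule imageI)
  thus "z : psci r z0 ` closure {z. psi z ~= 0}" using assms(1) by simp
 qed
 moreover have "compact (psci r z0 ` closure {z. psi z ~= 0})"
  unfolding psci_def using assms(2)
  by (intro compact_continuous_image continuous_psc) (simp add: tfun_iff compact_closure)
 ultimately have "bounded {z. psi (psc r z0 z) ~= 0}" using bounded_subset[OF compact_imp_bounded] by metis
 thus ?thesis using smooth_psc[OF tfun_smooth[OF assms(2)], of r z0] by (simp add: tfun_iff)
qed

text \<open>The premise on \<open>v\<close> says that \<open>v\<close> is an eigenvector of the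
  dilation: space axes have eigenvalue \<open>r\<close>, the time axis has \<open>r^2\<close>. The
  rest is a change of variables with the test function pulled back by \<open>psci\<close>.\<close>

lemma wder_psc:
 fixes z0 :: "(real^'n)*real"
 assumes r: "r > 0" and w: "wder v f g" and v: "(r *R fst v, r^2 * snd v) = c *R v" and c: "c > 0"
 shows "wder v (%z. f (psc r z0 z)) (%z. c * g (psc r z0 z))"
 unfolding wder_def
proof (intro conjI allI impI)
 show "locint (%z. f (psc r z0 z))" "locint (%z. c * g (psc r z0 z))"
  using wderD(1,2)[OF w] r by (auto intro!: locint_psc locint_cmult)
 fix psi :: "(real^'n)*real => real" assume psi: "tfun psi"
 define h where "h z = psi (psci r z0 z)" for z
 have h: "tfun h" unfolding h_def psci_def using r psi by (intro tfun_psc) auto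
 have hpsi: "h (psc r z0 z) = psi z" for z using r by (simp add: h_def)
 have eq: "fder psi (at z) v = c * fder h (at (psc r z0 z)) v" for z
  using frechet_psc[OF tfun_smooth[OF h] v, of z0 z] by (simp add: hpsi)
 define A where "A = (LI z. f (psc r z0 z) * fder h (at (psc r z0 z)) v)"
 define B where "B = (LI z. g (psc r z0 z) * h (psc r z0 z))"
 have rk: "r ^ hdim TYPE('n) ~= 0" using r by simp
 have "r ^ hdim TYPE('n) * A = r ^ hdim TYPE('n) * (- B)"
  unfolding A_def B_def mult_minus_right
   integral_psc[OF r integrable_tfun[OF wderD(1)[OF w] tfun_frechet[OF h, of v]], of z0, symmetric]
   integral_psc[OF r integrable_tfun[OF wderD(2)[OF w] h], of z0, symmetric]
  by (rule wderD(3)[OF w h])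
 hence AB: "A = - B" by (rule mult_left_cancel[OF rk, THEN iffD1])
 have "(LI z. f (psc r z0 z) * fder psi (at z) v) = c * A"
  unfolding eq A_def mult.left_commute[of _ c] by (rule integral_mult_right_zero)
 also have "... = - (c * B)" by (simp add: AB)
 also have "c * B = (LI z. c * g (psc r z0 z) * psi z)"
  unfolding B_def hpsi mult.assoc by (rule integral_mult_right_zero[symmetric])
 finally show "(LI z. f (psc r z0 z) * fder psi (at z) v)
   = - (LI z. c * g (psc r z0 z) * psi z)" .
qed

section \<open>Borel versions and localisation of weak derivatives\<close>

lemma borel_version:
 fixes f :: "'a::euclidean_space => real"
 assumes "f absolutely_integrable_on K" "K : sets borel"
 obtains f' where "f' : Bor" "intl f'"
  "AEL z. z : K --> f' z = f z" "!!z. z ~: K ==> f' z = 0"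
proof -
 have i: "integrable lebesgue (%z. indicator K z * f z)" using assms(1) by (simp add: set_integrable_def)
 hence "(%z. indicator K z * f z) : borel_measurable (completion lborel)" by auto
 from completion_ex_borel_measurable_real[OF this] obtain g where
  g: "g : borel_measurable lborel" "AEL z. indicator K z * f z = g z" by auto
 define f' where "f' z = indicator K z * g z" for z
 have m: "f' : Bor" using g(1) assms(2) by (simp add: f'_def[abs_def])
 have ae: "AEL z. indicator K z * f z = f' z"
  using g(2) by eventually_elim (auto simp: f'_def split: split_indicator)
 have "integrable lebesgue f'"
  by (rule integrable_cong_AE_imp[OF i]) (use m AE_completion[OF ae] in \<open>auto intro: measurable_completion\<close>)
 hence "intl f'" using m by (simp add: integrable_completion)
 moreover have "AEL z. z : K --> f' z = f z"
  using ae by eventually_elim auto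
 moreover have "f' z = 0" if "z ~: K" for z using that by (simp add: f'_def)
 ultimately show ?thesis using that m by blast
qed

lemma integral_lebesgue_on_version:
 fixes f f' h :: "'a::euclidean_space => real"
 assumes U: "U : sets lebesgue" and K: "K : sets borel" "K <= U" and f: "f absolutely_integrable_on K"
  and f': "f' : Bor" "AEL z. z : K --> f' z = f z"
  and h: "h : Bor" "!!z. z ~: K ==> h z = 0"
 shows "(LINT z|lebesgue_on U. f z * h z) = (LI z. f' z * h z)"
proof -
 have eq: "indicator U z *R (f z * h z) = (indicator K z * f z) * h z" for z
  using h(2)[of z] K(2) by (auto split: split_indicator)
 have "integrable lebesgue (%z. indicator K z * f z)" using f by (simp add: set_integrable_def)
 hence m0: "(%z. indicator K z * f z) : borel_measurable lebesgue" by (rule borel_measurable_integrable)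
 have "h : borel_measurable lebesgue" using h(1) by (auto intro: measurable_completion)
 from borel_measurable_times[OF m0 this]
 have m1: "(%z. (indicator K z * f z) * h z) : borel_measurable lebesgue" .
 have m2: "(%z. f' z * h z) : Bor" using f'(1) h(1) by auto
 have "(LINT z|lebesgue_on U. f z * h z) = (LINT z|lebesgue. indicator U z *R (f z * h z))"
  using U by (subst integral_restrict_space) auto
 also have "... = (LINT z|lebesgue. f' z * h z)"
  unfolding eq
 proof (rule integral_cong_AE[OF m1])
  show "(%z. f' z * h z) : borel_measurable lebesgue" using m2 by (auto intro: measurable_completion)
  show "AE z in lebesgue. indicator K z * f z * h z = f' z * h z"
   using AE_completion[OF f'(2)] by eventually_elim (use h(2) in \<open>auto split: split_indicator\<close>)
 qed
 also have "... = (LI z. f' z * h z)" using m2 by (simp add: integral_completion)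
 finally show ?thesis .
qed

lemma test_functions_tfun: "psi : test_functions U ==> tfun psi"
 by (simp add: tfun_def test_functions_def)

lemma test_functions_iff: "psi : test_functions U \<longleftrightarrow> tfun psi & closure {z. psi z ~= 0} <= U"
 by (auto simp: tfun_def test_functions_def)

text \<open>A test function supported in \<open>K\<close> sees the data only on \<open>K\<close>, so
  Borel versions that agree there almost everywhere may replace them.\<close>

lemma has_weak_derivative_version:
 fixes U :: "'a::euclidean_space set"
 assumes w: "has_weak_derivative U v f g" and U: "open U" and K: "compact K" "K <= U"
  and f': "f' : Bor" "AEL z. z : K --> f' z = f z"
  and g': "g' : Bor" "AEL z. z : K --> g' z = g z"
  and psi: "tfun psi" "closure {z. psi z ~= 0} <= K"
 shows "(LI z. f' z * fder psi (at z) v) = - (LI z. g' z * psi z)"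
proof -
 have ai: "f absolutely_integrable_on K" "g absolutely_integrable_on K"
  using w K by (auto simp: has_weak_derivative_def)
 have Ub: "U : sets lebesgue" "K : sets borel" using U K by (auto simp: borel_compact)
 have z0: "psi z = 0" "fder psi (at z) v = 0" if "z ~: K" for z
 proof -
  have "z ~: closure {z. psi z ~= 0}" using that psi(2) by blast
  moreover hence "z ~: closure {z. fder psi (at z) v ~= 0}"
   using support_frechet by blast
  ultimately show "psi z = 0" "fder psi (at z) v = 0"
   using closure_subset[of "{z. psi z ~= 0}"] closure_subset[of "{z. fder psi (at z) v ~= 0}"] by auto
 qed
 have "psi : test_functions U" using psi K by (auto simp: test_functions_iff)
 hence "(LINT z|lebesgue_on U. f z * fder psi (at z) v) = - (LINT z|lebesgue_on U. g z * psi z)"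
  using w by (auto simp: has_weak_derivative_def)
 moreover have "(LINT z|lebesgue_on U. f z * fder psi (at z) v) = (LI z. f' z * fder psi (at z) v)"
  by (rule integral_lebesgue_on_version[OF Ub K(2) ai(1) f' _ z0(2)])
   (use smooth_borel[OF tfun_smooth[OF tfun_frechet[OF psi(1)]]] in auto)
 moreover have "(LINT z|lebesgue_on U. g z * psi z) = (LI z. g' z * psi z)"
  by (rule integral_lebesgue_on_version[OF Ub K(2) ai(2) g' _ z0(1)])
   (use smooth_borel[OF tfun_smooth[OF psi(1)]] in auto)
 ultimately show ?thesis by simp
qed

lemma locint_integrable_mult:
 assumes f: "intl f" and c: "continuous_on UNIV c" shows "locint (%z. f z * c z)"
proof -
 have "locint f" unfolding locint_def
  using f integrable_mult_indicator[OF _ f] by auto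
 thus ?thesis using c by (rule locint_mult_continuous)
qed

text \<open>Testing the local identity with \<open>et * psi\<close> and expanding gives the Leibniz
  rule; the result lives on the whole space because \<open>et\<close> is supported in
  \<open>K\<close>.\<close>

lemma wder_cutoff:
 fixes U :: "'a::euclidean_space set"
 assumes w: "has_weak_derivative U v f g" and U: "open U" and K: "compact K" "K <= U"
  and f': "f' : Bor" "intl f'" "AEL z. z : K --> f' z = f z"
  and g': "g' : Bor" "intl g'" "AEL z. z : K --> g' z = g z"
  and et: "tfun et" "closure {z. et z ~= 0} <= K"
 shows "wder v (%z. f' z * et z) (%z. g' z * et z + f' z * fder et (at z) v)"
 unfolding wder_def
proof (intro conjI allI impI)
 note cet = smooth_continuous[OF tfun_smooth[OF et(1)]]
  and cdet = smooth_continuous[OF smooth_frechet[OF tfun_smooth[OF et(1)]], of v]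
 have lf: "locint (%z. f' z * et z)" and lg: "locint (%z. g' z * et z)"
  and lfd: "locint (%z. f' z * fder et (at z) v)"
  using f'(2) g'(2) cet cdet by (auto intro: locint_integrable_mult)
 show "locint (%z. f' z * et z)" "locint (%z. g' z * et z + f' z * fder et (at z) v)"
  by (intro lf locint_add lg lfd)+
 fix psi :: "'a => real" assume psi: "tfun psi"
 have p: "tfun (%z. et z * psi z)" using psi tfun_smooth[OF et(1)] by (rule tfun_mult[rotated])
 have "{z. et z * psi z ~= 0} <= {z. et z ~= 0}" by auto
 from closure_mono[OF this] et(2) have c: "closure {z. et z * psi z ~= 0} <= K" by blast
 have "(LI z. f' z * fder (%z. et z * psi z) (at z) v) = - (LI z. g' z * (et z * psi z))"
  by (rule has_weak_derivative_version[OF w U K f'(1,3) g'(1,3) p c])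
 moreover have "(LI z. f' z * fder (%z. et z * psi z) (at z) v)
  = (LI z. f' z * et z * fder psi (at z) v + f' z * fder et (at z) v * psi z)"
  by (subst frechet_mult[OF tfun_smooth[OF et(1)] tfun_smooth[OF psi]]) (simp add: algebra_simps)
 moreover have "... = (LI z. f' z * et z * fder psi (at z) v) + (LI z. f' z * fder et (at z) v * psi z)"
  by (intro Bochner_Integration.integral_add integrable_tfun lf lfd psi tfun_frechet)
 moreover have "(LI z. (g' z * et z + f' z * fder et (at z) v) * psi z)
  = (LI z. g' z * et z * psi z) + (LI z. f' z * fder et (at z) v * psi z)"
  unfolding distrib_right
  by (intro Bochner_Integration.integral_add integrable_tfun lg lfd psi)
 ultimately show "(LI z. f' z * et z * fder psi (at z) v)
  = - (LI z. (g' z * et z + f' z * fder et (at z) v) * psi z)"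
  by (simp add: mult.assoc)
qed

lemma locint_absolutely_integrable: "locint f ==> compact K ==> f absolutely_integrable_on K"
proof -
 assume f: "locint f" and K: "compact K"
 obtain a where a: "K <= cbox (-a) a" using bounded_subset_cbox_symmetric[OF compact_imp_bounded[OF K]] by blast
 have "intl (%z. indicator K z * (indicator (cbox (-a) a) z * f z))"
  using integrable_mult_indicator[OF _ locintD(2)[OF f], of K] K by (simp add: compact_imp_closed)
 also have "(%z. indicator K z * (indicator (cbox (-a) a) z * f z)) = (%z. indicator K z * f z)"
  using a by (intro ext) (auto split: split_indicator)
 finally show "f absolutely_integrable_on K"
  using locintD(1)[OF f] K
  by (subst set_integrable_def, subst integrable_completion) (auto simp: compact_imp_closed)
qed

lemma wder_imp_has_weak_derivative:
 assumes w: "wder v f g" and U: "open U"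
 shows "has_weak_derivative U v f g"
 unfolding has_weak_derivative_def
proof (intro conjI allI impI ballI)
 fix K assume "compact K & K <= U"
 thus "f absolutely_integrable_on K" "g absolutely_integrable_on K"
  using wderD(1,2)[OF w] locint_absolutely_integrable by blast+
next
 fix psi assume psi: "psi : test_functions U"
 define K where "K = closure {z. psi z ~= 0}"
 have t: "tfun psi" using psi by (rule test_functions_tfun)
 have K: "compact K" "K <= U" using psi by (auto simp: K_def test_functions_def)
 have z0: "psi z = 0" "fder psi (at z) v = 0" if "z ~: K" for z
  using that closure_subset[of "{z. psi z ~= 0}"] closure_subset[of "{z. fder psi (at z) v ~= 0}"]
   support_frechet[of psi v] unfolding K_def by auto
 have Ub: "U : sets lebesgue" "K : sets borel" using U K by (auto simp: borel_compact)
 have "(LINT z|lebesgue_on U. f z * fder psi (at z) v) = (LI z. f z * fder psi (at z) v)"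
  by (rule integral_lebesgue_on_version[OF Ub K(2) locint_absolutely_integrable[OF wderD(1)[OF w] K(1)]
     locintD(1)[OF wderD(1)[OF w]] _ smooth_borel[OF tfun_smooth[OF tfun_frechet[OF t]]] z0(2)]) auto
 moreover have "(LINT z|lebesgue_on U. g z * psi z) = (LI z. g z * psi z)"
  by (rule integral_lebesgue_on_version[OF Ub K(2) locint_absolutely_integrable[OF wderD(2)[OF w] K(1)]
     locintD(1)[OF wderD(2)[OF w]] _ smooth_borel[OF tfun_smooth[OF t]] z0(1)]) auto
 ultimately show "(LINT z|lebesgue_on U. f z * fder psi (at z) v) = - (LINT z|lebesgue_on U. g z * psi z)"
  using wderD(3)[OF w t] by simp
qed

section \<open>Pucci operators\<close>

lemma trace_eq: "trace (A ** X) = (SUM i:UNIV. SUM j:UNIV. A $ i $ j * X $ j $ i)" for A X :: "real^'n^'n"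
 by (simp add: trace_def matrix_matrix_mult_def)

lemma quad_form_axis: "axis i 1 \<bullet> (A *v axis j 1) = A $ i $ j" for A :: "real^'n^'n"
 by (simp add: matrix_vector_mul_component inner_axis' inner_axis row_def matrix_vector_mult_basis column_def)

lemma mat_quad: "xi \<bullet> (mat c *v xi) = c * (xi \<bullet> xi)" for xi :: "real^'n"
 by (simp add: matrix_vector_mult_def mat_def inner_vec_def if_distrib[of "%x. x * _"] sum_distrib_left mult.left_commute cong: if_cong)

lemma ellipticityD:
 assumes "A : ellipticity_set lam Lam"
 shows "A $ i $ j = A $ j $ i" "lam * (xi \<bullet> xi) <= xi \<bullet> (A *v xi)" "xi \<bullet> (A *v xi) <= Lam * (xi \<bullet> xi)"
 using assms by (auto simp: ellipticity_set_def mat_le_def mat_quad Sym_def transpose_def vec_eq_iff)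

text \<open>Diagonal entries are quadratic forms of axis vectors; an off-diagonal entry comes from
  the form at the sum of two axes, whose squared norm is 2.\<close>

lemma ellipticity_entries:
 fixes A :: "real^'n^'n"
 assumes A: "A : ellipticity_set lam Lam" and lam: "0 < lam"
 shows "lam <= A $ i $ i" "A $ i $ i <= Lam" "abs (A $ i $ j) <= Lam"
proof -
 note D = ellipticityD[OF A]
 show ii: "lam <= A $ i $ i" "A $ i $ i <= Lam" for i
  using D(2,3)[of "axis i 1"] by (auto simp: quad_form_axis inner_axis)
 show "abs (A $ i $ j) <= Lam"
 proof (cases "i = j")
  case True thus ?thesis using ii[of i] lam by simp
 next
  case False
  have q: "(axis i 1 + axis j 1) \<bullet> (A *v (axis i 1 + axis j 1)) = A $ i $ i + A $ j $ j + 2 * A $ i $ j"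
   using D(1)[of i j] by (simp add: matrix_vector_right_distrib inner_add_left inner_add_right quad_form_axis)
  have n: "(axis i 1 + axis j 1 :: real^'n) \<bullet> (axis i 1 + axis j 1) = 2"
   using False by (simp add: inner_add_left inner_add_right inner_axis_axis)
  show ?thesis using D(2,3)[of "axis i 1 + axis j 1"] ii[of i] ii[of j] lam unfolding q n by linarith
 qed
qed

lemma mat_in_ellipticity: "lam <= Lam ==> mat lam : ellipticity_set lam Lam"
 by (auto simp: ellipticity_set_def Sym_def mat_le_def mat_quad transpose_mat mult_right_mono)

lemma trace_bound:
 assumes "A : ellipticity_set lam Lam" "0 < lam"
 shows "abs (trace (A ** X)) <= Lam * (SUM i:UNIV. SUM j:UNIV. abs (X $ i $ j))"
proof -
 have "abs (trace (A ** X)) <= (SUM i:UNIV. SUM j:UNIV. abs (A $ i $ j * X $ j $ i))"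
  unfolding trace_eq by (intro order_trans[OF sum_abs] sum_mono sum_abs)
 also have "... <= (SUM i:UNIV. SUM j:UNIV. Lam * abs (X $ j $ i))"
  using ellipticity_entries(3)[OF assms] by (intro sum_mono) (simp add: abs_mult mult_right_mono)
 also have "... = Lam * (SUM i:UNIV. SUM j:UNIV. abs (X $ i $ j))"
  by (subst sum.swap) (simp add: sum_distrib_left)
 finally show ?thesis .
qed

lemma pucci_bdd:
 fixes X :: "real^'n^'n"
 assumes "0 < lam"
 shows "bdd_above ((%A. - trace (A ** X)) ` ellipticity_set lam Lam)"
proof (rule bdd_aboveI2)
 fix A :: "real^'n^'n" assume "A : ellipticity_set lam Lam"
 from trace_bound[OF this assms, of X]
 show "- trace (A ** X) <= Lam * (SUM i:UNIV. SUM j:UNIV. abs (X $ i $ j))" by linarith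
qed

lemma pucci_upper: "0 < lam ==> A : ellipticity_set lam Lam ==> - trace (A ** X) <= pucci_plus lam Lam X"
 unfolding pucci_plus_def by (intro cSUP_upper pucci_bdd)

lemma pucci_least:
 "lam <= Lam ==> (!!A. A : ellipticity_set lam Lam ==> - trace (A ** X) <= c) ==> pucci_plus lam Lam X <= c"
 unfolding pucci_plus_def using mat_in_ellipticity by (intro cSUP_least) auto

lemma pucci_minus_eq: "pucci_minus lam Lam (- X) = - pucci_plus lam Lam X"
proof -
 have eq: "trace (A ** (- X)) = - trace (A ** X)" for A by (simp add: trace_eq sum_negf)
 have "(%A. - trace (A ** (- X))) ` ellipticity_set lam Lam = uminus ` (%A. - trace (A ** X)) ` ellipticity_set lam Lam"
  by (simp add: image_image eq)
 thus ?thesis unfolding pucci_minus_def pucci_plus_def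
  by (simp add: Inf_real_def image_image)
qed

lemma trace_add: "trace (A ** (X + Y)) = trace (A ** X) + trace (A ** Y)" for A :: "real^'n^'n"
 by (simp add: trace_eq sum.distrib distrib_left)

lemma trace_scale: "trace (A ** (c *R X)) = c * trace (A ** X)" for A :: "real^'n^'n"
 by (simp add: trace_eq sum_distrib_left mult.left_commute)

lemma pucci_add_le:
 fixes X Y :: "real^'n^'n"
 assumes "0 < lam" "lam <= Lam"
 shows "pucci_plus lam Lam (X + Y) <= pucci_plus lam Lam X + pucci_plus lam Lam Y"
proof (rule pucci_least[OF assms(2)])
 fix A :: "real^'n^'n" assume A: "A : ellipticity_set lam Lam"
 show "- trace (A ** (X + Y)) <= pucci_plus lam Lam X + pucci_plus lam Lam Y"
  using pucci_upper[OF assms(1) A, of X] pucci_upper[OF assms(1) A, of Y] by (simp add: trace_add)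
qed

lemma pucci_scale:
 fixes X :: "real^'n^'n"
 assumes "0 < lam" "lam <= Lam" "c >= 0"
 shows "pucci_plus lam Lam (c *R X) = c * pucci_plus lam Lam X"
proof (cases "c = 0")
 case True
 have "pucci_plus lam Lam (0 :: real^'n^'n) <= 0" by (rule pucci_least[OF assms(2)]) (simp add: trace_def)
 moreover have "0 <= pucci_plus lam Lam (0 :: real^'n^'n)"
  using pucci_upper[OF assms(1) mat_in_ellipticity[OF assms(2)], of "0::real^'n^'n"] by (simp add: trace_def)
 ultimately show ?thesis using True by simp
next
 case False
 have le: "pucci_plus lam Lam (c *R X) <= c * pucci_plus lam Lam X" if "c > 0" for c and X :: "real^'n^'n"
 proof (rule pucci_least[OF assms(2)])
  fix A :: "real^'n^'n" assume A: "A : ellipticity_set lam Lam"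
  show "- trace (A ** (c *R X)) <= c * pucci_plus lam Lam X"
   using mult_left_mono[OF pucci_upper[OF assms(1) A, of X], of c] that by (simp add: trace_scale)
 qed
 have c: "c > 0" using False assms(3) by simp
 have "pucci_plus lam Lam ((1/c) *R (c *R X)) <= (1/c) * pucci_plus lam Lam (c *R X)"
  using c by (intro le) simp
 hence "c * pucci_plus lam Lam X <= pucci_plus lam Lam (c *R X)" using c by (simp add: field_simps)
 thus ?thesis using le[OF c, of X] by simp
qed

lemma sym_part_nth: "sym_part X $ i $ j = (X $ i $ j + X $ j $ i) / 2"
 by (simp add: sym_part_def transpose_def)

lemma sym_part_Sym: "sym_part X : Sym"
 by (auto simp: Sym_def transpose_def vec_eq_iff sym_part_nth add.commute)

lemma trace_sym_part:
 fixes X :: "real^'n^'n"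
 assumes "A : ellipticity_set lam Lam" shows "trace (A ** sym_part X) = trace (A ** X)"
proof -
 have "(SUM i:UNIV. SUM j:UNIV. A $ i $ j * X $ i $ j) = (SUM i:UNIV. SUM j:UNIV. A $ j $ i * X $ j $ i)"
  by (rule sum.swap)
 also have "... = (SUM i:UNIV. SUM j:UNIV. A $ i $ j * X $ j $ i)"
  by (intro sum.cong refl arg_cong2[where f="(*)"] ellipticityD(1)[OF assms])
 finally have "(SUM i:UNIV. SUM j:UNIV. A $ i $ j * X $ i $ j) = trace (A ** X)" by (simp add: trace_eq)
 hence "trace (A ** X) = (SUM i:UNIV. SUM j:UNIV. A $ i $ j * X $ j $ i) / 2 + (SUM i:UNIV. SUM j:UNIV. A $ i $ j * X $ i $ j) / 2"
  by (simp add: trace_eq)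
 thus ?thesis
  by (simp add: trace_eq[of A "sym_part X"] sym_part_nth sum.distrib[symmetric] sum_divide_distrib field_simps)
qed

lemma pucci_sym_part: "pucci_plus lam Lam (sym_part X) = pucci_plus lam Lam X"
 unfolding pucci_plus_def using trace_sym_part by (intro SUP_cong) auto

text \<open>Up to a nonnegative factor this matrix is the Hessian of a Gaussian. The lower
  ellipticity bound acts on the rank-one part, the upper one on the multiple of the
  identity.\<close>

lemma pucci_rank_one:
 fixes x :: "real^'n" and kappa s lam Lam :: real
 assumes lam: "0 < lam" "lam <= Lam" and s: "s >= 0" and k: "kappa >= 0"
 shows "pucci_plus lam Lam (\<chi> i j. s * (x $ i * x $ j) - (if i = j then kappa else 0))
  <= - s * lam * (norm x)^2 + kappa * (CARD('n) * Lam)"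
proof (rule pucci_least[OF lam(2)])
 fix A :: "real^'n^'n" assume A: "A : ellipticity_set lam Lam"
 have e1: "x \<bullet> (A *v x) = (SUM i:UNIV. SUM j:UNIV. A $ i $ j * (x $ j * x $ i))"
  by (simp add: inner_vec_def matrix_vector_mult_def sum_distrib_left mult_ac)
 have "(SUM j:UNIV. A $ i $ j * (s * (x $ j * x $ i) - (if j = i then kappa else 0)))
   = s * (SUM j:UNIV. A $ i $ j * (x $ j * x $ i)) - kappa * A $ i $ i" for i
 proof -
  have "(SUM j:UNIV. A $ i $ j * (s * (x $ j * x $ i) - (if j = i then kappa else 0)))
   = (SUM j:UNIV. s * (A $ i $ j * (x $ j * x $ i)) - (if j = i then kappa * A $ i $ j else 0))"
   by (intro sum.cong) (auto simp: algebra_simps)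
  thus ?thesis by (simp add: sum_subtractf sum_distrib_left)
 qed
 hence "trace (A ** (\<chi> i j. s * (x $ i * x $ j) - (if i = j then kappa else 0)))
   = s * (x \<bullet> (A *v x)) - kappa * (SUM i:UNIV. A $ i $ i)"
  by (simp add: trace_eq e1 sum_subtractf sum_distrib_left)
 moreover have "s * (lam * (norm x)^2) <= s * (x \<bullet> (A *v x))"
  using ellipticityD(2)[OF A, of x] s by (intro mult_left_mono) (auto simp: power2_norm_eq_inner)
 moreover have "kappa * (SUM i:UNIV. A $ i $ i) <= kappa * (SUM i:(UNIV::'n set). Lam)"
  using ellipticity_entries(2)[OF A lam(1)] k by (intro mult_left_mono sum_mono) auto
 ultimately show "- trace (A ** (\<chi> i j. s * (x $ i * x $ j) - (if i = j then kappa else 0)))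
   <= - s * lam * (norm x)^2 + kappa * (CARD('n) * Lam)" by simp
qed

section \<open>Test functions and supersolutions\<close>

definition Lloc :: "real => ('a::euclidean_space => real) => bool" where
 "Lloc p f \<longleftrightarrow> f : Bor & (ALL a b. intl (%z. indicator (cbox a b) z * abs (f z) powr p))"

lemma LlocD: "Lloc p f ==> f : Bor"
 "Lloc p f ==> intl (%z. indicator (cbox a b) z * abs (f z) powr p)"
 by (auto simp: Lloc_def)

lemma powr_add_le:
 fixes a b :: real assumes "p >= 0"
 shows "abs (a + b) powr p <= 2 powr p * (abs a powr p + abs b powr p)"
proof -
 have "abs (a + b) powr p <= (2 * max (abs a) (abs b)) powr p" using assms by (intro powr_mono2) auto
 also have "... = 2 powr p * (max (abs a) (abs b)) powr p" by (rule powr_mult)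
 also have "(max (abs a) (abs b)) powr p <= abs a powr p + abs b powr p" by (simp add: max_def)
 finally show ?thesis by simp
qed

lemma Lloc_cmult: "Lloc p f ==> Lloc p (%z. c * f z)"
 by (auto simp: Lloc_def abs_mult powr_mult mult.left_commute[of _ "abs c powr p"])

lemma Lloc_mono:
 assumes g: "Lloc p g" and f: "f : Bor" "!!z. abs (f z) <= C * abs (g z)" and p: "p >= 0"
 shows "Lloc p f"
 unfolding Lloc_def
proof (intro conjI allI)
 fix a b :: 'a
 have "intl (%z. abs C powr p * (indicator (cbox a b) z * abs (g z) powr p))"
  using LlocD(2)[OF g] by simp
 thus "intl (%z. indicator (cbox a b) z * abs (f z) powr p)"
 proof (rule Bochner_Integration.integrable_bound)
  show "AEL z. norm (indicator (cbox a b) z * abs (f z) powr p)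
    <= norm (abs C powr p * (indicator (cbox a b) z * abs (g z) powr p))"
  proof (rule AE_I2)
   fix z
   have "abs (f z) <= abs C * abs (g z)" using f(2)[of z] by (meson abs_ge_self abs_ge_zero mult_right_mono order_trans)
   hence "abs (f z) powr p <= (abs C * abs (g z)) powr p" using p by (intro powr_mono2) auto
   thus "norm (indicator (cbox a b) z * abs (f z) powr p)
    <= norm (abs C powr p * (indicator (cbox a b) z * abs (g z) powr p))"
    by (auto simp: powr_mult split: split_indicator)
  qed
 qed (use f(1) in auto)
qed (fact f(1))

lemma Lloc_add:
 assumes f: "Lloc p f" and g: "Lloc p g" and p: "p >= 0" shows "Lloc p (%z. f z + g z)"
 unfolding Lloc_def
proof (intro conjI allI)
 note m[measurable] = LlocD(1)[OF f] LlocD(1)[OF g]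
 show "(%z. f z + g z) : Bor" by simp
 fix a b :: 'a
 have "intl (%z. 2 powr p * (indicator (cbox a b) z * abs (f z) powr p + indicator (cbox a b) z * abs (g z) powr p))"
  using LlocD(2)[OF f] LlocD(2)[OF g] by simp
 thus "intl (%z. indicator (cbox a b) z * abs (f z + g z) powr p)"
 proof (rule Bochner_Integration.integrable_bound)
  show "AEL z. norm (indicator (cbox a b) z * abs (f z + g z) powr p)
   <= norm (2 powr p * (indicator (cbox a b) z * abs (f z) powr p + indicator (cbox a b) z * abs (g z) powr p))"
   by (intro AE_I2) (use powr_add_le[OF p] in \<open>auto split: split_indicator\<close>)
 qed auto
qed

lemma Lloc_continuous: assumes c: "continuous_on UNIV f" "p > 0" shows "Lloc p f"
 unfolding Lloc_def
proof (intro conjI allI)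
 show "f : Bor" using c(1) by (rule borel_measurable_continuous_onI)
 have "continuous_on UNIV (%z. abs (f z) powr p)"
  using c by (intro continuous_on_powr' continuous_on_rabs continuous_on_const) auto
 from locintD(2)[OF locint_continuous[OF this]]
 show "intl (%z. indicator (cbox a b) z * abs (f z) powr p)" for a b .
qed

lemma Lloc_integrable:
 assumes "f : Bor" "intl (%z. abs (f z) powr p)" shows "Lloc p f"
 using assms integrable_mult_indicator[OF _ assms(2)] by (auto simp: Lloc_def)

lemma Lloc_psc:
 fixes z0 :: "(real^'n)*real"
 assumes r: "r > 0" and f: "Lloc p f"
 shows "Lloc p (%z. f (psc r z0 z))"
proof -
 have "locint (%z. abs (f z) powr p)" using f by (auto simp: Lloc_def locint_def)
 from locint_psc[OF r this, of z0] show ?thesis using LlocD(1)[OF f] by (auto simp: Lloc_def locint_def)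
qed

lemma Lloc_Lp:
 assumes f: "Lloc p f" and S: "S : sets lebesgue" "bounded S"
 shows "f : Lp p S"
proof -
 have m: "f : borel_measurable lebesgue" using LlocD(1)[OF f] by (auto intro: measurable_completion)
 obtain a where a: "S <= cbox (-a) a" using bounded_subset_cbox_symmetric[OF S(2)] by blast
 have "intl (%z. indicator (cbox (-a) a) z * abs (f z) powr p)" by (rule LlocD(2)[OF f])
 hence "integrable lebesgue (%z. indicator (cbox (-a) a) z * abs (f z) powr p)"
  using LlocD(1)[OF f] by (subst integrable_completion) auto
 hence "integrable lebesgue (%z. indicator S z *R (indicator (cbox (-a) a) z * abs (f z) powr p))"
  using S(1) by (intro integrable_mult_indicator) auto
 moreover have "(%z. indicator S z *R (indicator (cbox (-a) a) z * abs (f z) powr p)) = (%z. indicator S z *R (abs (f z)) powr p)"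
  using a by (intro ext) (auto split: split_indicator)
 ultimately have "integrable (lebesgue_on S) (%z. abs (f z) powr p)"
  using S(1) by (simp add: integrable_restrict_space)
 thus ?thesis using m by (simp add: Lp_def measurable_restrict_space1)
qed

text \<open>A test function bundled with its weak derivatives on the whole space. Symmetry of
  \<open>D2phi\<close> is demanded at every point because the structure conditions speak of
  symmetric matrices only.\<close>

definition quad :: "real => ((real^'n)*real => real) => ((real^'n)*real => real)
   => ((real^'n)*real => real^'n) => ((real^'n)*real => real^'n^'n) => bool" where
 "quad p phi phit Dphi D2phi \<longleftrightarrow> continuous_on UNIV phi & wder (0, 1) phi phit & Lloc p phit &
  (ALL k. wder (axis k 1, 0) phi (%z. Dphi z $ k) & Lloc p (%z. Dphi z $ k)) &
  (ALL k l. wder (axis l 1, 0) (%z. Dphi z $ k) (%z. D2phi z $ k $ l) & Lloc p (%z. D2phi z $ k $ l)) &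
  (ALL z. D2phi z : Sym)"

lemma quad_add:
 assumes a: "quad p phi phit Dphi D2phi" and b: "quad p psi psit Dpsi D2psi" and p: "p > 0"
 shows "quad p (%z. phi z + psi z) (%z. phit z + psit z) (%z. Dphi z + Dpsi z) (%z. D2phi z + D2psi z)"
 using a b p unfolding quad_def
 by (auto intro!: continuous_on_add wder_add Lloc_add simp: Sym_def transpose_def vec_eq_iff)

lemma quad_scale:
 assumes a: "quad p phi phit Dphi D2phi"
 shows "quad p (%z. c * phi z) (%z. c * phit z) (%z. c *R Dphi z) (%z. c *R D2phi z)"
 using a unfolding quad_def
 by (auto intro!: continuous_on_mult wder_cmult Lloc_cmult simp: Sym_def transpose_def vec_eq_iff)

lemma quad_classical:
 fixes phi :: "(real^'n)*real => real"
 assumes c: "continuous_on UNIV phi" "continuous_on UNIV phit" "!!k. continuous_on UNIV (%z. Dphi z $ k)"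
   "!!k l. continuous_on UNIV (%z. D2phi z $ k $ l)"
  and t: "!!x t. ((%t. phi (x, t)) has_real_derivative phit (x, t)) (at t)"
  and x: "!!k x t s. ((%s. phi (x + s *R axis k 1, t)) has_real_derivative Dphi (x + s *R axis k 1, t) $ k) (at s)"
  and xx: "!!k l x t s. ((%s. Dphi (x + s *R axis l 1, t) $ k) has_real_derivative D2phi (x + s *R axis l 1, t) $ k $ l) (at s)"
  and sym: "!!z. D2phi z : Sym" and p: "p > 0"
 shows "quad p phi phit Dphi D2phi"
 unfolding quad_def
proof (intro conjI allI c(1) sym Lloc_continuous c p wder_classical)
 fix z :: "(real^'n)*real" and s :: real and k l
 show "((%s. phi (z + s *R (0, 1))) has_real_derivative phit (z + s *R (0, 1))) (at s)"
  using t[of "fst z" "s + snd z"] unfolding DERIV_shift by (cases z) (simp add: add.commute)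
 show "((%s. phi (z + s *R (axis k 1, 0))) has_real_derivative Dphi (z + s *R (axis k 1, 0)) $ k) (at s)"
  using x[of "fst z" k "snd z" s] by (cases z) simp
 show "((%s. Dphi (z + s *R (axis l 1, 0)) $ k) has_real_derivative D2phi (z + s *R (axis l 1, 0)) $ k $ l) (at s)"
  using xx[of "fst z" l "snd z" k s] by (cases z) simp
qed

lemma quad_psc:
 fixes z0 :: "(real^'n)*real"
 assumes q: "quad p phi phit Dphi D2phi" and r: "r > 0"
 shows "quad p (%z. phi (psc r z0 z)) (%z. r\<^sup>2 * phit (psc r z0 z)) (%z. r *R Dphi (psc r z0 z)) (%z. r\<^sup>2 *R D2phi (psc r z0 z))"
proof -
 have cont: "continuous_on UNIV (%z. phi (psc r z0 z))"
  using q by (auto simp: quad_def intro: continuous_on_compose2[OF _ continuous_psc])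
 have t: "wder (0, 1) (%z. phi (psc r z0 z)) (%z. r\<^sup>2 * phit (psc r z0 z))"
  using q r by (intro wder_psc) (auto simp: quad_def)
 have x: "wder (axis k 1, 0) (%z. phi (psc r z0 z)) (%z. r * Dphi (psc r z0 z) $ k)" for k
  using q r by (intro wder_psc) (auto simp: quad_def)
 have xx: "wder (axis l 1, 0) (%z. Dphi (psc r z0 z) $ k) (%z. r * D2phi (psc r z0 z) $ k $ l)" for k l
  using q r by (intro wder_psc[where f="%z. Dphi z $ k" and g="%z. D2phi z $ k $ l"]) (auto simp: quad_def)
 show ?thesis
  unfolding quad_def
 proof (intro conjI allI cont t)
  show "Lloc p (%z. r\<^sup>2 * phit (psc r z0 z))" using q r by (intro Lloc_cmult Lloc_psc) (auto simp: quad_def)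
  fix k l
  show "wder (axis k 1, 0) (%z. phi (psc r z0 z)) (%z. (r *R Dphi (psc r z0 z)) $ k)" using x by simp
  have "Lloc p (%z. r * Dphi (psc r z0 z) $ k)"
   using q r by (intro Lloc_cmult Lloc_psc[where f="%z. Dphi z $ k"]) (auto simp: quad_def)
  thus "Lloc p (%z. (r *R Dphi (psc r z0 z)) $ k)" by simp
  have "Lloc p (%z. r\<^sup>2 * D2phi (psc r z0 z) $ k $ l)"
   using q r by (intro Lloc_cmult Lloc_psc[where f="%z. D2phi z $ k $ l"]) (auto simp: quad_def)
  thus "Lloc p (%z. (r^2 *R D2phi (psc r z0 z)) $ k $ l)" by simp
  show "wder (axis l 1, 0) (%z. (r *R Dphi (psc r z0 z)) $ k) (%z. (r^2 *R D2phi (psc r z0 z)) $ k $ l)"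
   using wder_cmult[OF xx[of l k], of r] by (simp add: power2_eq_square mult.assoc)
  show "r^2 *R D2phi (psc r z0 z) : Sym" for z
  proof -
   have "D2phi (psc r z0 z) : Sym" using q unfolding quad_def by blast
   thus ?thesis by (simp add: Sym_def transpose_def vec_eq_iff)
  qed
 qed
qed

lemma bounded_cube: "bounded (cube r)" by (simp add: cube_def)

lemma bounded_cyl: "bounded (cyl (cube r) T)"
 unfolding cyl_def by (intro bounded_Times bounded_cube) (simp add: bounded_Ioc)

text \<open>Every strictly interior set is bounded, and on bounded sets the local conditions of
  \<open>quad\<close> give membership in the Sobolev class; so these functions are legal tests in
  the definition of a viscosity solution.\<close>

lemma quad_W21p_loc:
 fixes phi :: "(real^'n)*real => real"
 assumes q: "quad p phi phit Dphi D2phi" and p: "p > 0"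
 shows "phi : W21p_loc p (cube R) T" "has_weak_derivs (cyl (cube R) T) phi phit Dphi D2phi"
proof -
 have hw: "has_weak_derivs Q phi phit Dphi D2phi" for Q
  using q by (auto simp: quad_def has_weak_derivs_def intro!: wder_imp_has_weak_derivative)
 thus "has_weak_derivs (cyl (cube R) T) phi phit Dphi D2phi" .
 show "phi : W21p_loc p (cube R) T"
  unfolding W21p_loc_def
 proof (intro CollectI allI impI)
  fix Q' :: "((real^'n)*real) set" assume "strictly_inside Q' (cube R) T"
  hence Q': "Q' : sets lebesgue" "bounded Q'"
   using bounded_subset[OF bounded_cyl[of R T]] by (auto simp: strictly_inside_def)
  have L: "Lloc p phi" "Lloc p phit" "!!k. Lloc p (%z. Dphi z $ k)" "!!k l. Lloc p (%z. D2phi z $ k $ l)"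
   using q p by (auto simp: quad_def intro: Lloc_continuous)
  show "phi : W21p p Q'"
   unfolding W21p_def using hw[of Q'] Lloc_Lp[OF L(1) Q'] Lloc_Lp[OF L(2) Q'] Lloc_Lp[OF L(3) Q'] Lloc_Lp[OF L(4) Q']
   by blast
 qed
qed

section \<open>Limits of essential bounds and the passage from viscosity solutions to
  \<open>supers\<close>\<close>

lemma Limsup_filter_mono:
 fixes f :: "'a => ereal" assumes "F <= G" shows "Limsup F f <= Limsup G f"
 unfolding Limsup_def
 by (rule INF_superset_mono) (use assms in \<open>auto simp: le_filter_def\<close>)

text \<open>\<open>Lim\<close> is a description operator, so its value is known only once
  convergence is proved; monotonicity in the radius gives the limit as an infimum.\<close>

lemma mono_tendsto_at_right_Lim:
 fixes h :: "real => ereal"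
 assumes m: "!!s t. 0 < s ==> s <= t ==> h s <= h t"
 shows "(h \<longlongrightarrow> Lim (at_right 0) h) (at_right 0)" "r > 0 ==> Lim (at_right 0) h <= h r"
proof -
 define L where "L = (INF t\<in>{0<..}. h t)"
 have "(h \<longlongrightarrow> L) (at_right 0)"
 proof (rule order_tendstoI)
  fix a assume a: "a < L"
  have "a < h t" if "t > 0" for t using a that unfolding L_def by (meson INF_lower greaterThan_iff less_le_trans)
  thus "\<forall>\<^sub>F t in at_right 0. a < h t" by (auto simp: eventually_at_right_less eventually_at_filter)
 next
  fix a assume "L < a"
  then obtain t where t: "t > 0" "h t < a" unfolding L_def by (auto simp: INF_less_iff)
  have "h s < a" if "0 < s" "s < t" for s using m[of s t] that t by (auto intro: le_less_trans)
  thus "\<forall>\<^sub>F s in at_right 0. h s < a"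
   using t(1) by (auto simp: eventually_at_right intro!: exI[of _ t])
 qed
 moreover hence L: "Lim (at_right 0) h = L" by (intro tendsto_Lim) auto
 ultimately show "(h \<longlongrightarrow> Lim (at_right 0) h) (at_right 0)" by simp
 show "Lim (at_right 0) h <= h r" if "r > 0" using that unfolding L unfolding L_def by (intro INF_lower) auto
qed

lemma pcyl_mono: "0 <= s ==> s <= t ==> pcyl s z <= pcyl t z"
proof -
 assume st: "0 <= s" "s <= t"
 hence s2: "s^2 <= t^2" by (intro power_mono) auto
 have "box (fst z - vec s) (fst z + vec s) <= box (fst z - vec t) (fst z + vec t)"
  unfolding subset_eq mem_box_cart
 proof (intro ballI allI)
  fix x i assume "x : box (fst z - vec s) (fst z + vec s)"
  hence "(fst z - vec s) $ i < x $ i & x $ i < (fst z + vec s) $ i" by (simp add: mem_box_cart)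
  thus "(fst z - vec t) $ i < x $ i & x $ i < (fst z + vec t) $ i" using st by simp
 qed
 moreover have "{snd z - s\<^sup>2 <.. snd z} <= {snd z - t\<^sup>2 <.. snd z}"
 proof
  fix x assume "x : {snd z - s\<^sup>2 <.. snd z}"
  hence "snd z - s\<^sup>2 < x" "x <= snd z" by simp_all
  hence "snd z - t\<^sup>2 < x" using s2 by linarith
  thus "x : {snd z - t\<^sup>2 <.. snd z}" using \<open>x <= snd z\<close> by simp
 qed
 ultimately show ?thesis unfolding pcyl_def by (intro Sigma_mono) auto
qed

lemma pcyl_borel: "pcyl r z : sets borel"
 unfolding pcyl_def by (intro borel_Times) auto

lemma ae_filter_lebesgue_on_mono:
 assumes "S <= T" "S : sets lebesgue" "T : sets lebesgue"
 shows "ae_filter (lebesgue_on S) <= ae_filter (lebesgue_on T)"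
 using assms by (auto simp: le_filter_def AE_restrict_space_iff elim: eventually_mono)

lemma ess_sup_mono: "S <= T ==> S : sets lebesgue ==> T : sets lebesgue ==> ess_sup S g <= ess_sup T g"
 unfolding ess_sup_def by (intro Limsup_filter_mono ae_filter_lebesgue_on_mono)

lemma ess_inf_eq: "ess_inf S g = - ess_sup S (%z. - g z)"
 unfolding ess_inf_def ess_sup_def
 using ereal_Limsup_uminus[of "ae_filter (lebesgue_on S)" "%z. ereal (g z)"] by simp

lemma Lim_ess_sup_le:
 fixes z :: "(real^'n)*real"
 assumes ae: "AEL w. w : pcyl r z --> g w <= c" and r: "r > 0"
 shows "Lim (at_right 0) (%eps. ess_sup (pcyl eps z) g) <= ereal c"
proof -
 have S: "pcyl s z : sets lebesgue" for s :: real and z :: "(real^'n)*real" using pcyl_borel[of s z] by simp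
 have "Lim (at_right 0) (%eps. ess_sup (pcyl eps z) g) <= ess_sup (pcyl r z) g"
  by (rule mono_tendsto_at_right_Lim(2)[OF _ r]) (intro ess_sup_mono pcyl_mono S; simp)
 also have "... <= ereal c"
  unfolding ess_sup_def
 proof (rule Limsup_bounded)
  have "AE w in lebesgue. w : pcyl r z --> ereal (g w) <= ereal c" using AE_completion[OF ae] by simp
  thus "\<forall>\<^sub>F w in ae_filter (lebesgue_on (pcyl r z)). ereal (g w) <= ereal c"
   using S by (subst AE_restrict_space_iff) auto
 qed
 finally show ?thesis .
qed

lemma Lim_ess_inf_ge:
 fixes z :: "(real^'n)*real"
 assumes ae: "AEL w. w : pcyl r z --> c <= g w" and r: "r > 0"
 shows "ereal c <= Lim (at_right 0) (%eps. ess_inf (pcyl eps z) g)"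
proof -
 have S: "pcyl s z : sets lebesgue" for s :: real and z :: "(real^'n)*real" using pcyl_borel[of s z] by simp
 let ?h = "%eps. ess_sup (pcyl eps z) (%w. - g w)"
 have "Lim (at_right 0) ?h <= ereal (-c)"
  by (rule Lim_ess_sup_le[OF _ r]) (use ae in auto)
 moreover have "(?h \<longlongrightarrow> Lim (at_right 0) ?h) (at_right 0)"
 proof -
  have m: "0 < s ==> s <= t ==> ?h s <= ?h t" for s t by (intro ess_sup_mono pcyl_mono S; simp)
  show ?thesis using m by (rule mono_tendsto_at_right_Lim(1))
 qed
 ultimately have "((%eps. - ?h eps) \<longlongrightarrow> - Lim (at_right 0) ?h) (at_right 0)" "ereal c <= - Lim (at_right 0) ?h"
  using ereal_minus_le_minus[of "- ereal c" "Lim (at_right 0) ?h"] by (auto intro: tendsto_uminus_ereal)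
 moreover have "Lim (at_right 0) (%eps. - ?h eps) = - Lim (at_right 0) ?h"
  using calculation(1) by (intro tendsto_Lim) auto
 ultimately show ?thesis by (simp add: ess_inf_eq)
qed

text \<open>The supersolution inequality in contrapositive form, with the structure conditions already inserted.\<close>

definition supers :: "real => real => real => ((real^'n)*real => real) => ((real^'n)*real => real)
  => ((real^'n)*real => real) => bool" where
 "supers lam Lam p mu f u \<longleftrightarrow> continuous_on (closure Q_dom) u &
  (ALL phi phit Dphi D2phi z eps r. quad p phi phit Dphi D2phi & z : Q_dom & eps > 0 & r > 0 & pcyl r z <= Q_dom &
   (ALL w:pcyl r z. u z - phi z <= u w - phi w) -->
   ~ (AEL w. w : pcyl r z -->
      phit w + pucci_plus lam Lam (D2phi w) + mu w * norm (Dphi w) + f w <= - eps))"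

text \<open>The extremal operator is positively homogeneous, so a factor on \<open>u\<close> passes
  to \<open>f\<close> and leaves the drift coefficient alone. This is how heights are normalised
  later.\<close>

lemma supers_scale:
 fixes u :: "(real^'n)*real => real"
 assumes s: "supers lam Lam p mu f u" and c: "c > 0" and lam: "0 < lam" "lam <= Lam"
 shows "supers lam Lam p mu (%z. c * f z) (%z. c * u z)"
 unfolding supers_def
proof (intro conjI allI impI notI)
 show "continuous_on (closure Q_dom) (%z. c * u z)"
  using s by (auto simp: supers_def intro: continuous_on_mult)
 fix phi phit Dphi D2phi z eps r
 assume A: "quad p phi phit Dphi D2phi & z : Q_dom & eps > 0 & r > 0 & pcyl r z <= Q_dom &
   (ALL w:pcyl r z. c * u z - phi z <= c * u w - phi w)"
  and ae: "AEL w. w : pcyl r z -->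
      phit w + pucci_plus lam Lam (D2phi w) + mu w * norm (Dphi w) + c * f w <= - eps"
 let ?d = "1 / c"
 have q: "quad p (%z. ?d * phi z) (%z. ?d * phit z) (%z. ?d *R Dphi z) (%z. ?d *R D2phi z)"
  using A by (intro quad_scale) auto
 have "ALL w:pcyl r z. u z - ?d * phi z <= u w - ?d * phi w"
 proof
  fix w assume "w : pcyl r z"
  hence "c * u z - phi z <= c * u w - phi w" using A by blast
  hence "?d * (c * u z - phi z) <= ?d * (c * u w - phi w)" using c by (intro mult_left_mono) auto
  thus "u z - ?d * phi z <= u w - ?d * phi w" using c by (simp add: right_diff_distrib)
 qed
 moreover have "AEL w. w : pcyl r z -->
   ?d * phit w + pucci_plus lam Lam (?d *R D2phi w) + mu w * norm (?d *R Dphi w) + f w <= - (?d * eps)"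
  using ae
 proof (eventually_elim, intro impI)
  fix w assume "w : pcyl r z --> phit w + pucci_plus lam Lam (D2phi w) + mu w * norm (Dphi w) + c * f w <= - eps" "w : pcyl r z"
  hence "?d * (phit w + pucci_plus lam Lam (D2phi w) + mu w * norm (Dphi w) + c * f w) <= ?d * (- eps)"
   using c by (intro mult_left_mono) auto
  moreover have "pucci_plus lam Lam (?d *R D2phi w) = ?d * pucci_plus lam Lam (D2phi w)"
   using c lam by (intro pucci_scale) auto
  moreover have "norm (?d *R Dphi w) = ?d * norm (Dphi w)" using c by simp
  ultimately show "?d * phit w + pucci_plus lam Lam (?d *R D2phi w) + mu w * norm (?d *R Dphi w) + f w <= - (?d * eps)"
   using c by (simp add: algebra_simps)
 qed
 moreover have "?d * eps > 0" using A c by simp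
 ultimately show False
  using s A q unfolding supers_def by blast
qed

text \<open>For \<open>K - u\<close> the test function is negated, and \<open>pucci_minus\<close> at
  \<open>- X\<close> is \<open>- pucci_plus\<close> at \<open>X\<close>; so the two one-sided
  definitions lead to the same extremal inequality. The absolute value of \<open>f\<close> covers
  both signs, and passing to Borel versions costs a null set.\<close>

lemma visc_supers:
 fixes u :: "(real^'n)*real => real"
 assumes v: "Lp_visc_solution p (cube 10) 10 (%z xi X. G z xi X - f z) u"
  and sc: "structure_conditions lam Lam Q_dom mu G"
  and cu: "continuous_on (closure Q_dom) u" and p: "p > 0"
  and ae: "AEL w. w : Q_dom --> mu' w = mu w & f' w = abs (f w)"
 shows "supers lam Lam p mu' f' u" "supers lam Lam p mu' f' (%z. K - u z)"
proof -
 have Q: "Q_dom = cyl (cube 10) 10" by (simp add: Q_dom_def)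
 have zS: "(0::real^'n^'n) : Sym" by (simp add: Sym_def transpose_def vec_eq_iff)
 have up: "G w xi X <= pucci_plus lam Lam X + mu w * norm xi" if "w : Q_dom" "X : Sym" for w xi X
 proof -
  have "G w xi X - G w xi 0 <= pucci_plus lam Lam (X - 0)" "abs (G w xi 0) <= mu w * norm xi"
   using sc that zS unfolding structure_conditions_def by blast+
  thus ?thesis by simp
 qed
 have lo: "G w (- xi) (- X) >= - pucci_plus lam Lam X - mu w * norm xi" if "w : Q_dom" "X : Sym" for w xi X
 proof -
  have "- X : Sym" using that by (auto simp: Sym_def transpose_def vec_eq_iff)
  hence "pucci_minus lam Lam (- X - 0) <= G w (- xi) (- X) - G w (- xi) 0" "abs (G w (- xi) 0) <= mu w * norm (- xi)"
   using sc that zS unfolding structure_conditions_def by blast+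
  thus ?thesis by (simp add: pucci_minus_eq)
 qed
 show "supers lam Lam p mu' f' u"
  unfolding supers_def
 proof (intro conjI allI impI notI cu)
  fix phi phit Dphi D2phi z eps r
  assume A: "quad p phi phit Dphi D2phi & z : Q_dom & eps > 0 & r > 0 & pcyl r z <= Q_dom &
   (ALL w:pcyl r z. u z - phi z <= u w - phi w)"
  and ae2: "AEL w. w : pcyl r z -->
      phit w + pucci_plus lam Lam (D2phi w) + mu' w * norm (Dphi w) + f' w <= - eps"
  have D2: "D2phi w : Sym" for w using A unfolding quad_def by blast
  have c: "continuous_on (cyl (cube 10) 10) phi" using A by (auto simp: quad_def intro: continuous_on_subset)
  have "0 <= Lim (at_right 0) (%eps. ess_sup (pcyl eps z) (%w. phit w + (G w (Dphi w) (D2phi w) - f w)))"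
   using v A c quad_W21p_loc[of p phi phit Dphi D2phi 10 10] p
   unfolding Lp_visc_solution_def Lp_visc_supersolution_def Q by blast
  also have "... <= ereal (- eps)"
  proof (rule Lim_ess_sup_le)
   show "AEL w. w : pcyl r z --> phit w + (G w (Dphi w) (D2phi w) - f w) <= - eps"
    using ae ae2
   proof (eventually_elim, intro impI)
    fix w assume 1: "w : Q_dom --> mu' w = mu w & f' w = abs (f w)"
     and 2: "w : pcyl r z --> phit w + pucci_plus lam Lam (D2phi w) + mu' w * norm (Dphi w) + f' w <= - eps"
     and w: "w : pcyl r z"
    have wQ: "w : Q_dom" using A w by blast
    from up[OF this D2, of "Dphi w" w] 1 2 w wQ show "phit w + (G w (Dphi w) (D2phi w) - f w) <= - eps"
     using abs_ge_minus_self[of "f w"] by auto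
   qed
  qed (use A in auto)
  finally show False using A by simp
 qed
 show "supers lam Lam p mu' f' (%z. K - u z)"
  unfolding supers_def
 proof (intro conjI allI impI notI)
  show "continuous_on (closure Q_dom) (%z. K - u z)" by (intro continuous_on_diff continuous_on_const cu)
  fix phi phit Dphi D2phi z eps r
  assume A: "quad p phi phit Dphi D2phi & z : Q_dom & eps > 0 & r > 0 & pcyl r z <= Q_dom &
   (ALL w:pcyl r z. K - u z - phi z <= K - u w - phi w)"
  and ae2: "AEL w. w : pcyl r z -->
      phit w + pucci_plus lam Lam (D2phi w) + mu' w * norm (Dphi w) + f' w <= - eps"
  have D2: "D2phi w : Sym" for w using A unfolding quad_def by blast
  have q: "quad p (%z. - phi z) (%z. - phit z) (%z. - Dphi z) (%z. - D2phi z)"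
   using quad_scale[of p phi phit Dphi D2phi "-1"] A by simp
  have c: "continuous_on (cyl (cube 10) 10) (%z. - phi z)" using q by (auto simp: quad_def intro: continuous_on_subset)
  have m: "ALL w:pcyl r z. u w - (- phi w) <= u z - (- phi z)" using A by force
  have "ereal eps <= Lim (at_right 0) (%eps. ess_inf (pcyl eps z) (%w. - phit w + (G w (- Dphi w) (- D2phi w) - f w)))"
  proof (rule Lim_ess_inf_ge)
   show "AEL w. w : pcyl r z --> eps <= - phit w + (G w (- Dphi w) (- D2phi w) - f w)"
    using ae ae2
   proof (eventually_elim, intro impI)
    fix w assume 1: "w : Q_dom --> mu' w = mu w & f' w = abs (f w)"
     and 2: "w : pcyl r z --> phit w + pucci_plus lam Lam (D2phi w) + mu' w * norm (Dphi w) + f' w <= - eps"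
     and w: "w : pcyl r z"
    have wQ: "w : Q_dom" using A w by blast
    from lo[OF this D2, of w "Dphi w"] 1 2 w wQ show "eps <= - phit w + (G w (- Dphi w) (- D2phi w) - f w)"
     using abs_ge_self[of "f w"] by auto
   qed
  qed (use A in auto)
  also have "... <= 0"
   using v A c m quad_W21p_loc[OF q p, of 10 10]
   unfolding Lp_visc_solution_def Lp_visc_subsolution_def Q by blast
  finally show False using A by simp
 qed
qed

section \<open>Uniqueness and symmetry of weak derivatives\<close>

lemma fundamental_lemma:
 fixes g :: "'a::euclidean_space => real"
 assumes g: "locint g" and z: "!!psi. tfun psi ==> (LI z. g z * psi z) = 0"
 shows "AEL z. g z = 0"
proof -
 have b: "AEL z. z : box a b --> g z = 0" for a b
 proof (rule fundamental_lemma_box)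
  have i: "intl (%z. indicator (box a b) z *R (indicator (cbox a b) z * g z))"
   by (intro integrable_mult_indicator locintD(2)[OF g]) auto
  have eq: "(%z. indicator (box a b) z *R (indicator (cbox a b) z * g z)) = (%z. indicator (box a b) z * g z)"
   using box_subset_cbox[of a b] by (intro ext) (auto split: split_indicator)
  show "intl (%z. indicator (box a b) z * g z)" using i unfolding eq .
  fix psi :: "'a => real" assume psi: "psi : test_functions (box a b)"
  have eq2: "(%z. indicator (box a b) z * g z * psi z) = (%z. g z * psi z)"
  proof
   fix z
   have "psi z = 0" if "z ~: box a b"
    using psi that closure_subset[of "{z. psi z ~= 0}"] by (auto simp: test_functions_def)
   thus "indicator (box a b) z * g z * psi z = g z * psi z" by (auto split: split_indicator)
  qed
  show "(LI z. indicator (box a b) z * g z * psi z) = 0"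
   unfolding eq2 by (rule z[OF test_functions_tfun[OF psi]])
 qed
 have "AEL z. ALL n::nat. z : box (- (real n *R One)) (real n *R One) --> g z = 0"
  using b by (subst AE_all_countable) auto
 thus ?thesis
 proof eventually_elim
  fix z assume A: "ALL n::nat. z : box (- (real n *R One)) (real n *R One) --> g z = 0"
  have "z : (UN n::nat. box (- (real n *R One)) (real n *R One))" unfolding UN_box_eq_UNIV by simp
  thus "g z = 0" using A by blast
 qed
qed

lemma fundamental_lemma_eq:
 fixes g g' :: "'a::euclidean_space => real"
 assumes g: "locint g" "locint g'" and z: "!!psi. tfun psi ==> (LI z. g z * psi z) = (LI z. g' z * psi z)"
 shows "AEL z. g z = g' z"
proof -
 have "AEL z. g z + (-1) * g' z = 0"
 proof (rule fundamental_lemma)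
  show "locint (%z. g z + (-1) * g' z)" by (intro locint_add locint_cmult g)
  fix psi :: "'a => real" assume psi: "tfun psi"
  have "(LI z. (g z + (-1) * g' z) * psi z) = (LI z. g z * psi z - g' z * psi z)"
   by (simp add: algebra_simps)
  also have "... = 0"
   using z[OF psi] by (subst Bochner_Integration.integral_diff) (auto intro: integrable_tfun g psi)
  finally show "(LI z. (g z + (-1) * g' z) * psi z) = 0" .
 qed
 thus ?thesis by eventually_elim simp
qed

text \<open>Both iterated derivatives act on test functions through \<open>f\<close> and a mixed
  second derivative of the test function, and the latter is symmetric.\<close>

lemma wder_symmetric:
 fixes f :: "'a::euclidean_space => real"
 assumes "wder v f fv" "wder w f fw" "wder w fv fvw" "wder v fw fwv"
 shows "AEL z. fvw z = fwv z"
proof (rule fundamental_lemma_eq)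
 show "locint fvw" "locint fwv" using assms(3,4) wderD(2) by auto
 fix psi :: "'a => real" assume psi: "tfun psi"
 have "- (LI z. fvw z * psi z) = - (LI z. f z * fder (%z. fder psi (at z) w) (at z) v)"
  using wderD(3)[OF assms(3) psi] wderD(3)[OF assms(1) tfun_frechet[OF psi]] by simp
 moreover have "- (LI z. fwv z * psi z) = - (LI z. f z * fder (%z. fder psi (at z) v) (at z) w)"
  using wderD(3)[OF assms(4) psi] wderD(3)[OF assms(2) tfun_frechet[OF psi]] by simp
 ultimately show "(LI z. fvw z * psi z) = (LI z. fwv z * psi z)"
  using frechet_second_symmetric[OF tfun_smooth[OF psi], where v=v and w=w] by simp
qed

text \<open>Weak Hessians are symmetric only almost everywhere; symmetrising changes them on a null
  set and gives the pointwise symmetry that \<open>quad\<close> demands.\<close>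

lemma quad_symmetrize:
 fixes w :: "(real^'n)*real => real"
 assumes c: "continuous_on UNIV w" and t: "wder (0, 1) w wt" "Lloc p wt"
  and x: "!!k. wder (axis k 1, 0) w (%z. Dw z $ k)" "!!k. Lloc p (%z. Dw z $ k)"
  and xx: "!!k l. wder (axis l 1, 0) (%z. Dw z $ k) (%z. D2 z $ k $ l)" "!!k l. Lloc p (%z. D2 z $ k $ l)"
  and p: "p >= 0"
 shows "quad p w wt Dw (%z. sym_part (D2 z))" "AEL z. sym_part (D2 z) = D2 z"
proof -
 have "AEL z. ALL k l. D2 z $ k $ l = D2 z $ l $ k"
  by (subst AE_all_countable, intro allI, subst AE_all_countable)
   (use wder_symmetric[OF x(1) x(1) xx(1) xx(1)] in blast)
 thus ae: "AEL z. sym_part (D2 z) = D2 z"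
  by eventually_elim (simp add: vec_eq_iff sym_part_nth)
 have m: "(%z. sym_part (D2 z) $ k $ l) : Bor" for k l
  using LlocD(1)[OF xx(2)] by (simp add: sym_part_nth)
 have "wder (axis l 1, 0) (%z. Dw z $ k) (%z. sym_part (D2 z) $ k $ l)" for k l
  by (rule wder_AE_cong[OF xx(1) _ m]) (use ae in eventually_elim, simp)
 moreover have "Lloc p (%z. sym_part (D2 z) $ k $ l)" for k l
 proof -
  have "Lloc p (%z. (1/2) * (D2 z $ k $ l + D2 z $ l $ k))"
   by (intro Lloc_cmult Lloc_add xx(2) p)
  thus ?thesis by (simp add: sym_part_nth)
 qed
 ultimately show "quad p w wt Dw (%z. sym_part (D2 z))"
  unfolding quad_def using c t x sym_part_Sym by blast
qed

text \<open>Needed because \<open>ABP_solvable\<close> bounds norms of one choice of derivatives,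
  while membership in \<open>W21p_loc\<close> provides integrability for a possibly different
  choice. A bound on the norm alone would say nothing about a nonintegrable function, whose Bochner
  integral is \<open>0\<close> by default.\<close>

lemma weak_derivative_unique_box:
 fixes f :: "'a::euclidean_space => real"
 assumes w: "has_weak_derivative U v f g" and U: "open U" and ab: "cbox a b <= U"
  and w': "has_weak_derivative (box a b) v f' g'" and ff: "AEL z. z : box a b --> f' z = f z"
  and g': "g' absolutely_integrable_on (box a b)"
 shows "AEL z. z : box a b --> g' z = g z"
proof -
 have ai: "f absolutely_integrable_on cbox a b" "g absolutely_integrable_on cbox a b"
  using w ab by (auto simp: has_weak_derivative_def)
 obtain F where F: "F : Bor" "intl F" "AEL z. z : cbox a b --> F z = f z"
  using borel_version[OF ai(1)] by auto
 obtain G where G: "G : Bor" "intl G" "AEL z. z : cbox a b --> G z = g z"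
  using borel_version[OF ai(2)] by auto
 obtain G' where G': "G' : Bor" "intl G'" "AEL z. z : box a b --> G' z = g' z"
  using borel_version[OF g'] by auto
 have "AEL z. z : box a b --> G' z - G z = 0"
 proof (rule fundamental_lemma_box)
  have GG: "intl (%z. G' z - G z)" using G G' by auto
  thus "intl (%z. indicator (box a b) z * (G' z - G z))"
   using integrable_mult_indicator[OF _ GG, of "box a b"] by simp
  fix psi :: "'a => real" assume psi: "psi : test_functions (box a b)"
  define K where "K = closure {z. psi z ~= 0}"
  have K: "compact K" "K <= box a b" using psi by (auto simp: K_def test_functions_def)
  have KU: "K <= cbox a b" "K <= U" using K(2) ab box_subset_cbox[of a b] by blast+
  note t = test_functions_tfun[OF psi]
  have "AEL z. z : K --> F z = f' z"
   using F(3) ff by eventually_elim (use K KU in auto)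
  moreover have "AEL z. z : K --> F z = f z" "AEL z. z : K --> G z = g z"
   using F(3) G(3) by (eventually_elim; use KU in auto)+
  moreover have "AEL z. z : K --> G' z = g' z" using G'(3) by eventually_elim (use K in auto)
  ultimately have "(LI z. G' z * psi z) = (LI z. G z * psi z)"
   using has_weak_derivative_version[OF w U K(1) KU(2) F(1) _ G(1) _ t]
    has_weak_derivative_version[OF w' open_box K F(1) _ G'(1) _ t] by (simp add: K_def)
  moreover have "indicator (box a b) z * (G' z - G z) * psi z = G' z * psi z - G z * psi z" for z
   using K(2) closure_subset[of "{z. psi z ~= 0}"] unfolding K_def
   by (cases "psi z = 0") (auto simp: algebra_simps split: split_indicator)
  moreover have "intl (%z. G' z * psi z)" "intl (%z. G z * psi z)"
  proof -
   have "locint G'" "locint G" using locint_integrable_mult[OF G'(2), of "%_. 1"] locint_integrable_mult[OF G(2), of "%_. 1"] by auto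
   thus "intl (%z. G' z * psi z)" "intl (%z. G z * psi z)" using t by (auto intro: integrable_tfun)
  qed
  ultimately show "(LI z. indicator (box a b) z * (G' z - G z) * psi z) = 0" by simp
 qed
 thus ?thesis using G(3) G'(3)
  by eventually_elim (use box_subset_cbox in auto)
qed

lemma AE_box_boundary: "AEL z. z : cbox a b --> z : box a (b::'a::euclidean_space)"
proof (rule AE_I)
 show "{z : space lborel. ~ (z : cbox a b --> z : box a b)} <= cbox a b - box a b" by auto
 have "emeas (cbox a b - box a b) = emeas (cbox a b) - emeas (box a b)"
  using box_subset_cbox[of a b] emeasure_lborel_box_finite[of a b] by (intro emeasure_Diff) auto
 also have "... = 0" by (simp add: emeasure_lborel_box_eq emeasure_lborel_cbox_eq)
 finally show "emeas (cbox a b - box a b) = 0" .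
qed auto

lemma Lp_absolutely_integrable:
 fixes f :: "'a::euclidean_space => real"
 assumes f: "f : Lp p (box a b)" and p: "p >= 1"
 shows "f absolutely_integrable_on (box a b)"
proof -
 let ?M = "lebesgue_on (box a b)"
 interpret finite_measure ?M
  by (rule finite_measureI) (simp add: emeasure_restrict_space emeasure_lborel_box_eq)
 have m: "f : borel_measurable ?M" and i: "integrable ?M (%z. abs (f z) powr p)" using f by (auto simp: Lp_def)
 have "integrable ?M (%z. abs (f z))"
  by (rule power_mean(1)[OF _ p _ _ i]) (use m in \<open>auto intro: finite_measure_axioms\<close>)
 hence "integrable ?M f" using m by (simp add: integrable_abs_iff)
 thus ?thesis by (simp add: integrable_restrict_space set_integrable_def)
qed

text \<open>Integrability comes from \<open>g'\<close>, the value of the norm from \<open>g\<close>;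
  they agree almost everywhere on the open box, and the faces of the closed box are null.\<close>

lemma Lp_borel_version:
 fixes g :: "'a::euclidean_space => real"
 assumes g: "g absolutely_integrable_on cbox a b" and g': "g' : Lp p (box a b)"
  and gg: "AEL z. z : box a b --> g' z = g z" and p: "p > 0"
 obtains G where "G : Bor" "intl G" "AEL z. z : cbox a b --> G z = g z"
  "intl (%z. abs (G z) powr p)" "(LI z. abs (G z) powr p) = (Lp_norm p (box a b) g) powr p"
proof -
 obtain G where G: "G : Bor" "intl G" "AEL z. z : cbox a b --> G z = g z"
  "!!z. z ~: cbox a b ==> G z = 0"
  using borel_version[OF g] by auto
 have Gm: "(%z. abs (G z) powr p) : Bor" using G(1) by simp
 have e: "AEL z. indicator (box a b) z *R (abs (g' z)) powr p = abs (G z) powr p"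
  "AEL z. indicator (box a b) z *R (abs (g z)) powr p = abs (G z) powr p"
  using G(3) gg AE_box_boundary[of a b]
  by (eventually_elim, use G(4) box_subset_cbox[of a b] p in \<open>auto split: split_indicator\<close>)+
 have "integrable lebesgue (%z. indicator (box a b) z *R (abs (g' z)) powr p)"
  using g' by (simp add: Lp_def integrable_restrict_space)
 hence il: "integrable lebesgue (%z. abs (G z) powr p)"
  by (rule integrable_cong_AE_imp) (use Gm AE_completion[OF e(1)] in \<open>auto intro: measurable_completion\<close>)
 hence i: "intl (%z. abs (G z) powr p)" using Gm by (simp add: integrable_completion)
 have gm: "(%z. indicator (cbox a b) z * g z) : borel_measurable lebesgue"
  using g by (auto simp: set_integrable_def)
 have gm': "(%z. indicator (box a b) z *R (abs (g z)) powr p) : borel_measurable lebesgue"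
 proof -
  have "(%z. abs (indicator (cbox a b) z * g z) powr p) : borel_measurable lebesgue"
   using gm by (intro measurable_compose[OF gm, of "%y. abs y powr p"]) simp
  hence "(%z. indicator (box a b) z *R (abs (indicator (cbox a b) z * g z)) powr p) : borel_measurable lebesgue"
   by (intro borel_measurable_scaleR borel_measurable_indicator) auto
  moreover have "(%z. indicator (box a b) z *R (abs (indicator (cbox a b) z * g z)) powr p) = (%z. indicator (box a b) z *R (abs (g z)) powr p)"
   using box_subset_cbox[of a b] by (intro ext) (auto split: split_indicator)
  ultimately show ?thesis by simp
 qed
 have "(LINT z|lebesgue_on (box a b). abs (g z) powr p) = (LINT z|lebesgue. indicator (box a b) z *R (abs (g z)) powr p)"
  by (subst integral_restrict_space) auto
 also have "... = (LINT z|lebesgue. abs (G z) powr p)"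
  by (rule integral_cong_AE[OF gm' _ AE_completion[OF e(2)]]) (use il in auto)
 also have "... = (LI z. abs (G z) powr p)" using Gm by (simp add: integral_completion)
 finally have eq: "(LINT z|lebesgue_on (box a b). abs (g z) powr p) = (LI z. abs (G z) powr p)" .
 have "0 <= (LI z. abs (G z) powr p)" by (intro integral_nonneg_AE) auto
 hence "(Lp_norm p (box a b) g) powr p = (LI z. abs (G z) powr p)"
  unfolding Lp_norm_def eq using p by (simp add: powr_powr)
 thus ?thesis using that[OF G(1,2,3) i] by simp
qed

section \<open>The extremal equation\<close>

definition plat :: "real => real" where "plat y = stp (2 * y + 3) - stp (2 * y - 3)"

lemma smooth_plat_affine: "smooth (%y. plat (c + d * y))"
proof -
 have "smooth (%y. stp ((2 * c + 3) + (2 * d) * y))" "smooth (%y. stp ((2 * c - 3) + (2 * d) * y))"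
  using smooth_affine[OF bounded_linear_mult_right smooth_stp] by blast+
 from smooth_diff[OF this] show ?thesis by (simp add: plat_def algebra_simps)
qed

lemma plat_1: "abs y <= 1 ==> plat y = 1" by (simp add: plat_def stp_0 stp_1 abs_le_iff)

lemma plat_0: "2 <= abs y ==> plat y = 0"
 by (cases "y >= 0") (auto simp: plat_def stp_0 stp_1)

lemma plat_bounds: "0 <= plat y" "plat y <= 1"
 using stp_mono[of "2 * y - 3" "2 * y + 3"] stp_bounds[of "2 * y + 3"] stp_bounds[of "2 * y - 3"]
 by (auto simp: plat_def)

lemma frechet_local_const:
 fixes f :: "'a::euclidean_space => real"
 assumes "open S" "z : S" "!!w. w : S ==> f w = c"
 shows "fder f (at z) v = 0"
proof -
 have "((%z. c) has_derivative (%v. 0)) (at z)" by (rule has_derivative_const)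
 from has_derivative_transform_within_open[OF this assms(1,2), of f] assms(3)
 have "(f has_derivative (%v. 0)) (at z)" by simp
 from fun_cong[OF frechet_derivative_at[OF this], of v] show ?thesis by simp
qed

lemma tfun_common_bound:
 assumes "finite F" "!!f. f : F ==> tfun f"
 shows "EX B>=0. ALL f:F. ALL z. abs (f z) <= B"
 using assms
proof (induction F)
 case (insert f F)
 obtain B where B: "B >= 0" "ALL f:F. ALL z. abs (f z) <= B" using insert by auto
 obtain B' where B': "!!z. abs (f z) <= B'" "B' >= 0" using tfun_bounded[OF insert.prems[of f]] by auto
 show ?case using B B' by (intro exI[of _ "max B B'"]) (auto simp: le_max_iff_disj)
qed auto

text \<open>Bounds the p-th power of the norm rather than the norm, which keeps scaling identities
  free of roots; the price is a factor \<open>2 powr p\<close> at each sum.\<close>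

definition bd :: "real => real => ('a::euclidean_space => real) => bool" where
 "bd p M f \<longleftrightarrow> f : Bor & intl (%z. abs (f z) powr p) & (LI z. abs (f z) powr p) <= M"

lemma bdI_dominated:
 assumes g: "intl g" "(LI z. g z) <= M" and f: "f : Bor"
  and le: "AEL z. abs (f z) powr p <= g z"
 shows "bd p M f"
proof -
 have i: "intl (%z. abs (f z) powr p)"
  by (rule Bochner_Integration.integrable_bound[OF g(1)]) (use f le in auto)
 have "(LI z. abs (f z) powr p) <= (LI z. g z)"
  by (rule integral_mono_AE[OF i g(1) le])
 thus ?thesis using i f g(2) by (simp add: bd_def)
qed

lemma bd_add:
 assumes f: "bd p M f" and g: "bd p M' g" and p: "p >= 0"
 shows "bd p (2 powr p * (M + M')) (%z. f z + g z)"
proof (rule bdI_dominated[where g="%z. 2 powr p * (abs (f z) powr p + abs (g z) powr p)"])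
 show "(LI z. 2 powr p * (abs (f z) powr p + abs (g z) powr p)) <= 2 powr p * (M + M')"
  using f g unfolding bd_def by (subst integral_mult_right_zero, subst Bochner_Integration.integral_add) (auto intro!: mult_left_mono add_mono)
qed (use f g powr_add_le[OF p] in \<open>auto simp: bd_def\<close>)

lemma bd_mult:
 assumes f: "bd p M f" and e: "e : Bor" "!!z. abs (e z) <= B" and p: "p >= 0"
 shows "bd p (B powr p * M) (%z. f z * e z)"
proof (rule bdI_dominated[where g="%z. B powr p * abs (f z) powr p"])
 show "(LI z. B powr p * abs (f z) powr p) <= B powr p * M"
  using f unfolding bd_def by (subst integral_mult_right_zero) (auto intro!: mult_left_mono)
 show "AEL z. abs (f z * e z) powr p <= B powr p * abs (f z) powr p"
 proof (rule AE_I2)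
  fix z
  have "abs (e z) powr p <= B powr p" using e(2)[of z] p by (intro powr_mono2) auto
  thus "abs (f z * e z) powr p <= B powr p * abs (f z) powr p"
   by (simp add: abs_mult powr_mult mult.commute[of "B powr p"] mult_left_mono)
 qed
qed (use f e in \<open>auto simp: bd_def\<close>)

lemma bd_mono: "bd p M f ==> M <= M' ==> bd p M' f" by (auto simp: bd_def)

lemma bd_Lloc: "bd p M f ==> Lloc p f" by (auto simp: bd_def intro: Lloc_integrable)

text \<open>With this half-width even the cube enlarged three times stays within Euclidean norm 3/4,
  so all boxes below lie in the unit cylinder of \<open>ABP_solvable\<close>.\<close>

definition reg_a0 :: "'n::finite itself => real" where "reg_a0 _ = 1 / (4 * CARD('n))"

text \<open>The region in which the extremal equation is solved; solutions are cut off to the whole space around it.\<close>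

definition reg :: "((real^'n)*real) set" where
 "reg = box (vec (- reg_a0 TYPE('n)), 1/3) (vec (reg_a0 TYPE('n)), 2/3)"

lemma mem_box_Pair: "(x, t) : box (a, s) (b, r) \<longleftrightarrow> x : box a b & s < t & t < (r::real)"
 "(x, t) : cbox (a, s) (b, r) \<longleftrightarrow> x : cbox a b & s <= t & t <= (r::real)"
 by (auto simp: mem_box Basis_prod_def ball_Un)

lemma reg_iff: "(x, t) : (reg :: ((real^'n)*real) set) \<longleftrightarrow> (ALL i. abs (x $ i) < reg_a0 TYPE('n)) & 1/3 < t & t < 2/3"
 unfolding reg_def mem_box_Pair mem_box_cart abs_less_iff
 by (auto simp: minus_less_iff)

text \<open>The affine maps send the sides of \<open>reg\<close> to the ends of the plateau [-1,1]
  of \<open>plat\<close>; the support is then the box of twice the size about the same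
  centre.\<close>

definition cutf :: "(real^'n)*real => real" where
 "cutf = ptest (%b y. if fst b = 0 then plat (-3 + 6 * y) else plat (0 + (1 / reg_a0 TYPE('n)) * y))"

lemma a0_pos: "reg_a0 TYPE('n::finite) > 0" by (simp add: reg_a0_def)

lemma Basis_fst_cases:
 assumes "b : (Basis :: ((real^'n)*real) set)"
 obtains i where "b = (axis i 1, 0)" "fst b ~= 0" | "b = (0, 1)" "fst b = 0"
 using assms by (auto simp: Basis_prod_def Basis_vec_def axis_eq_axis axis_eq_0_iff)

lemma cutf_props:
 shows cutf_tfun: "tfun (cutf :: (real^'n)*real => real)"
  and cutf_supp: "closure {z. (cutf :: (real^'n)*real => real) z ~= 0}
     <= cbox (vec (- (2 * reg_a0 TYPE('n))), 1/6) (vec (2 * reg_a0 TYPE('n)), 5/6)"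
  and cutf_bounds: "0 <= cutf z" "cutf (z :: (real^'n)*real) <= 1"
  and cutf_1: "z : reg ==> cutf (z :: (real^'n)*real) = 1"
proof -
 let ?g = "%(b::(real^'n)*real) y. if fst b = 0 then plat (-3 + 6 * y) else plat (0 + (1 / reg_a0 TYPE('n)) * y)"
 let ?l = "(vec (- (2 * reg_a0 TYPE('n))), 1/6) :: (real^'n)*real"
 let ?u = "(vec (2 * reg_a0 TYPE('n)), 5/6) :: (real^'n)*real"
 note a0 = a0_pos[where 'n='n]
 have sm: "smooth (?g b)" for b using smooth_plat_affine[of "-3" 6] smooth_plat_affine[of 0 "1 / reg_a0 TYPE('n)"] by (cases "fst b = 0") auto
 have nz: "?l \<bullet> b <= y & y <= ?u \<bullet> b" if b: "b : Basis" and y: "?g b y ~= 0" for b y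
  using b
 proof (cases rule: Basis_fst_cases)
  case (1 i)
  hence "abs ((1 / reg_a0 TYPE('n)) * y) < 2" using y plat_0[of "(1 / reg_a0 TYPE('n)) * y"] by force
  hence "abs y < 2 * reg_a0 TYPE('n)" using a0 by (simp add: abs_mult field_simps)
  thus ?thesis using 1 by (auto simp: inner_axis)
 next
  case 2
  hence "abs (-3 + 6 * y) < 2" using y plat_0[of "-3 + 6 * y"] by force
  thus ?thesis using 2 by auto
 qed
 show "tfun (cutf :: (real^'n)*real => real)" unfolding cutf_def
  by (rule tfun_ptest[where l="?l" and u="?u"]) (use sm nz in auto)
 have "{z. (cutf :: (real^'n)*real => real) z ~= 0} <= cbox ?l ?u" unfolding cutf_def
  by (rule ptest_support) (use nz in auto)
 thus "closure {z. (cutf :: (real^'n)*real => real) z ~= 0} <= cbox ?l ?u"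
  by (intro closure_minimal) auto
 show "0 <= cutf z" "cutf z <= 1"
  unfolding cutf_def ptest_def using plat_bounds by (auto intro!: prod_nonneg prod_le_1)
 assume z: "z : reg"
 show "cutf z = 1"
  unfolding cutf_def ptest_def
 proof (rule prod.neutral, rule ballI)
  fix b :: "(real^'n)*real" assume "b : Basis"
  thus "?g b (z \<bullet> b) = 1"
  proof (cases rule: Basis_fst_cases)
   case (1 i)
   hence "abs (z \<bullet> b) < reg_a0 TYPE('n)" using z reg_iff[of "fst z" "snd z"] by (auto simp: inner_prod_def inner_axis)
   hence "abs ((1 / reg_a0 TYPE('n)) * (z \<bullet> b)) <= 1" using a0 by (simp add: abs_mult field_simps)
   thus ?thesis using 1 plat_1 by simp
  next
   case 2
   hence "z \<bullet> b = snd z" by (simp add: inner_prod_def)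
   hence "abs (-3 + 6 * (z \<bullet> b)) <= 1" using z reg_iff[of "fst z" "snd z"] by auto
   thus ?thesis using 2 plat_1 by simp
  qed
 qed
qed

definition source :: "real => ((real^'n)*real => real) => bool" where
 "source p h \<longleftrightarrow> h : Bor & (ALL z. 0 <= h z) & (ALL z. z ~: reg --> h z = 0) &
  intl (%z. abs (h z) powr p)"

lemma sourceD:
 assumes "source p h"
 shows "h : Bor" "ALL z. 0 <= h z" "ALL z. z ~: reg --> h z = 0" "intl (%z. abs (h z) powr p)"
 using assms unfolding source_def by blast+

lemma bdD: "bd p M f ==> f : Bor" "bd p M f ==> intl (%z. abs (f z) powr p)"
 "bd p M f ==> (LI z. abs (f z) powr p) <= M"
 by (auto simp: bd_def)

text \<open>Three nested boxes: the equation is kept on \<open>reg\<close>, the cut-off is supported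
  between \<open>Ka\<close> and \<open>Kb\<close>, and the interior estimate is used between
  \<open>Qa\<close> and \<open>Qb\<close>, at positive distance from the parabolic boundary.\<close>

definition Qa :: "(real^'n)*real" where "Qa = (vec (- (3 * reg_a0 TYPE('n))), 1/12)"
definition Qb :: "(real^'n)*real" where "Qb = (vec (3 * reg_a0 TYPE('n)), 11/12)"
definition Ka :: "(real^'n)*real" where "Ka = (vec (- (2 * reg_a0 TYPE('n))), 1/6)"
definition Kb :: "(real^'n)*real" where "Kb = (vec (2 * reg_a0 TYPE('n)), 5/6)"

lemma norm_small: fixes x :: "real^'n" assumes "!!i. abs (x $ i) <= c * reg_a0 TYPE('n)" shows "norm x <= c / 4"
proof -
 have "norm x <= (SUM i:UNIV. abs (x $ i))" by (rule norm_le_l1_cart)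
 also have "... <= (SUM i:(UNIV::'n set). c * reg_a0 TYPE('n))" by (intro sum_mono assms)
 also have "... = c / 4" by (simp add: reg_a0_def)
 finally show ?thesis .
qed

lemma Q_in_cyl: "cbox Qa Qb <= ball (0::real^'n) 1 \<times> {0<..<1}"
proof
 fix z :: "(real^'n)*real" assume z: "z : cbox Qa Qb"
 obtain x t where xt: "z = (x, t)" by (cases z)
 have "abs (x $ i) <= 3 * reg_a0 TYPE('n)" for i
  using z unfolding xt Qa_def Qb_def mem_box_Pair mem_box_cart abs_le_iff by (auto simp: minus_le_iff)
 from norm_small[OF this] show "z : ball (0::real^'n) 1 \<times> {0<..<1}"
  using z unfolding xt Qa_def Qb_def mem_box_Pair by auto
qed

lemma K_in_Q: "cbox Ka Kb <= box Qa (Qb :: (real^'n)*real)"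
proof
 fix z :: "(real^'n)*real" assume z: "z : cbox Ka Kb"
 obtain x t where xt: "z = (x, t)" by (cases z)
 show "z : box Qa Qb"
  using z a0_pos[where 'n='n] unfolding xt Qa_def Qb_def Ka_def Kb_def mem_box_Pair mem_box_cart
  by (auto simp: intro: order.strict_trans1 order.strict_trans2) (smt (verit))+
qed

lemma reg_in_K: "reg <= cbox Ka (Kb :: (real^'n)*real)"
proof
 fix z :: "(real^'n)*real" assume z: "z : reg"
 obtain x t where xt: "z = (x, t)" by (cases z)
 have "abs (x $ i) <= 2 * reg_a0 TYPE('n)" for i using z a0_pos[where 'n='n] unfolding xt reg_iff
  by (meson less_imp_le mult_le_cancel_right1 order_trans one_le_numeral less_le_not_le)
 thus "z : cbox Ka Kb"
  using z unfolding xt Ka_def Kb_def mem_box_Pair mem_box_cart reg_iff abs_le_iff by (auto simp: minus_le_iff)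
qed

lemma open_reg: "open reg" by (simp add: reg_def open_box)

lemma Q_strictly_inside: "strictly_inside (box Qa (Qb :: (real^'n)*real)) (ball 0 1) 1"
proof -
 have ne: "((0, 1/2) :: (real^'n)*real) : box Qa Qb"
  using a0_pos[where 'n='n] by (simp add: Qa_def Qb_def mem_box_Pair mem_box_cart)
 have sub: "box Qa Qb <= ball (0::real^'n) 1 \<times> {0<..<1}" using Q_in_cyl box_subset_cbox by blast
 have nb: "((0, 0) :: (real^'n)*real) : pbdry (ball 0 1) 1" by (simp add: pbdry_def)
 \<comment> \<open>The gap to the lateral boundary is 1 - 3/4; the gap in time to the base exceeds
   1/12, which is more than the square of 1/4.\<close>
 have "1/4 <= set_pdist (box Qa (Qb :: (real^'n)*real)) (pbdry (ball 0 1) 1)"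
  unfolding set_pdist_def
 proof (rule cINF_greatest)
  show "box Qa (Qb :: (real^'n)*real) \<times> pbdry (ball (0::real^'n) 1) 1 ~= {}"
   using ne nb by blast
  fix y assume ya: "y : box Qa (Qb :: (real^'n)*real) \<times> pbdry (ball (0::real^'n) 1) 1"
  obtain x t w s where y: "y = ((x, t), (w, s))" by (metis surj_pair)
  have z: "(x, t) : box Qa Qb" and w: "(w, s) : pbdry (ball (0::real^'n) 1) 1"
   using ya unfolding y by blast+
  have "abs (x $ i) <= 3 * reg_a0 TYPE('n)" for i
  proof -
   have "- (3 * reg_a0 TYPE('n)) < x $ i & x $ i < 3 * reg_a0 TYPE('n)"
    using z unfolding Qa_def Qb_def mem_box_Pair mem_box_cart by simp
   thus ?thesis by linarith
  qed
  from norm_small[OF this] have nx: "norm x <= 3/4" .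
  have t: "t > 1/12" using z by (simp add: Qa_def Qb_def mem_box_Pair)
  have "1/16 <= (norm (x - w))^2 + abs (t - s)"
  proof (cases "s = 0")
   case True
   thus ?thesis using t by (simp add: add_increasing)
  next
   case False
   hence "norm w = 1" using w by (auto simp: pbdry_def)
   hence "1/4 <= norm (x - w)" using nx norm_triangle_ineq2[of w x] by (simp add: norm_minus_commute)
   hence "(1/4)^2 <= (norm (x - w))^2" by (intro power_mono) auto
   moreover have "(0::real) <= abs (t - s)" by simp
   moreover have "(1/4)^2 = (1/16::real)" by (simp add: power2_eq_square)
   ultimately show ?thesis by linarith
  qed
  hence "sqrt ((1/4)^2) <= sqrt ((norm (x - w))^2 + abs (t - s))" by (intro real_sqrt_le_mono) (simp add: power2_eq_square)
  thus "1/4 <= (case y of (z, w) => pdist z w)" by (simp add: y pdist_def)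
 qed
 thus ?thesis unfolding strictly_inside_def using ne sub by (auto simp: cyl_def)
qed

lemma Lp_norm_nonneg: "0 <= Lp_norm p S f" by (simp add: Lp_norm_def)

lemma W21p_norm_components:
 "Lp_norm p Q ft <= W21p_norm p Q f ft Df D2f"
 "Lp_norm p Q (%z. Df z $ k) <= W21p_norm p Q f ft Df D2f"
 "Lp_norm p Q (%z. D2f z $ k $ l) <= W21p_norm p Q f ft Df D2f"
proof -
 have a: "Lp_norm p Q (%z. Df z $ k) <= (SUM k:UNIV. Lp_norm p Q (%z. Df z $ k))"
  by (intro member_le_sum) (auto simp: Lp_norm_nonneg)
 have "Lp_norm p Q (%z. D2f z $ k $ l) <= (SUM l:UNIV. Lp_norm p Q (%z. D2f z $ k $ l))"
  by (intro member_le_sum[where f="%l. Lp_norm p Q (%z. D2f z $ k $ l)"]) (auto simp: Lp_norm_nonneg)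
 also have "... <= (SUM k:UNIV. SUM l:UNIV. Lp_norm p Q (%z. D2f z $ k $ l))"
  by (intro member_le_sum[where f="%k. SUM l:UNIV. Lp_norm p Q (%z. D2f z $ k $ l)"]) (auto simp: Lp_norm_nonneg sum_nonneg)
 finally have b: "Lp_norm p Q (%z. D2f z $ k $ l) <= (SUM k:UNIV. SUM l:UNIV. Lp_norm p Q (%z. D2f z $ k $ l))" .
 have n: "0 <= (SUM k:UNIV. Lp_norm p Q (%z. Df z $ k))" "0 <= (SUM k:UNIV. SUM l:UNIV. Lp_norm p Q (%z. D2f z $ k $ l))"
  by (auto intro!: sum_nonneg Lp_norm_nonneg)
 show "Lp_norm p Q ft <= W21p_norm p Q f ft Df D2f"
  "Lp_norm p Q (%z. Df z $ k) <= W21p_norm p Q f ft Df D2f"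
  "Lp_norm p Q (%z. D2f z $ k $ l) <= W21p_norm p Q f ft Df D2f"
  unfolding W21p_norm_def using a b n Lp_norm_nonneg[of p Q f] Lp_norm_nonneg[of p Q ft] by linarith+
qed

lemma Lp_norm_supported:
 fixes h :: "'a::euclidean_space => real"
 assumes "h : Bor" "!!z. z ~: S ==> h z = 0" "S : sets borel" "p > 0"
 shows "Lp_norm p S h = (LI z. abs (h z) powr p) powr (1/p)"
proof -
 have "(LINT z|lebesgue_on S. abs (h z) powr p) = (LINT z|lebesgue. indicator S z *R (abs (h z)) powr p)"
  using assms by (subst integral_restrict_space) auto
 also have "(%z. indicator S z *R (abs (h z)) powr p) = (%z. abs (h z) powr p)"
  using assms by (intro ext) (auto split: split_indicator)
 also have "(LINT z|lebesgue. abs (h z) powr p) = (LI z. abs (h z) powr p)"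
  using assms by (subst integral_completion) auto
 finally show ?thesis by (simp add: Lp_norm_def)
qed

text \<open>The lower-case derivatives satisfy the equation; the upper-case ones are Borel versions
  of them on the closed box, integrable on the whole space, to which cut-offs can be
  applied.\<close>

definition "box_sol p lam Lam C h u ut Du D2u Ut DU D2U \<longleftrightarrow>
   continuous_on (cbox Qa Qb) u &
   (ALL z:cbox Qa Qb. - C * (LI z. abs (h z) powr p) powr (1/p) <= u z & u z <= 0) &
   has_weak_derivs (ball (0::real^'n) 1 \<times> {0<..<1}) u ut Du D2u &
   (AEL z. z : cbox Qa Qb --> Ut z = ut z) &
   (ALL k. AEL z. z : cbox Qa Qb --> DU k z = Du z $ k) &
   (ALL k l. AEL z. z : cbox Qa Qb --> D2U k l z = D2u z $ k $ l) &
   intl Ut & (ALL k. intl (DU k)) & (ALL k l. intl (D2U k l)) &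
   bd p (C powr p * (LI z. abs (h z) powr p)) Ut &
   (ALL k. bd p (C powr p * (LI z. abs (h z) powr p)) (DU k)) &
   (ALL k l. bd p (C powr p * (LI z. abs (h z) powr p)) (D2U k l)) &
   (AEL z. z : cbox Qa Qb --> ut z + pucci_plus lam Lam (D2u z) = - h z)"

text \<open>The extremal equation is solved with the nonpositive datum \<open>- h\<close>: its
  positive part vanishes, so the solution is nonpositive, and its depth is controlled by the norm of
  \<open>h\<close>.\<close>

lemma abp_on_box:
 fixes p lam Lam :: real
 assumes abp: "ABP_solvable TYPE('n::finite) lam Lam p" and p: "p >= 1"
 shows "EX C>=0. ALL h. source p h --> (EX u ut Du D2u Ut DU D2U. box_sol p lam Lam C (h :: (real^'n)*real => real) u ut Du D2u Ut DU D2U)"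
proof -
 let ?Q = "cyl (ball (0::real^'n) 1) 1" and ?O = "ball (0::real^'n) 1 \<times> {0<..<1::real}"
 let ?B = "box Qa (Qb :: (real^'n)*real)"
 have p0: "p > 0" using p by simp
 obtain C C' where C: "!!f. f : Lp p ?Q ==> EX u ut Du D2u.
    continuous_on (closure ?Q) u & u : W21p_loc p (ball 0 1) 1 & has_weak_derivs ?Q u ut Du D2u &
    (AE z in lebesgue_on ?Q. ut z + pucci_plus lam Lam (D2u z) = f z) &
    (ALL z:pbdry (ball 0 1) 1. u z = 0) &
    (ALL z:?Q. - C * Lp_norm p ?Q (%w. max (- f w) 0) <= u z &
        u z <= C * Lp_norm p ?Q (%w. max (f w) 0)) &
    (ALL Q'. strictly_inside Q' (ball 0 1) 1 -->
     W21p_norm p Q' u ut Du D2u <= C' (set_pdist Q' (pbdry (ball 0 1) 1)) * Lp_norm p ?Q f)"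
  using abp unfolding ABP_solvable_def Let_def by blast
 define d where "d = set_pdist ?B (pbdry (ball 0 1) 1)"
 \<comment> \<open>No sign is known for the constants supplied by the hypothesis, hence the maximum
   with \<open>0\<close>.\<close>
 define C0 where "C0 = max (max C (C' d)) 0"
 have C0: "C0 >= 0" "C <= C0" "C' d <= C0" by (auto simp: C0_def)
 have intQ: "interior ?Q = ?O" by (simp add: cyl_def interior_Times)
 have Oop: "open ?O" by (intro open_Times) auto
 have Qb: "?Q : sets borel" unfolding cyl_def by (intro borel_Times) auto
 have QO: "cbox Qa Qb <= ?O" by (rule Q_in_cyl)
 have OQ: "?O <= ?Q" by (auto simp: cyl_def)
 have regQ: "reg <= ?Q" using reg_in_K K_in_Q box_subset_cbox QO OQ by blast
 show ?thesis
 proof (rule exI[of _ C0], intro conjI allI impI C0(1))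
  fix h :: "(real^'n)*real => real"
  assume "source p h"
  note h = sourceD[OF this]
  define I where "I = (LI z. abs (h z) powr p)"
  define N where "N = I powr (1/p)"
  have I0: "I >= 0" unfolding I_def by (intro integral_nonneg_AE) auto
  have N0: "N >= 0" and NI: "N powr p = I" using I0 p0 by (auto simp: N_def powr_powr)
  let ?f = "%z. - h z"
  have fL: "?f : Lp p ?Q"
   by (rule Lloc_Lp[OF Lloc_integrable]) (use h Qb bounded_subset[OF bounded_Times] in \<open>auto simp: cyl_def bounded_Ioc intro!: bounded_Times\<close>)
  have hz: "z ~: ?Q ==> h z = 0" for z using h(3) regQ by blast
  have n1: "Lp_norm p ?Q (%w. max (- ?f w) 0) = N"
  proof -
   have "(%w. max (- ?f w) 0) = h" using h(2) by (intro ext) (simp add: max_absorb1 del: split_paired_All)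
   thus ?thesis using Lp_norm_supported[OF h(1) hz Qb p0] by (simp add: N_def I_def)
  qed
  have n2: "Lp_norm p ?Q (%w. max (?f w) 0) = 0"
  proof -
   have "(%w. max (?f w) 0) = (%w. 0)" using h(2) by (intro ext) (simp add: max_absorb2 del: split_paired_All)
   thus ?thesis using p0 by (simp add: Lp_norm_def)
  qed
  have n3: "Lp_norm p ?Q ?f = N"
   using h hz Lp_norm_supported[of ?f ?Q p] Qb p0 by (simp add: N_def I_def)
  obtain u ut Du D2u where u: "continuous_on (closure ?Q) u" "u : W21p_loc p (ball 0 1) 1" "has_weak_derivs ?Q u ut Du D2u"
   "AE z in lebesgue_on ?Q. ut z + pucci_plus lam Lam (D2u z) = ?f z"
   "!!z. z : ?Q ==> - C * Lp_norm p ?Q (%w. max (- ?f w) 0) <= u z & u z <= C * Lp_norm p ?Q (%w. max (?f w) 0)"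
   "!!Q'. strictly_inside Q' (ball 0 1) 1 ==> W21p_norm p Q' u ut Du D2u <= C' (set_pdist Q' (pbdry (ball 0 1) 1)) * Lp_norm p ?Q ?f"
   using C[OF fL] by blast
  have wO: "has_weak_derivs ?O u ut Du D2u" using u(3) Oop unfolding has_weak_derivs_def intQ by (simp add: interior_open)
  have "W21p_norm p ?B u ut Du D2u <= C' d * N" using u(6)[OF Q_strictly_inside] by (simp add: d_def n3)
  also have "... <= C0 * N" using C0 N0 by (intro mult_right_mono) auto
  finally have Wn: "W21p_norm p ?B u ut Du D2u <= C0 * N" .
  obtain vt Dv D2v where v: "has_weak_derivs ?B u vt Dv D2v" "vt : Lp p ?B" "!!k. (%z. Dv z $ k) : Lp p ?B"
   "!!k l. (%z. D2v z $ k $ l) : Lp p ?B"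
   using u(2) Q_strictly_inside unfolding W21p_loc_def W21p_def by blast
  have iB: "interior ?B = ?B" by (simp add: interior_open open_box)
  have c\<^sub>t: "AEL z. z : ?B --> vt z = ut z"
   by (rule weak_derivative_unique_box[OF _ Oop QO _ _ Lp_absolutely_integrable[OF v(2) p]])
    (use wO v(1) Oop in \<open>auto simp: has_weak_derivs_def iB interior_open\<close>)
  have c\<^sub>x: "AEL z. z : ?B --> Dv z $ k = Du z $ k" for k
   by (rule weak_derivative_unique_box[OF _ Oop QO _ _ Lp_absolutely_integrable[OF v(3) p], where v="(axis k 1, 0)" and f=u and f'=u])
    (use wO v(1) Oop in \<open>auto simp: has_weak_derivs_def iB interior_open\<close>)
  have c\<^sub>x\<^sub>x: "AEL z. z : ?B --> D2v z $ k $ l = D2u z $ k $ l" for k l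
   by (rule weak_derivative_unique_box[OF _ Oop QO _ c\<^sub>x Lp_absolutely_integrable[OF v(4) p], where v="(axis l 1, 0)"])
    (use wO v(1) Oop in \<open>auto simp: has_weak_derivs_def iB interior_open\<close>)
  have ai: "ut absolutely_integrable_on cbox Qa Qb" "(%z. Du z $ k) absolutely_integrable_on cbox Qa Qb"
   "(%z. D2u z $ k $ l) absolutely_integrable_on cbox Qa Qb" for k l
   using wO Oop QO by (auto simp: has_weak_derivs_def has_weak_derivative_def interior_open)
  have ver: "EX G. (AEL z. z : cbox Qa Qb --> G z = g z) & intl G & bd p (C0 powr p * I) G"
   if t: "g absolutely_integrable_on cbox Qa Qb" "g' : Lp p ?B" "AEL z. z : ?B --> g' z = g z"
    "Lp_norm p ?B g <= W21p_norm p ?B u ut Du D2u" for g g'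
  proof -
   obtain G where G: "G : Bor" "intl G" "AEL z. z : cbox Qa Qb --> G z = g z"
    "intl (%z. abs (G z) powr p)" "(LI z. abs (G z) powr p) = (Lp_norm p ?B g) powr p"
    using Lp_borel_version[OF t(1,2,3) p0] by blast
   have "(Lp_norm p ?B g) powr p <= (C0 * N) powr p"
    using t(4) Wn p0 Lp_norm_nonneg[of p ?B g] by (intro powr_mono2) auto
   also have "... = C0 powr p * I" using NI by (simp add: powr_mult)
   finally show ?thesis using G by (auto simp: bd_def)
  qed
  obtain Ut where Ut: "AEL z. z : cbox Qa Qb --> Ut z = ut z" "intl Ut" "bd p (C0 powr p * I) Ut"
   using ver[OF ai(1) v(2) c\<^sub>t W21p_norm_components(1)] by blast
  have "ALL k. EX G. (AEL z. z : cbox Qa Qb --> G z = Du z $ k) & intl G & bd p (C0 powr p * I) G"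
   by (intro allI ver[OF ai(2) v(3) c\<^sub>x W21p_norm_components(2)])
  from choice[OF this] obtain DU where DU: "!!k. AEL z. z : cbox Qa Qb --> DU k z = Du z $ k"
   "!!k. intl (DU k)" "!!k. bd p (C0 powr p * I) (DU k)" by blast
  have "ALL kl. EX G. (AEL z. z : cbox Qa Qb --> G z = D2u z $ fst kl $ snd kl) & intl G & bd p (C0 powr p * I) G"
   by (intro allI ver[OF ai(3) v(4) c\<^sub>x\<^sub>x W21p_norm_components(3)])
  from choice[OF this] obtain D2U' where D2U': "!!kl. AEL z. z : cbox Qa Qb --> D2U' kl z = D2u z $ fst kl $ snd kl"
   "!!kl. intl (D2U' kl)" "!!kl. bd p (C0 powr p * I) (D2U' kl)" by blast
  define D2U where "D2U k l = D2U' (k, l)" for k l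
  have D2U: "AEL z. z : cbox Qa Qb --> D2U k l z = D2u z $ k $ l"
   "intl (D2U k l)" "bd p (C0 powr p * I) (D2U k l)" for k l
   using D2U'[of "(k, l)"] by (simp_all add: D2U_def)
  have cont: "continuous_on (cbox Qa Qb) u"
   using u(1) QO OQ closure_subset by (meson continuous_on_subset subset_trans)
  have bounds: "ALL z:cbox Qa Qb. - C0 * N <= u z & u z <= 0"
  proof
   fix z assume "z : cbox (Qa :: (real^'n)*real) Qb"
   hence "z : ?Q" using QO OQ by blast
   from u(5)[OF this] have "- C * N <= u z" "u z <= 0" unfolding n1 n2 by auto
   moreover have "C * N <= C0 * N" using C0 N0 by (intro mult_right_mono) auto
   ultimately show "- C0 * N <= u z & u z <= 0" by simp
  qed
  have pde: "AEL z. z : cbox Qa Qb --> ut z + pucci_plus lam Lam (D2u z) = - h z"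
  proof -
   have "AE z in lebesgue. z : ?Q --> ut z + pucci_plus lam Lam (D2u z) = - h z"
    using u(4) Qb by (subst (asm) AE_restrict_space_iff) auto
   hence "AEL z. z : ?Q --> ut z + pucci_plus lam Lam (D2u z) = - h z"
    by (simp add: AE_completion_iff)
   thus ?thesis by eventually_elim (use QO OQ in blast)
  qed
  show "EX u ut Du D2u Ut DU D2U. box_sol p lam Lam C0 h u ut Du D2u Ut DU D2U" unfolding box_sol_def I_def[symmetric] N_def[symmetric]
   by (rule exI[of _ u], rule exI[of _ ut], rule exI[of _ Du], rule exI[of _ D2u],
     rule exI[of _ Ut], rule exI[of _ DU], rule exI[of _ D2U])
    (intro conjI allI cont bounds wO Ut DU D2U pde)
 qed
qed

lemma cutf_outside:
 assumes "z ~: cbox Ka (Kb :: (real^'n)*real)"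
 shows "cutf z = 0"
proof -
 have "z ~: closure {z. cutf z ~= 0}" using assms cutf_supp by (auto simp: Ka_def Kb_def)
 thus ?thesis using closure_subset[of "{z. cutf z ~= 0}"] by auto
qed

definition "ext_sol p lam Lam C h w wt Dw D2w \<longleftrightarrow> quad p (w :: (real^'n)*real => real) wt Dw D2w &
   (ALL z. - C * (LI z. abs (h z) powr p) powr (1/p) <= w z & w z <= 0) &
   (AEL z. z : reg --> wt z + pucci_plus lam Lam (D2w z) = - h z) &
   bd p (C * (LI z. abs (h z) powr p)) wt &
   (ALL k. bd p (C * (LI z. abs (h z) powr p)) (%z. Dw z $ k)) &
   (ALL k l. bd p (C * (LI z. abs (h z) powr p)) (%z. D2w z $ k $ l))"

text \<open>Multiplication by \<open>cutf\<close> extends the solution to the whole space. The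
  additional Leibniz terms involve only the solution and its gradient, which are already bounded on
  the support; on \<open>reg\<close> the cut-off is locally constant, so the equation is intact
  there.\<close>

lemma solver:
 fixes p lam Lam :: real
 assumes abp: "ABP_solvable TYPE('n::finite) lam Lam p" and p: "p >= 1"
 shows "EX C>0. ALL h. source p h --> (EX w wt Dw D2w. ext_sol p lam Lam C (h :: (real^'n)*real => real) w wt Dw D2w)"
proof -
 have p0: "p >= 0" "p > 0" using p by auto
 let ?O = "ball (0::real^'n) 1 \<times> {0<..<1::real}"
 let ?e = "cutf :: (real^'n)*real => real"
 let ?d = "%v z. fder ?e (at z) v"
 let ?dd = "%v v' z. fder (?d v) (at z) v'"
 define ax where "ax k = ((axis k 1, 0) :: (real^'n)*real)" for k
 have Oop: "open ?O" by (intro open_Times) auto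
 note e = cutf_tfun[where 'n='n]
 have de: "tfun (?d v)" for v by (rule tfun_frechet[OF e])
 have dde: "tfun (?dd v v')" for v v' by (rule tfun_frechet[OF de])
 have eK: "closure {z. ?e z ~= 0} <= cbox Ka Kb" using cutf_supp by (auto simp: Ka_def Kb_def)
 have deK: "closure {z. ?d v z ~= 0} <= cbox Ka Kb" for v using support_frechet[of ?e v] eK by blast
 obtain B where B: "B >= 0" "!!z. abs (?e z) <= B" "!!z. abs (?d (0,1) z) <= B" "!!k z. abs (?d (ax k) z) <= B"
  "!!k l z. abs (?dd (ax k) (ax l) z) <= B"
 proof -
  let ?F = "insert ?e (insert (?d (0,1)) (range (%k. ?d (ax k)) \<union> range (%(k, l). ?dd (ax k) (ax l))))"
  have "finite ?F" by simp
  moreover have "tfun f" if "f : ?F" for f using that by (auto intro!: e de dde)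
  ultimately obtain B where B: "B >= 0" "ALL f:?F. ALL z. abs (f z) <= B" using tfun_common_bound[of ?F] by blast
  have m1: "?d (ax k) : ?F" for k by (intro insertI2 UnI1 rangeI)
  have m2: "?dd (ax k) (ax l) : ?F" for k l
   by (intro insertI2 UnI2) (rule image_eqI[of _ _ "(k, l)"], simp_all)
  have m3: "?e : ?F" "?d (0,1) : ?F" by (rule insertI1, rule insertI2[OF insertI1])
  show thesis by (rule that[OF B(1)])
   (rule B(2)[THEN bspec, OF m3(1), THEN spec] B(2)[THEN bspec, OF m3(2), THEN spec]
    B(2)[THEN bspec, OF m1, THEN spec] B(2)[THEN bspec, OF m2, THEN spec])+
 qed
 obtain C0 where C0: "C0 >= 0" and S: "!!h. source p (h :: (real^'n)*real => real) ==> EX u ut Du D2u Ut DU D2U. box_sol p lam Lam C0 h u ut Du D2u Ut DU D2U"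
  using abp_on_box[OF abp p] by blast
 define V where "V = meas (cbox Qa (Qb :: (real^'n)*real))"
 have V0: "V >= 0" by (simp add: V_def)
 define b where "b = B powr p"
 define P where "P = (2::real) powr p"
 have b0: "b >= 0" and P1: "P >= 1" using p0 by (auto simp: b_def P_def ge_one_powr_ge_zero)
 define m where "m = C0 powr p * (1 + V)"
 have m0: "m >= 0" using V0 by (simp add: m_def)
 \<comment> \<open>The nesting mirrors the second derivatives, which are a sum of two sums of
   products; the single sum for \<open>wt\<close> and \<open>Dw\<close> is dominated by it.\<close>
 define C where "C = C0 + 1 + P * (P * (b * m + b * m) + P * (b * m + b * m))"
 have t0: "0 <= b * m" using b0 m0 by simp
 have C: "C > 0" "C0 <= C" "P * (P * (b * m + b * m) + P * (b * m + b * m)) <= C" "P * (b * m + b * m) <= C"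
 proof -
  have a: "0 <= P * (b * m + b * m)" using P1 t0 by simp
  have "P * (b * m + b * m) <= P * (P * (b * m + b * m))" using P1 a mult_right_mono[of 1 P "P * (b * m + b * m)"] by simp
  also have "... <= P * (P * (b * m + b * m) + P * (b * m + b * m))" using P1 a t0 by (intro mult_left_mono) auto
  finally have c: "P * (b * m + b * m) <= P * (P * (b * m + b * m) + P * (b * m + b * m))" .
  thus "C > 0" "C0 <= C" "P * (P * (b * m + b * m) + P * (b * m + b * m)) <= C" "P * (b * m + b * m) <= C"
   using a C0 unfolding C_def by linarith+
 qed
 show ?thesis
 proof (rule exI[of _ C], intro conjI allI impI C(1))
  fix h :: "(real^'n)*real => real"
  assume h': "source p h"
  note h = sourceD[OF h']
  define I where "I = (LI z. abs (h z) powr p)"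
  define N where "N = I powr (1/p)"
  have I0: "I >= 0" unfolding I_def by (intro integral_nonneg_AE) auto
  have N0: "N >= 0" and NI: "N powr p = I" using I0 p0 by (auto simp: N_def powr_powr)
  obtain u ut Du D2u Ut DU D2U where
   cu: "continuous_on (cbox Qa Qb) u" and bu: "ALL z:cbox Qa Qb. - C0 * N <= u z & u z <= 0" and
   wd: "has_weak_derivs ?O u ut Du D2u" and
   aeT: "AEL z. z : cbox Qa Qb --> Ut z = ut z" and
   aeX: "!!k. AEL z. z : cbox Qa Qb --> DU k z = Du z $ k" and
   aeXX: "!!k l. AEL z. z : cbox Qa Qb --> D2U k l z = D2u z $ k $ l" and
   iT: "intl Ut" and iX: "!!k. intl (DU k)" and iXX: "!!k l. intl (D2U k l)" and
   bT: "bd p (C0 powr p * I) Ut" and bX: "!!k. bd p (C0 powr p * I) (DU k)" and bXX: "!!k l. bd p (C0 powr p * I) (D2U k l)" and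
   pde: "AEL z. z : cbox Qa Qb --> ut z + pucci_plus lam Lam (D2u z) = - h z"
   using S[OF h'] unfolding box_sol_def I_def[symmetric] N_def[symmetric] by blast
  define U where "U z = indicator (cbox Qa Qb) z * u z" for z
  have Um: "U : Bor"
   unfolding U_def using borel_measurable_continuous_on_indicator[OF _ cu] by simp
  have UN: "abs (U z) <= C0 * N" for z using bu C0 N0 by (auto simp: U_def split: split_indicator)
  have iU: "intl U"
  proof -
   have "intl (%z. indicator (cbox Qa Qb) z *R u z)" using cu by (intro borel_integrable_compact) auto
   thus ?thesis by (simp add: U_def[abs_def])
  qed
  have bU: "bd p (m * I) U"
  proof (rule bdI_dominated[where g="%z. (C0 powr p * I) * indicator (cbox Qa Qb) z"])
   show "intl (%z. (C0 powr p * I) * indicator (cbox (Qa :: (real^'n)*real) Qb) z :: real)"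
    by (intro integrable_mult_right integrable_real_indicator emeasure_bounded_finite bounded_cbox) auto
   have "(LI z. (C0 powr p * I) * indicator (cbox (Qa :: (real^'n)*real) Qb) z) = C0 powr p * I * V"
    by (simp add: V_def)
   also have "... <= m * I" using I0 V0 by (simp add: m_def algebra_simps)
   finally show "(LI z. (C0 powr p * I) * indicator (cbox (Qa :: (real^'n)*real) Qb) z) <= m * I" .
   show "AEL z. abs (U z) powr p <= (C0 powr p * I) * indicator (cbox Qa Qb) z"
   proof (rule AE_I2)
    fix z
    have "abs (U z) powr p <= (C0 * N) powr p" using UN p0 by (intro powr_mono2) auto
    also have "... = C0 powr p * I" using NI by (simp add: powr_mult)
    finally show "abs (U z) powr p <= (C0 powr p * I) * indicator (cbox Qa Qb) z"
     by (auto simp: U_def split: split_indicator)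
   qed
  qed (fact Um)
  have le: "C0 powr p * I <= m * I" using I0 V0 by (intro mult_right_mono) (auto simp: m_def algebra_simps)
  note bT = bd_mono[OF bT le] and bX = bd_mono[OF bX le] and bXX = bd_mono[OF bXX le]
  have K: "compact (cbox Ka (Kb :: (real^'n)*real))" "cbox Ka (Kb :: (real^'n)*real) <= ?O"
   by (rule compact_cbox, rule subset_trans[OF subset_trans[OF K_in_Q box_subset_cbox] Q_in_cyl])
  have KQ: "z : cbox Qa Qb" if "z : cbox Ka (Kb :: (real^'n)*real)" for z
   using that subset_trans[OF K_in_Q box_subset_cbox] by (rule rev_subsetD)
  have aU: "AEL z. z : cbox Ka Kb --> U z = u z" by (intro AE_I2) (auto simp: U_def KQ)
  have aT: "AEL z. z : cbox Ka Kb --> Ut z = ut z" using aeT by eventually_elim (auto simp: KQ)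
  have aX: "AEL z. z : cbox Ka Kb --> DU k z = Du z $ k" for k using aeX[of k] by eventually_elim (auto simp: KQ)
  have aXX: "AEL z. z : cbox Ka Kb --> D2U k l z = D2u z $ k $ l" for k l using aeXX[of k l] by eventually_elim (auto simp: KQ)
  have iO: "interior ?O = ?O" using Oop by (simp add: interior_open)
  have hT: "has_weak_derivative ?O (0,1) u ut" and hX: "has_weak_derivative ?O (ax k) u (%z. Du z $ k)"
   and hXX: "has_weak_derivative ?O (ax l) (%z. Du z $ k) (%z. D2u z $ k $ l)" for k l
   using wd unfolding has_weak_derivs_def iO ax_def by blast+
  define w where "w z = U z * ?e z" for z
  define wt where "wt z = Ut z * ?e z + U z * ?d (0,1) z" for z
  define Dw where "Dw z = (\<chi> k. DU k z * ?e z + U z * ?d (ax k) z)" for z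
  define D2 where "D2 z = (\<chi> k l. (D2U k l z * ?e z + DU k z * ?d (ax l) z) + (DU l z * ?d (ax k) z + U z * ?dd (ax k) (ax l) z))" for z
  note bm = bdD(1)[OF bT] bdD(1)[OF bX] bdD(1)[OF bXX]
  have wt: "wder (0,1) w wt" unfolding w_def[abs_def] wt_def[abs_def]
   by (rule wder_cutoff[OF hT Oop K Um iU aU bm(1) iT aT e eK])
  have wx: "wder (ax k) w (%z. Dw z $ k)" for k unfolding w_def[abs_def] Dw_def vec_lambda_beta
   by (rule wder_cutoff[OF hX Oop K Um iU aU bm(2) iX aX e eK])
  have wxx: "wder (ax l) (%z. Dw z $ k) (%z. D2 z $ k $ l)" for k l unfolding Dw_def D2_def vec_lambda_beta
   by (intro wder_add wder_cutoff[OF hXX Oop K bm(2) iX aX bm(3) iXX aXX e eK]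
     wder_cutoff[OF hX Oop K Um iU aU bm(2) iX aX de deK])
  have me: "?e : Bor" "?d v : Bor" "?dd v v' : Bor" for v v'
   using smooth_borel tfun_smooth e de dde by blast+
  have bwt: "bd p (C * I) wt"
  proof -
   have "bd p (P * (b * (m * I) + b * (m * I))) wt" unfolding wt_def[abs_def] P_def b_def
    by (intro bd_add bd_mult bT bU me B p0)
   moreover have "P * (b * (m * I) + b * (m * I)) <= C * I" using mult_right_mono[OF C(4) I0] by (simp add: algebra_simps)
   ultimately show ?thesis by (rule bd_mono)
  qed
  have bDw: "bd p (C * I) (%z. Dw z $ k)" for k
  proof -
   have "bd p (P * (b * (m * I) + b * (m * I))) (%z. Dw z $ k)" unfolding Dw_def vec_lambda_beta P_def b_def
    by (intro bd_add bd_mult bX bU me B p0)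
   moreover have "P * (b * (m * I) + b * (m * I)) <= C * I" using mult_right_mono[OF C(4) I0] by (simp add: algebra_simps)
   ultimately show ?thesis by (rule bd_mono)
  qed
  have bD2: "bd p (C * I) (%z. D2 z $ k $ l)" for k l
  proof -
   have "bd p (P * (P * (b * (m * I) + b * (m * I)) + P * (b * (m * I) + b * (m * I)))) (%z. D2 z $ k $ l)"
    unfolding D2_def vec_lambda_beta P_def b_def
    by (intro bd_add bd_mult bXX bX bU me B p0)
   moreover have "P * (P * (b * (m * I) + b * (m * I)) + P * (b * (m * I) + b * (m * I))) <= C * I"
    using mult_right_mono[OF C(3) I0] by (simp add: algebra_simps)
   ultimately show ?thesis by (rule bd_mono)
  qed
  have cw: "continuous_on UNIV w"
  proof -
   have 1: "continuous_on (box Qa Qb) w"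
   proof -
    have "continuous_on (box Qa Qb) (%z. u z * ?e z)"
     by (intro continuous_on_mult continuous_on_subset[OF cu box_subset_cbox]
       continuous_on_subset[OF smooth_continuous[OF tfun_smooth[OF e]]]) auto
    moreover have "w z = u z * ?e z" if "z : box Qa Qb" for z
     using that box_subset_cbox[of Qa Qb] by (auto simp: w_def U_def)
    ultimately show ?thesis by simp
   qed
   have 2: "continuous_on (- cbox Ka Kb) w"
   proof -
    have "w z = 0" if "z : - cbox Ka Kb" for z using that by (simp add: w_def cutf_outside)
    thus ?thesis using continuous_on_eq[OF continuous_on_const[of "- cbox Ka Kb" 0], of w] by metis
   qed
   have "continuous_on (box Qa Qb \<union> - cbox Ka Kb) w"
    by (rule continuous_on_open_Un[OF _ _ 1 2]) (auto simp: open_box)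
   moreover have "box Qa Qb \<union> - cbox Ka Kb = (UNIV :: ((real^'n)*real) set)" using K_in_Q by auto
   ultimately show ?thesis by simp
  qed
  have q: "quad p w wt Dw (%z. sym_part (D2 z))" and sy: "AEL z. sym_part (D2 z) = D2 z"
   by (rule quad_symmetrize[OF cw wt bd_Lloc[OF bwt] _ bd_Lloc[OF bDw] _ bd_Lloc[OF bD2] p0(1)];
     use wx wxx in \<open>simp add: ax_def\<close>)+
  have bD2': "bd p (C * I) (%z. sym_part (D2 z) $ k $ l)" for k l
  proof (rule bdI_dominated[OF bdD(2,3)[OF bD2]])
   show "(%z. sym_part (D2 z) $ k $ l) : Bor" using bdD(1)[OF bD2] by (simp add: sym_part_nth)
   show "AEL z. abs (sym_part (D2 z) $ k $ l) powr p <= abs (D2 z $ k $ l) powr p" using sy by eventually_elim simp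
  qed
  have bw: "- C * N <= w z & w z <= 0" for z
  proof -
   have "U z <= 0" "- (C0 * N) <= U z" using bu UN[of z] by (auto simp: U_def split: split_indicator)
   moreover have "0 <= ?e z" "?e z <= 1" using cutf_bounds[of z] by auto
   ultimately have "w z <= 0" "U z <= w z" unfolding w_def
    using mult_left_mono_neg[of "?e z" 1 "U z"] by (auto simp: mult_le_0_iff)
   moreover have "C0 * N <= C * N" using C(2) N0 by (intro mult_right_mono) auto
   ultimately show ?thesis using \<open>- (C0 * N) <= U z\<close> by auto
  qed
  have dz: "?d v z = 0" if "z : reg" for v z
   by (rule frechet_local_const[OF open_reg that, of _ 1]) (rule cutf_1)
  have ddz: "?dd v v' z = 0" if "z : reg" for v v' z
   by (rule frechet_local_const[OF open_reg that, of _ 0]) (rule dz)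
  have "AEL z. ALL k l. z : cbox Qa Qb --> D2U k l z = D2u z $ k $ l"
   using aeXX by (subst AE_all_countable, intro allI, subst AE_all_countable) blast
  with aeT pde have P: "AEL z. z : reg --> wt z + pucci_plus lam Lam (sym_part (D2 z)) = - h z"
  proof (eventually_elim, intro impI)
   fix z assume 1: "z : cbox Qa Qb --> Ut z = ut z" "z : cbox Qa Qb --> ut z + pucci_plus lam Lam (D2u z) = - h z"
    "ALL k l. z : cbox Qa Qb --> D2U k l z = D2u z $ k $ l" and z: "z : reg"
   have zQ: "z : cbox Qa Qb" using z KQ[OF subsetD[OF reg_in_K]] by simp
   have "wt z = ut z" using 1 zQ cutf_1[OF z] dz[OF z] by (simp add: wt_def)
   moreover have "D2 z = D2u z" using 1 zQ cutf_1[OF z] dz[OF z] ddz[OF z] by (simp add: D2_def vec_eq_iff)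
   ultimately show "wt z + pucci_plus lam Lam (sym_part (D2 z)) = - h z" using 1 zQ by (simp add: pucci_sym_part)
  qed
  show "EX w wt Dw D2w. ext_sol p lam Lam C h w wt Dw D2w" unfolding ext_sol_def I_def[symmetric] N_def[symmetric]
   by (rule exI[of _ w], rule exI[of _ wt], rule exI[of _ Dw], rule exI[of _ "%z. sym_part (D2 z)"])
    (intro conjI allI q bw[THEN conjunct1] bw[THEN conjunct2] P bwt bDw bD2')
 qed
qed

section \<open>Potential estimate for the gradient\<close>

definition ucb :: "((real^'n)*real) set" where "ucb = cbox (- One) One"

definition ucv :: "'n::finite itself => real" where
 "ucv _ = meas (ucb :: ((real^'n)*real) set)"

text \<open>The mean over the parabolic box of radius \<open>r\<close> about \<open>z\<close>,
  two-sided in time, up to the constant factor \<open>ucv\<close>. Integrating over the fixed box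
  \<open>ucb\<close> keeps the domain independent of \<open>z\<close> for Fubini.\<close>

definition avg :: "real => ((real^'n)*real => real) => (real^'n)*real => real" where
 "avg r g z = (LI y. indicator ucb y * g (psc r z y))"

lemma ucb_borel [measurable]: "ucb : sets borel" by (simp add: ucb_def)

lemma ucv_pos: "ucv TYPE('n::finite) > 0"
proof -
 have "(0 :: (real^'n)*real) : box (- One) One" by (simp add: mem_box)
 thus ?thesis unfolding ucv_def ucb_def
  by (auto simp: measure_lborel_cbox_eq inner_diff_left inner_add_left intro!: prod_pos)
qed

lemma finite_measure_ucb: "finite_measure (restrict_space lborel (ucb :: ((real^'n)*real) set))"
 by (rule finite_measureI) (simp add: emeasure_restrict_space ucb_def less_top[symmetric])

lemma power_mean_ucb:
 fixes y :: "(real^'n)*real => real"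
 assumes p: "p >= 1" and y: "y : Bor" "!!x. y x >= 0"
  and i: "intl (%x. indicator ucb x * y x powr p)"
 shows "intl (%x. indicator ucb x * y x)"
  "(LI x. indicator ucb x * y x) powr p <= ucv TYPE('n) powr (p - 1) * (LI x. indicator ucb x * y x powr p)"
proof -
 let ?M = "restrict_space lborel (ucb :: ((real^'n)*real) set)"
 have m: "measure ?M (space ?M) = ucv TYPE('n)"
  by (simp add: ucv_def measure_restrict_space space_restrict_space)
 have mm: "y : borel_measurable ?M" using y(1) by (auto intro: measurable_restrict_space1)
 have ii: "integrable ?M (%x. y x powr p)" using i by (simp add: integrable_restrict_space)
 note P = power_mean[OF finite_measure_ucb p mm y(2) ii]
 show "intl (%x. indicator ucb x * y x)" using P(1) by (simp add: integrable_restrict_space)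
 show "(LI x. indicator ucb x * y x) powr p <= ucv TYPE('n) powr (p - 1) * (LI x. indicator ucb x * y x powr p)"
  using P(2) unfolding m by (simp add: integral_restrict_space)
qed

lemma nn_integral_lborel_translate:
 fixes c :: "'a::euclidean_space"
 assumes "f : Bor" shows "(NL z. f (c + z)) = (NL z. f z)"
proof -
 have "(NL z. f z) = (\<integral>\<^sup>+z. f z \<partial>distr lborel borel ((+) c))" by (simp add: lborel_distr_plus)
 also have "... = (NL z. f (c + z))" using assms by (subst nn_integral_distr) auto
 finally show ?thesis by simp
qed

lemma nn_integral_lborel_uminus:
 fixes f :: "'a::euclidean_space => ennreal"
 assumes "f : Bor" shows "(NL z. f (- z)) = (NL z. f z)"
proof -
 have "lborel = density (distr lborel borel (%x::'a. - x)) (%_. 1)"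
  using lborel_affine[of "-1" "0::'a"] by simp
 hence "(NL z. f z) = (\<integral>\<^sup>+z. f z \<partial>density (distr lborel borel (%x::'a. - x)) (%_. 1))" by simp
 also have "... = (NL z. f (- z))"
  using assms by (subst nn_integral_density) (auto simp: nn_integral_distr)
 finally show ?thesis by simp
qed

lemma psc_measurable' [measurable (raw)]:
 assumes "f : borel_measurable M" "g : borel_measurable M"
 shows "(%x. psc r (f x) (g x)) : borel_measurable M"
proof -
 have "(%y::(real^'n)*real. (r *R fst y, r^2 * snd y)) : Bor"
  by (intro borel_measurable_continuous_onI linear_continuous_on psc_bounded_linear)
 from measurable_compose[OF assms(2) this] show ?thesis
  unfolding psc_def using assms(1) by (intro borel_measurable_add) auto
qed

text \<open>Jensen with exponent \<open>q / p\<close> on the unit box, followed by a change of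
  variables. The bound is uniform in \<open>z\<close> and blows up like \<open>r\<close> to the
  power \<open>- hdim * p / q\<close>.\<close>

lemma avg_inner_bound:
 fixes mu :: "(real^'n)*real => real"
 assumes pq: "1 <= p" "p <= q" and r: "r > 0"
  and m: "mu : Bor" "!!z. mu z >= 0" "intl (%z. mu z powr q)" "(LI z. mu z powr q) <= W"
 shows "(NL y. ennreal (indicator ucb y * mu (psc r z y) powr p))
  <= ennreal (ucv TYPE('n) powr (1 - p/q) * (W / r ^ hdim TYPE('n)) powr (p/q))"
proof -
 let ?V = "ucv TYPE('n)"
 note V = ucv_pos[where 'n='n]
 have qp: "q / p >= 1" "p > 0" "q > 0" using pq by auto
 let ?y = "%y. mu (psc r z y) powr p"
 have ipsc: "intl (%y. mu (psc r z y) powr q)" using integrable_psc[OF r m(3)] by simp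
 have e: "?y x powr (q/p) = mu (psc r z x) powr q" for x using qp by (simp add: powr_powr)
 have i: "intl (%x. indicator ucb x * ?y x powr (q/p))"
  unfolding e using integrable_mult_indicator[OF _ ipsc, of ucb] by simp
 have ym: "?y : Bor" using m(1) by measurable
 note P = power_mean_ucb[OF qp(1) ym _ i]
 have W0: "(LI z. mu z powr q) >= 0" by (intro integral_nonneg_AE) auto
 have "(LI x. indicator ucb x * ?y x powr (q/p)) <= (LI y. mu (psc r z y) powr q)"
  by (rule integral_mono[OF i ipsc]) (auto simp: e split: split_indicator)
 also have "... = (LI z. mu z powr q) / r ^ hdim TYPE('n)"
  using integral_psc[OF r m(3), of z] r by (simp add: field_simps)
 also have "... <= W / r ^ hdim TYPE('n)" using r m(4) by (intro divide_right_mono) auto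
 finally have b: "(LI x. indicator ucb x * ?y x powr (q/p)) <= W / r ^ hdim TYPE('n)" .
 let ?J = "LI x. indicator ucb x * ?y x"
 have J0: "?J >= 0" by (intro integral_nonneg_AE) auto
 have "?J powr (q/p) <= ?V powr (q/p - 1) * (W / r ^ hdim TYPE('n))"
  by (rule order_trans[OF P(2) mult_left_mono[OF b]]) simp_all
 hence "(?J powr (q/p)) powr (p/q) <= (?V powr (q/p - 1) * (W / r ^ hdim TYPE('n))) powr (p/q)"
  using qp by (intro powr_mono2) auto
 also have "(?J powr (q/p)) powr (p/q) = ?J" using qp J0 by (simp add: powr_powr)
 also have "(?V powr (q/p - 1) * (W / r ^ hdim TYPE('n))) powr (p/q) = ?V powr (1 - p/q) * (W / r ^ hdim TYPE('n)) powr (p/q)"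
 proof -
  have "(q/p - 1) * (p/q) = 1 - p/q" using qp by (simp add: field_simps)
  thus ?thesis by (simp only: powr_mult powr_powr)
 qed
 finally have Jb: "?J <= ?V powr (1 - p/q) * (W / r ^ hdim TYPE('n)) powr (p/q)" .
 have "(NL y. ennreal (indicator ucb y * mu (psc r z y) powr p)) = ennreal ?J"
  by (intro nn_integral_eq_integral P(1)) auto
 thus ?thesis using Jb by (simp add: ennreal_leI)
qed

text \<open>Jensen moves the power inside the mean. After Tonelli and a shift the weight is averaged
  around the point where \<open>g\<close> sits, so the previous bound applies uniformly and leaves
  the integral of \<open>g powr p\<close>.\<close>

lemma weighted_avg:
 fixes mu g :: "(real^'n)*real => real"
 assumes pq: "1 <= p" "p <= q" and r: "r > 0"
  and m: "mu : Bor" "!!z. mu z >= 0" "intl (%z. mu z powr q)" "(LI z. mu z powr q) <= W"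
  and g: "g : Bor" "!!z. g z >= 0" "intl (%z. g z powr p)" "(LI z. g z powr p) <= I"
 shows "(NL z. ennreal (mu z powr p * avg r g z powr p))
  <= ennreal (ucv TYPE('n) powr (p - p/q) * (W / r ^ hdim TYPE('n)) powr (p/q) * I)"
proof -
 let ?V = "ucv TYPE('n)" and ?d = "hdim TYPE('n)"
 note V = ucv_pos[where 'n='n]
 note [measurable] = m(1) g(1)
 have I00: "0 <= (LI z. g z powr p)" by (rule int_nonneg) simp
 hence I0: "I >= 0" using g(4) by linarith
 have p0: "p > 0" using pq by simp
 have pt: "ennreal (avg r g z powr p) <= ennreal (?V powr (p - 1)) * (NL y. ennreal (indicator ucb y * g (psc r z y) powr p))" for z
 proof -
  have i: "intl (%y. indicator ucb y * g (psc r z y) powr p)"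
   using integrable_mult_indicator[OF _ integrable_psc[OF r g(3)], of ucb z] by simp
  have "avg r g z powr p <= ?V powr (p - 1) * (LI y. indicator ucb y * g (psc r z y) powr p)"
   unfolding avg_def by (rule power_mean_ucb(2)[OF pq(1) _ _ i]) (use g in auto)
  moreover have "(NL y. ennreal (indicator ucb y * g (psc r z y) powr p)) = ennreal (LI y. indicator ucb y * g (psc r z y) powr p)"
   by (intro nn_integral_eq_integral i) auto
  ultimately show ?thesis by (simp add: ennreal_mult[symmetric] ennreal_leI)
 qed
 have "(NL z. ennreal (mu z powr p * avg r g z powr p))
  <= (NL z. ennreal (?V powr (p - 1)) * (NL y. ennreal (mu z powr p) * ennreal (indicator ucb y * g (psc r z y) powr p)))"
 proof (rule nn_integral_mono)
  fix z :: "(real^'n)*real"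
  have "ennreal (mu z powr p * avg r g z powr p) = ennreal (mu z powr p) * ennreal (avg r g z powr p)" by (rule ennreal_mult) auto
  also have "... <= ennreal (mu z powr p) * (ennreal (?V powr (p - 1)) * (NL y. ennreal (indicator ucb y * g (psc r z y) powr p)))"
   by (intro mult_left_mono pt) auto
  also have "... = ennreal (?V powr (p - 1)) * (NL y. ennreal (mu z powr p) * ennreal (indicator ucb y * g (psc r z y) powr p))"
   by (subst nn_integral_cmult) (auto simp: mult.left_commute)
  finally show "ennreal (mu z powr p * avg r g z powr p) <= ennreal (?V powr (p - 1)) * (NL y. ennreal (mu z powr p) * ennreal (indicator ucb y * g (psc r z y) powr p))" .
 qed
 also have "... = ennreal (?V powr (p - 1)) * (NL z. (NL y. ennreal (mu z powr p) * ennreal (indicator ucb y * g (psc r z y) powr p)))"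
  by (rule nn_integral_cmult) measurable
 also have "(NL z. (NL y. ennreal (mu z powr p) * ennreal (indicator ucb y * g (psc r z y) powr p)))
  = (NL y. (NL z. ennreal (mu z powr p) * ennreal (indicator ucb y * g (psc r z y) powr p)))"
  by (rule lborel_pair.Fubini'[symmetric]) measurable
 also have "... = (NL y. (NL z. ennreal (mu (psc r z (-y)) powr p) * ennreal (indicator ucb y * g z powr p)))"
 proof (rule nn_integral_cong)
  fix y :: "(real^'n)*real"
  let ?c = "- (r *R fst y, r^2 * snd y)"
  have "(NL z. ennreal (mu z powr p) * ennreal (indicator ucb y * g (psc r z y) powr p))
   = (NL z. ennreal (mu (?c + z) powr p) * ennreal (indicator ucb y * g (psc r (?c + z) y) powr p))"
   by (rule nn_integral_lborel_translate[symmetric]) measurable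
  moreover have "psc r (?c + z) y = z" "?c + z = psc r z (- y)" for z by (auto simp: psc_def prod_eq_iff)
  ultimately show "(NL z. ennreal (mu z powr p) * ennreal (indicator ucb y * g (psc r z y) powr p))
   = (NL z. ennreal (mu (psc r z (-y)) powr p) * ennreal (indicator ucb y * g z powr p))" by simp
 qed
 also have "... = (NL z. (NL y. ennreal (mu (psc r z (-y)) powr p) * ennreal (indicator ucb y * g z powr p)))"
  by (rule lborel_pair.Fubini') measurable
 also have "... <= (NL z. ennreal (g z powr p) * ennreal (?V powr (1 - p/q) * (W / r ^ ?d) powr (p/q)))"
 proof (rule nn_integral_mono)
  fix z :: "(real^'n)*real"
  have "(NL y. ennreal (mu (psc r z (-y)) powr p) * ennreal (indicator ucb y * g z powr p))
   = (NL y. ennreal (g z powr p) * ennreal (indicator ucb (- y) * mu (psc r z (-y)) powr p))"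
   by (intro nn_integral_cong)
    (auto simp: ucb_def mem_box ennreal_mult'[symmetric] mult.commute mult.left_commute minus_le_iff split: split_indicator)
  also have "... = (NL y. ennreal (g z powr p) * ennreal (indicator ucb y * mu (psc r z y) powr p))"
   by (rule nn_integral_lborel_uminus[where f="%y. ennreal (g z powr p) * ennreal (indicator ucb y * mu (psc r z y) powr p)"]) measurable
  also have "... = ennreal (g z powr p) * (NL y. ennreal (indicator ucb y * mu (psc r z y) powr p))"
   by (rule nn_integral_cmult) measurable
  also have "... <= ennreal (g z powr p) * ennreal (?V powr (1 - p/q) * (W / r ^ ?d) powr (p/q))"
   by (intro mult_left_mono avg_inner_bound pq r m) auto
  finally show "(NL y. ennreal (mu (psc r z (-y)) powr p) * ennreal (indicator ucb y * g z powr p))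
   <= ennreal (g z powr p) * ennreal (?V powr (1 - p/q) * (W / r ^ ?d) powr (p/q))" .
 qed
 also have "... = (NL z. ennreal (g z powr p)) * ennreal (?V powr (1 - p/q) * (W / r ^ ?d) powr (p/q))"
  by (rule nn_integral_multc) measurable
 also have "(NL z. ennreal (g z powr p)) = ennreal (LI z. g z powr p)"
  by (intro nn_integral_eq_integral g(3)) auto
 finally have "(NL z. ennreal (mu z powr p * avg r g z powr p))
  <= ennreal (?V powr (p - 1)) * (ennreal (LI z. g z powr p) * ennreal (?V powr (1 - p/q) * (W / r ^ ?d) powr (p/q)))"
  by (simp add: mult_left_mono)
 also have "... = ennreal (?V powr (p - 1) * ((LI z. g z powr p) * (?V powr (1 - p/q) * (W / r ^ ?d) powr (p/q))))"
  using I00 by (simp add: ennreal_mult)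
 also have "... <= ennreal (?V powr (p - 1) * (I * (?V powr (1 - p/q) * (W / r ^ ?d) powr (p/q))))"
  using g(4) by (intro ennreal_leI mult_left_mono mult_right_mono) auto
 also have "?V powr (p - 1) * (I * (?V powr (1 - p/q) * (W / r ^ ?d) powr (p/q))) = ?V powr (p - p/q) * (W / r ^ ?d) powr (p/q) * I"
  using V by (simp add: powr_add[symmetric] mult_ac)
 finally show ?thesis .
qed

lemma power_mean_sum:
 fixes alpha y :: "nat => real"
 assumes p: "p >= 1" and "!!j. alpha j >= 0" "!!j. y j >= 0"
 shows "(SUM j<N. alpha j * y j) powr p <= (SUM j<N. alpha j) powr (p - 1) * (SUM j<N. alpha j * y j powr p)"
proof -
 let ?M = "point_measure {..<N} (%j. ennreal (alpha j))"
 have f: "finite_measure ?M"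
  by (rule finite_measureI) (simp add: space_point_measure emeasure_point_measure_finite less_top[symmetric])
 have "measure ?M (space ?M) = (SUM j<N. alpha j)"
  using assms by (simp add: measure_def space_point_measure emeasure_point_measure_finite sum_nonneg)
 moreover have "integrable ?M (%j. y j powr p)" by (rule integrable_point_measure_finite) simp
 moreover have "integral\<^sup>L ?M g = (SUM j<N. alpha j * g j)" for g :: "nat => real"
  using assms by (subst lebesgue_integral_point_measure_finite) auto
 ultimately show ?thesis using power_mean(2)[OF f p, of y] assms by simp
qed

definition rad :: "nat => real" where "rad j = (1/2) ^ j"

lemma rad_pos: "rad j > 0" and rad_le: "rad j <= 1" and rad_Suc: "rad (Suc j) = rad j / 2"
 by (auto simp: rad_def power_le_one)

lemma rad_lim: "rad ----> 0" unfolding rad_def[abs_def] by (rule LIMSEQ_power_zero) simp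

text \<open>A dyadic truncation of the parabolic Riesz potential of order one.\<close>

definition pot :: "((real^'n)*real => real) => nat => (real^'n)*real => real" where
 "pot g N z = (SUM j<N. rad j * avg (rad j) g z)"

lemma avg_measurable [measurable]:
 assumes [measurable]: "g : Bor" shows "avg r g : Bor"
proof -
 have "(%z. LI y. indicator ucb y * g (psc r z y)) : borel_measurable lborel"
  by (rule lborel.borel_measurable_lebesgue_integral) measurable
 thus ?thesis unfolding avg_def[abs_def] by simp
qed

lemma avg_nonneg: "(!!z. g z >= 0) ==> avg r g z >= 0"
 unfolding avg_def by (intro integral_nonneg_AE) auto

definition potc :: "'n::finite itself => real => real => real" where
 "potc T p q = (1 / (1 - (1/2) powr (1 - hdim T / q))) powr p * ucv T powr (p - p/q)"

text \<open>Each weight is split as \<open>rad j powr (1 - theta)\<close> times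
  \<open>rad j powr theta\<close> with \<open>theta = hdim / q\<close>. The second factor cancels
  the blow-up of the weighted mean at radius \<open>rad j\<close>; the first sums geometrically
  because \<open>q\<close> exceeds the homogeneous dimension.\<close>

lemma weighted_pot:
 fixes mu g :: "(real^'n)*real => real"
 assumes pq: "1 <= p" "p <= q" "real (hdim TYPE('n)) < q"
  and m: "mu : Bor" "!!z. mu z >= 0" "intl (%z. mu z powr q)" "(LI z. mu z powr q) <= W"
  and g: "g : Bor" "!!z. g z >= 0" "intl (%z. g z powr p)" "(LI z. g z powr p) <= I"
 shows "(NL z. ennreal (mu z powr p * pot g N z powr p)) <= ennreal (potc TYPE('n) p q * (W powr (p/q) * I))"
proof -
 let ?V = "ucv TYPE('n)" and ?d = "hdim TYPE('n)"
 note [measurable] = m(1) g(1)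
 define theta where "theta = real ?d / q"
 have q0: "q > 0" "p > 0" using pq by auto
 have th: "theta < 1" using pq q0 by (simp add: theta_def)
 define s where "s = (1/2::real) powr (1 - theta)"
 have s: "0 < s" "s < 1" using th by (auto simp: s_def powr_def ln_div mult_less_0_iff)
 define A where "A = 1 / (1 - s)"
 have A: "A > 0" using s by (simp add: A_def)
 define alpha where "alpha j = s ^ j" for j :: nat
 have alpha: "alpha j = rad j powr (1 - theta)" "alpha j > 0" for j
  using s by (simp_all add: alpha_def s_def rad_def powr_power powr_realpow[symmetric] powr_powr mult.commute)
 have a0: "0 <= alpha j" for j using alpha(2) by (rule less_imp_le)
 have sA: "(SUM j<N. alpha j) <= A" for N
 proof -
  have "(SUM j<N. s ^ j) <= (\<Sum>j. s ^ j)" using s by (intro sum_le_suminf summable_geometric) auto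
  thus ?thesis using s by (simp add: alpha_def A_def suminf_geometric)
 qed
 have I0: "I >= 0" "W >= 0"
 proof -
  have "0 <= (LI z. g z powr p)" "0 <= (LI z. mu z powr q)"
   by (rule int_nonneg, simp)+
  thus "I >= 0" "W >= 0" using g(4) m(4) by linarith+
 qed
 let ?B = "?V powr (p - p/q) * (W powr (p/q) * I)"
 have one: "(NL z. ennreal (alpha j * rad j powr (theta * p)) * ennreal (mu z powr p * avg (rad j) g z powr p)) <= ennreal (alpha j * ?B)" for j
 proof -
  have "(NL z. ennreal (alpha j * rad j powr (theta * p)) * ennreal (mu z powr p * avg (rad j) g z powr p))
   = ennreal (alpha j * rad j powr (theta * p)) * (NL z. ennreal (mu z powr p * avg (rad j) g z powr p))"
   by (rule nn_integral_cmult) measurable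
  also have "... <= ennreal (alpha j * rad j powr (theta * p)) * ennreal (?V powr (p - p/q) * (W / rad j ^ ?d) powr (p/q) * I)"
   by (intro mult_left_mono weighted_avg pq rad_pos m g) auto
  also have "... = ennreal (alpha j * rad j powr (theta * p) * (?V powr (p - p/q) * (W / rad j ^ ?d) powr (p/q) * I))"
   using alpha(2)[of j] I0 by (intro ennreal_mult[symmetric]) auto
  also have "(W / rad j ^ ?d) powr (p/q) = W powr (p/q) * rad j powr (- (theta * p))"
  proof -
   have "(W / rad j ^ ?d) powr (p/q) = W powr (p/q) / (rad j powr real ?d) powr (p/q)"
    using rad_pos[of j] I0 by (simp add: powr_divide powr_realpow)
   also have "(rad j powr real ?d) powr (p/q) = rad j powr (theta * p)" by (simp add: powr_powr theta_def)
   finally show ?thesis by (simp add: powr_minus divide_inverse)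
  qed
  also have "alpha j * rad j powr (theta * p) * (?V powr (p - p/q) * (W powr (p/q) * rad j powr (- (theta * p))) * I) = alpha j * ?B"
   using rad_pos[of j] by (simp add: powr_minus field_simps)
  finally show ?thesis .
 qed
 have pt: "pot g N z powr p <= A powr (p - 1) * (SUM j<N. alpha j * rad j powr (theta * p) * avg (rad j) g z powr p)" for z
 proof -
  have e1: "pot g N z = (SUM j<N. alpha j * (rad j powr theta * avg (rad j) g z))"
  proof -
   have "rad j = alpha j * rad j powr theta" for j using rad_pos[of j] by (simp add: alpha(1) powr_add[symmetric])
   thus ?thesis unfolding pot_def by (simp add: mult.assoc[symmetric])
  qed
  have "pot g N z powr p <= (SUM j<N. alpha j) powr (p - 1) * (SUM j<N. alpha j * (rad j powr theta * avg (rad j) g z) powr p)"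
   unfolding e1 by (rule power_mean_sum[OF pq(1)]) (simp_all only: less_imp_le[OF alpha(2)] avg_nonneg[OF g(2)] mult_nonneg_nonneg powr_ge_zero)
  also have "... <= A powr (p - 1) * (SUM j<N. alpha j * (rad j powr theta * avg (rad j) g z) powr p)"
   by (intro mult_right_mono powr_mono2 sA sum_nonneg mult_nonneg_nonneg powr_ge_zero a0) (use pq in simp)
  also have "(SUM j<N. alpha j * (rad j powr theta * avg (rad j) g z) powr p) = (SUM j<N. alpha j * rad j powr (theta * p) * avg (rad j) g z powr p)"
   by (simp add: powr_mult powr_powr mult.assoc)
  finally show ?thesis .
 qed
 have "(NL z. ennreal (mu z powr p * pot g N z powr p))
  <= (NL z. ennreal (A powr (p - 1)) * (SUM j<N. ennreal (alpha j * rad j powr (theta * p)) * ennreal (mu z powr p * avg (rad j) g z powr p)))"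
 proof (rule nn_integral_mono)
  fix z
  have "mu z powr p * pot g N z powr p <= mu z powr p * (A powr (p - 1) * (SUM j<N. alpha j * rad j powr (theta * p) * avg (rad j) g z powr p))"
   using pt by (intro mult_left_mono) auto
  also have "... = A powr (p - 1) * (SUM j<N. alpha j * rad j powr (theta * p) * (mu z powr p * avg (rad j) g z powr p))"
   by (simp add: sum_distrib_left mult_ac)
  finally have "ennreal (mu z powr p * pot g N z powr p) <= ennreal (A powr (p - 1) * (SUM j<N. alpha j * rad j powr (theta * p) * (mu z powr p * avg (rad j) g z powr p)))"
   by (rule ennreal_leI)
  also have "... = ennreal (A powr (p - 1)) * (SUM j<N. ennreal (alpha j * rad j powr (theta * p)) * ennreal (mu z powr p * avg (rad j) g z powr p))"
   using a0 by (simp add: ennreal_mult sum_nonneg flip: sum_ennreal)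
  finally show "ennreal (mu z powr p * pot g N z powr p) <= ennreal (A powr (p - 1)) * (SUM j<N. ennreal (alpha j * rad j powr (theta * p)) * ennreal (mu z powr p * avg (rad j) g z powr p))" .
 qed
 also have "... = ennreal (A powr (p - 1)) * (NL z. (SUM j<N. ennreal (alpha j * rad j powr (theta * p)) * ennreal (mu z powr p * avg (rad j) g z powr p)))"
  by (rule nn_integral_cmult) measurable
 also have "(NL z. (SUM j<N. ennreal (alpha j * rad j powr (theta * p)) * ennreal (mu z powr p * avg (rad j) g z powr p)))
   = (SUM j<N. NL z. ennreal (alpha j * rad j powr (theta * p)) * ennreal (mu z powr p * avg (rad j) g z powr p))"
  by (rule nn_integral_sum) measurable
 also have "ennreal (A powr (p - 1)) * (SUM j<N. NL z. ennreal (alpha j * rad j powr (theta * p)) * ennreal (mu z powr p * avg (rad j) g z powr p))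
   <= ennreal (A powr (p - 1)) * (SUM j<N. ennreal (alpha j * ?B))"
  by (intro mult_left_mono sum_mono one) auto
 also have "... = ennreal (A powr (p - 1) * ((SUM j<N. alpha j) * ?B))"
  using a0 I0 by (simp add: ennreal_mult sum_nonneg sum_distrib_right flip: sum_ennreal)
 also have "... <= ennreal (A powr (p - 1) * (A * ?B))"
  using sA I0 by (intro ennreal_leI mult_left_mono mult_right_mono) auto
 also have "A powr (p - 1) * (A * ?B) = A powr p * ?B" using A by (simp add: powr_diff)
 also have "... = potc TYPE('n) p q * (W powr (p/q) * I)"
  by (simp add: potc_def A_def s_def theta_def)
 finally show ?thesis .
qed

lemma norm_psc_le: "0 <= r ==> r <= 1 ==> norm (psc r z y - z) <= norm y"
proof -
 assume r: "0 <= r" "r <= 1"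
 have "r^2 <= 1" using r by (simp add: power_le_one)
 hence "norm (r *R fst y) <= norm (fst y)" "norm (r^2 * snd y) <= norm (snd y)"
  using r by (auto simp: abs_mult mult_left_le_one_le)
 hence "(norm (r *R fst y))^2 + (norm (r^2 * snd y))^2 <= (norm (fst y))^2 + (norm (snd y))^2"
  by (intro add_mono power_mono) auto
 thus ?thesis by (simp add: psc_def norm_prod_def)
qed

definition moll :: "((real^'n)*real => real) => real => ((real^'n)*real => real) => (real^'n)*real => real" where
 "moll rho r f z = (LI y. f (psc r z y) * rho y)"

text \<open>Fubini and a shift move the mollification onto the smooth \<open>psi\<close>, where
  convergence is pointwise and dominated. Weak convergence is enough to identify an almost
  everywhere limit later, without Lebesgue's differentiation theorem.\<close>

lemma moll_weak_limit:
 fixes f :: "(real^'n)*real => real"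
 assumes f: "locint f" and rho: "tfun rho" and psi: "tfun psi"
 shows "(%j. LI z. moll rho (rad j) f z * psi z) ----> (LI y. rho y) * (LI z. f z * psi z)"
proof -
 note [measurable] = locintD(1)[OF f] smooth_borel[OF tfun_smooth[OF rho]] smooth_borel[OF tfun_smooth[OF psi]]
 obtain R1 where R1: "!!z. psi z ~= 0 ==> norm z <= R1" using psi by (auto simp: tfun_iff bounded_iff)
 obtain R2 where R2: "!!z. rho z ~= 0 ==> norm z <= R2" using rho by (auto simp: tfun_iff bounded_iff)
 obtain B where B: "!!z. abs (psi z) <= B" "B >= 0" using tfun_bounded[OF psi] by blast
 define S where "S = cball (0 :: (real^'n)*real) (R1 + R2)"
 have S[measurable]: "S : sets borel" by (simp add: S_def)
 have iS: "intl (%z. f z * (B * indicator S z))"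
 proof (rule integrable_bounded_support[OF f, where B=B])
  show "(%z. B * indicator S z) : Bor" by measurable
  show "abs (B * indicator S z) <= B" for z using B(2) by (auto split: split_indicator)
  show "bounded {z. B * indicator S z ~= (0::real)}"
   by (rule bounded_subset[OF bounded_cball[of 0 "R1 + R2"]]) (auto simp: S_def split: split_indicator_asm)
 qed
 define K where "K = (LI z. abs (f z * (B * indicator S z)))"
 have iS': "intl (%z. abs (f z * (B * indicator S z)))" using iS by auto
 have irho: "intl rho"
  using integrable_tfun[OF locint_continuous[OF continuous_on_const[of UNIV 1]] rho] by simp
 define Psi where "Psi j y = (LI z. f z * psi (psc (rad j) z (- y)))" for j y
 have dom: "abs (f z * psi (psc (rad j) z (- y))) <= abs (f z * (B * indicator S z))" if "rho y ~= 0" for z y j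
 proof (cases "psi (psc (rad j) z (- y)) = 0")
  case False
  have "norm (psc (rad j) z (- y) - z) <= norm (- y)" using rad_pos[of j] rad_le[of j] by (intro norm_psc_le) auto
  hence "norm z <= R1 + R2" using R1[OF False] R2[OF that] norm_triangle_ineq2[of z "psc (rad j) z (- y)"]
   by (simp add: norm_minus_commute)
  thus ?thesis using B(1)[of "psc (rad j) z (- y)"] B(2) by (auto simp: abs_mult S_def intro!: mult_left_mono)
 qed simp
 have Psilim: "(%j. Psi j y) ----> (LI z. f z * psi z)" if "rho y ~= 0" for y
  unfolding Psi_def
 proof (rule integral_dominated_convergence[where w="%z. abs (f z * (B * indicator S z))"])
  show "AEL z. (%j. f z * psi (psc (rad j) z (- y))) ----> f z * psi z"
  proof (rule AE_I2)
   fix z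
   have "(%j. z + (rad j *R fst (- y), (rad j)^2 * snd (- y))) ----> z + (0 *R fst (- y), 0^2 * snd (- y))"
    by (intro tendsto_intros rad_lim)
   hence "(%j. psc (rad j) z (- y)) ----> z" by (simp add: psc_def zero_prod_def[symmetric])
   from continuous_on_tendsto_compose[OF smooth_continuous[OF tfun_smooth[OF psi]] this]
   show "(%j. f z * psi (psc (rad j) z (- y))) ----> f z * psi z" by (intro tendsto_mult_left) auto
  qed
  show "AEL z. norm (f z * psi (psc (rad j) z (- y))) <= abs (f z * (B * indicator S z))" for j
   using dom[OF that] by (intro AE_I2) (simp only: real_norm_def)
 qed (use iS' in auto)
 have Psibd: "abs (Psi j y * rho y) <= K * abs (rho y)" for j y
 proof (cases "rho y = 0")
  case False
  have "abs (Psi j y) <= (LI z. abs (f z * psi (psc (rad j) z (- y))))" unfolding Psi_def by (rule integral_abs_bound)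
  also have "... <= K" unfolding K_def
   by (rule integral_mono_AE'[OF iS']) (use dom[OF False] in auto)
  finally show ?thesis by (simp add: abs_mult mult_right_mono)
 qed simp
 have Psim[measurable]: "Psi j : Bor" for j
 proof -
  have "(%y. LI z. f z * psi (psc (rad j) z (- y))) : borel_measurable lborel"
   by (rule lborel.borel_measurable_lebesgue_integral) measurable
  thus ?thesis unfolding Psi_def[abs_def] by simp
 qed
 have "(%j. LI y. Psi j y * rho y) ----> (LI y. (LI z. f z * psi z) * rho y)"
 proof (rule integral_dominated_convergence[where w="%y. K * abs (rho y)"])
  show "AEL y. (%j. Psi j y * rho y) ----> (LI z. f z * psi z) * rho y"
  proof (rule AE_I2)
   fix y show "(%j. Psi j y * rho y) ----> (LI z. f z * psi z) * rho y"
    using tendsto_mult_right[OF Psilim[of y], of "rho y"] by (cases "rho y = 0") auto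
  qed
  show "AEL y. norm (Psi j y * rho y) <= K * abs (rho y)" for j using Psibd by (intro AE_I2) (simp only: real_norm_def)
 qed (use irho in auto)
 moreover have "(LI z. moll rho (rad j) f z * psi z) = (LI y. Psi j y * rho y)" for j
 proof -
  let ?F = "%y z. f (psc (rad j) z y) * psi z * rho y"
  have tr: "(LI z. h (f (psc (rad j) z y) * psi z)) = (LI z. h (f z * psi (psc (rad j) z (- y))))"
   if [measurable]: "h : Bor" for y and h :: "real => real"
  proof -
   let ?c = "- (rad j *R fst y, (rad j)^2 * snd y)"
   have "(LI z. h (f (psc (rad j) z y) * psi z)) = (LI z. h (f (psc (rad j) (?c + z) y) * psi (?c + z)))"
    by (rule integral_lborel_translate(1)[symmetric]) measurable
   moreover have "psc (rad j) (?c + z) y = z" "?c + z = psc (rad j) z (- y)" for z by (auto simp: psc_def prod_eq_iff)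
   ultimately show ?thesis by simp
  qed
  have li: "locint (%z. f (psc (rad j) z y))" for y
  proof -
   let ?c = "(rad j *R fst y, (rad j)^2 * snd y)"
   have "psc (rad j) z y = psc 1 ?c z" for z by (simp add: psc_def prod_eq_iff)
   thus ?thesis using locint_psc[OF zero_less_one f, of ?c] by simp
  qed
  have ii: "integrable (lborel \<Otimes>\<^sub>M lborel) (%(y, z). ?F y z)"
  proof (rule lborel_pair.Fubini_integrable)
   show "(%(y, z). ?F y z) : borel_measurable (lborel \<Otimes>\<^sub>M lborel)" by measurable
   show "AEL y. intl (%z. case (y, z) of (y, z) => ?F y z)"
    using integrable_tfun[OF li psi] by (intro AE_I2) auto
   show "intl (%y. LI z. norm (case (y, z) of (y, z) => ?F y z))"
   proof (rule Bochner_Integration.integrable_bound[where f="%y. K * abs (rho y)"])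
    show "intl (%y. K * abs (rho y))" using irho by auto
    show "(%y. LI z. norm (case (y, z) of (y, z) => ?F y z)) : borel_measurable lborel"
     by (rule lborel.borel_measurable_lebesgue_integral) measurable
    show "AEL y. norm (LI z. norm (case (y, z) of (y, z) => ?F y z)) <= norm (K * abs (rho y))"
    proof (rule AE_I2)
     fix y
     have "(LI z. norm (case (y, z) of (y, z) => ?F y z)) = abs (rho y) * (LI z. abs (f (psc (rad j) z y) * psi z))"
     proof -
      have "(LI z. norm (case (y, z) of (y, z) => ?F y z)) = (LI z. abs (rho y) * abs (f (psc (rad j) z y) * psi z))"
       by (intro Bochner_Integration.integral_cong) (simp_all add: abs_mult)
      thus ?thesis by (simp only: integral_mult_right_zero)
     qed
     also have "(LI z. abs (f (psc (rad j) z y) * psi z)) = (LI z. abs (f z * psi (psc (rad j) z (- y))))"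
      using tr[of abs] by simp
     also have "abs (rho y) * ... <= abs (rho y) * K"
     proof (cases "rho y = 0")
      case False
      have "(LI z. abs (f z * psi (psc (rad j) z (- y)))) <= K" unfolding K_def
       by (rule integral_mono_AE'[OF iS']) (use dom[OF False] in auto)
      thus ?thesis by (intro mult_left_mono) auto
     qed simp
     finally show "norm (LI z. norm (case (y, z) of (y, z) => ?F y z)) <= norm (K * abs (rho y))"
      using abs_ge_self[of "K * abs (rho y)"] by (simp add: mult.commute)
    qed
   qed
  qed
  have "(LI z. moll rho (rad j) f z * psi z) = (LI z. (LI y. ?F y z))"
   unfolding moll_def by (simp add: mult_ac flip: integral_mult_left_zero)
  also have "... = (LI y. (LI z. ?F y z))"
   using lborel_pair.Fubini_integral[OF ii] by simp
  also have "... = (LI y. Psi j y * rho y)"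
   unfolding Psi_def using tr[of "%x. x"] by simp
  finally show ?thesis .
 qed
 ultimately show ?thesis by (simp add: mult.commute)
qed

lemma nn_integral_fatou_real:
 fixes X :: "nat => 'a::euclidean_space => real"
 assumes m: "!!N. X N : Bor" and lim: "AEL z. (%N. X N z) ----> Y z"
  and K: "!!N. (NL z. ennreal (X N z)) <= K"
 shows "(NL z. ennreal (Y z)) <= K"
proof -
 have "(NL z. ennreal (Y z)) = (NL z. liminf (%N. ennreal (X N z)))"
 proof (rule nn_integral_cong_AE)
  show "AEL z. ennreal (Y z) = liminf (%N. ennreal (X N z))"
   using lim by eventually_elim (intro lim_imp_Liminf[symmetric] tendsto_ennrealI, auto)
 qed
 also have "... <= liminf (%N. NL z. ennreal (X N z))"
  using m by (intro nn_integral_liminf) auto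
 also have "... <= K" using K by (intro Liminf_le) auto
 finally show ?thesis .
qed

lemma le_one_plus_powr: fixes y p :: real assumes "y >= 0" "p >= 1" shows "y <= 1 + y powr p"
proof (cases "y <= 1")
 case True thus ?thesis by (meson add_increasing2 powr_ge_zero)
next
 case False
 hence "y powr 1 <= y powr p" using assms by (intro powr_mono) auto
 thus ?thesis using False by simp
qed

lemma Lloc_locint: assumes f: "Lloc p f" and p: "p >= 1" shows "locint f"
 unfolding locint_def
proof (intro conjI allI)
 show "f : Bor" by (rule LlocD(1)[OF f])
 fix a b :: 'a
 have "intl (%z. indicator (cbox a b) z + indicator (cbox a b) z * abs (f z) powr p)"
  using LlocD(2)[OF f] by (intro Bochner_Integration.integrable_add integrable_real_indicator emeasure_bounded_finite bounded_cbox) auto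
 thus "intl (%z. indicator (cbox a b) z * f z)"
  by (rule Bochner_Integration.integrable_bound)
   (use LlocD(1)[OF f] le_one_plus_powr[OF abs_ge_zero p] in \<open>auto split: split_indicator\<close>)
qed

lemma integrable_of_nn_bound:
 assumes "f : Bor" "!!z. f z >= 0" "(NL z. ennreal (f z)) <= ennreal K" "K >= 0"
 shows "intl f" "(LI z. f z) <= K"
proof -
 show "intl f"
  using assms by (intro integrableI_nonneg) (auto intro: le_less_trans)
 hence "ennreal (LI z. f z) <= ennreal K" using assms by (subst nn_integral_eq_integral[symmetric]) auto
 thus "(LI z. f z) <= K" using assms(4) by (simp add: ennreal_le_iff)
qed

lemma pot_mono: assumes "!!z. g z >= 0" "M <= N" shows "pot g M z <= pot g N z"
 unfolding pot_def
 by (rule sum_mono2) (use assms avg_nonneg[of g] rad_pos less_imp_le[OF rad_pos] in \<open>auto intro!: mult_nonneg_nonneg\<close>)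

lemma pot_measurable [measurable]: "g : Bor ==> pot g N : Bor"
 unfolding pot_def[abs_def] by measurable

text \<open>Monotone convergence: moments of partial sums that stay bounded on every box force the
  series to converge almost everywhere. It serves both the dyadic potential and the Neumann
  series.\<close>

lemma moment_summable:
 fixes x :: "nat => 'a::euclidean_space => real"
 assumes p: "1 <= p" and x: "!!j. x j : Bor" "!!j z. x j z >= 0"
  and B: "!!a b. EX K>=0. ALL N. (NL z. ennreal (indicator (cbox a b) z * (SUM j<N. x j z) powr p)) <= ennreal K"
 shows "AEL z. summable (%j. x j z)" and "Lloc p (%z. \<Sum>j. x j z)"
proof -
 note [measurable] = x(1)
 have p0: "p > 0" using p by auto
 have s0: "(SUM j<N. x j z) >= 0" for N z using x(2) by (intro sum_nonneg) auto
 have ae: "AEL z. z : cbox a b --> summable (%j. x j z)" for a b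
 proof -
  obtain K where K: "K >= 0" "!!N. (NL z. ennreal (indicator (cbox a b) z * (SUM j<N. x j z) powr p)) <= ennreal K" using B by blast
  let ?X = "%N z. ennreal (indicator (cbox a b) z * (SUM j<N. x j z) powr p)"
  have "(NL z. (SUP N. ?X N z)) = (SUP N. NL z. ?X N z)"
  proof (rule nn_integral_monotone_convergence_SUP)
   show "incseq ?X"
    using s0 p0 x(2)
    by (auto simp: incseq_def le_fun_def intro!: ennreal_leI mult_left_mono powr_mono2 sum_mono2)
  qed measurable
  also have "... <= ennreal K" using K by (intro SUP_least) auto
  finally have "(NL z. (SUP N. ?X N z)) ~= \<infinity>" using ennreal_less_top[of K] by (auto simp: top_unique)
  hence "AEL z. (SUP N. ?X N z) ~= \<infinity>" by (intro nn_integral_PInf_AE) auto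
  thus ?thesis
  proof (eventually_elim, intro impI)
   fix z assume fin: "(SUP N. ?X N z) ~= \<infinity>" and z: "z : cbox a b"
   then obtain k where k: "k >= 0" "(SUP N. ?X N z) = ennreal k" by (cases "SUP N. ?X N z") auto
   have "(SUM j<N. x j z) powr p <= k" for N
   proof -
    have "?X N z <= ennreal k" unfolding k(2)[symmetric] by (rule SUP_upper) simp
    thus ?thesis using z k(1) by (simp add: ennreal_le_iff)
   qed
   hence pb: "(SUM j<N. x j z) <= 1 + k" for N
    using le_one_plus_powr[OF s0 p] by (meson add_left_mono order_trans)
   show "summable (%j. x j z)"
   proof (rule bounded_imp_summable)
    show "0 <= x n z" for n by (rule x(2))
    show "(SUM j<=n. x j z) <= 1 + k" for n using pb[of "Suc n"] by (simp only: lessThan_Suc_atMost)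
   qed
  qed
 qed
 have "AEL z. ALL n::nat. z : cbox (- (real n *R One)) (real n *R One) --> summable (%j. x j z)"
  using ae by (subst AE_all_countable) auto
 thus summ: "AEL z. summable (%j. x j z)"
 proof eventually_elim
  fix z assume A: "ALL n::nat. z : cbox (- (real n *R One)) (real n *R One) --> summable (%j. x j z)"
  have "z : (UN n::nat. box (- (real n *R One)) (real n *R One))" unfolding UN_box_eq_UNIV by simp
  thus "summable (%j. x j z)" using A box_subset_cbox by blast
 qed
 have Sm[measurable]: "(%z. \<Sum>j. x j z) : Bor" by measurable
 show "Lloc p (%z. \<Sum>j. x j z)"
  unfolding Lloc_def
 proof (intro conjI allI Sm)
  fix a b :: 'a
  obtain K where K: "K >= 0" "!!N. (NL z. ennreal (indicator (cbox a b) z * (SUM j<N. x j z) powr p)) <= ennreal K" using B by blast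
  show "intl (%z. indicator (cbox a b) z * abs (\<Sum>j. x j z) powr p)"
  proof (rule integrable_of_nn_bound(1)[OF _ _ _ K(1)])
   show "(NL z. ennreal (indicator (cbox a b) z * abs (\<Sum>j. x j z) powr p)) <= ennreal K"
   proof (rule nn_integral_fatou_real[where X="%N z. indicator (cbox a b) z * (SUM j<N. x j z) powr p"])
    show "AEL z. (%N. indicator (cbox a b) z * (SUM j<N. x j z) powr p) ----> indicator (cbox a b) z * abs (\<Sum>j. x j z) powr p"
     using summ
    proof eventually_elim
     fix z assume s: "summable (%j. x j z)"
     have l: "(%N. (SUM j<N. x j z)) ----> (\<Sum>j. x j z)" by (rule summable_LIMSEQ[OF s])
     have "0 <= (\<Sum>j. x j z)" using s x(2) by (intro suminf_nonneg) auto
     thus "(%N. indicator (cbox a b) z * (SUM j<N. x j z) powr p) ----> indicator (cbox a b) z * abs (\<Sum>j. x j z) powr p"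
      using l p0 s0
      by (intro tendsto_mult_left tendsto_powr2) (auto intro: always_eventually)
    qed
   qed (use K in auto)
  qed auto
 qed
qed

text \<open>The weighted estimate with the indicator of a box as weight.\<close>

lemma potential_summable:
 fixes g :: "(real^'n)*real => real"
 assumes pq: "1 <= p" "p <= q" "real (hdim TYPE('n)) < q"
  and g: "g : Bor" "!!z. g z >= 0" "intl (%z. g z powr p)"
 shows "AEL z. summable (%j. rad j * avg (rad j) g z)"
  and "Lloc p (%z. \<Sum>j. rad j * avg (rad j) g z)"
proof -
 note [measurable] = g(1)
 have p0: "p > 0" "q > 0" using pq by auto
 define I where "I = (LI z. g z powr p)"
 have I0: "I >= 0" unfolding I_def by (rule int_nonneg) simp
 have B: "EX K>=0. ALL N. (NL z. ennreal (indicator (cbox a b) z * (SUM j<N. rad j * avg (rad j) g z) powr p)) <= ennreal K" for a b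
 proof -
  let ?mu = "indicator (cbox a b) :: (real^'n)*real => real"
  have e: "?mu z powr s = ?mu z" if "s > 0" for s z using that by (auto split: split_indicator)
  have i: "intl ?mu" by (intro integrable_real_indicator emeasure_bounded_finite bounded_cbox) auto
  show ?thesis
   using weighted_pot[OF pq, of ?mu "LI z. ?mu z powr q" g I] i g p0 I0
   by (intro exI[of _ "potc TYPE('n) p q * ((LI z. ?mu z powr q) powr (p/q) * I)"])
    (auto simp: e I_def potc_def pot_def intro!: mult_nonneg_nonneg)
 qed
 have x: "(%z. rad j * avg (rad j) g z) : Bor" "rad j * avg (rad j) g z >= 0" for j z
  by (measurable, intro mult_nonneg_nonneg avg_nonneg g(2) less_imp_le[OF rad_pos])
 show "AEL z. summable (%j. rad j * avg (rad j) g z)" "Lloc p (%z. \<Sum>j. rad j * avg (rad j) g z)"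
  by (rule moment_summable[OF pq(1) x B])+
qed

text \<open>The mollifications of \<open>f\<close> start below a multiple of the mean of
  \<open>g\<close> at scale one and change by at most \<open>Cs * rad j\<close> times the mean at
  scale \<open>rad j\<close>. So they are controlled by the potential of \<open>g\<close>, and Fatou
  transfers the weighted bound to their limit.\<close>

lemma potential_estimate:
 fixes f g mu :: "(real^'n)*real => real"
 assumes pq: "1 <= p" "p <= q" "real (hdim TYPE('n)) < q"
  and f: "locint f" and rho: "tfun rho" "!!y. rho y ~= 0 ==> y : ucb" "!!y. abs (rho y) <= B" "B >= 0" "(LI y. rho y) = c0" "c0 > 0"
  and g: "g : Bor" "!!z. abs (f z) <= g z" "intl (%z. g z powr p)" "(LI z. g z powr p) <= I"
  and step: "!!j z. abs (moll rho (rad (Suc j)) f z - moll rho (rad j) f z) <= Cs * (rad j * avg (rad j) g z)" and Cs: "Cs >= 0"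
  and m: "mu : Bor" "!!z. mu z >= 0" "intl (%z. mu z powr q)" "(LI z. mu z powr q) <= W"
 shows "bd p (((B + Cs) / c0) powr p * potc TYPE('n) p q * (W powr (p/q) * I)) (%z. mu z * f z)"
proof -
 note [measurable] = g(1) locintD(1)[OF f] m(1) smooth_borel[OF tfun_smooth[OF rho(1)]]
 have p0: "p > 0" using pq by simp
 have g0: "g z >= 0" for z using g(2)[of z] by linarith
 have gl: "locint g"
  by (rule Lloc_locint[OF Lloc_integrable pq(1)]) (use g g0 in auto)
 define a where "a N z = moll rho (rad N) f z" for N z
 have am[measurable]: "a N : Bor" for N
 proof -
  have "(%z. LI y. f (psc (rad N) z y) * rho y) : borel_measurable lborel"
   by (rule lborel.borel_measurable_lebesgue_integral) measurable
  thus ?thesis unfolding a_def moll_def[abs_def] by simp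
 qed
 have a0: "abs (a 0 z) <= B * avg 1 g z" for z
 proof -
  have i: "intl (%y. indicator ucb y * g (psc 1 z y))"
   using locintD(2)[OF locint_psc[OF zero_less_one gl]] by (simp add: ucb_def)
  have "abs (a 0 z) <= (LI y. abs (f (psc 1 z y) * rho y))" unfolding a_def moll_def by (simp add: rad_def integral_abs_bound)
  also have "... <= (LI y. B * (indicator ucb y * g (psc 1 z y)))"
  proof (rule integral_mono_AE')
   show "intl (%y. B * (indicator ucb y * g (psc 1 z y)))" using i by simp
   show "AEL y. abs (f (psc 1 z y) * rho y) <= B * (indicator ucb y * g (psc 1 z y))"
   proof (rule AE_I2)
    fix y
    have "abs (f (psc 1 z y)) * abs (rho y) <= g (psc 1 z y) * (B * indicator ucb y)"
     using g(2)[of "psc 1 z y"] g0[of "psc 1 z y"] rho(2)[of y] rho(3)[of y] rho(4) by (cases "rho y = 0") (auto intro!: mult_mono)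
    thus "abs (f (psc 1 z y) * rho y) <= B * (indicator ucb y * g (psc 1 z y))" by (simp add: abs_mult mult_ac)
   qed
   show "AEL y. 0 <= B * (indicator ucb y * g (psc 1 z y))"
    by (intro AE_I2 mult_nonneg_nonneg g0 rho(4)) simp
  qed
  finally show ?thesis by (simp add: avg_def)
 qed
 have aN: "abs (a N z) <= (B + Cs) * pot g (Suc N) z" for N z
 proof -
  have "abs (a N z) <= B * pot g 1 z + Cs * pot g N z"
  proof (induction N)
   case 0 thus ?case using a0[of z] by (simp add: pot_def rad_def)
  next
   case (Suc N)
   have "abs (a (Suc N) z) <= abs (a N z) + Cs * (rad N * avg (rad N) g z)" using step[of N z] unfolding a_def by linarith
   also have "... <= B * pot g 1 z + Cs * pot g (Suc N) z" using Suc by (simp add: pot_def algebra_simps)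
   finally show ?case .
  qed
  also have "... <= B * pot g (Suc N) z + Cs * pot g (Suc N) z"
   using rho(4) Cs by (intro add_mono mult_left_mono pot_mono g0) auto
  finally show ?thesis by (simp add: algebra_simps)
 qed
 define S where "S z = (\<Sum>j. rad j * avg (rad j) g z)" for z
 note PS = potential_summable[OF pq g(1) g0 g(3)]
 have SL: "locint S" using Lloc_locint[OF PS(2) pq(1)] by (simp add: S_def[abs_def])
 have Sm[measurable]: "S : Bor" by (rule locintD(1)[OF SL])
 have BC: "B + Cs >= 0" using rho(4) Cs by simp
 define al where "al z = lim (%N. a N z)" for z
 have atm[measurable]: "al : Bor" unfolding al_def[abs_def] by measurable
 have lima: "AEL z. (%N. a N z) ----> al z & (ALL N. abs (a N z) <= (B + Cs) * S z) & abs (al z) <= (B + Cs) * S z"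
  using PS(1)
 proof eventually_elim
  fix z assume s: "summable (%j. rad j * avg (rad j) g z)"
  have "summable (%j. a (Suc j) z - a j z)"
   by (rule summable_comparison_test'[OF summable_mult[OF s, of Cs], of 0]) (use step in \<open>simp add: a_def\<close>)
  from summable_LIMSEQ[OF this] have "convergent (%N. a N z - a 0 z)" unfolding sum_lessThan_telescope[of "%i. a i z"] by (auto simp: convergent_def)
  hence "convergent (%N. (a N z - a 0 z) + a 0 z)" by (intro convergent_add convergent_const)
  hence l: "(%N. a N z) ----> al z" unfolding al_def by (simp add: convergent_LIMSEQ_iff)
  have "pot g N z <= S z" for N unfolding pot_def S_def
   using s avg_nonneg[where g=g, OF g0] less_imp_le[OF rad_pos] by (intro sum_le_suminf) auto
  hence b: "abs (a N z) <= (B + Cs) * S z" for N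
   using aN[of N z] BC by (meson mult_left_mono order_trans)
  moreover have "abs (al z) <= (B + Cs) * S z"
   by (rule LIMSEQ_le_const2[OF tendsto_rabs[OF l]]) (use b in auto)
  ultimately show "(%N. a N z) ----> al z & (ALL N. abs (a N z) <= (B + Cs) * S z) & abs (al z) <= (B + Cs) * S z" using l by blast
 qed
 have atl: "locint al"
  unfolding locint_def
 proof (intro conjI allI atm)
  fix u v :: "(real^'n)*real"
  have "intl (%z. (B + Cs) * (indicator (cbox u v) z * S z))" using locintD(2)[OF SL] by simp
  thus "intl (%z. indicator (cbox u v) z * al z)"
  proof (rule Bochner_Integration.integrable_bound)
   show "AEL z. norm (indicator (cbox u v) z * al z) <= norm ((B + Cs) * (indicator (cbox u v) z * S z))"
    using lima by eventually_elim (auto split: split_indicator)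
  qed simp
 qed
 \<comment> \<open>The limit \<open>al\<close> is taken pointwise; it is recognised as
   \<open>c0 * f\<close> by comparison with the weak limit of the same sequence.\<close>
 have "AEL z. al z = c0 * f z"
 proof (rule fundamental_lemma_eq[OF atl locint_cmult[OF f]])
  fix psi :: "(real^'n)*real => real" assume psi: "tfun psi"
  note [measurable] = smooth_borel[OF tfun_smooth[OF psi]]
  have "(%N. LI z. a N z * psi z) ----> (LI z. al z * psi z)"
  proof (rule integral_dominated_convergence[where w="%z. abs ((B + Cs) * (S z * psi z))"])
   show "intl (%z. abs ((B + Cs) * (S z * psi z)))" using integrable_tfun[OF SL psi] by auto
   show "AEL z. (%N. a N z * psi z) ----> al z * psi z" using lima by eventually_elim (auto intro: tendsto_mult_right)
   show "AEL z. norm (a N z * psi z) <= abs ((B + Cs) * (S z * psi z))" for N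
    using lima
   proof eventually_elim
    fix z assume "(%N. a N z) ----> al z & (ALL N. abs (a N z) <= (B + Cs) * S z) & abs (al z) <= (B + Cs) * S z"
    hence "abs (a N z) <= abs ((B + Cs) * S z)" by (meson abs_ge_self order_trans)
    thus "norm (a N z * psi z) <= abs ((B + Cs) * (S z * psi z))" by (simp add: abs_mult mult_right_mono flip: mult.assoc)
   qed
  qed measurable
  moreover have "(%N. LI z. a N z * psi z) ----> c0 * (LI z. f z * psi z)"
   using moll_weak_limit[OF f rho(1) psi] by (simp add: a_def rho(5))
  ultimately have "(LI z. al z * psi z) = c0 * (LI z. f z * psi z)" by (rule LIMSEQ_unique)
  thus "(LI z. al z * psi z) = (LI z. c0 * f z * psi z)" by (simp add: mult.assoc)
 qed
 with lima have lim2: "AEL z. (%N. mu z powr p * abs (a N z) powr p) ----> mu z powr p * abs (c0 * f z) powr p"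
 proof eventually_elim
  fix z assume 1: "(%N. a N z) ----> al z & (ALL N. abs (a N z) <= (B + Cs) * S z) & abs (al z) <= (B + Cs) * S z"
   and 2: "al z = c0 * f z"
  have "(%N. abs (a N z)) ----> abs (c0 * f z)" using 1 2 by (auto intro: tendsto_rabs)
  thus "(%N. mu z powr p * abs (a N z) powr p) ----> mu z powr p * abs (c0 * f z) powr p"
   using p0 by (intro tendsto_mult_left tendsto_powr2) (auto intro: always_eventually)
 qed
 let ?P = "potc TYPE('n) p q * (W powr (p/q) * I)"
 have I0: "0 <= I"
 proof -
  have "0 <= (LI z. g z powr p)" by (rule int_nonneg) simp
  thus ?thesis using g(4) by linarith
 qed
 have P0: "?P >= 0" using I0 by (simp add: potc_def)
 have "(NL z. ennreal (mu z powr p * abs (c0 * f z) powr p)) <= ennreal ((B + Cs) powr p * ?P)"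
 proof (rule nn_integral_fatou_real[OF _ lim2])
  fix N
  have "(NL z. ennreal (mu z powr p * abs (a N z) powr p))
    <= (NL z. ennreal ((B + Cs) powr p) * ennreal (mu z powr p * pot g (Suc N) z powr p))"
  proof (rule nn_integral_mono)
   fix z
   have "abs (a N z) powr p <= ((B + Cs) * pot g (Suc N) z) powr p" using aN p0 by (intro powr_mono2) auto
   hence "mu z powr p * abs (a N z) powr p <= mu z powr p * ((B + Cs) * pot g (Suc N) z) powr p" by (intro mult_left_mono) auto
   also have "... = (B + Cs) powr p * (mu z powr p * pot g (Suc N) z powr p)" by (simp add: powr_mult)
   finally show "ennreal (mu z powr p * abs (a N z) powr p) <= ennreal ((B + Cs) powr p) * ennreal (mu z powr p * pot g (Suc N) z powr p)"
    by (subst ennreal_mult[symmetric]) (auto intro: ennreal_leI)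
  qed
  also have "... = ennreal ((B + Cs) powr p) * (NL z. ennreal (mu z powr p * pot g (Suc N) z powr p))"
   by (rule nn_integral_cmult) measurable
  also have "... <= ennreal ((B + Cs) powr p) * ennreal ?P"
   by (intro mult_left_mono weighted_pot pq m g g0) auto
  also have "... = ennreal ((B + Cs) powr p * ?P)" using P0 by (intro ennreal_mult[symmetric]) auto
  finally show "(NL z. ennreal (mu z powr p * abs (a N z) powr p)) <= ennreal ((B + Cs) powr p * ?P)" .
 qed measurable
 moreover have "(B + Cs) powr p * ?P >= 0" using P0 by simp
 ultimately have F: "intl (%z. mu z powr p * abs (c0 * f z) powr p)"
  "(LI z. mu z powr p * abs (c0 * f z) powr p) <= (B + Cs) powr p * ?P"
  using integrable_of_nn_bound[of "%z. mu z powr p * abs (c0 * f z) powr p"] by auto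
 show ?thesis
 proof (rule bdI_dominated[where g="%z. (1 / c0 powr p) * (mu z powr p * abs (c0 * f z) powr p)"])
  show "intl (%z. (1 / c0 powr p) * (mu z powr p * abs (c0 * f z) powr p))" using F(1) by simp
  have "(LI z. (1 / c0 powr p) * (mu z powr p * abs (c0 * f z) powr p)) = (1 / c0 powr p) * (LI z. mu z powr p * abs (c0 * f z) powr p)"
   by (rule integral_mult_right_zero)
  also have "... <= (1 / c0 powr p) * ((B + Cs) powr p * ?P)" using F(2) by (intro mult_left_mono) auto
  also have "... = ((B + Cs) / c0) powr p * potc TYPE('n) p q * (W powr (p/q) * I)"
   using BC rho(6) by (simp add: powr_divide)
  finally show "(LI z. (1 / c0 powr p) * (mu z powr p * abs (c0 * f z) powr p)) <= ((B + Cs) / c0) powr p * potc TYPE('n) p q * (W powr (p/q) * I)" .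
  show "AEL z. abs (mu z * f z) powr p <= (1 / c0 powr p) * (mu z powr p * abs (c0 * f z) powr p)"
   using rho(6) m(2) by (intro AE_I2) (simp add: abs_mult powr_mult)
 qed measurable
qed

section \<open>Increments of mollifications when the radius is halved\<close>

definition bsc :: "(real^'n)*real => real" where "bsc b = (if fst b = 0 then 4 else 2)"

lemma bsc_ge: "bsc b >= 1" by (simp add: bsc_def)

text \<open>The passage from scale one to scale one half is made one coordinate at a time;
  \<open>S\<close> collects the coordinates already contracted, each factor keeping its
  mass.\<close>

definition krn :: "((real^'n)*real) set => (real^'n)*real => real => real" where
 "krn S b y = (if b : S then bsc b * eta (bsc b * y) else eta y)"

lemma smooth_scaled: "smooth (f :: real => real) ==> smooth (%y. f (c * y))"
 using smooth_affine[OF bounded_linear_mult_right, of f 0 c] by simp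

lemma smooth_krn: "smooth (krn S b)"
 unfolding krn_def[abs_def] using smooth_mult[OF smooth_const smooth_scaled[OF smooth_eta]] smooth_eta by (cases "b : S") auto

lemma krn_support: "krn S b y ~= 0 ==> -1 <= y & y <= 1"
proof (rule ccontr)
 assume k: "krn S b y ~= 0" and "~ (-1 <= y & y <= 1)"
 hence y: "abs y >= 1" by auto
 have "1 * 1 <= bsc b * abs y" using y bsc_ge[of b] by (intro mult_mono) auto
 hence "abs (bsc b * y) >= 1" using bsc_ge[of b] by (simp add: abs_mult)
 thus False using k y eta_0 by (auto simp: krn_def split: if_splits)
qed

text \<open>Primitive of the difference between the contracted and the original factor. It has
  bounded support because both have the same mass, and this is what permits integration by
  parts.\<close>

definition krb :: "(real^'n)*real => real => real" where "krb b y = stp (bsc b * y) - stp y"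

lemma smooth_krb: "smooth (krb b)"
 unfolding krb_def[abs_def] by (intro smooth_diff smooth_scaled smooth_stp)

lemma krb_support: "krb b y ~= 0 ==> -1 <= y & y <= 1"
proof (rule ccontr)
 assume k: "krb b y ~= 0" and n: "~ (-1 <= y & y <= 1)"
 show False
 proof (cases "y > 1")
  case True
  hence "bsc b * y >= 1" using bsc_ge[of b] mult_mono[of 1 "bsc b" 1 y] by simp
  thus False using k True by (simp add: krb_def stp_1)
 next
  case False
  hence y: "- y >= 1" using n by auto
  hence "bsc b * (- y) >= 1" using bsc_ge[of b] mult_mono[of 1 "bsc b" 1 "- y"] by simp
  thus False using k y by (simp add: krb_def stp_0)
 qed
qed

lemma krb_DERIV: "(krb b has_real_derivative (bsc b * eta (bsc b * y) - eta y)) (at y)"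
proof -
 have "((%y. stp (bsc b * y)) has_real_derivative eta (bsc b * y) * bsc b) (at y)"
  by (rule DERIV_chain2[OF stp_DERIV]) (auto intro!: derivative_eq_intros)
 from DERIV_diff[OF this stp_DERIV] show ?thesis by (simp add: krb_def[abs_def] mult.commute)
qed

lemma ptest_split: "i : Basis ==> ptest h w = h i (w \<bullet> i) * (PROD b:Basis-{i}. h b (w \<bullet> b))"
 unfolding ptest_def by (simp add: prod.remove)

lemma ptest_upd_diff:
 assumes "i : Basis"
 shows "ptest (h(i := %y. u y - v y)) z = ptest (h(i := u)) z - ptest (h(i := v)) z"
proof -
 have e: "ptest (h(i := k)) z = k (z \<bullet> i) * (PROD b:Basis-{i}. h b (z \<bullet> b))" for k
  unfolding ptest_split[OF assms] by (auto intro!: prod.cong)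
 show ?thesis unfolding e by (simp add: left_diff_distrib)
qed

lemma tfun_unit:
 assumes "!!b. smooth (h b)" "!!b y. h b y ~= 0 ==> -1 <= y & y <= 1"
 shows "tfun (ptest h :: (real^'n)*real => real)" "ptest h (z :: (real^'n)*real) ~= 0 ==> z : ucb"
  "fder (ptest h) (at z) v ~= 0 ==> z : ucb"
proof -
 have nz: "(- One) \<bullet> b <= y & y <= One \<bullet> b" if "b : (Basis :: ((real^'n)*real) set)" "h b y ~= 0" for b y
  using assms(2)[OF that(2)] that(1) by simp
 show "tfun (ptest h :: (real^'n)*real => real)"
  by (rule tfun_ptest[where l="- One" and u=One]) (use assms(1) nz in auto)
 have sub: "{z. ptest h z ~= 0} <= (ucb :: ((real^'n)*real) set)"
  unfolding ucb_def by (rule ptest_support) (use nz in auto)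
 thus "ptest h z ~= 0 ==> z : ucb" by blast
 have "closure {z. ptest h z ~= 0} <= (ucb :: ((real^'n)*real) set)"
  using sub by (intro closure_minimal) (auto simp: ucb_def)
 hence "closure {z. fder (ptest h) (at z) v ~= 0} <= (ucb :: ((real^'n)*real) set)"
  using support_frechet by blast
 thus "fder (ptest h) (at z) v ~= 0 ==> z : ucb"
  using closure_subset[of "{z. fder (ptest h) (at z) v ~= 0}"] by blast
qed

lemma integral_ucb_bound:
 fixes X \<chi>' :: "(real^'n)*real => real"
 assumes g: "locint g" "!!z. abs (X z) <= g z" and c: "!!z. abs (\<chi>' z) <= B" "!!z. \<chi>' z ~= 0 ==> z : ucb"
 shows "abs (LI z. X z * \<chi>' z) <= B * (LI z. indicator ucb z * g z)"
proof -
 have i: "intl (%z. B * (indicator ucb z * g z))" using locintD(2)[OF g(1)] by (simp add: ucb_def)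
 have B0: "B >= 0" using c(1)[of 0] by linarith
 have g0: "g z >= 0" for z using g(2)[of z] by linarith
 have "abs (LI z. X z * \<chi>' z) <= (LI z. abs (X z * \<chi>' z))" by (rule integral_abs_bound)
 also have "... <= (LI z. B * (indicator ucb z * g z))"
 proof (rule integral_mono_AE'[OF i])
  show "AEL z. abs (X z * \<chi>' z) <= B * (indicator ucb z * g z)"
  proof (rule AE_I2)
   fix z
   have "abs (X z) * abs (\<chi>' z) <= g z * (B * indicator ucb z)"
    using g(2)[of z] g0[of z] c(1)[of z] c(2)[of z] B0 by (cases "\<chi>' z = 0") (auto intro!: mult_mono)
   thus "abs (X z * \<chi>' z) <= B * (indicator ucb z * g z)" by (simp add: abs_mult mult_ac)
  qed
  show "AEL z. 0 <= B * (indicator ucb z * g z)"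
   by (intro AE_I2 mult_nonneg_nonneg B0 g0) simp
 qed
 also have "... = B * (LI z. indicator ucb z * g z)" by (rule integral_mult_right_zero)
 finally show ?thesis .
qed

text \<open>Contracting coordinate \<open>i\<close> changes the kernel by an exact derivative in
  direction \<open>i\<close>. A space derivative is integrated by parts onto \<open>Dw\<close>,
  giving \<open>D2\<close>. In the time direction no derivative of \<open>Dw\<close> is available:
  the space derivative is moved from \<open>w\<close> to the kernel, the mixed derivatives are
  exchanged, and the time derivative falls on \<open>w\<close>.\<close>

lemma kernel_step:
 fixes S :: "((real^'n)*real) set"
 assumes i: "i : Basis" "i ~: S"
 shows "EX C>=0. ALL w wt Dw D2 p g. quad p w wt Dw D2 & locint g & (ALL z. abs (wt z) <= g z) & (ALL k l z. abs (D2 z $ k $ l) <= g z) -->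
  (abs ((LI z. Dw z $ k * ptest (krn (insert i S)) z) - (LI z. Dw z $ k * ptest (krn S) z)))
   <= C * (LI z. indicator ucb z * g z)"
proof -
 define h where "h = (krn S)(i := krb i)"
 have hs1: "smooth (h b)" for b
  using smooth_krn[of S b] smooth_krb[of b] by (cases "b = i") (simp_all add: h_def)
 have hs2: "-1 <= y & y <= 1" if "h b y ~= 0" for b y
  using that krn_support[of S b y] krb_support[of b y] by (cases "b = i") (simp_all add: h_def)
 note hs = hs1 hs2
 have T1: "tfun (ptest h)" by (rule tfun_unit(1)[OF hs1 hs2])
 have T2: "z : ucb" if "ptest h z ~= 0" for z by (rule tfun_unit(2)[OF hs1 hs2 that])
 have T3: "z : ucb" if "fder (ptest h) (at z) v ~= 0" for z v by (rule tfun_unit(3)[OF hs1 hs2 that])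
 let ?c = "ptest h" and ?ax = "(axis k 1, 0) :: (real^'n)*real"
 obtain B1 where B1: "!!z. abs (?c z) <= B1" "B1 >= 0" using tfun_bounded[OF T1] by blast
 obtain B2 where B2: "!!z. abs (fder ?c (at z) ?ax) <= B2" "B2 >= 0" using tfun_bounded[OF tfun_frechet[OF T1]] by blast
 have fr: "fder ?c (at z) i = ptest (krn (insert i S)) z - ptest (krn S) z" for z
 proof -
  have "fder ?c (at z) i = ptest (h(i := %y. bsc i * eta (bsc i * y) - eta y)) z"
   by (rule frechet_ptest[OF hs(1) i(1)]) (simp add: h_def krb_DERIV)
  also have "... = ptest (h(i := %y. bsc i * eta (bsc i * y))) z - ptest (h(i := eta)) z"
   by (rule ptest_upd_diff[OF i(1)])
  also have "h(i := %y. bsc i * eta (bsc i * y)) = krn (insert i S)" using i(2) by (auto simp: h_def krn_def fun_eq_iff)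
  also have "h(i := eta) = krn S" using i(2) by (auto simp: h_def krn_def fun_eq_iff)
  finally show ?thesis .
 qed
 show ?thesis
 proof (rule exI[of _ "B1 + B2"], intro conjI allI impI)
  show "0 <= B1 + B2" using B1 B2 by simp
  fix w wt Dw D2 p g
  assume A: "quad p w wt Dw (D2 :: (real^'n)*real => real^'n^'n) & locint g & (ALL z. abs (wt z) <= g z) & (ALL k l z. abs (D2 z $ k $ l) <= g z)"
  have g: "locint g" "!!z. abs (wt z) <= g z" "!!k l z. abs (D2 z $ k $ l) <= g z" using A by blast+
  have g0: "g z >= 0" for z using g(2)[of z] by linarith
  have J: "0 <= (LI z. indicator ucb z * g z)" using g0 by (intro int_nonneg) auto
  have lD: "locint (%z. Dw z $ k)" using A wderD(2) unfolding quad_def by blast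
  have kt: "tfun (ptest (krn R) :: (real^'n)*real => real)" for R by (rule tfun_unit(1)[OF smooth_krn krn_support])
  have "(LI z. Dw z $ k * ptest (krn (insert i S)) z) - (LI z. Dw z $ k * ptest (krn S) z)
    = (LI z. Dw z $ k * fder ?c (at z) i)"
   unfolding fr right_diff_distrib
   by (rule Bochner_Integration.integral_diff[symmetric]) (intro integrable_tfun lD kt)+
  moreover have "abs (LI z. Dw z $ k * fder ?c (at z) i) <= (B1 + B2) * (LI z. indicator ucb z * g z)"
   using i(1)
  proof (cases rule: Basis_fst_cases)
   case (1 l)
   have "wder (axis l 1, 0) (%z. Dw z $ k) (%z. D2 z $ k $ l)" using A unfolding quad_def by blast
   from wderD(3)[OF this T1] have "(LI z. Dw z $ k * fder ?c (at z) i) = - (LI z. D2 z $ k $ l * ?c z)"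
    using 1 by simp
   moreover have "abs (LI z. D2 z $ k $ l * ?c z) <= B1 * (LI z. indicator ucb z * g z)"
    by (rule integral_ucb_bound[OF g(1) g(3) B1(1) T2])
   moreover have "B1 * (LI z. indicator ucb z * g z) <= (B1 + B2) * (LI z. indicator ucb z * g z)"
    using J B2 by (intro mult_right_mono) auto
   ultimately show ?thesis by simp
  next
   case 2
   have wt: "wder (0, 1) w wt" and wk: "wder ?ax w (%z. Dw z $ k)" using A unfolding quad_def by blast+
   have "(LI z. Dw z $ k * fder ?c (at z) i)
     = - (LI z. w z * fder (%z. fder ?c (at z) i) (at z) ?ax)"
    using wderD(3)[OF wk tfun_frechet[OF T1, of i]] by simp
   also have "... = - (LI z. w z * fder (%z. fder ?c (at z) ?ax) (at z) (0, 1))"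
    using frechet_second_symmetric[OF tfun_smooth[OF T1], where v=i and w="?ax"] 2 by simp
   also have "... = (LI z. wt z * fder ?c (at z) ?ax)"
    using wderD(3)[OF wt tfun_frechet[OF T1, of ?ax]] by simp
   finally have e: "(LI z. Dw z $ k * fder ?c (at z) i) = (LI z. wt z * fder ?c (at z) ?ax)" .
   have "abs (LI z. wt z * fder ?c (at z) ?ax) <= B2 * (LI z. indicator ucb z * g z)"
    by (rule integral_ucb_bound[OF g(1) g(2) B2(1) T3])
   moreover have "B2 * (LI z. indicator ucb z * g z) <= (B1 + B2) * (LI z. indicator ucb z * g z)"
    using J B1 by (intro mult_right_mono) auto
   ultimately show ?thesis unfolding e by linarith
  qed
  ultimately show "abs ((LI z. Dw z $ k * ptest (krn (insert i S)) z) - (LI z. Dw z $ k * ptest (krn S) z))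
   <= (B1 + B2) * (LI z. indicator ucb z * g z)" by simp
 qed
qed

lemma kernel_steps:
 fixes S :: "((real^'n)*real) set"
 assumes "finite S" "S <= Basis"
 shows "EX C>=0. ALL w wt Dw D2 p g. quad p w wt Dw D2 & locint g & (ALL z. abs (wt z) <= g z) & (ALL k l z. abs (D2 z $ k $ l) <= g z) -->
  (abs ((LI z. Dw z $ k * ptest (krn S) z) - (LI z. Dw z $ k * ptest (krn {}) z)))
   <= C * (LI z. indicator ucb z * g z)"
 using assms
proof (induction S)
 case empty
 thus ?case by (intro exI[of _ 0]) simp
next
 case (insert i S)
 obtain C1 where C1: "C1 >= 0" "!!w wt Dw D2 p g. quad p w wt Dw D2 & locint g & (ALL z. abs (wt z) <= g z) & (ALL k l z. abs (D2 z $ k $ l) <= g z) -->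
  (abs ((LI z. Dw z $ k * ptest (krn S) z) - (LI z. Dw z $ k * ptest (krn {}) z)))
   <= C1 * (LI z. indicator ucb z * g z)"
  using insert by auto
 obtain C2 where C2: "C2 >= 0" "!!w wt Dw D2 p g. quad p w wt Dw D2 & locint g & (ALL z. abs (wt z) <= g z) & (ALL k l z. abs (D2 z $ k $ l) <= g z) -->
  (abs ((LI z. Dw z $ k * ptest (krn (insert i S)) z) - (LI z. Dw z $ k * ptest (krn S) z)))
   <= C2 * (LI z. indicator ucb z * g z)"
  using kernel_step[of i S k] insert by auto
 show ?case
 proof (rule exI[of _ "C1 + C2"], intro conjI allI impI)
  show "0 <= C1 + C2" using C1 C2 by simp
  fix w wt Dw D2 p g
  assume A: "quad p w wt Dw (D2 :: (real^'n)*real => real^'n^'n) & locint g & (ALL z. abs (wt z) <= g z) & (ALL k l z. abs (D2 z $ k $ l) <= g z)"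
  show "abs ((LI z. Dw z $ k * ptest (krn (insert i S)) z) - (LI z. Dw z $ k * ptest (krn {}) z))
   <= (C1 + C2) * (LI z. indicator ucb z * g z)"
   using C1(2)[THEN mp, OF A] C2(2)[THEN mp, OF A] unfolding distrib_right by linarith
 qed
qed

definition mol0 :: "(real^'n)*real => real" where "mol0 = ptest (krn {})"

lemma mol0_tfun: "tfun mol0" and mol0_supp: "mol0 z ~= 0 ==> z : ucb"
 unfolding mol0_def by (rule tfun_unit(1,2)[OF smooth_krn krn_support], assumption+)+

text \<open>Only positivity is used, as the potential estimate divides by this mass. The mean value
  theorem for \<open>stp\<close> gives a point where \<open>eta\<close> is positive, and a nonempty
  open set is not null.\<close>

lemma mol0_integral_pos: "(LI y. mol0 (y :: (real^'n)*real)) > 0"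
proof -
 have i: "intl (mol0 :: (real^'n)*real => real)"
  using integrable_tfun[OF locint_continuous[OF continuous_on_const[of UNIV 1]] mol0_tfun] by simp
 have n: "mol0 (y :: (real^'n)*real) >= 0" for y
  unfolding mol0_def ptest_def krn_def by (intro prod_nonneg) (simp add: eta_nonneg)
 have "EX xi. eta xi > 0"
 proof -
  obtain xi where "stp 1 - stp (-1) = (1 - (-1)) * eta xi" using MVT2[of "-1" 1 stp eta] stp_DERIV by auto
  hence "eta xi = 1/2" using stp_1[of 1] stp_0[of "-1"] by simp
  thus ?thesis by (intro exI[of _ xi]) simp
 qed
 then obtain xi where xi: "eta xi > 0" by blast
 have pos: "mol0 (xi *R One :: (real^'n)*real) > 0"
  unfolding mol0_def ptest_def krn_def by (intro prod_pos) (simp add: xi)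
 have "(LI y. mol0 (y :: (real^'n)*real)) ~= 0"
 proof
  assume "(LI y. mol0 (y :: (real^'n)*real)) = 0"
  hence ae: "AEL y. mol0 (y :: (real^'n)*real) = 0"
   using integral_nonneg_eq_0_iff_AE[OF i] n by auto
  let ?U = "{y. mol0 (y :: (real^'n)*real) ~= 0}"
  have "open ?U" using smooth_continuous[OF tfun_smooth[OF mol0_tfun]]
   by (intro open_Collect_neq continuous_on_const)
  moreover have "negligible ?U"
  proof -
   have "?U : null_sets lborel" using ae \<open>open ?U\<close> by (subst AE_iff_null_sets) auto
   thus ?thesis by (simp add: negligible_iff_null_sets null_sets_completionI)
  qed
  moreover have "xi *R One : ?U" using pos by simp
  hence "?U ~= {}" by blast
  ultimately show False using open_not_negligible by blast
 qed
 moreover have "(LI y. mol0 (y :: (real^'n)*real)) >= 0" using n by (intro int_nonneg) auto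
 ultimately show ?thesis by linarith
qed

text \<open>With all coordinates contracted the kernel is the parabolic rescaling of the original
  one, and the product of the factors \<open>bsc\<close> is the Jacobian.\<close>

lemma krn_Basis: "ptest (krn Basis) (y :: (real^'n)*real) = 2 ^ hdim TYPE('n) * mol0 (psc 2 0 y)"
proof -
 have e: "psc 2 0 y \<bullet> b = bsc b * (y \<bullet> b)" if "b : Basis" for b
  using that by (cases rule: Basis_fst_cases) (auto simp: inner_prod_def bsc_def)
 have "(PROD b:(Basis :: ((real^'n)*real) set). bsc b) = 2 ^ hdim TYPE('n)"
 proof -
  have B: "(Basis :: ((real^'n)*real) set) = (%u. (u, 0)) ` Basis \<union> {(0, 1)}" by (auto simp: Basis_prod_def)
  have nz: "u ~= 0" if "u : Basis" for u :: "real^'n" using that by auto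
  have "(PROD b:(Basis :: ((real^'n)*real) set). bsc b) = (PROD u:(Basis::(real^'n) set). 2) * (4::real)"
   unfolding B
   by (subst prod.union_disjoint) (use nz in \<open>auto simp: prod.reindex inj_on_def bsc_def intro!: prod.cong\<close>)
  thus ?thesis by (simp add: hdim_def power_add)
 qed
 moreover have "ptest (krn Basis) y = (PROD b:(Basis :: ((real^'n)*real) set). bsc b) * mol0 (psc 2 0 y)"
  unfolding ptest_def mol0_def krn_def by (simp add: prod.distrib e cong: prod.cong)
 ultimately show ?thesis by simp
qed

lemma moll_half:
 fixes f :: "(real^'n)*real => real"
 assumes f: "locint f" and r: "r > 0"
 shows "moll mol0 (r/2) f z = (LI y. f (psc r z y) * ptest (krn Basis) y)"
proof -
 have i: "intl (%y. f (psc (r/2) z y) * mol0 y)"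
  using r by (intro integrable_tfun locint_psc f mol0_tfun) auto
 have e: "psc (r/2) z (psc 2 0 y) = psc r z y" for y by (simp add: psc_def prod_eq_iff power_divide)
 have "moll mol0 (r/2) f z = 2 ^ hdim TYPE('n) * (LI y. f (psc r z y) * mol0 (psc 2 0 y))"
  unfolding moll_def using integral_psc[OF _ i, of 2 0] by (simp add: e)
 also have "... = (LI y. 2 ^ hdim TYPE('n) * (f (psc r z y) * mol0 (psc 2 0 y)))"
  by (rule integral_mult_right_zero[symmetric])
 finally show ?thesis unfolding krn_Basis by (simp add: mult.left_commute)
qed

text \<open>Rescaling by \<open>r\<close> about \<open>z\<close> reduces to the unit step: gradients
  gain a factor \<open>r\<close>, while \<open>wt\<close> and \<open>D2\<close> gain
  \<open>r^2\<close>. The increment therefore carries one factor \<open>r\<close>, as the potential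
  needs.\<close>

lemma moll_step:
 "EX C>=0. ALL (w :: (real^'n)*real => real) wt Dw D2 p g r z. quad p w wt Dw D2 & locint g & (ALL z. abs (wt z) <= g z) & (ALL k l z. abs (D2 z $ k $ l) <= g z) & 0 < r -->
  (abs (moll mol0 (r/2) (%z. Dw z $ k) z - moll mol0 r (%z. Dw z $ k) z)) <= C * (r * avg r g z)"
proof -
 obtain C where C: "C >= 0" "!!w wt Dw D2 p g. quad p w wt Dw D2 & locint g & (ALL z. abs (wt z) <= g z) & (ALL k l z. abs (D2 z $ k $ l) <= g z) -->
  (abs ((LI z. Dw z $ k * ptest (krn Basis) z) - (LI z. Dw z $ k * ptest (krn {}) z)))
   <= C * (LI z. indicator ucb z * g z)"
  using kernel_steps[of "Basis :: ((real^'n)*real) set" k] by auto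
 show ?thesis
 proof (rule exI[of _ C], intro conjI allI impI C(1))
  fix w wt Dw D2 p g r and z :: "(real^'n)*real"
  assume A: "quad p w wt Dw (D2 :: (real^'n)*real => real^'n^'n) & locint g & (ALL z. abs (wt z) <= g z) & (ALL k l z. abs (D2 z $ k $ l) <= g z) & 0 < (r::real)"
  have r: "r > 0" using A by blast
  have lD: "locint (%z. Dw z $ k)" using A wderD(2) unfolding quad_def by blast
  let ?h = "%y. r\<^sup>2 * g (psc r z y)"
  have q: "quad p (%y. w (psc r z y)) (%y. r\<^sup>2 * wt (psc r z y)) (%y. r *R Dw (psc r z y)) (%y. r\<^sup>2 *R D2 (psc r z y))"
   using A by (intro quad_psc) auto
  have H: "locint ?h & (ALL y. abs (r^2 * wt (psc r z y)) <= ?h y) & (ALL k l y. abs ((r^2 *R D2 (psc r z y)) $ k $ l) <= ?h y)"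
   using A by (auto intro!: locint_cmult locint_psc mult_left_mono simp: abs_mult simp del: split_paired_All)
  have "abs ((LI y. (r *R Dw (psc r z y)) $ k * ptest (krn Basis) y) - (LI y. (r *R Dw (psc r z y)) $ k * ptest (krn {}) y))
   <= C * (LI y. indicator ucb y * ?h y)"
   using C(2)[of p "%y. w (psc r z y)" "%y. r\<^sup>2 * wt (psc r z y)" "%y. r *R Dw (psc r z y)" "%y. r\<^sup>2 *R D2 (psc r z y)" ?h] q H by blast
  also have "(LI y. indicator ucb y * ?h y) = r^2 * avg r g z"
   unfolding avg_def mult.left_commute[of _ "r^2"] by (rule integral_mult_right_zero)
  also have "(LI y. (r *R Dw (psc r z y)) $ k * ptest (krn Basis) y) = r * moll mol0 (r/2) (%z. Dw z $ k) z"
   unfolding moll_half[OF lD r] by (simp add: mult.assoc)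
  also have "(LI y. (r *R Dw (psc r z y)) $ k * ptest (krn {}) y) = r * moll mol0 r (%z. Dw z $ k) z"
   unfolding moll_def mol0_def by (simp add: mult.assoc)
  finally have "r * abs (moll mol0 (r/2) (%z. Dw z $ k) z - moll mol0 r (%z. Dw z $ k) z) <= r * (C * (r * avg r g z))"
   using r by (simp add: abs_mult right_diff_distrib[symmetric] power2_eq_square mult_ac)
  thus "abs (moll mol0 (r/2) (%z. Dw z $ k) z - moll mol0 r (%z. Dw z $ k) z) <= C * (r * avg r g z)"
   using r by (simp only: mult_le_cancel_left_pos)
 qed
qed

lemma sum_powr_le:
 fixes f :: "'i => real"
 assumes S: "finite S" and p: "p >= 0"
 shows "(SUM i:S. abs (f i)) powr p <= real (card S) powr p * (SUM i:S. abs (f i) powr p)"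
proof (cases "S = {}")
 case False
 have "Max ((%i. abs (f i)) ` S) : (%i. abs (f i)) ` S" using S False by (intro Max_in) auto
 then obtain j where j: "j : S" "Max ((%i. abs (f i)) ` S) = abs (f j)" by auto
 have "(SUM i:S. abs (f i)) <= real (card S) * abs (f j)"
  by (rule sum_bounded_above) (use S j(2)[symmetric] in auto)
 hence "(SUM i:S. abs (f i)) powr p <= (real (card S) * abs (f j)) powr p" using p by (intro powr_mono2 sum_nonneg) auto
 also have "... = real (card S) powr p * abs (f j) powr p" by (rule powr_mult)
 also have "abs (f j) powr p <= (SUM i:S. abs (f i) powr p)" using S j(1) by (intro member_le_sum) auto
 finally show ?thesis by (simp add: mult_left_mono)
qed simp

lemma bd_sum_abs:
 fixes f :: "'i => 'a::euclidean_space => real"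
 assumes S: "finite S" and p: "p >= 0" and f: "!!i. i : S ==> bd p M (f i)"
 shows "bd p (real (card S) powr p * (real (card S) * M)) (%z. SUM i:S. abs (f i z))"
proof (rule bdI_dominated[where g="%z. real (card S) powr p * (SUM i:S. abs (f i z) powr p)"])
 have i: "intl (%z. SUM i:S. abs (f i z) powr p)" using f bdD(2) by (intro Bochner_Integration.integrable_sum) blast
 thus "intl (%z. real (card S) powr p * (SUM i:S. abs (f i z) powr p))" by simp
 have "(LI z. (SUM i:S. abs (f i z) powr p)) = (SUM i:S. LI z. abs (f i z) powr p)"
  using f bdD(2) by (intro Bochner_Integration.integral_sum) blast
 also have "... <= real (card S) * M" using f bdD(3) by (intro sum_bounded_above) blast
 finally show "(LI z. real (card S) powr p * (SUM i:S. abs (f i z) powr p)) <= real (card S) powr p * (real (card S) * M)"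
  by (subst integral_mult_right_zero) (auto intro: mult_left_mono)
 show "(%z. SUM i:S. abs (f i z)) : Bor" using f bdD(1) by (intro borel_measurable_sum borel_measurable_abs) blast
 show "AEL z. \<bar>SUM i:S. abs (f i z)\<bar> powr p <= real (card S) powr p * (SUM i:S. abs (f i z) powr p)"
  using sum_powr_le[OF S p] by (intro AE_I2) (simp add: sum_nonneg)
qed

definition wfun :: "real => real => ('a::euclidean_space => real) => bool" where
 "wfun q W mu \<longleftrightarrow> mu : Bor & (ALL z. 0 <= mu z) & intl (%z. mu z powr q) & (LI z. mu z powr q) <= W"

lemma wfunD:
 assumes "wfun q W mu"
 shows "mu : Bor" "!!z. 0 <= mu z" "intl (%z. mu z powr q)" "(LI z. mu z powr q) <= W"
 using assms unfolding wfun_def by blast+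

text \<open>The dominating function is the sum of the absolute values of all derivatives. What
  matters is the factor \<open>W powr (p/q)\<close>: a small drift makes the passage from a source
  to \<open>mu * norm (Dw)\<close> a contraction.\<close>

lemma gradient_estimate:
 assumes pq: "1 <= p" "p <= q" "real (hdim TYPE('n::finite)) < q"
 shows "EX C>0. ALL (w :: (real^'n)*real => real) wt Dw D2 M mu W. quad p w wt Dw D2 --> bd p M wt -->
  (ALL k. bd p M (%z. Dw z $ k)) --> (ALL k l. bd p M (%z. D2 z $ k $ l)) --> wfun q W mu -->
  bd p (C * (W powr (p/q) * M)) (%z. mu z * norm (Dw z))"
proof -
 let ?n = "real CARD('n)"
 have p0: "p >= 0" "p > 0" using pq by auto
 obtain B where B: "!!y. abs (mol0 (y :: (real^'n)*real)) <= B" "B >= 0" using tfun_bounded[OF mol0_tfun] by blast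
 define c0 where "c0 = (LI y. mol0 (y :: (real^'n)*real))"
 have c0: "c0 > 0" unfolding c0_def by (rule mol0_integral_pos)
 have "ALL k. EX C>=0. ALL (w :: (real^'n)*real => real) wt Dw D2 p g r z. quad p w wt Dw D2 & locint g & (ALL z. abs (wt z) <= g z) & (ALL k l z. abs (D2 z $ k $ l) <= g z) & 0 < r -->
  (abs (moll mol0 (r/2) (%z. Dw z $ k) z - moll mol0 r (%z. Dw z $ k) z)) <= C * (r * avg r g z)"
  using moll_step by blast
 from choice[OF this] obtain cs where cs: "ALL k. 0 <= cs k & (ALL (w :: (real^'n)*real => real) wt Dw D2 p g r z. quad p w wt Dw D2 & locint g & (ALL z. abs (wt z) <= g z) & (ALL k l z. abs (D2 z $ k $ l) <= g z) & 0 < r -->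
  (abs (moll mol0 (r/2) (%z. Dw z $ k) z - moll mol0 r (%z. Dw z $ k) z)) <= cs k * (r * avg r g z))"
  by (rule exE)
 have cs1: "cs k >= 0" for k using cs by blast
 define Cs where "Cs = (SUM k:UNIV. cs k)"
 have Cs: "cs k <= Cs" "Cs >= 0" for k using cs1 by (auto simp: Cs_def intro!: member_le_sum sum_nonneg)
 define c1 where "c1 = 2 powr p * (2 powr p * (1 + ?n powr p * ?n) + real (CARD('n) * CARD('n)) powr p * real (CARD('n) * CARD('n)))"
 define C3 where "C3 = ((B + Cs) / c0) powr p * potc TYPE('n) p q"
 define C where "C = ?n powr p * (?n * (C3 * c1)) + 1"
 have c1: "c1 >= 0" unfolding c1_def by (intro mult_nonneg_nonneg add_nonneg_nonneg) auto
 have C3: "C3 >= 0" by (simp add: C3_def potc_def)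
 show ?thesis
 proof (rule exI[of _ C], intro conjI allI impI)
  have "0 <= ?n powr p * (?n * (C3 * c1))" using c1 C3 by (intro mult_nonneg_nonneg) auto
  thus "C > 0" unfolding C_def by linarith
  fix w :: "(real^'n)*real => real" and wt Dw D2 M and mu :: "(real^'n)*real => real" and W
  assume q: "quad p w wt Dw D2" and bt: "bd p M wt" and bx: "ALL k. bd p M (%z. Dw z $ k)"
   and bxx: "ALL k l. bd p M (%z. D2 z $ k $ l)" and m: "wfun q W mu"
  note m' = wfunD[OF m]
  have M0: "M >= 0"
  proof -
   have "0 <= (LI z. abs (wt z) powr p)" by (rule int_nonneg) simp
   thus ?thesis using bdD(3)[OF bt] by linarith
  qed
  define g where "g z = (1 * abs (wt z) + (SUM k:UNIV. abs (Dw z $ k))) + (SUM kl:UNIV. abs (D2 z $ fst kl $ snd kl))" for z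
  have bw: "bd p M (%z. abs (wt z))" using bt by (auto simp: bd_def)
  have bg: "bd p (c1 * M) g"
  proof -
   have 1: "bd p (?n powr p * (?n * M)) (%z. SUM k:UNIV. abs (Dw z $ k))"
    using bd_sum_abs[of UNIV p M "%k z. Dw z $ k"] bx p0 by simp
   have 2: "bd p (real (CARD('n) * CARD('n)) powr p * (real (CARD('n) * CARD('n)) * M)) (%z. SUM kl:UNIV. abs (D2 z $ fst kl $ snd kl))"
    using bd_sum_abs[of "UNIV :: ('n \<times> 'n) set" p M "%kl z. D2 z $ fst kl $ snd kl"] bxx p0 by simp
   have "bd p (2 powr p * (2 powr p * (M + ?n powr p * (?n * M)) + real (CARD('n) * CARD('n)) powr p * (real (CARD('n) * CARD('n)) * M))) g"
    unfolding g_def[abs_def] using bd_add[OF bd_add[OF bw 1 p0(1)] 2 p0(1)] by simp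
   moreover have "2 powr p * (2 powr p * (M + ?n powr p * (?n * M)) + real (CARD('n) * CARD('n)) powr p * (real (CARD('n) * CARD('n)) * M)) = c1 * M"
    by (simp add: c1_def algebra_simps)
   ultimately show ?thesis by simp
  qed
  have gk: "abs (Dw y $ k) <= g y" and gkl: "abs (D2 y $ k $ l) <= g y" and gt: "abs (wt y) <= g y" for y k l
  proof -
   have a: "0 <= (SUM k:UNIV. abs (Dw y $ k))" "0 <= (SUM kl:UNIV. abs (D2 y $ fst kl $ snd kl))"
    by (rule sum_nonneg, simp)+
   have b: "abs (Dw y $ k) <= (SUM k:UNIV. abs (Dw y $ k))" by (intro member_le_sum) auto
   have c: "abs (D2 y $ fst (k, l) $ snd (k, l)) <= (SUM kl:UNIV. abs (D2 y $ fst kl $ snd kl))"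
    by (rule member_le_sum[where f="%kl. abs (D2 y $ fst kl $ snd kl)"]) auto
   show "abs (Dw y $ k) <= g y" "abs (D2 y $ k $ l) <= g y" "abs (wt y) <= g y"
    using a b c[unfolded fst_conv snd_conv] abs_ge_zero[of "wt y"] unfolding g_def by linarith+
  qed
  have g0: "g z >= 0" for z using gt[of z] by linarith
  have gp: "g : Bor" "intl (%z. g z powr p)" "(LI z. g z powr p) <= c1 * M"
   using bdD[OF bg] g0 by (simp_all add: abs_of_nonneg)
  have gl: "locint g" by (rule Lloc_locint[OF bd_Lloc[OF bg] pq(1)])
  have each: "bd p (C3 * (W powr (p/q) * (c1 * M))) (%z. mu z * Dw z $ k)" for k
  proof -
   have "locint (%z. Dw z $ k)" using q wderD(2) unfolding quad_def by blast
   moreover have "abs (moll mol0 (rad (Suc j)) (%z. Dw z $ k) z - moll mol0 (rad j) (%z. Dw z $ k) z) <= Cs * (rad j * avg (rad j) g z)" for j z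
   proof -
    have "abs (moll mol0 (rad j / 2) (%z. Dw z $ k) z - moll mol0 (rad j) (%z. Dw z $ k) z) <= cs k * (rad j * avg (rad j) g z)"
     by (rule cs[THEN spec, THEN conjunct2, rule_format, of p w wt Dw D2]) (intro conjI allI q gl gt gkl rad_pos)
    also have "... <= Cs * (rad j * avg (rad j) g z)"
     by (intro mult_right_mono Cs mult_nonneg_nonneg less_imp_le[OF rad_pos] avg_nonneg g0)
    finally show ?thesis by (simp add: rad_Suc)
   qed
   ultimately show ?thesis unfolding C3_def
    by (intro potential_estimate[OF pq _ mol0_tfun mol0_supp B c0_def[symmetric] c0 gp(1) gk gp(2,3) _ Cs(2) m'])
  qed
  have "bd p (?n powr p * (?n * (C3 * (W powr (p/q) * (c1 * M))))) (%z. SUM k:UNIV. abs (mu z * Dw z $ k))"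
   using bd_sum_abs[of UNIV p "C3 * (W powr (p/q) * (c1 * M))" "%k z. mu z * Dw z $ k"] each p0 by simp
  hence b2: "bd p (C * (W powr (p/q) * M)) (%z. SUM k:UNIV. abs (mu z * Dw z $ k))"
  proof (rule bd_mono)
   have "0 <= W powr (p/q) * M" using M0 by simp
   thus "?n powr p * (?n * (C3 * (W powr (p/q) * (c1 * M)))) <= C * (W powr (p/q) * M)"
    unfolding C_def by (simp add: algebra_simps)
  qed
  show "bd p (C * (W powr (p/q) * M)) (%z. mu z * norm (Dw z))"
  proof (rule bdI_dominated[OF bdD(2,3)[OF b2]])
   have "(%z. Dw z $ k) : Bor" for k using bx bdD(1) by blast
   hence "Dw : Bor" by (subst borel_measurable_euclidean_space) (auto simp: Basis_vec_def inner_axis)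
   thus "(%z. mu z * norm (Dw z)) : Bor" using m'(1) by measurable
   show "AEL z. abs (mu z * norm (Dw z)) powr p <= \<bar>SUM k:UNIV. abs (mu z * Dw z $ k)\<bar> powr p"
   proof (rule AE_I2)
    fix z
    have "mu z * norm (Dw z) <= mu z * (SUM k:UNIV. abs (Dw z $ k))" using m'(2) by (intro mult_left_mono norm_le_l1_cart) auto
    also have "... = (SUM k:UNIV. abs (mu z * Dw z $ k))" using m'(2)[of z] by (simp add: sum_distrib_left abs_mult)
    finally show "abs (mu z * norm (Dw z)) powr p <= \<bar>SUM k:UNIV. abs (mu z * Dw z $ k)\<bar> powr p"
     using m'(2)[of z] p0 by (intro powr_mono2) auto
   qed
  qed
 qed
qed

section \<open>Series of functions with weak derivatives\<close>

lemma series_moments: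
 fixes F :: "nat => 'a::euclidean_space => real"
 assumes p: "1 <= p" and F: "!!k. F k : Bor"
  and B: "!!a b. EX K>=0. ALL k. bd p (K * (1/4) powr (p * real k)) (%z. indicator (cbox a b) z * F k z)"
 shows "AEL z. summable (%k. abs (F k z))" "Lloc p (%z. \<Sum>k. abs (F k z))"
proof -
 have p0: "p > 0" using p by simp
 note [measurable] = F
 have "EX K>=0. ALL N. (NL z. ennreal (indicator (cbox a b) z * (SUM j<N. abs (F j z)) powr p)) <= ennreal K" for a b
 proof -
  obtain K where K: "K >= 0" "!!k. bd p (K * (1/4) powr (p * real k)) (%z. indicator (cbox a b) z * F k z)" using B by blast
  \<comment> \<open>The p-th moments decay like \<open>alpha k\<close> to the power
    \<open>2 * p\<close>. The power mean with weights \<open>alpha k\<close> spends half of this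
    decay and still leaves a convergent sum.\<close>
  define alpha where "alpha k = (1/2::real) ^ k" for k :: nat
  have alpha0: "alpha k >= 0" "alpha k > 0" for k by (auto simp: alpha_def)
  have sA: "(SUM k<N. alpha k) <= 2" for N
  proof -
   have "(SUM k<N. (1/2::real) ^ k) <= (\<Sum>k. (1/2) ^ k)" by (intro sum_le_suminf summable_geometric) auto
   thus ?thesis by (simp add: alpha_def suminf_geometric)
  qed
  have pk: "(1/4) powr (p * real k) = (alpha k * alpha k) powr p" for k
  proof -
   have "(1/4::real) powr (p * real k) = ((1/4) powr real k) powr p" by (simp add: powr_powr mult.commute)
   also have "(1/4::real) powr real k = (1/4) ^ k" by (rule powr_realpow) simp
   finally show ?thesis by (simp add: alpha_def power_mult_distrib[symmetric])
  qed
  have "(NL z. ennreal (indicator (cbox a b) z * (SUM j<N. abs (F j z)) powr p)) <= ennreal (2 powr (p - 1) * (2 * K))" for N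
  proof -
   let ?G = "%z. 2 powr (p - 1) * (SUM k<N. alpha k * ((1 / alpha k) powr p * abs (indicator (cbox a b) z * F k z) powr p))"
   have iG: "intl (%z. alpha k * ((1 / alpha k) powr p * abs (indicator (cbox a b) z * F k z) powr p))" for k
    using bdD(2)[OF K(2)[of k]] by simp
   have pt: "indicator (cbox a b) z * (SUM j<N. abs (F j z)) powr p <= ?G z" for z
   proof (cases "z : cbox a b")
    case True
    have "(SUM j<N. abs (F j z)) powr p = (SUM j<N. alpha j * (abs (F j z) / alpha j)) powr p"
     using alpha0(2) by (simp add: less_imp_neq[symmetric])
    also have "... <= (SUM j<N. alpha j) powr (p - 1) * (SUM j<N. alpha j * (abs (F j z) / alpha j) powr p)"
     by (rule power_mean_sum[OF p]) (use alpha0 in auto)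
    also have "... <= 2 powr (p - 1) * (SUM j<N. alpha j * (abs (F j z) / alpha j) powr p)"
     by (intro mult_right_mono powr_mono2 sA sum_nonneg mult_nonneg_nonneg powr_ge_zero alpha0) (use p in simp)
    also have "(SUM j<N. alpha j * (abs (F j z) / alpha j) powr p) = (SUM k<N. alpha k * ((1 / alpha k) powr p * abs (F k z) powr p))"
     by (simp add: powr_mult[symmetric])
    finally show ?thesis using True by simp
   qed (auto intro!: sum_nonneg mult_nonneg_nonneg alpha0)
   have "(NL z. ennreal (indicator (cbox a b) z * (SUM j<N. abs (F j z)) powr p)) <= (NL z. ennreal (?G z))"
    using pt by (intro nn_integral_mono ennreal_leI)
   also have "... = ennreal (LI z. ?G z)"
    by (intro nn_integral_eq_integral) (use iG in \<open>auto intro!: sum_nonneg mult_nonneg_nonneg alpha0 AE_I2\<close>)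
   also have "(LI z. ?G z) = 2 powr (p - 1) * (SUM k<N. alpha k * ((1 / alpha k) powr p * (LI z. abs (indicator (cbox a b) z * F k z) powr p)))"
    using iG by (subst integral_mult_right_zero, subst Bochner_Integration.integral_sum) auto
   also have "... <= 2 powr (p - 1) * (SUM k<N. alpha k * K)"
   proof (intro mult_left_mono sum_mono alpha0)
    fix k
    have "(1 / alpha k) powr p * (LI z. abs (indicator (cbox a b) z * F k z) powr p) <= (1 / alpha k) powr p * (K * (alpha k * alpha k) powr p)"
     using bdD(3)[OF K(2)[of k]] unfolding pk by (intro mult_left_mono) auto
    also have "... = K * alpha k powr p" using alpha0(2)[of k] by (simp add: powr_divide powr_mult)
    also have "... <= K * 1" using K(1) alpha0(2)[of k] p0 by (intro mult_left_mono powr_le1) (auto simp: alpha_def power_le_one)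
    finally show "(1 / alpha k) powr p * (LI z. abs (indicator (cbox a b) z * F k z) powr p) <= K" by simp
   qed auto
   also have "... <= 2 powr (p - 1) * (2 * K)"
    using sA K(1) by (intro mult_left_mono) (auto simp: sum_distrib_right[symmetric] mult_right_mono)
   finally show ?thesis by (simp add: ennreal_leI)
  qed
  thus ?thesis using K(1) by (intro exI[of _ "2 powr (p - 1) * (2 * K)"]) auto
 qed
 note MS = moment_summable[OF p _ _ this]
 show "AEL z. summable (%k. abs (F k z))" by (rule MS(1)) auto
 show "Lloc p (%z. \<Sum>k. abs (F k z))" by (rule MS(2)) auto
qed

lemma series_limit:
 fixes F :: "nat => 'a::euclidean_space => real"
 assumes p: "1 <= p" and F: "!!k. F k : Bor"
  and s: "AEL z. summable (%k. abs (F k z))" and L: "Lloc p (%z. \<Sum>k. abs (F k z))"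
 shows "Lloc p (%z. \<Sum>k. F k z)"
  and "tfun psi ==> (%n. LI z. (SUM k<n. F k z) * psi z) ----> (LI z. (\<Sum>k. F k z) * psi z)"
proof -
 note [measurable] = F
 let ?S = "%z. \<Sum>k. abs (F k z)"
 have Sm[measurable]: "(%z. \<Sum>k. F k z) : Bor" by measurable
 have le: "AEL z. abs (\<Sum>k. F k z) <= ?S z & (ALL n. abs (SUM k<n. F k z) <= ?S z) & (%n. SUM k<n. F k z) ----> (\<Sum>k. F k z)"
  using s
 proof eventually_elim
  fix z assume s: "summable (%k. abs (F k z))"
  have "abs (SUM k<n. F k z) <= ?S z" for n
   by (rule order_trans[OF sum_abs]) (intro sum_le_suminf s, auto)
  thus "abs (\<Sum>k. F k z) <= ?S z & (ALL n. abs (SUM k<n. F k z) <= ?S z) & (%n. SUM k<n. F k z) ----> (\<Sum>k. F k z)"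
   using summable_rabs[OF s] summable_LIMSEQ[OF summable_rabs_cancel[OF s]] by blast
 qed
 show "Lloc p (%z. \<Sum>k. F k z)"
  unfolding Lloc_def
 proof (intro conjI allI Sm)
  fix a b :: 'a
  show "intl (%z. indicator (cbox a b) z * abs (\<Sum>k. F k z) powr p)"
  proof (rule Bochner_Integration.integrable_bound[OF LlocD(2)[OF L]])
   show "AEL z. norm (indicator (cbox a b) z * abs (\<Sum>k. F k z) powr p) <= norm (indicator (cbox a b) z * abs (?S z) powr p)"
    using le
   proof eventually_elim
    fix z assume "abs (\<Sum>k. F k z) <= ?S z & (ALL n. abs (SUM k<n. F k z) <= ?S z) & (%n. SUM k<n. F k z) ----> (\<Sum>k. F k z)"
    hence "abs (\<Sum>k. F k z) <= abs (?S z)" by linarith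
    hence "abs (\<Sum>k. F k z) powr p <= abs (?S z) powr p" using p by (intro powr_mono2) auto
    thus "norm (indicator (cbox a b) z * abs (\<Sum>k. F k z) powr p) <= norm (indicator (cbox a b) z * abs (?S z) powr p)"
     by (auto split: split_indicator)
   qed
  qed measurable
 qed
 assume psi: "tfun psi"
 note [measurable] = smooth_borel[OF tfun_smooth[OF psi]]
 show "(%n. LI z. (SUM k<n. F k z) * psi z) ----> (LI z. (\<Sum>k. F k z) * psi z)"
 proof (rule integral_dominated_convergence[where w="%z. abs (?S z * psi z)"])
  show "intl (%z. abs (?S z * psi z))" using integrable_tfun[OF Lloc_locint[OF L p] psi] by (rule integrable_abs)
  show "AEL z. (%n. (SUM k<n. F k z) * psi z) ----> (\<Sum>k. F k z) * psi z"
   using le by eventually_elim (auto intro: tendsto_mult_right)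
  show "AEL z. norm ((SUM k<n. F k z) * psi z) <= abs (?S z * psi z)" for n
   using le
  proof eventually_elim
   fix z assume "abs (\<Sum>k. F k z) <= ?S z & (ALL n. abs (SUM k<n. F k z) <= ?S z) & (%n. SUM k<n. F k z) ----> (\<Sum>k. F k z)"
   hence "abs (SUM k<n. F k z) <= abs (?S z)" by (meson abs_ge_self order_trans)
   thus "norm ((SUM k<n. F k z) * psi z) <= abs (?S z * psi z)" by (simp add: abs_mult mult_right_mono)
  qed
 qed measurable
qed

text \<open>The weak identity is linear, so it holds for partial sums; dominated convergence,
  supplied by \<open>series_limit\<close>, passes to the limit on both sides.\<close>

lemma wder_suminf:
 fixes f g :: "nat => 'a::euclidean_space => real"
 assumes p: "1 <= p" and w: "!!k. wder v (f k) (g k)"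
  and f: "AEL z. summable (%k. abs (f k z))" "Lloc p (%z. \<Sum>k. abs (f k z))"
  and g: "AEL z. summable (%k. abs (g k z))" "Lloc p (%z. \<Sum>k. abs (g k z))"
 shows "wder v (%z. \<Sum>k. f k z) (%z. \<Sum>k. g k z)"
 unfolding wder_def
proof (intro conjI allI impI)
 have fm: "f k : Bor" "g k : Bor" for k
  using wderD(1,2)[OF w] locintD(1) by blast+
 note sf = series_limit[OF p fm(1) f] and sg = series_limit[OF p fm(2) g]
 show "locint (%z. \<Sum>k. f k z)" "locint (%z. \<Sum>k. g k z)" using Lloc_locint[OF sf(1) p] Lloc_locint[OF sg(1) p] .
 fix psi :: "'a => real" assume psi: "tfun psi"
 have "(LI z. (SUM k<n. f k z) * fder psi (at z) v) = - (LI z. (SUM k<n. g k z) * psi z)" for n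
 proof -
  have "(LI z. (SUM k<n. f k z) * fder psi (at z) v) = (SUM k<n. LI z. f k z * fder psi (at z) v)"
   unfolding sum_distrib_right
   by (intro Bochner_Integration.integral_sum integrable_tfun wderD(1)[OF w] tfun_frechet psi)
  also have "... = - (SUM k<n. LI z. g k z * psi z)" using wderD(3)[OF w psi] by (simp add: sum_negf)
  also have "(SUM k<n. LI z. g k z * psi z) = (LI z. (SUM k<n. g k z) * psi z)"
   unfolding sum_distrib_right
   by (intro Bochner_Integration.integral_sum[symmetric] integrable_tfun wderD(2)[OF w] psi)
  finally show ?thesis .
 qed
 with sf(2)[OF tfun_frechet[OF psi, of v]]
 have "(%n. - (LI z. (SUM k<n. g k z) * psi z)) ----> (LI z. (\<Sum>k. f k z) * fder psi (at z) v)" by simp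
 thus "(LI z. (\<Sum>k. f k z) * fder psi (at z) v) = - (LI z. (\<Sum>k. g k z) * psi z)"
  using tendsto_minus[OF sg(2)[OF psi]] LIMSEQ_unique by blast
qed

section \<open>The extremal equation with drift\<close>

text \<open>The next source is \<open>mu * norm (Dw k)\<close> on \<open>reg\<close>, where
  \<open>w k\<close> solves the extremal equation for the current one. Adding the equations
  telescopes the sources, and the sublinearity of the extremal operator and of the norm turns the
  sum into the required inequality.\<close>

lemma solver_drift:
 fixes p q lam Lam :: real
 assumes abp: "ABP_solvable TYPE('n::finite) lam Lam p" and pq: "1 <= p" "p <= q" "real (hdim TYPE('n)) < q"
  and lam: "0 < lam" "lam <= Lam"
 shows "EX C>0. EX delta>0. ALL mu h. wfun q delta mu --> source p h -->
  (EX w wt Dw D2w. quad p (w :: (real^'n)*real => real) wt Dw D2w &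
   (ALL z. - C * (LI z. abs (h z) powr p) powr (1/p) <= w z & w z <= 0) &
   (AEL z. z : reg --> wt z + pucci_plus lam Lam (D2w z) + mu z * norm (Dw z) <= - h z))"
proof -
 define I where "I h = (LI z. abs (h z) powr p)" for h :: "(real^'n)*real => real"
 have I0: "I h >= 0" for h unfolding I_def by (rule int_nonneg) simp
 have p0: "p > 0" "p >= 0" using pq by auto
 obtain Cs where Cs: "Cs > 0" and sv: "!!h. source p h ==>
  EX w wt Dw D2w. ext_sol p lam Lam Cs (h :: (real^'n)*real => real) w wt Dw D2w"
  using solver[OF abp pq(1)] by blast
 obtain Cg where Cg: "Cg > 0" and gr: "!!(w :: (real^'n)*real => real) wt Dw D2 M mu W. quad p w wt Dw D2 ==> bd p M wt ==>
  (ALL k. bd p M (%z. Dw z $ k)) ==> (ALL k l. bd p M (%z. D2 z $ k $ l)) ==> wfun q W mu ==>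
  bd p (Cg * (W powr (p/q) * M)) (%z. mu z * norm (Dw z))"
  using gradient_estimate[OF pq] by blast
 \<comment> \<open>Chosen so that passing from one source to the next multiplies the p-th power of
   its norm by at most \<open>(1/4) powr p\<close>.\<close>
 define delta where "delta = ((1/4) powr p / (Cg * Cs)) powr (q/p)"
 have delta: "delta > 0" using Cg Cs by (simp add: delta_def)
 have deltap: "Cg * (delta powr (p/q) * (Cs * x)) = (1/4) powr p * x" for x
 proof -
  have "delta powr (p/q) = (1/4) powr p / (Cg * Cs)" using pq Cg Cs by (simp add: delta_def powr_powr)
  thus ?thesis using Cg Cs by simp
 qed
 have main: "EX w wt Dw D2w. quad p (w :: (real^'n)*real => real) wt Dw D2w &
   (ALL z. - (2 * Cs) * I h0 powr (1/p) <= w z & w z <= 0) &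
   (AEL z. z : reg --> wt z + pucci_plus lam Lam (D2w z) + mu z * norm (Dw z) <= - h0 z)"
  if mu: "wfun q delta mu" and h0: "source p h0" for mu h0
 proof -
  define S where "S h T \<longleftrightarrow> (case T of (w, wt, Dw, D2w) => ext_sol p lam Lam Cs (h :: (real^'n)*real => real) w wt Dw D2w)" for h T
  have "ALL h. EX T. source p h --> S h T" using sv unfolding S_def split_paired_Ex case_prod_conv by blast
  from choice[OF this] obtain sol where sol: "!!h. source p h ==> S h (sol h)" by blast
  \<comment> \<open>Restriction to \<open>reg\<close> keeps the new source admissible for the solver
    and costs nothing, because the inequality is claimed only there.\<close>
  define nxt where "nxt h z = indicator reg z * (mu z * norm ((fst \<circ> snd \<circ> snd) (sol h) z))" for h z
  note mu' = wfunD[OF mu]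
  have nx: "source p (nxt h) & I (nxt h) <= (1/4) powr p * I h" if h: "source p h" for h
  proof -
   obtain w wt Dw D2 where T: "sol h = (w, wt, Dw, D2)" by (cases "sol h") auto
   note s = sol[OF h, unfolded S_def T case_prod_conv ext_sol_def, folded I_def]
   have b: "bd p ((1/4) powr p * I h) (%z. mu z * norm (Dw z))" using gr[of w wt Dw D2 "Cs * I h" delta mu] s mu deltap by simp
   have "bd p (1 powr p * ((1/4) powr p * I h)) (%z. (mu z * norm (Dw z)) * indicator reg z)"
    by (rule bd_mult[OF b]) (auto simp: p0 open_reg split: split_indicator)
   hence b: "bd p ((1/4) powr p * I h) (nxt h)" by (simp add: nxt_def[abs_def] T mult.commute)
   show ?thesis unfolding source_def using bdD[OF b] mu'(2) by (auto simp: nxt_def T I_def)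
  qed
  define h where "h k = (nxt ^^ k) h0" for k
  have hS: "h (Suc k) = nxt (h k)" "h 0 = h0" for k by (simp_all add: h_def)
  have src: "source p (h k)" for k by (induction k) (use h0 nx hS in auto)
  have Ik: "I (h k) <= (1/4) powr (p * real k) * I h0" for k
  proof (induction k)
   case (Suc k)
   have "I (h (Suc k)) <= (1/4) powr p * I (h k)" using nx[OF src[of k]] hS by simp
   also have "... <= (1/4) powr p * ((1/4) powr (p * real k) * I h0)" using Suc by (intro mult_left_mono) auto
   finally show ?case by (simp add: powr_add[symmetric] algebra_simps)
  qed (simp add: hS)
  define w wt Dw D2 where "w k = fst (sol (h k))" and "wt k = (fst \<circ> snd) (sol (h k))"
   and "Dw k = (fst \<circ> snd \<circ> snd) (sol (h k))" and "D2 k = (snd \<circ> snd \<circ> snd) (sol (h k))" for k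
  have "sol (h k) = (w k, wt k, Dw k, D2 k)" for k by (simp add: w_def wt_def Dw_def D2_def)
  note s = sol[OF src, unfolded S_def this case_prod_conv ext_sol_def, folded I_def]
  have q: "quad p (w k) (wt k) (Dw k) (D2 k)" and wb: "- Cs * I (h k) powr (1/p) <= w k z" "w k z <= 0"
   and eq: "AEL z. z : reg --> wt k z + pucci_plus lam Lam (D2 k z) = - h k z"
   and bt: "bd p (Cs * I (h k)) (wt k)" and bx: "bd p (Cs * I (h k)) (%z. Dw k z $ i)"
   and bxx: "bd p (Cs * I (h k)) (%z. D2 k z $ i $ j)" for k z i j
   using s[of k] by blast+
  have hn: "h (Suc k) z = mu z * norm (Dw k z)" if "z : reg" for k z using that by (simp add: hS nxt_def Dw_def)
  have wv: "wder (0, 1) (w k) (wt k)" "wder (axis i 1, 0) (w k) (%z. Dw k z $ i)"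
   "wder (axis j 1, 0) (%z. Dw k z $ i) (%z. D2 k z $ i $ j)" "continuous_on UNIV (w k)" "D2 k z : Sym" for k i j z
   using q[of k] unfolding quad_def by blast+
  have IkN: "I (h k) powr (1/p) <= I h0 powr (1/p) * (1/4)^k" for k
  proof -
   have "I (h k) powr (1/p) <= ((1/4) powr (p * real k) * I h0) powr (1/p)" using Ik I0 p0 by (intro powr_mono2) auto
   also have "... = (1/4) powr real k * I h0 powr (1/p)" using p0 by (simp add: powr_mult powr_powr)
   also have "(1/4::real) powr real k = (1/4)^k" by (rule powr_realpow) simp
   finally show ?thesis by (simp add: mult.commute)
  qed
  define A where "A = Cs * I h0 powr (1/p)"
  have A0: "A >= 0" using Cs by (simp add: A_def)
  have wA: "abs (w k z) <= A * (1/4)^k" for k z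
  proof -
   have "Cs * I (h k) powr (1/p) <= Cs * (I h0 powr (1/p) * (1/4)^k)" using IkN Cs by (intro mult_left_mono) auto
   thus ?thesis using wb[of k z] by (simp add: A_def)
  qed
  have gs: "summable (%k. A * (1/4)^k)" by (intro summable_mult summable_geometric) simp
  have sw: "summable (%k. w k z)" for z by (rule summable_comparison_test'[OF gs, of 0]) (use wA in auto)
  have mom: "(AEL z. summable (%k. abs (F k z))) & Lloc p (%z. \<Sum>k. abs (F k z))"
   if F: "!!k. bd p (Cs * I (h k)) (F k)" for F :: "nat => (real^'n)*real => real"
  proof -
   have B: "EX K>=0. ALL k. bd p (K * (1/4) powr (p * real k)) (%z. indicator (cbox a b) z * F k z)" for a b
   proof (intro exI[of _ "Cs * I h0"] conjI allI)
    fix k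
    have "bd p (1 powr p * (Cs * I (h k))) (%z. F k z * indicator (cbox a b) z)"
     by (rule bd_mult[OF F]) (auto simp: p0 split: split_indicator)
    moreover have "Cs * I (h k) <= Cs * I h0 * (1/4) powr (p * real k)" using mult_left_mono[OF Ik[of k], of Cs] Cs by (simp add: algebra_simps)
    ultimately show "bd p (Cs * I h0 * (1/4) powr (p * real k)) (%z. indicator (cbox a b) z * F k z)"
     by (subst mult.commute) (auto intro: bd_mono)
   qed (use Cs I0 in simp)
   show ?thesis by (rule conjI) (rule series_moments[where F=F, OF pq(1) bdD(1)[OF F] B])+
  qed
  have wm: "w k : Bor" for k using wv(4) by (rule borel_measurable_continuous_onI)
  have momw: "(AEL z. summable (%k. abs (w k z))) & Lloc p (%z. \<Sum>k. abs (w k z))"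
  proof -
   have B: "EX K>=0. ALL k. bd p (K * (1/4) powr (p * real k)) (%z. indicator (cbox a b) z * w k z)" for a b
   proof (intro exI[of _ "A powr p * meas (cbox a b)"] conjI allI)
    fix k
    show "bd p (A powr p * meas (cbox a b) * (1/4) powr (p * real k)) (%z. indicator (cbox a b) z * w k z)"
    proof (rule bdI_dominated[where g="%z. A powr p * (1/4) powr (p * real k) * indicator (cbox a b) z"])
     have "abs (w k z) powr p <= A powr p * (1/4) powr (p * real k)" for z
     proof -
      have "abs (w k z) powr p <= (A * (1/4)^k) powr p" using wA p0 by (intro powr_mono2) auto
      also have "(1/4::real)^k = (1/4) powr real k" by (rule powr_realpow[symmetric]) simp
      finally show ?thesis by (simp add: powr_mult powr_powr mult.commute)
     qed
     thus "AEL z. abs (indicator (cbox a b) z * w k z) powr p <= A powr p * (1/4) powr (p * real k) * indicator (cbox a b) z"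
      by (intro AE_I2) (auto simp: indicator_def)
     have "intl (indicator (cbox a b) :: (real^'n)*real => real)"
      using emeasure_bounded_finite[OF bounded_cbox[of a b]] by (intro integrable_real_indicator) auto
     thus "intl (%z. A powr p * (1/4) powr (p * real k) * indicator (cbox a b) z)" by simp
     show "(%z. indicator (cbox a b) z * w k z) : Bor" using wm[of k] by simp
    qed simp
   qed simp
   show ?thesis by (rule conjI) (rule series_moments[where F=w, OF pq(1) wm B])+
  qed
  define W Wt DW D2W where "W z = (\<Sum>k. w k z)" and "Wt z = (\<Sum>k. wt k z)"
   and "DW z = (\<chi> i. \<Sum>k. Dw k z $ i)" and "D2W z = (\<chi> i j. \<Sum>k. D2 k z $ i $ j)" for z
  have momt: "(AEL z. summable (%k. abs (wt k z))) & Lloc p (%z. \<Sum>k. abs (wt k z))"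
   and momx: "(AEL z. summable (%k. abs (Dw k z $ i))) & Lloc p (%z. \<Sum>k. abs (Dw k z $ i))"
   and momxx: "(AEL z. summable (%k. abs (D2 k z $ i $ j))) & Lloc p (%z. \<Sum>k. abs (D2 k z $ i $ j))" for i j
   by (rule mom, rule bt, rule mom, rule bx, rule mom, rule bxx)
  have "quad p W Wt DW D2W" unfolding quad_def
  proof (intro conjI allI)
   have "uniform_limit UNIV (%n z. SUM k<n. w k z) W sequentially" unfolding W_def
    by (rule Weierstrass_m_test[OF _ gs]) (use wA in auto)
   thus "continuous_on UNIV W" by (rule uniform_limit_theorem[rotated]) (auto intro!: always_eventually continuous_intros wv)
   show "wder (0, 1) W Wt" unfolding W_def[abs_def] Wt_def[abs_def]
    by (rule wder_suminf[where f=w and g=wt, OF pq(1) wv(1) momw[THEN conjunct1] momw[THEN conjunct2] momt[THEN conjunct1] momt[THEN conjunct2]])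
   show "Lloc p Wt" unfolding Wt_def[abs_def] by (rule series_limit(1)[where F=wt, OF pq(1) bdD(1)[OF bt] momt[THEN conjunct1] momt[THEN conjunct2]])
   fix i j
   show "wder (axis i 1, 0) W (%z. DW z $ i)" unfolding W_def[abs_def] DW_def[abs_def] vec_lambda_beta
    by (rule wder_suminf[where f=w and g="%k z. Dw k z $ i", OF pq(1) wv(2) momw[THEN conjunct1] momw[THEN conjunct2] momx[THEN conjunct1] momx[THEN conjunct2]])
   show "Lloc p (%z. DW z $ i)" unfolding DW_def[abs_def] vec_lambda_beta by (rule series_limit(1)[where F="%k z. Dw k z $ i", OF pq(1) bdD(1)[OF bx] momx[THEN conjunct1] momx[THEN conjunct2]])
   show "wder (axis j 1, 0) (%z. DW z $ i) (%z. D2W z $ i $ j)" unfolding DW_def[abs_def] D2W_def[abs_def] vec_lambda_beta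
    by (rule wder_suminf[where f="%k z. Dw k z $ i" and g="%k z. D2 k z $ i $ j", OF pq(1) wv(3) momx[THEN conjunct1] momx[THEN conjunct2] momxx[THEN conjunct1] momxx[THEN conjunct2]])
   show "Lloc p (%z. D2W z $ i $ j)" unfolding D2W_def[abs_def] vec_lambda_beta by (rule series_limit(1)[where F="%k z. D2 k z $ i $ j", OF pq(1) bdD(1)[OF bxx] momxx[THEN conjunct1] momxx[THEN conjunct2]])
  next
   fix z
   have "D2 k z $ i $ j = D2 k z $ j $ i" for k i j using wv(5)[of k z] unfolding Sym_def by (simp add: transpose_def vec_eq_iff)
   thus "D2W z : Sym" unfolding Sym_def by (simp add: transpose_def vec_eq_iff D2W_def)
  qed
  moreover have "- (2 * Cs) * I h0 powr (1/p) <= W z & W z <= 0" for z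
  proof
   have "- W z = (\<Sum>k. - w k z)" unfolding W_def using sw by (rule suminf_minus[symmetric])
   also have "... <= (\<Sum>k. A * (1/4)^k)" by (rule suminf_le[OF _ summable_minus[OF sw] gs]) (use wA in \<open>simp add: abs_le_iff\<close>)
   also have "... = A * (4/3)" by (subst suminf_mult) (simp_all add: suminf_geometric summable_geometric)
   finally show "- (2 * Cs) * I h0 powr (1/p) <= W z" using A0 by (simp add: A_def)
   show "W z <= 0" unfolding W_def by (rule suminf_le_const[OF sw]) (intro sum_nonpos wb)
  qed
  moreover have "AEL z. z : reg --> Wt z + pucci_plus lam Lam (D2W z) + mu z * norm (DW z) <= - h0 z"
  proof -
   have "AEL z. ALL k. z : reg --> wt k z + pucci_plus lam Lam (D2 k z) = - h k z" unfolding AE_all_countable using eq by blast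
   moreover have "AEL z. ALL i:UNIV. summable (%k. abs (Dw k z $ i))" by (intro AE_finite_allI finite_class.finite_UNIV conjunct1[OF momx])
   moreover have "AEL z. ALL i:UNIV. ALL j:UNIV. summable (%k. abs (D2 k z $ i $ j))" by (intro AE_finite_allI finite_class.finite_UNIV conjunct1[OF momxx])
   ultimately show ?thesis using momt[THEN conjunct1]
   proof eventually_elim
    case (elim z)
    have lt: "(%n. SUM k<n. wt k z) ----> Wt z" unfolding Wt_def using elim(4) by (intro summable_LIMSEQ[OF summable_rabs_cancel])
    have lx: "(%n. SUM k<n. Dw k z) ----> DW z"
     using elim(2) by (intro vec_tendstoI) (auto simp: DW_def intro!: summable_LIMSEQ[OF summable_rabs_cancel])
    have lxx: "(%n. (SUM k<n. D2 k z)) ----> D2W z"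
     using elim(3) by (intro vec_tendstoI) (auto simp: D2W_def intro!: summable_LIMSEQ[OF summable_rabs_cancel])
    have lh: "(%n. mu z * norm (Dw n z)) ----> 0"
    proof -
     have "(%n. Dw n z) ----> 0" using elim(2) by (intro vec_tendstoI) (auto intro!: summable_LIMSEQ_zero[OF summable_rabs_cancel])
     from tendsto_mult_left[OF tendsto_norm[OF this], of "mu z"] show ?thesis by simp
    qed
    show ?case
    proof
     assume z: "z : reg"
     have "- trace (B ** D2W z) <= - h0 z - Wt z - mu z * norm (DW z)" if B: "B : ellipticity_set lam Lam" for B
     proof -
      \<comment> \<open>After \<open>n\<close> terms the only defect is the next source
        \<open>h n\<close>, which vanishes in the limit. Working with one matrix \<open>B\<close> at
        a time makes the second-order term linear, so the limit can be taken termwise before the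
        supremum over matrices.\<close>
      have fin: "(SUM k<n. wt k z) + - trace (B ** (SUM k<n. D2 k z)) + mu z * norm (SUM k<n. Dw k z) <= - h0 z + h n z" for n
      proof (induction n)
       case 0
       have "trace (0 :: real^'n^'n) = 0" by (simp add: trace_def)
       thus ?case by (simp add: hS)
      next
       case (Suc n)
       have 1: "- trace (B ** ((SUM k<n. D2 k z) + D2 n z)) = - trace (B ** (SUM k<n. D2 k z)) + - trace (B ** D2 n z)" by (simp add: trace_add)
       have 2: "- trace (B ** D2 n z) <= pucci_plus lam Lam (D2 n z)" using pucci_upper[OF lam(1) B] .
       have 3: "wt n z + pucci_plus lam Lam (D2 n z) = - h n z" using elim(1) z by blast
       have "mu z * norm ((SUM k<n. Dw k z) + Dw n z) <= mu z * (norm (SUM k<n. Dw k z) + norm (Dw n z))"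
        using mu'(2) norm_triangle_ineq by (intro mult_left_mono) auto
       hence 4: "mu z * norm ((SUM k<n. Dw k z) + Dw n z) <= mu z * norm (SUM k<n. Dw k z) + h (Suc n) z" using hn[OF z] by (simp add: algebra_simps)
       show ?case using Suc 1 2 3 4 by simp
      qed
      have tr: "(%n. trace (B ** (SUM k<n. D2 k z))) ----> trace (B ** D2W z)" unfolding trace_eq
       by (intro tendsto_intros lxx)
      have "(%n. (SUM k<Suc n. wt k z) + - trace (B ** (SUM k<Suc n. D2 k z)) + mu z * norm (SUM k<Suc n. Dw k z)) ----> Wt z + - trace (B ** D2W z) + mu z * norm (DW z)"
       by (rule LIMSEQ_Suc) (intro tendsto_intros lt tr lx)
      moreover have "(%n. - h0 z + h (Suc n) z) ----> - h0 z + 0" unfolding hn[OF z] by (intro tendsto_intros lh)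
      ultimately have "Wt z + - trace (B ** D2W z) + mu z * norm (DW z) <= - h0 z + 0"
       by (rule LIMSEQ_le) (use fin in blast)
      thus ?thesis by simp
     qed
     hence "pucci_plus lam Lam (D2W z) <= - h0 z - Wt z - mu z * norm (DW z)" by (rule pucci_least[OF lam(2)])
     thus "Wt z + pucci_plus lam Lam (D2W z) + mu z * norm (DW z) <= - h0 z" by simp
    qed
   qed
  qed
  ultimately show ?thesis by blast
 qed
 show ?thesis using main Cs delta unfolding I_def by (intro exI[of _ "2 * Cs"] exI[of _ delta] conjI) auto
qed

section \<open>Barrier and growth lemma\<close>

lemma DERIV_mult_flat:
 fixes theta g :: "real => real"
 assumes "(theta has_real_derivative 0) (at a)" "theta a = 0" "isCont g a"
 shows "((%t. theta t * g t) has_real_derivative 0) (at a)"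
proof -
 have "((%t. (theta t - theta a) / (t - a)) \<longlongrightarrow> 0) (at a)" using assms(1) by (simp add: has_field_derivative_iff)
 from tendsto_mult[OF this assms(3)[unfolded isCont_def]]
 show ?thesis using assms(2) by (simp add: has_field_derivative_iff)
qed

text \<open>The heat kernel is frozen for times below \<open>1/2\<close>, where the cutoff in time vanishes, so that the barrier is defined
 on the whole space.\<close>

definition sclk :: "real => real => real" where "sclk t0 t = max (t - 1/2) 0 + t0"

text \<open>A Gaussian whose time power \<open>m\<close> replaces the usual half dimension; it is
  written as one exponential so that sizes are compared through logarithms.\<close>

definition heat :: "real => real => real => (real^'n)*real => real" where
 "heat lam m t0 z = exp (- m * ln (sclk t0 (snd z)) - (fst z \<bullet> fst z) / (4 * lam * sclk t0 (snd z)))"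

definition ramp :: "real => real => real" where "ramp t1 t = stp (2 * (t - 1/2) / t1 - 1)"
definition dramp :: "real => real => real" where "dramp t1 t = eta (2 * (t - 1/2) / t1 - 1) * (2 / t1)"

text \<open>Subtracting the level \<open>c\<close> makes the barrier nonpositive wherever the
  Gaussian is below \<open>c\<close>; the ramp removes the times up to 1/2.\<close>

definition bar :: "real => real => real => real => real => (real^'n)*real => real" where
 "bar lam m t0 t1 c z = ramp t1 (snd z) * (heat lam m t0 z - c)"
definition bart :: "real => real => real => real => real => (real^'n)*real => real" where
 "bart lam m t0 t1 c z = dramp t1 (snd z) * (heat lam m t0 z - c) + ramp t1 (snd z) * (heat lam m t0 z *
  ((fst z \<bullet> fst z) / (4 * lam * (sclk t0 (snd z))^2) - m / sclk t0 (snd z)))"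
definition barx :: "real => real => real => real => (real^'n)*real => real^'n" where
 "barx lam m t0 t1 z = (\<chi> k. ramp t1 (snd z) * heat lam m t0 z * (- fst z $ k / (2 * lam * sclk t0 (snd z))))"
definition barxx :: "real => real => real => real => (real^'n)*real => real^'n^'n" where
 "barxx lam m t0 t1 z = (\<chi> k l. ramp t1 (snd z) * heat lam m t0 z *
  (1 / (4 * lam^2 * (sclk t0 (snd z))^2) * (fst z $ k * fst z $ l) - (if k = l then 1 / (2 * lam * sclk t0 (snd z)) else 0)))"

lemma sclk_pos: "t0 > 0 ==> sclk t0 t > 0" by (simp add: sclk_def add_nonneg_pos)

lemma ramp_DERIV: "(ramp t1 has_real_derivative dramp t1 t) (at t)" if "t1 > 0"
 unfolding ramp_def[abs_def] dramp_def using that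
 by (intro DERIV_chain2[OF stp_DERIV]) (auto intro!: derivative_eq_intros)

lemma ramp_early: "t1 > 0 ==> t <= 1/2 ==> ramp t1 t = 0 & dramp t1 t = 0"
proof -
 assume a: "t1 > 0" "t <= 1/2"
 have "2 * (t - 1/2) / t1 <= 0" using a by (intro divide_nonpos_pos) auto
 thus ?thesis by (auto simp: ramp_def dramp_def stp_0 eta_0)
qed

lemma ramp_late: "t1 > 0 ==> t >= 1/2 + t1 ==> ramp t1 t = 1 & dramp t1 t = 0"
proof -
 assume a: "t1 > 0" "t >= 1/2 + t1"
 have "2 * (t - 1/2) / t1 >= 2" using a by (simp add: pos_le_divide_eq)
 thus ?thesis by (auto simp: ramp_def dramp_def stp_1 eta_0)
qed

lemma heat_continuous: "t0 > 0 ==> lam > 0 ==> continuous_on UNIV (heat lam m t0)"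
 unfolding heat_def[abs_def] sclk_def using sclk_pos[of t0]
 by (intro continuous_intros) (auto simp: sclk_def less_imp_neq[symmetric])

lemma bar_quad:
 assumes pos: "lam > 0" "t0 > 0" "t1 > 0" "p > 0"
 shows "quad p (bar lam m t0 t1 c :: (real^'n)*real => real) (bart lam m t0 t1 c) (barx lam m t0 t1) (barxx lam m t0 t1)"
proof (rule quad_classical)
 have s: "sclk t0 t ~= 0" "sclk t0 t > 0" for t using sclk_pos[OF pos(2), of t] by auto
 have cs: "continuous_on UNIV (%z :: (real^'n)*real. sclk t0 (snd z))" unfolding sclk_def by (intro continuous_intros)
 note ch = heat_continuous[OF pos(2,1), of m]
 have ce: "continuous_on UNIV eta" using smooth_continuous[OF smooth_eta] .
 have cp: "continuous_on UNIV stp" using smooth_continuous[OF smooth_stp] .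
 have cr: "continuous_on UNIV (%z :: (real^'n)*real. ramp t1 (snd z))" "continuous_on UNIV (%z :: (real^'n)*real. dramp t1 (snd z))"
  unfolding ramp_def dramp_def using pos(3)
  by (auto intro!: continuous_intros continuous_on_compose2[OF cp] continuous_on_compose2[OF ce])
 show "continuous_on UNIV (bar lam m t0 t1 c :: (real^'n)*real => real)" unfolding bar_def[abs_def] by (intro continuous_intros cr ch)
 show "continuous_on UNIV (bart lam m t0 t1 c :: (real^'n)*real => real)" unfolding bart_def[abs_def]
  using pos s by (intro continuous_intros cr ch cs) auto
 show "continuous_on UNIV (%z :: (real^'n)*real. barx lam m t0 t1 z $ k)" for k unfolding barx_def vec_lambda_beta
  using pos s by (intro continuous_intros cr ch cs) auto
 show "continuous_on UNIV (%z :: (real^'n)*real. barxx lam m t0 t1 z $ k $ l)" for k l unfolding barxx_def vec_lambda_beta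
  using pos s by (cases "k = l") (auto intro!: continuous_intros cr ch cs)
 show "barxx lam m t0 t1 z : Sym" for z :: "(real^'n)*real" by (simp add: Sym_def barxx_def transpose_def vec_eq_iff mult.commute)
 fix x :: "real^'n" and k l :: 'n and t r :: real
 show "((%t. bar lam m t0 t1 c (x, t)) has_real_derivative bart lam m t0 t1 c (x, t)) (at t)"
 proof (rule linorder_cases[of t "1/2"])
  assume t: "t < 1/2"
  have "((%t. 0) has_real_derivative bart lam m t0 t1 c (x, t)) (at t)" using ramp_early[OF pos(3), of t] t by (simp add: bart_def)
  thus ?thesis
  proof (rule has_field_derivative_transform_within_open[where S="{..<1/2}"])
   show "0 = bar lam m t0 t1 c (x, y)" if "y : {..<1/2}" for y using ramp_early[OF pos(3), of y] that by (simp add: bar_def)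
  qed (use t in auto)
 next
  assume t: "t = 1/2"
  have "isCont (%t. heat lam m t0 (x, t) - c) (1/2)"
   by (intro continuous_intros continuous_on_interior[of UNIV] continuous_on_compose2[OF ch]) auto
  from DERIV_mult_flat[OF _ _ this, of "ramp t1"] ramp_DERIV[OF pos(3), of "1/2"] ramp_early[OF pos(3), of "1/2"]
  show ?thesis by (simp add: t bar_def[abs_def] bart_def)
 next
  assume t: "t > 1/2"
  have st: "sclk t0 t = t - 1/2 + t0" using t by (simp add: sclk_def)
  have p: "t - 1/2 + t0 > 0" using s(2)[of t] st by simp
  have der: "((%y. exp (- m * ln y - (x \<bullet> x) / (4 * lam * y))) has_real_derivative
    exp (- m * ln y - (x \<bullet> x) / (4 * lam * y)) * ((x \<bullet> x) / (4 * lam * y^2) - m / y)) (at y)" if "y > 0" for y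
   using that pos(1) by (auto intro!: derivative_eq_intros simp: power2_eq_square)
  have ds: "((%t. t - 1/2 + t0) has_real_derivative 1) (at t)" by (auto intro!: derivative_eq_intros)
  from DERIV_chain2[where g="%t. t - 1/2 + t0", OF der[OF p] ds]
  have "((%t. exp (- m * ln (t - 1/2 + t0) - (x \<bullet> x) / (4 * lam * (t - 1/2 + t0)))) has_real_derivative
    heat lam m t0 (x, t) * ((x \<bullet> x) / (4 * lam * (sclk t0 t)^2) - m / sclk t0 t)) (at t)"
   unfolding st heat_def fst_conv snd_conv by simp
  hence "((%t. heat lam m t0 (x, t)) has_real_derivative
    heat lam m t0 (x, t) * ((x \<bullet> x) / (4 * lam * (sclk t0 t)^2) - m / sclk t0 t)) (at t)"
   by (rule has_field_derivative_transform_within_open[where S="{1/2<..}"]) (use t in \<open>auto simp: heat_def sclk_def\<close>)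
  from DERIV_mult[OF ramp_DERIV[OF pos(3), of t] DERIV_diff[OF this DERIV_const[of c]]]
  show ?thesis by (simp add: bar_def[abs_def] bart_def mult.commute add.commute)
 qed
 define S where "S = sclk t0 t"
 have S: "S > 0" using s by (simp add: S_def)
 have ip: "(x + r *R axis k 1) \<bullet> (x + r *R axis k 1) = x \<bullet> x + 2 * r * x $ k + r^2" for r k
  by (simp add: inner_add_left inner_add_right inner_axis inner_axis' power2_eq_square distrib_left)
 have dh: "((%r. heat lam m t0 (x + r *R axis k 1, t)) has_real_derivative
  heat lam m t0 (x + r *R axis k 1, t) * (- (x + r *R axis k 1) $ k / (2 * lam * S))) (at r)" for r k
  unfolding heat_def fst_conv snd_conv S_def[symmetric] ip using S pos(1)
  by (auto intro!: derivative_eq_intros simp: divide_simps) (simp add: algebra_simps)?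
 show "((%r. bar lam m t0 t1 c (x + r *R axis k 1, t)) has_real_derivative barx lam m t0 t1 (x + r *R axis k 1, t) $ k) (at r)"
  unfolding bar_def barx_def fst_conv snd_conv vec_lambda_beta S_def[symmetric]
  using DERIV_cmult[OF DERIV_diff[OF dh[of k r] DERIV_const[of c]], of "ramp t1 t"] by (simp add: mult.assoc)
 have dx: "((%r. - (x + r *R axis l 1) $ k / (2 * lam * S)) has_real_derivative - (if k = l then 1 / (2 * lam * S) else 0)) (at r)"
  using S pos(1) by (cases "k = l") (auto intro!: derivative_eq_intros simp: axis_def)
 have eq: "R * (h * (- a / (2 * lam * S)) * (- b / (2 * lam * S)) + - d * h) = R * h * (1 / (4 * lam^2 * S^2) * (b * a) - d)" for R h a b d
  using S pos(1) by (simp add: field_simps power2_eq_square)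
 show "((%r. barx lam m t0 t1 (x + r *R axis l 1, t) $ k) has_real_derivative barxx lam m t0 t1 (x + r *R axis l 1, t) $ k $ l) (at r)"
  unfolding barx_def barxx_def fst_conv snd_conv vec_lambda_beta S_def[symmetric] eq[symmetric]
  using DERIV_cmult[OF DERIV_mult[OF dh[of l r] dx], of "ramp t1 t"] by (simp only: mult.assoc)
qed (rule pos)

text \<open>With \<open>4 * lam\<close> in the exponent, the quadratic terms of the time derivative
  and of the extremal operator cancel, and \<open>m\<close> is large enough for the remaining terms
  in the inverse clock. Only the derivative of the ramp survives.\<close>

lemma bar_subsolution:
 assumes pos: "0 < lam" "lam <= Lam" "t0 > 0" "t1 > 0" and m: "real CARD('n) * Lam / (2 * lam) <= m"
 shows "bart lam m t0 t1 c z + pucci_plus lam Lam (barxx lam m t0 t1 z) <= dramp t1 (snd z) * (heat lam m t0 (z :: (real^'n)*real) - c)"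
proof -
 define S where "S = sclk t0 (snd z)"
 have S: "S > 0" using sclk_pos[OF pos(3)] by (simp add: S_def)
 define g where "g = ramp t1 (snd z) * heat lam m t0 z"
 have g: "g >= 0" unfolding g_def ramp_def heat_def by (intro mult_nonneg_nonneg stp_bounds) simp
 have "barxx lam m t0 t1 z = g *R (\<chi> i j. 1 / (4 * lam^2 * S^2) * (fst z $ i * fst z $ j) - (if i = j then 1 / (2 * lam * S) else 0))"
  by (simp add: barxx_def g_def S_def vec_eq_iff)
 hence "pucci_plus lam Lam (barxx lam m t0 t1 z) <= g * (- (1 / (4 * lam^2 * S^2)) * lam * (norm (fst z))^2 + 1 / (2 * lam * S) * (CARD('n) * Lam))"
  using pos S g pucci_rank_one[OF pos(1,2), of "1 / (4 * lam^2 * S^2)" "1 / (2 * lam * S)" "fst z"]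
  by (simp add: pucci_scale mult_left_mono)
 also have "... <= g * (m / S - (fst z \<bullet> fst z) / (4 * lam * S^2))"
 proof (rule mult_left_mono[OF _ g])
  have "1 / (2 * lam * S) * (CARD('n) * Lam) <= m / S" using m S pos(1) by (simp add: field_simps)
  moreover have "- (1 / (4 * lam^2 * S^2)) * lam * (norm (fst z))^2 = - ((fst z \<bullet> fst z) / (4 * lam * S^2))"
   using pos(1) by (simp add: dot_square_norm power2_eq_square)
  ultimately show "- (1 / (4 * lam^2 * S^2)) * lam * (norm (fst z))^2 + 1 / (2 * lam * S) * (CARD('n) * Lam) <= m / S - (fst z \<bullet> fst z) / (4 * lam * S^2)"
   by linarith
 qed
 finally show ?thesis by (simp add: bart_def g_def S_def algebra_simps)
qed

text \<open>The right-hand side is the maximum over \<open>s\<close>, attained at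
  \<open>s = A / m\<close>; it follows from \<open>ln x <= x - 1\<close>.\<close>

lemma neg_ln_bound:
 fixes m A s :: real
 assumes "m > 0" "A > 0" "s > 0" shows "- m * ln s - A / s <= m * ln (m / A) - m"
proof -
 have "ln (A / (m * s)) <= A / (m * s) - 1" using assms by (intro ln_le_minus_one) auto
 hence "ln (A / m) - ln s <= A / (m * s) - 1" using assms by (simp add: ln_div ln_mult)
 from mult_left_mono[OF this, of m] have "m * ln (A / m) - m * ln s <= A / s - m" using assms by (simp add: right_diff_distrib)
 moreover have "ln (m / A) = - ln (A / m)" using assms by (simp add: ln_div)
 ultimately show ?thesis by simp
qed

text \<open>The region to which failure of the subsolution inequality will be confined; the given
  box of the growth lemma is rescaled to it.\<close>

definition unitcyl :: "real => ((real^'n)*real) set" where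
 "unitcyl sg = {z. (ALL i. abs (fst z $ i) < sg) & 1/2 < snd z & snd z <= 1/2 + sg^2}"

text \<open>The level \<open>c\<close> is half of a lower bound for the Gaussian on the target
  region. Then \<open>sg\<close> is so small that the Gaussian is below \<open>c\<close> far out at
  all times, and the ramp so short that while it rises the Gaussian is below \<open>c\<close>
  outside the small box. The only harmful term, the derivative of the ramp, is thus positive on
  \<open>unitcyl sg\<close> at most.\<close>

lemma barrier:
 fixes lam Lam a b :: real
 assumes lam: "0 < lam" "lam <= Lam" and ab: "a >= 1" "b > 0" and p: "p > 0"
 shows "EX sg M C B psi psit Dpsi D2psi. 0 < sg & a * sg < reg_a0 TYPE('n) / 2 & (1 + b) * sg^2 < 1/6 & 0 <= M & 0 <= C & 0 <= B &
  quad p (psi :: (real^'n::finite) \<times> real => real) psit Dpsi D2psi & (ALL z. snd z <= 1/2 --> psi z <= 0) &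
  (ALL z i. reg_a0 TYPE('n) / 2 <= abs (fst z $ i) --> psi z <= 0) & (ALL z. psi z <= M) &
  (ALL z. (ALL i. abs (fst z $ i) <= a * sg) & 1/2 + sg^2 <= snd z & snd z <= 1/2 + (1 + b) * sg^2 --> 2 <= psi z) &
  (ALL z. psit z + pucci_plus lam Lam (D2psi z) <= C * indicator (unitcyl sg) z) & (ALL z:reg. norm (Dpsi z) <= B)"
proof -
 define a0 where "a0 = reg_a0 TYPE('n)"
 have a0: "a0 > 0" unfolding a0_def by (rule a0_pos)
 let ?n = "real CARD('n)"
 have n: "?n >= 1" by (simp add: Suc_leI)
 define m where "m = max 1 (?n * Lam / (2 * lam))"
 have m: "m >= 1" "?n * Lam / (2 * lam) <= m" by (auto simp: m_def)
 define A where "A = a0^2 / (16 * lam)"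
 have A: "A > 0" using a0 lam by (simp add: A_def)
 \<comment> \<open>Logarithm of \<open>c\<close> without its term in \<open>sg\<close>: a lower
   bound of the Gaussian on the target, with \<open>ln 2\<close> taken off so that subtracting
   \<open>c\<close> still leaves \<open>c\<close>.\<close>
 define L where "L = - ln 2 - m * ln (2 + b) - ?n * a^2 / (4 * lam)"
 \<comment> \<open>Largest possible exponent of the Gaussian, over all times, at distance at least
   \<open>a0 / 2\<close>.\<close>
 define KA where "KA = m * ln (m / A) - m"
 \<comment> \<open>The first entry forces \<open>KA\<close> below \<open>ln c\<close>; the other two
   keep the target region inside \<open>reg\<close>.\<close>
 define sg where "sg = min (exp ((L - KA) / (2 * m))) (min (a0 / (4 * a)) (1 / (7 * (1 + b))))"
 have sg: "sg > 0" using a0 ab by (simp add: sg_def)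
 have sg1: "sg <= exp ((L - KA) / (2 * m))" "sg <= a0 / (4 * a)" "sg <= 1 / (7 * (1 + b))" by (simp_all add: sg_def)
 have as: "a * sg < a0 / 2"
 proof -
  have "a * sg <= a * (a0 / (4 * a))" using sg1(2) ab by (intro mult_left_mono) auto
  thus ?thesis using ab a0 by simp
 qed
 have bs: "(1 + b) * sg^2 < 1/6"
 proof -
  have "1 / (7 * (1 + b)) <= 1" using ab by simp
  hence "sg <= 1" using sg1(3) by linarith
  hence "sg^2 <= sg" using sg by (simp add: power2_eq_square mult_left_le)
  hence "(1 + b) * sg^2 <= (1 + b) * (1 / (7 * (1 + b)))" using sg1(3) ab by (intro mult_left_mono) auto
  also have "... = 1/7" using ab by (simp add: divide_simps)
  finally show ?thesis by simp
 qed
 define c where "c = exp (L - 2 * m * ln sg)"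
 have c: "c > 0" by (simp add: c_def)
 have KAc: "KA <= L - 2 * m * ln sg"
 proof -
  have "ln sg <= ln (exp ((L - KA) / (2 * m)))" using sg1(1) sg by (subst ln_le_cancel_iff) auto
  hence "ln sg <= (L - KA) / (2 * m)" by simp
  hence "2 * m * ln sg <= L - KA" using m(1) by (simp add: pos_le_divide_eq mult.commute)
  thus ?thesis by simp
 qed
 define A' where "A' = 1 / (4 * lam)"
 have A': "A' > 0" using lam by (simp add: A'_def)
 \<comment> \<open>Half of the exponent \<open>A' / y\<close> bounds the time power by
   \<open>K'\<close>; the other half beats \<open>K' - L\<close> as soon as
   \<open>y <= 2 * eps\<close>, which holds during the ramp.\<close>
 define K' where "K' = m * ln (m / (A'/2)) - m"
 define eps where "eps = min 1 ((A'/2) / (abs (K' - L) + 1)) / 2"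
 have "(A'/2) / (abs (K' - L) + 1) > 0" using A' by (intro divide_pos_pos) auto
 hence eps: "eps > 0" "eps <= 1/2" "2 * eps <= (A'/2) / (abs (K' - L) + 1)" by (auto simp: eps_def)
 define t0 where "t0 = eps * sg^2"
 have t0: "t0 > 0" "t0 <= sg^2" using eps sg by (auto simp: t0_def mult_left_le_one_le)
 have n2: "fst z \<bullet> fst z = (norm (fst z))^2" for z :: "(real^'n)*real" by (rule dot_square_norm)
 have xi: "r^2 <= fst z \<bullet> fst z" if "r <= abs (fst z $ i)" "0 <= r" for r i and z :: "(real^'n)*real"
  unfolding n2 using that component_le_norm_cart[of "fst z" i] by (intro power_mono) linarith+
 have sp: "sclk t0 t > 0" "sclk t0 t >= t0" for t using sclk_pos[OF t0(1)] by (auto simp: sclk_def)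
 define G where "G = (heat lam m t0 :: (real^'n)*real => real)"
 define H where "H = exp (- m * ln t0)"
 have GH: "0 < G z" "G z <= H" for z
 proof -
  have "m * ln t0 <= m * ln (sclk t0 (snd z))" using sp[of "snd z"] m(1) t0(1) by (intro mult_left_mono) auto
  moreover have "0 <= (fst z \<bullet> fst z) / (4 * lam * sclk t0 (snd z))" using sp(1)[of "snd z"] lam by simp
  ultimately show "G z <= H" unfolding G_def heat_def H_def by simp
 qed (simp add: G_def heat_def)
 have lat: "G z <= c" if "a0 / 2 <= abs (fst z $ i)" for z i
 proof -
  define s where "s = sclk t0 (snd z)"
  have s: "s > 0" using sp by (simp add: s_def)
  have "(a0/2)^2 <= fst z \<bullet> fst z" using xi[OF that] a0 by simp
  hence "(a0/2)^2 / (4 * lam * s) <= (fst z \<bullet> fst z) / (4 * lam * s)" using lam s by (intro divide_right_mono) auto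
  moreover have "(a0/2)^2 / (4 * lam * s) = A / s" by (simp add: A_def power_divide)
  moreover have "- m * ln s - A / s <= KA" unfolding KA_def using m A s by (intro neg_ln_bound) auto
  ultimately have "- m * ln s - (fst z \<bullet> fst z) / (4 * lam * s) <= L - 2 * m * ln sg" using KAc by linarith
  thus ?thesis by (simp add: G_def heat_def c_def s_def)
 qed
 have act: "G z <= c" if "sg <= abs (fst z $ i)" "snd z <= 1/2 + t0" for z i
 proof -
  define s where "s = sclk t0 (snd z)"
  have s: "s > 0" "s <= 2 * t0" using sp that(2) t0 by (auto simp: s_def sclk_def)
  define y where "y = s / sg^2"
  have y: "y > 0" "s = y * sg^2" using s sg by (auto simp: y_def)
  have y2: "y <= (A'/2) / (abs (K' - L) + 1)"
  proof -
   have "y * sg^2 <= (2 * eps) * sg^2" using s(2) unfolding y(2)[symmetric] by (simp add: t0_def)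
   thus ?thesis using eps(3) sg by simp
  qed
  have "abs (K' - L) + 1 > 0" by linarith
  hence "y * (abs (K' - L) + 1) <= A'/2" using y2 by (subst (asm) pos_le_divide_eq)
  hence "abs (K' - L) + 1 <= (A'/2) / y" using y(1) by (subst pos_le_divide_eq) (simp_all only: mult.commute)
  moreover have "- m * ln y - (A'/2) / y <= K'" unfolding K'_def using m A' y by (intro neg_ln_bound) auto
  moreover have "A' / y = (A'/2) / y + (A'/2) / y" by (simp add: add_divide_distrib[symmetric])
  ultimately have 1: "- m * ln y - A' / y <= L" by linarith
  have "sg^2 / (4 * lam * s) <= (fst z \<bullet> fst z) / (4 * lam * s)" using xi[OF that(1)] sg lam s by (intro divide_right_mono) auto
  moreover have "sg^2 / (4 * lam * s) = A' / y" using y sg by (simp add: A'_def)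
  moreover have "- m * ln s = - m * ln y - 2 * m * ln sg" unfolding y(2) using y sg by (simp add: ln_mult ln_realpow algebra_simps)
  ultimately have "- m * ln s - (fst z \<bullet> fst z) / (4 * lam * s) <= L - 2 * m * ln sg" using 1 by linarith
  thus ?thesis by (simp add: G_def heat_def c_def s_def)
 qed
 have low: "2 * c <= G z" if x: "!!i. abs (fst z $ i) <= a * sg" and t: "1/2 + sg^2 <= snd z" "snd z <= 1/2 + (1 + b) * sg^2" for z
 proof -
  define s where "s = sclk t0 (snd z)"
  have sg: "sg^2 > 0" using sg by simp
  have s: "s >= sg^2" "s <= (2 + b) * sg^2" using t t0 sg by (auto simp: s_def sclk_def algebra_simps max_def)
  have "fst z \<bullet> fst z = (SUM i:UNIV. (fst z $ i)\<^sup>2)" by (simp add: inner_vec_def power2_eq_square)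
  also have "... <= (SUM i:(UNIV :: 'n set). (a * sg)\<^sup>2)" using x power_mono[of "abs (fst z $ i)" "a * sg" 2 for i] by (intro sum_mono) simp
  finally have "(fst z \<bullet> fst z) / (4 * lam * s) <= (?n * (a * sg)^2) / (4 * lam * sg^2)" using lam s sg by (intro frac_le) auto
  also have "... = ?n * a^2 / (4 * lam)" using sg by (simp add: power_mult_distrib)
  finally have 1: "(fst z \<bullet> fst z) / (4 * lam * s) <= ?n * a^2 / (4 * lam)" .
  have "ln s <= ln ((2 + b) * sg^2)" using s sg by (intro ln_mono) linarith+
  also have "... = ln (2 + b) + 2 * ln sg" using ab sg by (simp add: ln_mult ln_realpow)
  finally have "m * ln s <= m * (ln (2 + b) + 2 * ln sg)" using m by (intro mult_left_mono) auto
  hence "ln 2 + (L - 2 * m * ln sg) <= - m * ln s - (fst z \<bullet> fst z) / (4 * lam * s)" using 1 by (simp add: L_def algebra_simps)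
  hence "exp (ln 2 + (L - 2 * m * ln sg)) <= G z" by (simp add: G_def heat_def s_def)
  thus ?thesis by (simp add: exp_add c_def)
 qed
 obtain E where E: "!!x. eta x <= E" "E >= 0"
 proof -
  have "bounded (eta ` {-1..1})" by (intro compact_imp_bounded compact_continuous_image continuous_on_subset[OF smooth_continuous[OF smooth_eta]]) auto
  then obtain E where "!!x. x : {-1..1} ==> abs (eta x) <= E" unfolding bounded_iff by fastforce
  hence "eta x <= max E 0" for x using eta_0[of x] by (cases "x : {-1..1}") (force simp: abs_le_iff)+
  thus ?thesis using that[of "max E 0"] by auto
 qed
 note r01 = stp_bounds
 \<comment> \<open>On the target the barrier is at least \<open>c\<close>, so this factor raises it
   to 2; one unit will be spent on the correction.\<close>
 define k where "k = 2 / c"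
 have k: "k > 0" using c by (simp add: k_def)
 note t00 = t0(1)
 note ba = bar_def ramp_def G_def[symmetric]
 show ?thesis
 proof (intro exI conjI allI impI ballI)
  show "0 < sg" "a * sg < reg_a0 TYPE('n) / 2" "(1 + b) * sg^2 < 1/6" using sg as bs by (simp_all add: a0_def)
  show "0 <= k * H" "0 <= k * (E * (2 / t0) * H)" "0 <= k * (?n * (H * (a0 / (2 * lam * t0))))" using k E t0 lam a0 by (simp_all add: H_def)
  show "quad p (%z. k * bar lam m t0 t0 c z) (%z. k * bart lam m t0 t0 c z) (%z. k *R barx lam m t0 t0 z) (%z. k *R (barxx lam m t0 t0 z :: real^'n^'n))"
   by (rule quad_scale[OF bar_quad[OF lam(1) t00 t00 p]])
  fix z :: "(real^'n)*real"
  show "k * bar lam m t0 t0 c z <= 0" if "snd z <= 1/2" using ramp_early[OF t00 that] by (simp add: bar_def)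
  show "k * bar lam m t0 t0 c z <= 0" if "reg_a0 TYPE('n) / 2 <= abs (fst z $ i)" for i
   using lat[of z i] that k r01(1) by (simp add: ba a0_def mult_nonneg_nonpos)
  show "k * bar lam m t0 t0 c z <= k * H"
  proof (rule mult_left_mono)
   have "bar lam m t0 t0 c z <= ramp t0 (snd z) * G z" using c r01(1) by (simp add: ba mult_left_mono)
   also have "... <= 1 * H" unfolding ramp_def using GH[of z] by (intro mult_mono r01) auto
   finally show "bar lam m t0 t0 c z <= H" by simp
  qed (use k in simp)
  show "2 <= k * bar lam m t0 t0 c z" if x: "(ALL i. abs (fst z $ i) <= a * sg) & 1/2 + sg^2 <= snd z & snd z <= 1/2 + (1 + b) * sg^2"
  proof -
   have "2 * c <= G z" using x by (intro low) auto
   hence "c <= bar lam m t0 t0 c z" using ramp_late[OF t00, of "snd z"] x t0 by (simp add: bar_def G_def[symmetric])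
   thus ?thesis using c by (simp add: k_def pos_le_divide_eq)
  qed
  show "k * bart lam m t0 t0 c z + pucci_plus lam Lam (k *R barxx lam m t0 t0 z) <= k * (E * (2 / t0) * H) * indicator (unitcyl sg) z"
  proof -
   have d0: "dramp t0 (snd z) >= 0" "dramp t0 (snd z) <= E * (2 / t0)" unfolding dramp_def using t0 eta_nonneg E by (auto intro: mult_right_mono divide_right_mono)
   have "dramp t0 (snd z) * (G z - c) <= E * (2 / t0) * H * indicator (unitcyl sg) z"
   proof (cases "z : unitcyl sg")
    case True
    have "dramp t0 (snd z) * (G z - c) <= dramp t0 (snd z) * H" using c GH[of z] d0 by (intro mult_left_mono) linarith+
    also have "... <= E * (2 / t0) * H" using d0 by (intro mult_right_mono) (auto simp: H_def)
    finally show ?thesis using True by simp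
   next
    case False
    have "dramp t0 (snd z) * (G z - c) <= 0"
    proof (cases "1/2 < snd z & snd z < 1/2 + t0")
     case True
     then obtain i where "sg <= abs (fst z $ i)" using False t0 by (force simp: unitcyl_def not_less)
     thus ?thesis using act[of z i] True d0 by (intro mult_nonneg_nonpos) auto
    next
     case False
     thus ?thesis using ramp_early[OF t00, of "snd z"] ramp_late[OF t00, of "snd z"] by auto
    qed
    thus ?thesis using False by simp
   qed
   hence "bart lam m t0 t0 c z + pucci_plus lam Lam (barxx lam m t0 t0 z) <= E * (2 / t0) * H * indicator (unitcyl sg) z"
    using bar_subsolution[OF lam t00 t00 m(2), of c z] by (simp add: G_def)
   from mult_left_mono[OF this less_imp_le[OF k]] show ?thesis using k lam by (simp add: pucci_scale algebra_simps)
  qed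
  show "norm (k *R barx lam m t0 t0 z) <= k * (?n * (H * (a0 / (2 * lam * t0))))" if z: "z : reg"
  proof -
   have "norm (barx lam m t0 t0 z) <= (SUM i:UNIV. abs (barx lam m t0 t0 z $ i))" by (rule norm_le_l1_cart)
   also have "... <= (SUM i:(UNIV :: 'n set). H * (a0 / (2 * lam * t0)))"
   proof (rule sum_mono)
    fix i :: 'n
    have "abs (fst z $ i) <= a0" using z reg_iff[of "fst z" "snd z"] by (auto simp: a0_def intro: less_imp_le)
    hence 1: "abs (fst z $ i) / (2 * lam * sclk t0 (snd z)) <= a0 / (2 * lam * t0)" using sp lam t0 a0 by (intro frac_le) auto
    have "abs (barx lam m t0 t0 z $ i) = ramp t0 (snd z) * G z * (abs (fst z $ i) / (2 * lam * sclk t0 (snd z)))"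
     using sp(1)[of "snd z"] lam GH(1)[of z] by (simp add: barx_def G_def[symmetric] abs_mult ramp_def r01)
    also have "... <= (1 * H) * (a0 / (2 * lam * t0))"
     unfolding ramp_def using GH[of z] sp(1)[of "snd z"] lam r01 by (intro mult_mono 1) (auto simp: H_def)
    finally show "abs (barx lam m t0 t0 z $ i) <= H * (a0 / (2 * lam * t0))" by simp
   qed
   also have "... = ?n * (H * (a0 / (2 * lam * t0)))" by simp
   finally have "norm (barx lam m t0 t0 z) <= ?n * (H * (a0 / (2 * lam * t0)))" .
   from mult_left_mono[OF this less_imp_le[OF k]] show ?thesis using k by simp
  qed
 qed
qed

section \<open>Comparison of supersolutions with test functions on slabs\<close>

definition slab :: "real^'n => real => real => real => ((real^'n)*real) set" where
 "slab x0 rho s t = {z. (ALL i. abs (fst z $ i - x0 $ i) <= rho) & s <= snd z & snd z <= t}"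

lemma slab_eq_cbox: "slab x0 rho s t = cbox (x0 - vec rho, s) (x0 + vec rho, t)"
 by (auto simp: slab_def mem_box_Pair mem_box_cart abs_le_iff algebra_simps)

lemma compact_slab: "compact (slab x0 rho s t)" unfolding slab_eq_cbox by (rule compact_cbox)

lemma abs_less_between: "abs y < c \<longleftrightarrow> - c < y & y < (c :: real)" and abs_le_between: "abs y <= c \<longleftrightarrow> - c <= y & y <= (c :: real)"
 by auto

lemma in_Q_dom: "z : Q_dom \<longleftrightarrow> (ALL i. abs (fst z $ i) < 10) & 0 < snd z & snd z <= 10"
 by (cases z) (auto simp: Q_dom_def cyl_def cube_def mem_box_cart abs_less_between)

lemma closure_Q_dom: "closure (Q_dom :: ((real^'n)*real) set) = slab 0 10 0 10"
proof -
 have "box (vec (-10)) (vec 10) ~= ({} :: (real^'n) set)" using vec_eq_iff by (auto simp: interval_ne_empty_cart)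
 hence "closure (Q_dom :: ((real^'n)*real) set) = cbox (vec (-10)) (vec 10) \<times> {0..10}"
  by (simp add: Q_dom_def cyl_def cube_def closure_Times closure_box)
 thus ?thesis by (auto simp: slab_def mem_box_cart abs_le_between)
qed

lemma in_pcyl: "w : pcyl r z \<longleftrightarrow> (ALL i. abs (fst w $ i - fst z $ i) < r) & snd z - r\<^sup>2 < snd w & snd w <= snd z"
 by (cases w) (auto simp: pcyl_def mem_box_cart abs_less_iff algebra_simps)

text \<open>At a negative minimum of \<open>u - phi\<close> one has
  \<open>u < phi <= M < M'\<close>, so by continuity the differential inequality matters only where
  \<open>u < M'\<close>. The test function may therefore violate it wherever \<open>u\<close> is
  large.\<close>

lemma comparison:
 fixes x0 :: "real^'n"
 assumes s: "supers lam Lam p mu f u" and x0: "!!i. abs (x0 $ i) + rho < 10" and t: "0 <= t0" "t1 <= 10" and rho: "rho > 0"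
  and q: "quad p phi phit Dphi D2phi" and eps: "eps > 0"
  and bot: "!!z. z : slab x0 rho t0 t1 ==> snd z = t0 ==> phi z <= u z"
  and side: "!!z i. z : slab x0 rho t0 t1 ==> abs (fst z $ i - x0 $ i) = rho ==> phi z <= u z"
  and M: "!!z. z : slab x0 rho t0 t1 ==> phi z <= M" "M < M'"
  and ae: "AEL z. z : slab x0 rho t0 t1 --> u z < M' --> phit z + pucci_plus lam Lam (D2phi z) + mu z * norm (Dphi z) + f z <= - eps"
  and y: "y : slab x0 rho t0 t1"
 shows "phi y <= u y"
proof (rule ccontr)
 let ?D = "slab x0 rho t0 t1"
 assume "~ phi y <= u y"
 hence neg: "u y - phi y < 0" by simp
 have xin: "abs (fst z $ i) < 10" if "z : ?D" for z i using that x0[of i] by (auto simp: slab_def dest!: spec[of _ i])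
 have DQ: "?D <= closure Q_dom" using xin t unfolding closure_Q_dom by (fastforce simp: slab_def intro: less_imp_le)
 have cu: "continuous_on (closure Q_dom) u" using s by (simp add: supers_def)
 have "continuous_on UNIV phi" using q unfolding quad_def by blast
 hence "continuous_on ?D (%z. u z - phi z)"
  by (rule continuous_on_diff[OF continuous_on_subset[OF cu DQ] continuous_on_subset[OF _ subset_UNIV]])
 from continuous_attains_inf[OF compact_slab _ this] y obtain m where m: "m : ?D" "!!z. z : ?D ==> u m - phi m <= u z - phi z" by blast
 have um: "u m < phi m" using m(2)[OF y] neg by simp
 have m1: "snd m ~= t0" "abs (fst m $ i - x0 $ i) ~= rho" for i using bot[OF m(1)] side[OF m(1)] um by (auto simp: not_le[symmetric])
 have m2: "t0 < snd m" "snd m <= t1" "abs (fst m $ i - x0 $ i) < rho" for i using m(1) m1 m1(2)[of i] by (auto simp: slab_def order.strict_iff_order)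
 have "u m < M'" using um M(1)[OF m(1)] M(2) by linarith
 moreover have "m : closure Q_dom" using DQ m(1) by blast
 ultimately obtain d where d0: "d > 0" "ALL w:closure Q_dom. dist w m < d --> dist (u w) (u m) < M' - u m"
  using cu[unfolded continuous_on_iff, rule_format, of m "M' - u m"] by auto
 have d: "u w < M'" if "w : closure Q_dom" "dist w m < d" for w
  using d0 d0(2)[rule_format, OF that] by (auto simp: dist_real_def)
 define g where "g = Min ((%i. rho - abs (fst m $ i - x0 $ i)) ` UNIV)"
 have g: "g > 0" "g <= rho - abs (fst m $ i - x0 $ i)" for i using m2(3) by (auto simp: g_def)
 define n1 where "n1 = real CARD('n) + 1"
 have n1: "n1 >= 1" by (simp add: n1_def)
 \<comment> \<open>Small enough for the backward cylinder at the minimum to stay in the slab and in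
   the neighbourhood where \<open>u < M'\<close>; \<open>n1\<close> converts coordinate bounds into
   a bound on the distance.\<close>
 define r where "r = min (min 1 g) (min (snd m - t0) (d / (2 * n1)))"
 have r: "r > 0" "r <= 1" "r <= g" "r <= snd m - t0" "r <= d / (2 * n1)" using g(1) m2(1) d0(1) n1 by (auto simp: r_def)
 have r2: "r^2 <= r" using r(1,2) by (simp add: power2_eq_square mult_left_le)
 have cD: "w : ?D & dist w m < d & t0 < snd w" if w: "w : pcyl r m" for w
 proof -
  have wi: "abs (fst w $ i - fst m $ i) < r" for i using w by (simp add: in_pcyl)
  have wt: "snd m - r\<^sup>2 < snd w" "snd w <= snd m" using w by (auto simp: in_pcyl)
  have "abs (fst w $ i - x0 $ i) <= rho" for i using wi[of i] g(2)[of i] r(3) by linarith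
  moreover have tw: "t0 < snd w" "snd w <= t1" using wt r2 r(4) m2(2) by linarith+
  ultimately have "w : ?D" by (simp add: slab_def)
  moreover have "dist w m < d"
  proof -
   have "norm (fst w - fst m) <= (SUM i:UNIV. abs ((fst w - fst m) $ i))" by (rule norm_le_l1_cart)
   also have "... <= (SUM i:(UNIV :: 'n set). r)" by (intro sum_mono) (use wi in \<open>auto intro: less_imp_le\<close>)
   finally have "norm (fst w - fst m) <= real CARD('n) * r" by simp
   moreover have "norm (snd w - snd m) <= r" using wt r2 by simp
   moreover have "norm (w - m) <= norm (fst w - fst m) + norm (snd w - snd m)" using norm_Pair_le[of "fst (w - m)" "snd (w - m)"] by (cases w; cases m) simp
   ultimately have "dist w m <= n1 * r" by (simp add: n1_def dist_norm algebra_simps)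
   also have "... <= n1 * (d / (2 * n1))" using r(5) n1 by (intro mult_left_mono) auto
   also have "... < d" using n1 d0(1) by simp
   finally show ?thesis .
  qed
  ultimately show ?thesis using tw by blast
 qed
 have sub: "pcyl r m <= Q_dom" using cD xin t unfolding in_Q_dom subset_eq by (fastforce simp: slab_def)
 have "m : pcyl r m" using r(1) by (simp add: in_pcyl)
 hence mQ: "m : Q_dom" using sub by blast
 have "ALL w:pcyl r m. u m - phi m <= u w - phi w" using cD m(2) by blast
 moreover have "AEL w. w : pcyl r m --> phit w + pucci_plus lam Lam (D2phi w) + mu w * norm (Dphi w) + f w <= - eps"
  using ae
 proof eventually_elim
  case (elim w)
  thus ?case using cD[of w] d[of w] DQ by blast
 qed
 ultimately show False using s q mQ eps r(1) sub unfolding supers_def by blast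
qed

section \<open>The growth lemma\<close>

definition qbox :: "real^'n => real => real => ((real^'n)*real) set" where
 "qbox x0 t0 l = {z. (ALL i. abs (fst z $ i - x0 $ i) < l) & t0 < snd z & snd z <= t0 + l^2}"

lemma qbox_borel: "qbox x0 t0 l : sets borel"
proof -
 have "qbox x0 t0 l = box (x0 - vec l) (x0 + vec l) \<times> {t0<..t0 + l^2}"
  by (auto simp: qbox_def mem_box_cart abs_less_iff algebra_simps)
 thus ?thesis by (simp add: borel_Times)
qed

lemma borel_sublevel: "S : sets borel ==> continuous_on S u ==> {z:S. u z < (c::real)} : sets borel"
 for S :: "'a::euclidean_space set"
proof -
 assume S: "S : sets borel" and c: "continuous_on S u"
 have "{z : space (restrict_space borel S). u z < c} : sets (restrict_space borel S)"
  using borel_measurable_continuous_on_restrict[OF c] by (intro borel_measurable_less) auto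
 thus ?thesis using S by (auto simp: sets_restrict_space_iff space_restrict_space)
qed

text \<open>A split at the threshold \<open>theta\<close>. On a bounded region it bounds the p-th
  power of the drift by a small constant plus a multiple of its q-th power, in place of Hoelder's
  inequality.\<close>

lemma powr_interpolate:
 fixes x theta p q :: real
 assumes "0 <= x" "0 < theta" "0 < p" "p <= q"
 shows "x powr p <= theta powr p + theta powr (p - q) * x powr q"
proof (cases "x <= theta")
 case True
 hence "x powr p <= theta powr p" using assms by (intro powr_mono2) auto
 thus ?thesis by (simp add: add_increasing2)
next
 case False
 have "x powr p = x powr (p - q) * x powr q" using False assms by (simp add: powr_add[symmetric])
 also have "... <= theta powr (p - q) * x powr q" using False assms by (intro mult_right_mono powr_mono2') auto
 finally show ?thesis by (simp add: add_increasing)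
qed

lemma reg_finite: "emeas (reg :: ((real^'n)*real) set) < \<infinity>" "reg : sets borel"
 using emeasure_bounded_finite[of "reg :: ((real^'n)*real) set"] open_reg by (auto simp: reg_def bounded_box)

lemma powr_root_le: "p > 0 ==> x >= 0 ==> K >= 0 ==> K * ((x / (K + 1)) powr (1/p)) powr p <= (x :: real)"
proof -
 assume a: "p > 0" "x >= 0" "K >= 0"
 have "K * ((x / (K + 1)) powr (1/p)) powr p = (K / (K + 1)) * x" using a by (simp add: powr_powr)
 also have "... <= 1 * x" using a by (intro mult_right_mono) auto
 finally show ?thesis by simp
qed

text \<open>\<open>R\<close> exceeds \<open>a\<close> because nonnegativity of \<open>u\<close> is
  required up to the distance where the barrier has become nonpositive. The bound
  \<open>delta\<close> on \<open>f\<close> belongs to the normalised heights \<open>M\<close> and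
  1.\<close>

definition grows :: "'n::finite itself => real => real => real => real => real => real => real => real => real => real => real => real => bool" where
 "grows n lam Lam p q W a b M et ls delta R \<longleftrightarrow>
  (ALL mu f u (x0 :: real^'n) t0 l. wfun q W mu --> wfun p delta f --> supers lam Lam p mu f u --> 0 < l --> l <= ls -->
   (ALL i. abs (x0 $ i) <= 8) --> 0 <= t0 --> t0 + (1 + b) * l^2 <= 10 --> (ALL z:slab x0 (R * l) t0 (t0 + (1 + b) * l^2). 0 <= u z) -->
   meas {z : qbox x0 t0 l. u z < M} <= et * l ^ hdim TYPE('n) -->
   (ALL z:slab x0 (a * l) (t0 + l^2) (t0 + (1 + b) * l^2). 1 <= u z))"

text \<open>After rescaling, the comparison function is the barrier plus a nonpositive correction.
  The source of the correction pays for every defect: the part of the box where \<open>u\<close> is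
  small, the drift acting on the barrier, \<open>f\<close>, and a positive constant for strictness.
  It is so small in \<open>L^p\<close> that the correction stays above -1, and the barrier height 2
  leaves at least 1.\<close>

theorem growth:
 fixes lam Lam p q a b W :: real
 assumes abp: "ABP_solvable TYPE('n::finite) lam Lam p" and pq: "1 <= p" "p <= q" "real (hdim TYPE('n)) < q" "real (hdim TYPE('n)) < 2 * p"
  and lam: "0 < lam" "lam <= Lam" and ab: "1 <= a" "0 < b" and W: "0 <= W"
 shows "EX M>1. EX et>0. EX ls>0. EX delta>0. EX R>=a. R * ls <= 1 &
  grows TYPE('n) lam Lam p q W a b M et ls delta R"
proof -
 let ?h = "hdim TYPE('n)"
 define a0 where "a0 = reg_a0 TYPE('n)"
 have a0: "a0 > 0" unfolding a0_def by (rule a0_pos)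
 have p: "p > 0" "p >= 0" and q: "q > 0" using pq by auto
 obtain sg M C B psi psit Dpsi D2psi where sg: "0 < sg" "a * sg < a0 / 2" "(1 + b) * sg^2 < 1/6" and MCB: "0 <= M" "0 <= C" "0 <= B"
  and qpsi: "quad p (psi :: (real^'n)*real => real) psit Dpsi D2psi" and psi0: "!!z. snd z <= 1/2 ==> psi z <= 0"
  and psis: "!!z i. a0 / 2 <= abs (fst z $ i) ==> psi z <= 0" and psiM: "!!z. psi z <= M"
  and psi2: "!!z. (ALL i. abs (fst z $ i) <= a * sg) ==> 1/2 + sg^2 <= snd z ==> snd z <= 1/2 + (1 + b) * sg^2 ==> 2 <= psi z"
  and psiC: "!!z. psit z + pucci_plus lam Lam (D2psi z) <= C * indicator (unitcyl sg) z" and psiB: "!!z. z : reg ==> norm (Dpsi z) <= B"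
  using barrier[OF lam ab p(1), where 'n='n] unfolding a0_def by (elim exE conjE) metis
 obtain Cd deltad where Cd: "Cd > 0" "deltad > 0" and sd: "!!mu h. wfun q deltad mu ==> source p h ==>
  (EX w wt Dw D2w. quad p (w :: (real^'n)*real => real) wt Dw D2w &
   (ALL z. - Cd * (LI z. abs (h z) powr p) powr (1/p) <= w z & w z <= 0) &
   (AEL z. z : reg --> wt z + pucci_plus lam Lam (D2w z) + mu z * norm (Dw z) <= - h z))"
  using solver_drift[OF abp pq(1-3) lam] by blast
 define V where "V = meas (reg :: ((real^'n)*real) set)"
 have V: "V >= 0" by (simp add: V_def)
 \<comment> \<open>Four contributions are added by three nested uses of \<open>bd_add\<close>; the
   divisor keeps their total below \<open>(1 / Cd) powr p\<close>, hence the correction above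
   -1.\<close>
 define eps0 where "eps0 = (1 / Cd) powr p / (4 * 8 powr p)"
 have eps0: "eps0 > 0" using Cd by (simp add: eps0_def)
 define et where "et = eps0 / (C powr p + 1) / sg ^ ?h"
 have C1: "C powr p + 1 > 0" "B powr p * V >= 0" using V by (auto intro: add_nonneg_pos)
 have et: "et > 0" using eps0 C1 sg by (simp add: et_def)
 \<comment> \<open>This threshold makes the constant part of the interpolated drift small;
   \<open>deltam\<close> is chosen afterwards to make the part with the q-th power small.\<close>
 define theta where "theta = (eps0 / 2 / (B powr p * V + 1)) powr (1/p)"
 have theta: "theta > 0" using eps0 C1 unfolding theta_def by (simp add: add_nonneg_pos)
 define k where "k = B powr p * theta powr (p - q)"
 have k: "k >= 0" by (simp add: k_def)
 define deltam where "deltam = min deltad (eps0 / 2 / (k + 1))"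
 have deltam: "deltam > 0" "deltam <= deltad" "deltam <= eps0 / 2 / (k + 1)" using Cd eps0 k by (auto simp: deltam_def)
 define eps' where "eps' = (eps0 / (V + 1)) powr (1/p)"
 have eps': "eps' > 0" using eps0 V by (simp add: eps'_def)
 \<comment> \<open>With this bound on the scale \<open>r\<close> one has \<open>R * l <= 1\<close>,
   so the comparison slab stays in the domain.\<close>
 define rm where "rm = 2 / a0"
 have rm: "rm > 0" using a0 by (simp add: rm_def)
 define delta where "delta = eps0 / (rm powr (2 * p - ?h))"
 have delta: "delta > 0" using eps0 rm by (simp add: delta_def)
 \<comment> \<open>Here \<open>q - hdim\<close> is positive: shrinking the box makes the rescaled
   drift as small as required, however large \<open>W\<close> is.\<close>
 define rs where "rs = min rm ((deltam / (W + 1)) powr (1 / (q - ?h)))"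
 have rs: "rs > 0" "rs <= rm" "rs <= (deltam / (W + 1)) powr (1 / (q - ?h))" using rm deltam W by (auto simp: rs_def)
 define R where "R = a0 / (2 * sg)"
 have R: "R >= a" "R > 0" using sg a0 by (auto simp: R_def pos_le_divide_eq)
 have sga: "sg < a0" "sg^2 < 1/6"
 proof -
  have "1 * sg <= a * sg" "1 * sg^2 <= (1 + b) * sg^2" using ab sg by (intro mult_right_mono; simp)+
  thus "sg < a0" "sg^2 < 1/6" using sg a0 by linarith+
 qed
 have ucreg: "unitcyl sg <= (reg :: ((real^'n)*real) set)"
 proof
  fix z :: "(real^'n)*real" assume z: "z : unitcyl sg"
  hence "abs (fst z $ i) < sg" for i by (simp add: unitcyl_def)
  hence "abs (fst z $ i) < a0" for i using sga(1) by (rule less_trans)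
  thus "z : reg" using z sga reg_iff[of "fst z" "snd z"] by (auto simp: unitcyl_def a0_def)
 qed
 have main: "1 <= u y"
  if mu: "wfun q W mu" and f: "wfun p delta f" and su: "supers lam Lam p mu f u" and l: "0 < l" "l <= sg * rs"
   and x0: "ALL i. abs (x0 $ i) <= 8" and t0: "0 <= t0" "t0 + (1 + b) * l^2 <= 10"
   and u0: "ALL z:slab x0 (R * l) t0 (t0 + (1 + b) * l^2). 0 <= u z"
   and me: "meas {z : qbox x0 t0 l. u z < M + 2} <= et * l ^ ?h"
   and y: "y : slab x0 (a * l) (t0 + l^2) (t0 + (1 + b) * l^2)" for mu f u l t0 y and x0 :: "real^'n"
 proof -
  define r where "r = l / sg"
  have r: "r > 0" "l = sg * r" "r <= rs" using l sg by (auto simp: r_def pos_divide_le_eq mult.commute)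
  \<comment> \<open>The shift makes the rescaled time 1/2, where the barrier starts, correspond to
    \<open>t0\<close>.\<close>
  define z0 where "z0 = (x0, t0 - r\<^sup>2 / 2)"
  have Rl: "R * l = r * (a0 / 2)" using sg by (simp add: R_def r(2))
  have Rl1: "R * l <= 1"
  proof -
   have "r * (a0/2) <= rm * (a0/2)" using r rs a0 by (intro mult_right_mono) auto
   thus ?thesis using a0 by (simp add: Rl rm_def)
  qed
  have pi: "fst (psci r z0 z) = (1/r) *R (fst z - x0)" "snd (psci r z0 z) = (snd z - t0) / r^2 + 1/2" for z
   using r(1) by (simp_all add: psci_def z0_def scaleR_diff_right power_divide diff_divide_distrib)
  have pii: "abs (fst (psci r z0 z) $ i) = abs (fst z $ i - x0 $ i) / r" for z i using r(1) by (simp add: pi abs_mult)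
  have l2: "l^2 = sg^2 * r^2" by (simp add: r(2) power_mult_distrib)
  have r2: "r^2 > 0" using r(1) by simp
  have ti: "snd (psci r z0 z) <= 1/2 + c \<longleftrightarrow> snd z <= t0 + c * r^2" "1/2 + c <= snd (psci r z0 z) \<longleftrightarrow> t0 + c * r^2 <= snd z" for c z
   unfolding pi using pos_divide_le_eq[OF r2, of "snd z - t0" c] pos_le_divide_eq[OF r2, of c "snd z - t0"] by auto
  let ?D = "slab x0 (R * l) t0 (t0 + (1 + b) * l^2)"
  have inreg: "psci r z0 z : reg" if z: "z : ?D" for z
  proof -
   have "abs (fst (psci r z0 z) $ i) <= a0 / 2" for i unfolding pii using z r(1) by (simp add: slab_def Rl pos_divide_le_eq mult.commute)
   hence "abs (fst (psci r z0 z) $ i) < a0" for i by (rule le_less_trans) (use a0 in simp)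
   moreover have "1/2 <= snd (psci r z0 z)" using ti(2)[of 0 z] z by (simp add: slab_def)
   moreover have "snd (psci r z0 z) <= 1/2 + (1 + b) * sg^2" unfolding ti(1) using z by (simp add: slab_def l2 mult.assoc)
   ultimately show ?thesis using sg(3) reg_iff[of "fst (psci r z0 z)" "snd (psci r z0 z)"] by (auto simp: a0_def)
  qed
  have uq: "psci r z0 z : unitcyl sg \<longleftrightarrow> z : qbox x0 t0 l" for z
  proof -
   have "abs (fst (psci r z0 z) $ i) < sg \<longleftrightarrow> abs (fst z $ i - x0 $ i) < l" for i
    unfolding pii r(2) using r(1) by (rule pos_divide_less_eq)
   moreover have "1/2 < snd (psci r z0 z) \<longleftrightarrow> t0 < snd z" using ti(1)[of z 0] by (simp add: not_le[symmetric])
   moreover have "snd (psci r z0 z) <= 1/2 + sg^2 \<longleftrightarrow> snd z <= t0 + l^2" unfolding ti(1) l2 ..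
   ultimately show ?thesis unfolding unitcyl_def qbox_def mem_Collect_eq by blast
  qed
  define Bz where "Bz = {z : qbox x0 t0 l. u z < M + 2}"
  have Qc: "qbox x0 t0 l <= closure Q_dom"
  proof
   fix z assume z: "z : qbox x0 t0 l"
   have "1 * l^2 <= (1 + b) * l^2" using ab by (intro mult_right_mono) auto
   moreover have "l <= 1" using Rl1 R(1) ab l mult_right_mono[of 1 R l] by linarith
   moreover have "abs (fst z $ i) <= 10" for i using z x0[rule_format, of i] \<open>l <= 1\<close> by (auto simp: qbox_def dest!: spec[of _ i])
   ultimately show "z : closure Q_dom" using z t0 by (auto simp: closure_Q_dom slab_def qbox_def)
  qed
  have Bz: "Bz : sets borel" unfolding Bz_def
   using su by (intro borel_sublevel qbox_borel continuous_on_subset[OF _ Qc]) (auto simp: supers_def)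
  note fb = wfunD[OF f] and mb = wfunD[OF mu]
  note [measurable] = fb(1) mb(1) Bz reg_finite(2)
  have r_int: "r ^ ?h * (LI z. g (psc r z0 z)) = (LI z. g z)" if "intl g" for g :: "_ => real"
   using integral_psc[OF r(1) that, of z0] by simp
  have rh: "r ^ ?h = r powr ?h" using r(1) by (simp add: powr_realpow)
  define m where "m z = indicator reg z * (r * mu (psc r z0 z))" for z
  have m0: "m z >= 0" for z using mb(2) r(1) by (simp add: m_def)
  have mq: "wfun q deltam m"
  proof -
   have [measurable]: "m : Bor" unfolding m_def[abs_def] by measurable
   have i: "intl (%z. r powr q * mu (psc r z0 z) powr q)" using integrable_psc[OF r(1) mb(3)] by simp
   have le: "m z powr q <= r powr q * mu (psc r z0 z) powr q" for z using r(1) mb(2) by (auto simp: m_def powr_mult indicator_def)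
   have i2: "intl (%z. m z powr q)" by (rule Bochner_Integration.integrable_bound[OF i]) (use le in auto)
   have "(LI z. m z powr q) <= (LI z. r powr q * mu (psc r z0 z) powr q)" by (rule integral_mono[OF i2 i le])
   also have "... = r powr (q - ?h) * (LI z. mu z powr q)"
    using r_int[OF mb(3)] r(1) by (simp add: powr_diff rh[symmetric] field_simps)
   also have "... <= (deltam / (W + 1)) * W"
   proof (rule mult_mono)
    have "r powr (q - ?h) <= ((deltam / (W + 1)) powr (1 / (q - ?h))) powr (q - ?h)" using r rs pq by (intro powr_mono2) auto
    thus "r powr (q - ?h) <= deltam / (W + 1)" using pq deltam W by (simp add: powr_powr)
   qed (use mb deltam W in auto)
   also have "... <= deltam * 1" using deltam W by (simp add: pos_divide_le_eq mult_left_mono)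
   finally show ?thesis using i2 m0 by (simp add: wfun_def)
  qed
  \<comment> \<open>In the box but outside \<open>Bz\<close>, \<open>u\<close> is at least
    \<open>M + 2\<close> and comparison asks for no inequality; so the term that repairs the barrier
    can live on \<open>Bz\<close>, whose measure is small.\<close>
  define h where "h z = C * indicator Bz (psc r z0 z) + B * m z + indicator reg z * (r^2 * f (psc r z0 z)) + eps' * indicator reg z" for z
  have b1: "bd p eps0 (%z. C * indicator Bz (psc r z0 z))"
  proof (rule bdI_dominated[where g="%z. C powr p * indicator Bz (psc r z0 z)"])
   have e: "emeas Bz < \<infinity>" by (rule emeasure_bounded_finite, rule bounded_subset[OF compact_imp_bounded[OF compact_slab[of x0 l t0 "t0 + l^2"]]])
     (auto simp: Bz_def qbox_def slab_def less_imp_le)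
   have iB: "intl (indicator Bz :: _ => real)" using e Bz by (intro integrable_real_indicator) auto
   show "intl (%z. C powr p * indicator Bz (psc r z0 z))" using integrable_psc[OF r(1) iB] by simp
   have "r ^ ?h * (LI z. indicator Bz (psc r z0 z)) <= et * l ^ ?h" unfolding r_int[OF iB] using me e Bz by (simp add: Bz_def)
   hence "r ^ ?h * (LI z. indicator Bz (psc r z0 z)) <= r ^ ?h * (et * sg ^ ?h)" by (simp add: r(2) power_mult_distrib mult_ac)
   hence "(LI z. indicator Bz (psc r z0 z)) <= et * sg ^ ?h" by (rule mult_left_le_imp_le) (use r(1) in simp)
   also have "et * sg ^ ?h = eps0 / (C powr p + 1)" using sg by (simp add: et_def)
   finally have "(LI z. indicator Bz (psc r z0 z)) <= eps0 / (C powr p + 1)" .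
   hence "C powr p * (LI z. indicator Bz (psc r z0 z)) <= C powr p * (eps0 / (C powr p + 1))" by (intro mult_left_mono) auto
   also have "... <= eps0" using C1 eps0 by (simp add: pos_divide_le_eq algebra_simps)
   finally show "(LI z. C powr p * indicator Bz (psc r z0 z)) <= eps0" by simp
   show "(%z. C * indicator Bz (psc r z0 z)) : Bor" by measurable
  qed (use MCB in \<open>auto intro!: AE_I2 simp: indicator_def\<close>)
  have ir: "intl (indicator reg :: (real^'n)*real => real)" using reg_finite by (intro integrable_real_indicator) auto
  have b2: "bd p eps0 (%z. B * m z)"
  proof (rule bdI_dominated[where g="%z. B powr p * (theta powr p * indicator reg z + theta powr (p - q) * m z powr q)"])
   have im: "intl (%z. m z powr q)" "(LI z. m z powr q) <= deltam" "m : Bor" using mq by (auto simp: wfun_def)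
   show "intl (%z. B powr p * (theta powr p * indicator reg z + theta powr (p - q) * m z powr q))" using im ir by simp
   have "(LI z. B powr p * (theta powr p * indicator reg z + theta powr (p - q) * m z powr q))
    = (B powr p * V) * theta powr p + k * (LI z. m z powr q)"
    using im ir by (simp add: V_def k_def algebra_simps)
   also have "... <= eps0 / 2 + eps0 / 2"
   proof (rule add_mono)
    show "(B powr p * V) * theta powr p <= eps0 / 2" unfolding theta_def using p eps0 C1 by (intro powr_root_le) auto
    have "k * (LI z. m z powr q) <= k * (eps0 / 2 / (k + 1))" using im(2) deltam(3) k by (intro mult_left_mono) auto
    also have "... <= eps0 / 2" using k eps0 by (simp add: pos_divide_le_eq algebra_simps)
    finally show "k * (LI z. m z powr q) <= eps0 / 2" .
   qed
   finally show "(LI z. B powr p * (theta powr p * indicator reg z + theta powr (p - q) * m z powr q)) <= eps0" by simp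
   show "(%z. B * m z) : Bor" using im(3) by simp
   have "m z powr p <= theta powr p * indicator reg z + theta powr (p - q) * m z powr q" for z
    using powr_interpolate[OF m0 theta p(1) pq(2), of z] by (cases "z : reg") (auto simp: m_def)
   thus "AEL z. abs (B * m z) powr p <= B powr p * (theta powr p * indicator reg z + theta powr (p - q) * m z powr q)"
    using MCB m0 by (intro AE_I2) (simp add: abs_mult powr_mult mult_left_mono)
  qed
  have b3: "bd p eps0 (%z. indicator reg z * (r^2 * f (psc r z0 z)))"
  proof (rule bdI_dominated[where g="%z. r powr (2 * p) * f (psc r z0 z) powr p"])
   show "intl (%z. r powr (2 * p) * f (psc r z0 z) powr p)" using integrable_psc[OF r(1) fb(3)] by simp
   have "(LI z. r powr (2 * p) * f (psc r z0 z) powr p) = r powr (2 * p - ?h) * (LI z. f z powr p)"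
    using r_int[OF fb(3)] r(1) by (simp add: powr_diff rh[symmetric] field_simps)
   also have "... <= rm powr (2 * p - ?h) * delta" using r rs pq fb by (intro mult_mono powr_mono2) auto
   finally show "(LI z. r powr (2 * p) * f (psc r z0 z) powr p) <= eps0" using rm by (simp add: delta_def)
   have "r powr (2 * p) = (r^2) powr p" using r(1) by (simp add: powr_powr powr_realpow[symmetric] del: powr_numeral)
   thus "AEL z. abs (indicator reg z * (r^2 * f (psc r z0 z))) powr p <= r powr (2 * p) * f (psc r z0 z) powr p"
    using fb(2) by (intro AE_I2) (auto simp: indicator_def powr_mult abs_mult)
  qed measurable
  have b4: "bd p eps0 (%z :: (real^'n)*real. eps' * indicator reg z)"
  proof (rule bdI_dominated[where g="%z :: (real^'n)*real. eps' powr p * indicator reg z"])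
   show "intl (%z :: (real^'n)*real. eps' powr p * indicator reg z)" using ir by simp
   have "V * eps' powr p <= eps0" unfolding eps'_def using p eps0 V by (intro powr_root_le) auto
   thus "(LI z. eps' powr p * indicator (reg :: ((real^'n)*real) set) z) <= eps0" by (simp add: V_def mult.commute)
  qed (use eps' in \<open>auto simp: indicator_def\<close>)
  have bh: "bd p ((1 / Cd) powr p) h"
  proof -
   have "bd p (2 powr p * (2 powr p * (2 powr p * (eps0 + eps0) + eps0) + eps0)) h" unfolding h_def[abs_def]
    by (intro bd_add b1 b2 b3 b4 p)
   thus ?thesis
   proof (rule bd_mono)
    define j where "j = (2::real) powr p"
    have j: "j >= 1" unfolding j_def using p by (simp add: ge_one_powr_ge_zero)
    have "(8::real) powr p = j * j * j" unfolding j_def powr_mult[symmetric] by simp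
    hence e: "(1 / Cd) powr p = 4 * (j * j * j) * eps0" using j by (simp add: eps0_def)
    have "j * eps0 <= j * j * eps0" "j * j * eps0 <= j * j * j * eps0" using mult_left_mono[OF j, of "j * eps0"] mult_left_mono[OF j, of "j * j * eps0"] j eps0 by (simp_all add: mult_ac)
    thus "2 powr p * (2 powr p * (2 powr p * (eps0 + eps0) + eps0) + eps0) <= (1 / Cd) powr p"
     unfolding e j_def[symmetric] by (simp add: algebra_simps)
   qed
  qed
  have Bzr: "indicator Bz (psc r z0 z) = (0::real)" if "z ~: reg" for z
   using that ucreg uq[of "psc r z0 z"] r(1) by (auto simp: Bz_def indicator_def)
  have src: "source p h"
   unfolding source_def using bdD[OF bh] Bzr m0 fb(2) MCB eps' by (auto simp: h_def m_def)
  have "wfun q deltad m" using mq deltam(2) unfolding wfun_def by auto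
  from sd[OF this src] obtain w wt Dw D2w where qw: "quad p (w :: (real^'n)*real => real) wt Dw D2w"
   and wb: "!!z. - Cd * (LI z. abs (h z) powr p) powr (1/p) <= w z" "!!z. w z <= 0"
   and we: "AEL z. z : reg --> wt z + pucci_plus lam Lam (D2w z) + m z * norm (Dw z) <= - h z" by blast
  have w1: "- 1 <= w z" for z
  proof -
   have "(LI z. abs (h z) powr p) powr (1/p) <= ((1 / Cd) powr p) powr (1/p)"
    using bdD(3)[OF bh] p by (intro powr_mono2 int_nonneg) auto
   hence "Cd * (LI z. abs (h z) powr p) powr (1/p) <= Cd * (1 / Cd)" using Cd p by (intro mult_left_mono) (simp_all add: powr_powr)
   thus ?thesis using wb(1)[of z] Cd by simp
  qed
  have qphi: "quad p (%z. psi (psci r z0 z) + w (psci r z0 z)) (%z. (1/r)\<^sup>2 * (psit (psci r z0 z) + wt (psci r z0 z)))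
   (%z. (1/r) *R (Dpsi (psci r z0 z) + Dw (psci r z0 z))) (%z. (1/r)\<^sup>2 *R (D2psi (psci r z0 z) + D2w (psci r z0 z)))"
   unfolding psci_def using quad_psc[OF quad_add[OF qpsi qw p(1)], of "1/r"] r(1) by simp
  have y': "y : ?D"
  proof -
   have "a * l <= R * l" "0 <= l^2" using R l by (auto intro: mult_right_mono)
   moreover have "t0 + l^2 <= snd y" using y by (simp add: slab_def)
   hence "t0 <= snd y" by (rule order_trans[rotated]) simp
   ultimately show ?thesis using y unfolding slab_def by (auto intro: order_trans)
  qed
  have "psi (psci r z0 y) + w (psci r z0 y) <= u y"
  proof (rule comparison[OF su _ t0 _ qphi _ _ _ _ _ _ y'])
   show "abs (x0 $ i) + R * l < 10" for i using x0[rule_format, of i] Rl1 by linarith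
   show "R * l > 0" using R l by simp
   show "0 < eps' / r^2" using eps' r2 by simp
   show "psi (psci r z0 z) + w (psci r z0 z) <= u z" if "z : ?D" "snd z = t0" for z
    using psi0[of "psci r z0 z"] wb(2)[of "psci r z0 z"] u0 that ti(1)[of z 0] by force
   show "psi (psci r z0 z) + w (psci r z0 z) <= u z" if "z : ?D" "abs (fst z $ i - x0 $ i) = R * l" for z i
    using psis[of "psci r z0 z" i] wb(2)[of "psci r z0 z"] u0 that r(1) unfolding pii Rl by force
   show "psi (psci r z0 z) + w (psci r z0 z) <= M" for z using psiM[of "psci r z0 z"] wb(2)[of "psci r z0 z"] by linarith
   show "M < M + 2" by simp
   have "AEL z. psci r z0 z : reg --> wt (psci r z0 z) + pucci_plus lam Lam (D2w (psci r z0 z)) + m (psci r z0 z) * norm (Dw (psci r z0 z)) <= - h (psci r z0 z)"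
    unfolding psci_def by (rule AE_psc[OF _ we]) (use r(1) in simp)
   thus "AEL z. z : ?D --> u z < M + 2 --> (1/r)\<^sup>2 * (psit (psci r z0 z) + wt (psci r z0 z)) +
     pucci_plus lam Lam ((1/r)^2 *R (D2psi (psci r z0 z) + D2w (psci r z0 z))) + mu z * norm ((1/r) *R (Dpsi (psci r z0 z) + Dw (psci r z0 z))) + f z <= - (eps' / r^2)"
   proof (eventually_elim, intro impI)
    fix z assume e: "psci r z0 z : reg --> wt (psci r z0 z) + pucci_plus lam Lam (D2w (psci r z0 z)) + m (psci r z0 z) * norm (Dw (psci r z0 z)) <= - h (psci r z0 z)"
     and z: "z : ?D" "u z < M + 2"
    let ?z = "psci r z0 z"
    have zr: "?z : reg" by (rule inreg[OF z(1)])
    have pz: "psc r z0 ?z = z" using r(1) by simp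
    have mz: "m ?z = r * mu z" using zr pz by (simp add: m_def)
    have hz: "h ?z = C * indicator (unitcyl sg) ?z + B * m ?z + r^2 * f z + eps'"
     using zr z(2) uq[of z] by (simp add: h_def pz Bz_def indicator_def)
    have "pucci_plus lam Lam (D2psi ?z + D2w ?z) <= pucci_plus lam Lam (D2psi ?z) + pucci_plus lam Lam (D2w ?z)" by (rule pucci_add_le[OF lam])
    moreover have "m ?z * norm (Dpsi ?z + Dw ?z) <= m ?z * (B + norm (Dw ?z))"
     using m0 norm_triangle_ineq[of "Dpsi ?z" "Dw ?z"] psiB[OF zr] by (intro mult_left_mono) (auto intro: order_trans)
    ultimately have "psit ?z + wt ?z + pucci_plus lam Lam (D2psi ?z + D2w ?z) + m ?z * norm (Dpsi ?z + Dw ?z) + r^2 * f z <= - eps'"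
     using e zr psiC[of ?z] hz by (simp add: algebra_simps)
    from mult_left_mono[OF this, of "(1/r)^2"]
    have "(1/r)^2 * (psit ?z + wt ?z + pucci_plus lam Lam (D2psi ?z + D2w ?z) + m ?z * norm (Dpsi ?z + Dw ?z) + r^2 * f z) <= (1/r)^2 * - eps'" by simp
    moreover have "mu z * norm ((1/r) *R (Dpsi ?z + Dw ?z)) = (1/r)^2 * (m ?z * norm (Dpsi ?z + Dw ?z))"
     using r(1) by (simp add: mz power2_eq_square)
    moreover have "pucci_plus lam Lam ((1/r)^2 *R (D2psi ?z + D2w ?z)) = (1/r)^2 * pucci_plus lam Lam (D2psi ?z + D2w ?z)" by (rule pucci_scale[OF lam]) simp
    moreover have "(1/r)^2 * (r^2 * f z) = f z" using r(1) by (simp add: power_divide)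
    moreover have "(1/r)^2 * - eps' = - (eps' / r^2)" by (simp add: power_divide)
    ultimately show "(1/r)^2 * (psit ?z + wt ?z) + pucci_plus lam Lam ((1/r)^2 *R (D2psi ?z + D2w ?z)) +
     mu z * norm ((1/r) *R (Dpsi ?z + Dw ?z)) + f z <= - (eps' / r^2)" by (simp only: distrib_left)
   qed
  qed
  moreover have "2 <= psi (psci r z0 y)"
  proof (rule psi2)
   show "ALL i. abs (fst (psci r z0 y) $ i) <= a * sg" unfolding pii using y r by (auto simp: slab_def pos_divide_le_eq mult_ac)
   show "1/2 + sg^2 <= snd (psci r z0 y)" "snd (psci r z0 y) <= 1/2 + (1 + b) * sg^2"
    unfolding ti using y by (simp_all add: slab_def l2 mult.assoc)
  qed
  ultimately show ?thesis using w1[of "psci r z0 y"] by linarith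
 qed
 have "R * (sg * rs) <= 1"
 proof -
  have "R * (sg * rs) = (a0/2) * rs" using sg by (simp add: R_def)
  also have "... <= (a0/2) * rm" using rs a0 by (intro mult_left_mono) auto
  finally show ?thesis using a0 by (simp add: rm_def)
 qed
 thus ?thesis
  unfolding grows_def using MCB et sg rs delta R main
  by (intro exI[of _ "M + 2"] exI[of _ et] exI[of _ "sg * rs"] exI[of _ delta] exI[of _ R] conjI allI impI ballI) (simp_all del: split_paired_All)
qed

section \<open>Propagation along chains of boxes\<close>

text \<open>The growth property at all heights, with widening 5 and duration 5. Dividing by the
  height \<open>H\<close> divides \<open>f\<close> as well, hence the restriction to heights above
  \<open>omega\<close>; each use loses a factor \<open>2^g\<close>.\<close>

definition grow :: "nat => real => real => real => ((real^'n)*real => real) => bool" where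
 "grow g et ls omega u \<longleftrightarrow> continuous_on (closure Q_dom) u & (ALL x0 t0 l H. omega <= H --> 0 <= H --> 0 < l --> l <= ls -->
  (ALL i. abs (x0 $ i) <= 8) --> 0 <= t0 --> t0 + 5 * l^2 <= 10 -->
  meas {z : qbox x0 t0 l. u z < 2^g * H} <= et * l ^ hdim TYPE('n) --> (ALL z:slab x0 (5 * l) (t0 + l^2) (t0 + 5 * l^2). H <= u z))"

locale growing =
 fixes g :: nat and et ls omega :: real and u :: "(real^'n::finite) \<times> real => real"
 assumes gr: "grow g et ls omega u" and et0: "0 <= et"
begin

lemma step:
 assumes "omega <= H" "0 <= H" "0 < l" "l <= ls" "!!i. abs (x $ i) <= 8" "0 <= t" "t + 5 * l^2 <= 10"
  and b: "!!z. z : qbox x t l ==> 2^g * H <= u z" and z: "z : slab x (5 * l) (t + l^2) (t + 5 * l^2)"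
 shows "H <= u z"
proof -
 have E: "{z : qbox x t l. u z < 2^g * H} = {}" using b by (force simp: not_less[symmetric])
 have "meas {z : qbox x t l. u z < 2^g * H} <= et * l ^ hdim TYPE('n)" unfolding E using et0 assms(3) by simp
 thus ?thesis using gr assms unfolding grow_def by blast
qed

lemma level: "0 <= H ==> H <= 2^g * H" "omega <= H ==> 0 <= H ==> omega <= 2^g * H"
 using mult_right_mono[of 1 "2^g" H] by auto

text \<open>Each use of \<open>step\<close> adds one layer of duration \<open>l^2\<close> at the
  same place and costs one factor \<open>2^g\<close>; the induction fills everything below the new
  layer at the level above.\<close>

lemma stack:
 assumes "omega <= H" "0 <= H" and l: "0 < l" "l <= ls" and x: "!!i. abs (x $ i) <= 8" and t: "0 <= t"
 shows "t + (5 + real j) * l^2 <= 10 ==> (!!z. z : slab x (5 * l) (t + l^2) (t + 5 * l^2) ==> (2^g)^j * H <= u z) ==>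
  z : slab x (5 * l) (t + l^2) (t + (5 + real j) * l^2) ==> H <= u z"
 using assms(1,2)
proof (induction j arbitrary: H z)
 case (Suc j)
 have l2: "0 < l^2" using l by simp
 have lj: "(5 + real j) * l^2 <= (5 + real (Suc j)) * l^2" by (intro mult_right_mono) auto
 have IH: "2^g * H <= u y" if "y : slab x (5 * l) (t + l^2) (t + (5 + real j) * l^2)" for y
 proof (rule Suc.IH[OF _ _ that])
  show "t + (5 + real j) * l^2 <= 10" using lj Suc.prems(1) by linarith
  show "(2 ^ g) ^ j * (2^g * H) <= u z" if "z : slab x (5 * l) (t + l^2) (t + 5 * l^2)" for z
   using Suc.prems(2)[OF that] by (simp add: mult_ac)
 qed (use level[of H] Suc.prems in auto)
 show ?case
 proof (cases "snd z <= t + (5 + real j) * l^2")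
  case True
  thus ?thesis using IH[of z] Suc.prems(3,5) level(1)[of H] by (auto simp: slab_def)
 next
  case False
  show ?thesis
  proof (rule step[of H l x "t + (real j + 1) * l^2"])
   fix y assume "y : qbox x (t + (real j + 1) * l^2) l"
   hence y: "abs (fst y $ i - x $ i) < l" "t + (real j + 1) * l^2 < snd y" "snd y <= t + (real j + 1) * l^2 + l^2" for i by (auto simp: qbox_def)
   have "l^2 <= (real j + 1) * l^2" "(real j + 1) * l^2 + l^2 <= (5 + real j) * l^2" by (simp_all add: distrib_right)
   hence "t + l^2 <= snd y" "snd y <= t + (5 + real j) * l^2" using y(2,3) by linarith+
   moreover have "abs (fst y $ i - x $ i) <= 5 * l" for i using y(1)[of i] l by linarith
   ultimately have "y : slab x (5 * l) (t + l^2) (t + (5 + real j) * l^2)" by (simp add: slab_def)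
   thus "2^g * H <= u y" by (rule IH)
  qed (use Suc.prems l x t False l2 in \<open>auto simp: slab_def algebra_simps\<close>)
 qed
qed simp

text \<open>The widening 5 leaves room for a shift by at most \<open>2 * l\<close> per coordinate
  within a time between \<open>l^2\<close> and \<open>4 * l^2\<close>, so boxes of equal size can
  follow a straight line.\<close>

lemma chain:
 assumes l: "0 < l" "l <= ls" and t: "0 <= t" and v: "!!i. abs (v $ i) <= 2 * l" and tau: "l^2 <= tau" "tau <= 4 * l^2"
 shows "omega <= H ==> 0 <= H ==> (!!i j. j <= k ==> abs (x $ i + real j * v $ i) <= 8) ==> t + real k * tau + 5 * l^2 <= 10 ==>
  (!!z. z : qbox x t l ==> (2^g)^k * H <= u z) ==> z : qbox (x + real k *R v) (t + real k * tau) l ==> H <= u z"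
proof (induction k arbitrary: H z)
 case (Suc k)
 have tau0: "tau >= 0" using tau(1) by (rule order_trans[rotated]) simp
 have IH: "2^g * H <= u y" if "y : qbox (x + real k *R v) (t + real k * tau) l" for y
  using Suc.prems tau0 level[of H] by (intro Suc.IH[OF _ _ _ _ _ that]) (auto simp: algebra_simps)
 show ?case
 proof (rule step[OF Suc.prems(1,2) l _ _ _ IH])
  show "abs ((x + real k *R v) $ i) <= 8" for i using Suc.prems(3)[of k i] by simp
  show "0 <= t + real k * tau" "t + real k * tau + 5 * l^2 <= 10" using t tau0 Suc.prems(4) by (auto simp: algebra_simps)
  have "abs (fst z $ i - (x + real k *R v) $ i) <= 5 * l" for i
  proof -
   have "abs (fst z $ i - (x $ i + real k * v $ i + v $ i)) < l" using Suc.prems(6) by (simp add: qbox_def algebra_simps)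
   thus ?thesis using v[of i] by simp
  qed
  thus "z : slab (x + real k *R v) (5 * l) (t + real k * tau + l^2) (t + real k * tau + 5 * l^2)"
   using Suc.prems(6) tau by (auto simp: qbox_def slab_def algebra_simps)
 qed
qed simp

text \<open>The slab above a box contains the box of twice the radius that starts when the first one
  ends. The durations passed add up to the geometric sum \<open>(4^k - 1) / 3 * l^2\<close>.\<close>

lemma doubling:
 assumes x: "!!i. abs (x $ i) <= 8" and t: "0 <= t" "t + 6 * ls^2 <= 10" and l: "0 < l"
 shows "omega <= H ==> 0 <= H ==> 2^k * l <= 2 * ls ==>
  (!!z. z : qbox x t l ==> (2^g)^k * H <= u z) ==> z : qbox x (t + (4^k - 1) / 3 * l^2) (2^k * l) ==> H <= u z"
proof (induction k arbitrary: H z)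
 case (Suc k)
 have kl: "2^k * l <= ls" using Suc.prems(3) by simp
 have k0: "0 < 2^k * l" using l by simp
 have IH: "2^g * H <= u y" if "y : qbox x (t + (4^k - 1) / 3 * l^2) (2^k * l)" for y
  using Suc.prems level[of H] kl k0 by (intro Suc.IH[OF _ _ _ _ that]) (auto simp: algebra_simps)
 have e: "(2^k * l)^2 = 4^k * l^2" by (simp add: power_mult_distrib power_mult[symmetric] mult.commute[of k]) (simp add: power_mult)
 have b: "4^k * l^2 <= ls^2" unfolding e[symmetric] using kl k0 by (intro power_mono) auto
 have p1: "1 * l^2 <= 4^k * l^2" by (intro mult_right_mono) auto
 show ?case
 proof (rule step[OF Suc.prems(1,2) k0 kl x _ _ IH])
  show "0 <= t + (4^k - 1) / 3 * l^2" using t p1 by (simp add: algebra_simps)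
  have Y: "0 <= l^2" by simp
  have "t + (X - Y) / 3 + 5 * X <= 10" if "X <= Z" "Y <= X" "0 <= Y" "t + 6 * Z <= 10" for X Y Z :: real using that by (simp add: diff_divide_distrib)
  from this[OF b _ Y t(2)] p1 have "t + (4^k * l^2 - l\<^sup>2) / 3 + 5 * (4^k * l^2) <= 10" by simp
  thus "t + (4^k - 1) / 3 * l^2 + 5 * (2^k * l)^2 <= 10" unfolding e by (simp add: left_diff_distrib)
  have "abs (fst z $ i - x $ i) <= 5 * (2^k * l)" for i
  proof -
   have "abs (fst z $ i - x $ i) < 2 * (2^k * l)" using Suc.prems(5) by (simp add: qbox_def algebra_simps)
   thus ?thesis using k0 by linarith
  qed
  moreover have "(2^Suc k * l)^2 = 4 * (4^k * l^2)" by (simp add: power_mult_distrib e[symmetric])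
  ultimately show "z : slab x (5 * (2^k * l)) (t + (4^k - 1) / 3 * l^2 + (2^k * l)^2) (t + (4^k - 1) / 3 * l^2 + 5 * (2^k * l)^2)"
   unfolding e using Suc.prems(5) by (auto simp: qbox_def slab_def field_simps)
 qed
qed simp

text \<open>Doubling brings the radius close to \<open>ls\<close>, then a chain of boxes of that
  size runs straight to the target. The number of chain steps is bounded; the doublings cost
  \<open>2^g\<close> each, which amounts to the power \<open>g\<close> of the initial
  radius.\<close>

lemma spread:
 fixes c :: real
 defines "c \<equiv> 1 / (2^g)^(nat \<lceil>40 / ls^2\<rceil> + 1)"
 assumes x: "!!i. abs (x $ i) <= 2" and t: "0 <= t" "t <= 1" and l: "0 < l" "l <= ls" "ls <= 1/4"
  and H: "omega <= c * H * l^g" "0 <= H" and b: "!!z. z : qbox x t l ==> H <= u z" and z: "z : J2"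
 shows "c * H * l^g <= u z"
proof -
 define k where "k = nat \<lfloor>log 2 (ls / l)\<rfloor>"
 have k: "2^k * l <= ls" "ls < 2 * (2^k * l)"
 proof -
  have lg: "0 <= log 2 (ls / l)" using l by simp
  hence "real k <= log 2 (ls / l)" "log 2 (ls / l) < real k + 1" by (simp_all add: k_def)
  hence "2 powr real k <= ls / l" "ls / l < 2 powr (real k + 1)" using l by (simp_all add: le_log_iff log_less_iff)
  thus "2^k * l <= ls" "ls < 2 * (2^k * l)" using l by (simp_all add: powr_realpow powr_add pos_le_divide_eq pos_divide_less_eq)
 qed
 define Lb where "Lb = 2^k * l"
 have Lb: "0 < Lb" "Lb <= 1/4" "ls / 2 <= Lb" "Lb <= ls" using l k by (auto simp: Lb_def)
 have Lb2: "Lb^2 <= (1/4)^2" "(ls/2)^2 <= Lb^2" "Lb^2 > 0" "ls^2 <= (1/4)^2" using Lb l by (auto intro: power_mono)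
 define t1 where "t1 = t + (4^k - 1) / 3 * l^2"
 have X: "4^k * l^2 = Lb^2" by (simp add: Lb_def power_mult_distrib power_mult[symmetric] mult.commute[of k]) (simp add: power_mult)
 have "1 * l^2 <= 4^k * l^2" by (intro mult_right_mono) auto
 moreover have "0 <= t + (X - Y) / 3 & t + (X - Y) / 3 <= 1 + 1/48" if "1 * Y <= X" "0 <= Y" "X <= (1/4)^2" for X Y :: real
  using that t by (simp add: power2_eq_square diff_divide_distrib)
 ultimately have "0 <= t + (4^k * l^2 - l\<^sup>2) / 3 & t + (4^k * l^2 - l\<^sup>2) / 3 <= 1 + 1/48" using Lb2(1) X by auto
 hence t1: "0 <= t1" "t1 <= 1 + 1/48" by (simp_all add: t1_def left_diff_distrib)
 have g1: "(2::real)^g >= 1" by simp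
 have J: "9 < snd z" "snd z <= 10" "abs (fst z $ i) < 1" for i
  using z by (cases z; auto simp: J2_def cube_def mem_box_cart abs_less_between)+
 \<comment> \<open>Time available to the chain, leaving \<open>5 * Lb^2\<close> so that
   \<open>z\<close> lies exactly on the top of the last slab.\<close>
 define T where "T = snd z - t1 - 5 * Lb^2"
 have T: "T >= 7" "T <= 10" using J(1,2) t1 Lb2 by (auto simp: T_def power2_eq_square)
 \<comment> \<open>With this number of steps each lasts between one and four box durations. As at
   least 7 units of time remain and \<open>Lb <= 1/4\<close>, there are enough steps for each shift
   to stay below two radii.\<close>
 define K where "K = nat \<lfloor>T / Lb^2\<rfloor>"
 have "T / Lb^2 >= 7 / (1/4)^2" using T Lb2 by (intro frac_le) auto
 hence T2: "T / Lb^2 >= 112" by (simp add: power2_eq_square)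
 hence K1: "real K <= T / Lb^2" "T / Lb^2 < real K + 1" by (simp_all add: K_def)
 hence K2: "real K >= 111" "K > 0" using T2 by linarith+
 have KT: "real K * Lb^2 <= T" "T <= 2 * real K * Lb^2" "T < (real K + 1) * Lb^2"
 proof -
  show "real K * Lb^2 <= T" using K1(1) Lb2 by (simp add: pos_le_divide_eq)
  show *: "T < (real K + 1) * Lb^2" using K1(2) Lb2 by (simp add: pos_divide_less_eq)
  have "(real K + 1) * Lb^2 <= 2 * real K * Lb^2" using K2 Lb2 by (intro mult_right_mono) auto
  thus "T <= 2 * real K * Lb^2" using * by linarith
 qed
 have K3: "K <= nat \<lceil>40 / ls^2\<rceil>"
 proof -
  have "T / Lb^2 <= 10 / (ls/2)^2" using T Lb2 l by (intro frac_le) auto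
  also have "... = 40 / ls^2" by (simp add: power_divide)
  finally have "real K <= 40 / ls^2" using K1 by linarith
  thus ?thesis by linarith
 qed
 define v where "v = (1 / real K) *R (fst z - x)"
 define tau where "tau = T / real K"
 have Kt: "real K * tau = T" "real K *R v = fst z - x" using K2 by (simp_all add: tau_def v_def)
 have tau: "Lb^2 <= tau" "tau <= 4 * Lb^2" using KT K2 Lb2 by (auto simp: tau_def pos_le_divide_eq pos_divide_le_eq mult_ac)
 have v: "abs (v $ i) <= 2 * Lb" for i
 proof -
  have "7 <= (2 * real K * Lb) * Lb" using T KT by (simp add: power2_eq_square mult.assoc)
  also have "... <= (2 * real K * Lb) * (1/4)" using Lb by (intro mult_left_mono) auto
  finally have "28 <= 2 * real K * Lb" by simp
  moreover have "abs (fst z $ i - x $ i) <= 3" using x[of i] J(3)[of i] by linarith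
  ultimately have "abs (fst z $ i - x $ i) <= 2 * real K * Lb" by linarith
  thus ?thesis using K2 by (simp add: v_def abs_mult pos_divide_le_eq mult_ac)
 qed
 \<comment> \<open>The final level, from which all losses are multiplied back: \<open>k\<close>
   doublings, \<open>K\<close> chain steps and one last step onto \<open>z\<close>.\<close>
 define H2 where "H2 = H / (2^g)^k / (2^g)^(K + 1)"
 have H2: "c * H * l^g <= H2" "0 <= H2"
 proof -
  have "l^g * (2^g)^k = Lb^g" by (simp add: Lb_def power_mult_distrib power_mult[symmetric] mult.commute)
  also have "... <= 1" using Lb by (intro power_le_one) auto
  finally have 1: "l^g <= 1 / (2^g)^k" by (simp add: pos_le_divide_eq)
  have 2: "c <= 1 / (2^g)^(K + 1)" unfolding c_def using g1 K3 by (intro divide_left_mono power_increasing) auto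
  have "c * l^g <= (1 / (2^g)^(K + 1)) * (1 / (2^g)^k)" using 1 2 l by (intro mult_mono) auto
  from mult_left_mono[OF this H(2)] show "c * H * l^g <= H2" by (simp add: H2_def mult_ac)
  show "0 <= H2" using H by (simp add: H2_def)
 qed
 have ch: "2^g * H2 <= u y" if y: "y : qbox (x + real K *R v) (t1 + real K * tau) Lb" for y
 proof (rule chain[OF Lb(1,4) t1(1) v tau _ _ _ _ _ y])
  show "omega <= 2^g * H2" "0 <= 2^g * H2" using H H2 level[of H2] by auto
  show "abs (x $ i + real j * v $ i) <= 8" if "j <= K" for i j
  proof -
   have "real j * abs (v $ i) <= real K * abs (v $ i)" using that by (intro mult_right_mono) auto
   also have "... = abs (fst z $ i - x $ i)" using K2 by (simp add: v_def abs_mult)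
   finally have "abs (real j * v $ i) <= 3" using x[of i] J(3)[of i] by (simp add: abs_mult)
   thus ?thesis using x[of i] by linarith
  qed
  show "t1 + real K * tau + 5 * Lb^2 <= 10" using J unfolding Kt by (simp add: T_def)
  fix y assume y: "y : qbox x t1 Lb"
  have e: "(2^g)^K * (2^g * H2) = H / (2^g)^k" by (simp add: H2_def)
  show "(2^g)^K * (2^g * H2) <= u y" unfolding e
  proof (rule doubling[OF _ t(1) _ l(1), where k=k])
   show "abs (x $ i) <= 8" for i using x[of i] by simp
   show "t + 6 * ls^2 <= 10" using t Lb2 by (simp add: power2_eq_square)
   have "1 * H2 <= (2^g)^(K+1) * H2" using H2 g1 by (intro mult_right_mono one_le_power) auto
   thus "omega <= H / (2^g)^k" using H H2 by (simp add: H2_def)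
   show "y : qbox x (t + (4^k - 1) / 3 * l^2) (2^k * l)" using y by (simp add: t1_def Lb_def)
   show "2^k * l <= 2 * ls" using Lb l by (simp add: Lb_def)
  qed (use H b in auto)
 qed
 have "H2 <= u z"
 proof (rule step[OF _ _ Lb(1,4) _ _ _ ch])
  show "omega <= H2" "0 <= H2" using H H2 by auto
  show "abs ((x + real K *R v) $ i) <= 8" for i unfolding Kt using J(3)[of i] by simp
  show "0 <= t1 + real K * tau" "t1 + real K * tau + 5 * Lb^2 <= 10" using J T t1 unfolding Kt by (simp_all add: T_def)
  show "z : slab (x + real K *R v) (5 * Lb) (t1 + real K * tau + Lb^2) (t1 + real K * tau + 5 * Lb^2)"
   unfolding Kt using Lb by (auto simp: slab_def T_def)
 qed
 thus ?thesis using H2 by linarith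
qed

end

section \<open>Crawling ink spots\<close>

lemma bounded_fmeasurable: "A : sets borel ==> bounded A ==> A : fmeasurable lborel" for A :: "'a::euclidean_space set"
 using emeasure_bounded_finite by (auto intro!: fmeasurableI)

text \<open>Walking from left to right, always jump to the end of the interval that starts first: on each jump the upper
 parts of the intervals cover the required fraction.\<close>

lemma stack_measure:
 fixes s tau :: "'i => real" and m t :: real
 assumes F: "finite F" and tau: "!!i. tau i > 0" and m: "m > 0"
 shows "m / (m + 1) * meas ((UN i:F. {s i<..s i + (m + 1) * tau i}) \<inter> {t<..})
  <= meas ((UN i:F. {s i + tau i<..s i + (m + 1) * tau i}) \<inter> {t<..})"
proof (induction "card {i:F. t < s i + (m + 1) * tau i}" arbitrary: t rule: less_induct)
 case less
 define e where "e i = s i + (m + 1) * tau i" for i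
 let ?U = "UN i:F. {s i<..e i}" and ?J = "UN i:F. {s i + tau i<..e i}" and ?theta = "m / (m + 1)"
 have se: "s i + tau i < e i" "s i < s i + tau i" for i using tau[of i] m by (simp_all add: e_def distrib_right)
 have fm: "?U \<inter> {t<..} : fmeasurable lborel" "?J \<inter> {t<..} : fmeasurable lborel" for t
  using F by (auto intro!: bounded_fmeasurable bounded_Int)
 show ?case
 proof (cases "{i:F. t < e i} = {}")
  case True
  hence "?U \<inter> {t<..} = {}" by (force simp: not_less)
  thus ?thesis by (simp add: e_def)
 next
  case False
  note fin = finite_subset[OF Collect_restrict F, of "%i. t < e i"]
  define j where "j = arg_min_on s {i:F. t < e i}"
  have j: "j : F" "t < e j" "!!i. i : F ==> t < e i ==> s j <= s i"
   using arg_min_if_finite[OF fin False, of s] unfolding j_def[symmetric] by (auto simp: not_less)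
  \<comment> \<open>Intervals that reach beyond \<open>t\<close> start no earlier than
    \<open>s j\<close>, so the union misses everything between \<open>t\<close> and
    \<open>t'\<close>.\<close>
  define t' where "t' = max t (s j)"
  have t': "t <= t'" "s j <= t'" "t' < e j" using j(2) se[of j] by (auto simp: t'_def)
  have "card {i:F. e j < e i} < card {i:F. t < e i}" using F j by (intro psubset_card_mono) auto
  hence IH: "?theta * meas (?U \<inter> {e j<..}) <= meas (?J \<inter> {e j<..})"
   using less[of "e j"] unfolding e_def[symmetric] by simp
  have "?U \<inter> {t<..} <= {t'<..e j} \<union> (?U \<inter> {e j<..})"
  proof
   fix y assume "y : ?U \<inter> {t<..}"
   then obtain i where i: "i : F" "s i < y" "y <= e i" "t < y" by auto
   hence "t' < y" using j(3)[of i] by (simp add: t'_def)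
   thus "y : {t'<..e j} \<union> (?U \<inter> {e j<..})" using i by auto
  qed
  hence "meas (?U \<inter> {t<..}) <= meas ({t'<..e j} \<union> (?U \<inter> {e j<..}))"
   by (rule measure_mono_fmeasurable[OF _ _ fmeasurable.Un[OF _ fm(1)]]) (use fm(1)[of t] in \<open>auto simp: fmeasurableD intro!: bounded_fmeasurable\<close>)
  also have "... <= meas {t'<..e j} + meas (?U \<inter> {e j<..})" using fm(1)[of "e j"] by (intro measure_Un_le) (auto simp: fmeasurableD)
  finally have 1: "meas (?U \<inter> {t<..}) <= (e j - t') + meas (?U \<inter> {e j<..})" using t' by simp
  define r where "r = max t' (s j + tau j)"
  have r: "r <= e j" using t' se[of j] by (simp add: r_def)
  have "meas {r<..e j} + meas (?J \<inter> {e j<..}) = meas ({r<..e j} \<union> (?J \<inter> {e j<..}))"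
   by (rule measure_Un_AE[symmetric]) (use fm(2)[of "e j"] in \<open>auto simp: fmeasurableD intro!: bounded_fmeasurable AE_I2\<close>)
  also have "... <= meas (?J \<inter> {t<..})"
  proof (rule measure_mono_fmeasurable[OF _ _ fm(2)])
   show "{r<..e j} \<union> (?J \<inter> {e j<..}) <= ?J \<inter> {t<..}" using j t' by (auto simp: r_def)
  qed (use fm(2)[of "e j"] in \<open>auto simp: fmeasurableD\<close>)
  finally have 2: "(e j - r) + meas (?J \<inter> {e j<..}) <= meas (?J \<inter> {t<..})" using r by simp
  have "?theta * (e j - t') <= e j - r"
  proof (cases "s j + tau j <= t'")
   case True
   have "?theta * (e j - t') <= 1 * (e j - t')" using t' m by (intro mult_right_mono) auto
   thus ?thesis using True by (simp add: r_def)
  next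
   case False
   have "?theta * (e j - t') <= ?theta * (e j - s j)" using t' m by (intro mult_left_mono) auto
   also have "... = m * tau j" using m by (simp add: e_def)
   finally show ?thesis using False by (simp add: r_def e_def algebra_simps)
  qed
  moreover have "?theta * meas (?U \<inter> {t<..}) <= ?theta * ((e j - t') + meas (?U \<inter> {e j<..}))" using 1 m by (intro mult_left_mono) auto
  ultimately show ?thesis using 2 IH unfolding e_def[symmetric] by (simp only: distrib_left)
 qed
qed

text \<open>A ceiling is determined by the integers above it, and multiplying by \<open>N\<close>
  keeps integers among the bounds that are tested. This makes cells of successive levels
  nested.\<close>

lemma ceiling_mult_cong: "N > 0 ==> \<lceil>real N * a\<rceil> = \<lceil>real N * b\<rceil> ==> \<lceil>a\<rceil> = \<lceil>b\<rceil>"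
proof -
 assume N: "N > 0" and e: "\<lceil>real N * a\<rceil> = \<lceil>real N * b\<rceil>"
 have "\<lceil>a\<rceil> <= i \<longleftrightarrow> \<lceil>real N * a\<rceil> <= int N * i" for a i using N by (simp add: ceiling_le_iff)
 thus ?thesis using e by (metis order_antisym order_refl)
qed

section \<open>Dyadic parabolic cells\<close>

locale cells =
 fixes x0 :: "real^'n::finite" and t0 l :: real
 assumes l: "l > 0"
begin

definition len :: "nat => real" where "len k = l / 2^k"
text \<open>Ceilings make the cells open on the left and closed on the right, like the time
  intervals of the cylinders; as level sets of \<open>idx\<close> they partition the space. Here
  \<open>x0\<close> is the lower corner, and each level halves lengths and quarters
  durations.\<close>

definition idx :: "nat => (real^'n)*real => (int^'n) \<times> int" where
 "idx k z = (\<chi> a. \<lceil>(fst z $ a - x0 $ a) / (2 * len k)\<rceil>, \<lceil>(snd z - t0) / (len k)^2\<rceil>)"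
definition cell :: "nat => (real^'n)*real => ((real^'n)*real) set" where "cell k z = {w. idx k w = idx k z}"
definition Q0 :: "((real^'n)*real) set" where "Q0 = {z. (ALL a. x0 $ a < fst z $ a & fst z $ a <= x0 $ a + 2 * l) & t0 < snd z & snd z <= t0 + l^2}"
definition vol :: "nat => real" where "vol k = 2 ^ CARD('n) * len k ^ hdim TYPE('n)"
text \<open>The centre of the cell in space; with its initial time \<open>ct\<close> a cell is a
  \<open>qbox\<close> up to faces.\<close>

definition cx :: "nat => (real^'n)*real => real^'n" where "cx k z = (\<chi> a. x0 $ a + (2 * real_of_int (fst (idx k z) $ a) - 1) * len k)"
definition ct :: "nat => (real^'n)*real => real" where "ct k z = t0 + (real_of_int (snd (idx k z)) - 1) * (len k)^2"

lemma len: "len k > 0" "len (Suc k) = len k / 2" "len k <= l" and len_0: "len 0 = l"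
 using l by (auto simp: len_def field_simps)

lemma cell_iff: "w : cell k z \<longleftrightarrow> (ALL a. cx k z $ a - len k < fst w $ a & fst w $ a <= cx k z $ a + len k) & ct k z < snd w & snd w <= ct k z + (len k)^2"
proof -
 have L: "2 * len k > 0" "(len k)^2 > 0" using len[of k] by auto
 have 1: "\<lceil>y / c\<rceil> = i \<longleftrightarrow> (real_of_int i - 1) * c < y & y <= real_of_int i * c" if "c > 0" for y c i
  using that by (simp add: ceiling_eq_iff pos_less_divide_eq pos_divide_le_eq)
 have "w : cell k z \<longleftrightarrow> (ALL a. \<lceil>(fst w $ a - x0 $ a) / (2 * len k)\<rceil> = fst (idx k z) $ a) & \<lceil>(snd w - t0) / (len k)^2\<rceil> = snd (idx k z)"
  unfolding cell_def mem_Collect_eq idx_def[of k w] by (auto simp: prod_eq_iff vec_eq_iff)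
 thus ?thesis unfolding 1[OF L(1)] 1[OF L(2)] by (simp add: cx_def ct_def algebra_simps less_diff_eq)
qed

lemma self_cell: "z : cell k z" by (simp add: cell_def)

lemma cell_cbox: "box (cx k z - vec (len k), ct k z) (cx k z + vec (len k), ct k z + (len k)^2) <= cell k z"
 "cell k z <= cbox (cx k z - vec (len k), ct k z) (cx k z + vec (len k), ct k z + (len k)^2)"
 by (auto simp: cell_iff mem_box_Pair mem_box_cart less_imp_le)

lemma cell_borel [measurable]: "cell k z : sets borel"
proof -
 have [measurable]: "(%w :: (real^'n)*real. fst w $ a) : Bor" "(snd :: (real^'n)*real => real) : Bor" for a
  by (intro borel_measurable_continuous_onI continuous_intros)+
 have "cell k z = {w : space borel. (ALL a. cx k z $ a - len k < fst w $ a & fst w $ a <= cx k z $ a + len k) & ct k z < snd w & snd w <= ct k z + (len k)^2}"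
  by (auto simp: cell_iff)
 also have "... : sets borel" by (measurable)
 finally show ?thesis .
qed

lemma cell_measure: "meas (cell k z) = vol k" "cell k z : fmeasurable lborel"
proof -
 let ?a = "(cx k z - vec (len k), ct k z)" and ?b = "(cx k z + vec (len k), ct k z + (len k)^2)"
 show f: "cell k z : fmeasurable lborel" by (intro bounded_fmeasurable cell_borel bounded_subset[OF bounded_cbox cell_cbox(2)])
 have le: "?a \<bullet> b <= ?b \<bullet> b" if "b : Basis" for b using that len[of k] by (auto simp: Basis_prod_def Basis_vec_def inner_axis)
 have "cx k z - vec (len k) : cbox (cx k z - vec (len k)) (cx k z + vec (len k))" using len[of k] by (simp add: mem_box_cart less_imp_le)
 hence ne: "cbox (cx k z - vec (len k)) (cx k z + vec (len k)) ~= {}" by blast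
 have pr: "meas (cbox ?a ?b) = vol k" unfolding content_Pair content_cbox_cart[OF ne]
  using len[of k] by (simp add: vol_def hdim_def power_mult_distrib power_add power2_eq_square)
 moreover have "meas (box ?a ?b) = meas (cbox ?a ?b)" using le by (simp add: measure_lborel_box_eq measure_lborel_cbox_eq)
 moreover have "meas (box ?a ?b) <= meas (cell k z)" by (intro measure_mono_fmeasurable cell_cbox f) auto
 moreover have "meas (cell k z) <= meas (cbox ?a ?b)" using f by (intro measure_mono_fmeasurable cell_cbox fmeasurable_cbox) (auto simp: fmeasurableD)
 ultimately show "meas (cell k z) = vol k" by linarith
qed

lemma idx_coarser: "idx (Suc k) w = idx (Suc k) z ==> idx k w = idx k z"
proof -
 assume e: "idx (Suc k) w = idx (Suc k) z"
 have c: "y / (2 * len (Suc k)) = real 2 * (y / (2 * len k))" "y / (len (Suc k))^2 = real 4 * (y / (len k)^2)" for y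
  using len(1)[of k] by (simp_all add: len(2) power_divide)
 have "\<lceil>real 2 * ((fst w $ a - x0 $ a) / (2 * len k))\<rceil> = \<lceil>real 2 * ((fst z $ a - x0 $ a) / (2 * len k))\<rceil>"
  "\<lceil>real 4 * ((snd w - t0) / (len k)^2)\<rceil> = \<lceil>real 4 * ((snd z - t0) / (len k)^2)\<rceil>" for a
  using e unfolding idx_def c by (auto simp: vec_eq_iff simp del: of_nat_numeral times_divide_eq_right)
 thus ?thesis using ceiling_mult_cong unfolding idx_def by (simp add: vec_eq_iff del: of_nat_numeral times_divide_eq_right) (meson zero_less_numeral)
qed

lemma cell_coarser: "j <= k ==> w : cell k z ==> w : cell j z"
 by (induction rule: inc_induct) (auto simp: cell_def dest: idx_coarser)

lemma Q0_cell: "Q0 = cell 0 (x0 + vec l, t0 + l^2)"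
proof -
 have "cx 0 (x0 + vec l, t0 + l^2) = x0 + vec l" "ct 0 (x0 + vec l, t0 + l^2) = t0"
  using l by (auto simp: cx_def ct_def idx_def len_0 vec_eq_iff ceiling_eq_iff)
 thus ?thesis by (auto simp: Q0_def cell_iff len_0 algebra_simps)
qed

lemma cell_Q0: "z : Q0 ==> cell k z <= Q0" "z : Q0 ==> cell 0 z = Q0"
proof -
 assume z: "z : Q0"
 thus "cell 0 z = Q0" unfolding Q0_cell cell_def by auto
 thus "cell k z <= Q0" using cell_coarser[of 0 k] by blast
qed

end

lemma emeasure_slices:
 "A : sets borel ==> emeas A = (NL x. emeas (Pair x -` A))" for A :: "('a::euclidean_space \<times> real) set"
 using lborel.emeasure_pair_measure_alt[of A lborel] unfolding lborel_prod by simp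

lemma slice_borel: "A : sets borel ==> Pair x -` A : sets borel" for A :: "('a::euclidean_space \<times> real) set"
 using sets_Pair1[of A lborel lborel x] unfolding lborel_prod by simp

context cells
begin

lemma vol_pos: "vol k > 0" using len[of k] by (simp add: vol_def)

text \<open>Each point of \<open>A\<close> lies in a largest cell that has a dense cell one level
  down. In such a cell \<open>A\<close> itself is not dense, because its parent was not selected;
  this gives the factor \<open>1 - mu\<close>. The stacks above selected cells lie in
  \<open>B\<close>. On every vertical line they are intervals, \<open>stack_measure\<close> compares
  their lengths, and integration over the lines compares measures.\<close>

lemma ink_inequality:
 fixes A B :: "((real^'n)*real) set" and mu m :: real
 assumes A: "A : sets borel" "A <= Q0" and B: "B : sets borel" "bounded B" and mu: "0 < mu" "mu < 1" and m: "m > 0"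
  and op: "!!z. z : A ==> EX k. cell k z <= A" and sparse: "meas A <= (1 - mu) * vol 0"
  and stack: "!!k z w t. z : Q0 ==> w : cell k z ==> (1 - mu) * vol (Suc k) < meas (A \<inter> cell (Suc k) w) ==>
   ct k z + (len k)^2 < t ==> t <= ct k z + (m + 1) * (len k)^2 ==> (fst z, t) : B"
 shows "m / (m + 1) * meas A <= (1 - mu) * meas B"
proof -
 define theta where "theta = m / (m + 1)"
 have theta: "theta > 0" using m by (simp add: theta_def)
 define D where "D k z \<longleftrightarrow> z : Q0 & (EX w:cell k z. (1 - mu) * vol (Suc k) < meas (A \<inter> cell (Suc k) w))" for k z
 \<comment> \<open>Taking the first level at which \<open>D\<close> holds makes the selected cells
   maximal, hence disjoint.\<close>
 define G where "G k = {z. D k z & (ALL j<k. ~ D j z)}" for k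
 have Dinv: "D j w" if "D j z" "w : cell j z" for j w z
 proof -
  have "cell j w = cell j z" using that(2) by (simp add: cell_def)
  thus ?thesis using that cell_Q0(1)[of z j] unfolding D_def by blast
 qed
 have sym: "z : cell j w" if "w : cell j z" for j w z using that by (simp add: cell_def)
 have Ginv: "w : G k" if z: "z : G k" and w: "w : cell k z" for k w z
 proof -
  have "D k w" using z w Dinv unfolding G_def by blast
  moreover have "~ D j w" if "j < k" for j
   using Dinv[of j w z] sym[OF cell_coarser[OF less_imp_le[OF that] w]] z that unfolding G_def by blast
  ultimately show ?thesis by (simp add: G_def)
 qed
 define pc where "pc p = {z : G (fst p). idx (fst p) z = snd p}" for p
 have pc: "pc p = cell (fst p) z" if "z : pc p" for p z
 proof -
  have z: "z : G (fst p)" "snd p = idx (fst p) z" using that by (auto simp: pc_def)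
  show ?thesis using Ginv[OF z(1)] unfolding pc_def z(2) cell_def by blast
 qed
 have pcb: "pc p : sets borel" for p
 proof (cases "pc p = {}")
  case False
  then obtain z where "z : pc p" by blast
  from pc[OF this] show ?thesis by (simp add: cell_borel)
 qed simp
 define GN where "GN N = (UN p:{..<N} \<times> UNIV. pc p)" for N
 have GN: "z : GN N \<longleftrightarrow> (EX k<N. z : G k)" for z N by (auto simp: GN_def pc_def)
 have GNb[measurable]: "GN N : sets borel" for N unfolding GN_def using pcb by (intro sets.countable_UN'') auto
 have AB[measurable]: "A : sets borel" "B : sets borel" using A B by auto
 have Q0f: "Q0 : fmeasurable lborel" unfolding Q0_cell by (rule cell_measure)
 have Af: "A : fmeasurable lborel" using fmeasurableI2[OF Q0f A(2)] A(1) by simp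
 have Bf: "B : fmeasurable lborel" using B by (rule bounded_fmeasurable)
 have low: "emeas (A \<inter> pc p) <= ennreal (1 - mu) * emeas (pc p)" for p
 proof (cases "pc p = {}")
  case False
  then obtain z where z: "z : pc p" by blast
  obtain k c where p: "p = (k, c)" by (cases p)
  have zG: "z : G k" using z p by (simp add: pc_def)
  have f: "A \<inter> cell k z : fmeasurable lborel" using Af cell_borel by (intro fmeasurable_Int_fmeasurable) auto
  have "meas (A \<inter> cell k z) <= (1 - mu) * vol k"
  proof (cases k)
   case 0
   have "meas (A \<inter> cell k z) <= meas A" using f Af by (intro measure_mono_fmeasurable) (auto simp: fmeasurableD)
   thus ?thesis using sparse 0 by simp
  next
   case (Suc k')
   hence "~ D k' z" "z : Q0" using zG by (auto simp: G_def D_def)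
   thus ?thesis using self_cell[of z k'] Suc unfolding D_def by (auto simp: not_less)
  qed
  hence "ennreal (meas (A \<inter> cell k z)) <= ennreal (1 - mu) * ennreal (meas (cell k z))"
   using mu vol_pos[of k] by (simp add: cell_measure(1) ennreal_mult[symmetric] ennreal_leI less_imp_le)
  thus ?thesis using f cell_measure(2)[of k z] pc[OF z] p by (simp add: emeasure_eq_measure2)
 qed simp
 have AG: "emeas (A \<inter> GN N) <= ennreal (1 - mu) * emeas (GN N)" for N
 proof -
  have disj: "disjoint_family_on pc ({..<N} \<times> UNIV)"
   unfolding disjoint_family_on_def
  proof (intro ballI impI)
   fix p p' :: "nat \<times> (int^'n) \<times> int" assume ne: "p ~= p'"
   show "pc p \<inter> pc p' = {}"
   proof (rule ccontr)
    assume "pc p \<inter> pc p' ~= {}"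
    then obtain z where z: "z : G (fst p)" "z : G (fst p')" "idx (fst p) z = snd p" "idx (fst p') z = snd p'" by (auto simp: pc_def)
    hence "fst p = fst p'" using linorder_cases[of "fst p" "fst p'"] by (auto simp: G_def)
    thus False using z ne by (simp add: prod_eq_iff)
   qed
  qed
  have "emeas (A \<inter> GN N) = emeas (UN p:{..<N} \<times> UNIV. A \<inter> pc p)" unfolding GN_def by (simp only: Int_UN_distrib)
  also have "... = (\<integral>\<^sup>+p. emeas (A \<inter> pc p) \<partial>count_space ({..<N} \<times> UNIV))"
  proof (rule emeasure_UN_countable)
   show "disjoint_family_on (%p. A \<inter> pc p) ({..<N} \<times> UNIV)" using disj unfolding disjoint_family_on_def by blast
  qed (use pcb A in auto)
  also have "... <= (\<integral>\<^sup>+p. ennreal (1 - mu) * emeas (pc p) \<partial>count_space ({..<N} \<times> UNIV))" by (intro nn_integral_mono low)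
  also have "... = ennreal (1 - mu) * (\<integral>\<^sup>+p. emeas (pc p) \<partial>count_space ({..<N} \<times> UNIV))" by (rule nn_integral_cmult) simp
  also have "(\<integral>\<^sup>+p. emeas (pc p) \<partial>count_space ({..<N} \<times> UNIV)) = emeas (GN N)"
   unfolding GN_def using disj pcb by (intro emeasure_UN_countable[symmetric]) auto
  finally show ?thesis .
 qed
 have GB: "ennreal theta * emeas (GN N) <= emeas B" for N
 proof -
  have sl: "ennreal theta * emeas (Pair x -` GN N) <= emeas (Pair x -` B)" for x
  proof -
   \<comment> \<open>On the vertical line through \<open>x\<close> a selected cell is named by its
     level and its position in time, and the bounds on both make the family finite. The sample point
     is the top of the cell, which belongs to it.\<close>
   define F where "F = {(k, i). k < N & i : {1..4^N} & (x, t0 + real_of_int i * (len k)^2) : G k}"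
   define s where "s p = t0 + (real_of_int (snd p) - 1) * (len (fst p))^2" for p :: "nat \<times> int"
   define tau where "tau p = (len (fst p))^2" for p :: "nat \<times> int"
   have F: "finite F" by (rule finite_subset[of _ "{..<N} \<times> {1..4^N}"]) (auto simp: F_def)
   have tau: "tau p > 0" for p using len(1)[of "fst p"] by (simp add: tau_def)
   let ?U = "UN p:F. {s p<..s p + (m + 1) * tau p}" and ?J = "UN p:F. {s p + tau p<..s p + (m + 1) * tau p}"
   have idt: "\<lceil>real_of_int i * (len k)^2 / (len k)^2\<rceil> = i" for i k using len(1)[of k] by simp
   have GU: "Pair x -` GN N <= ?U"
   proof
    fix t assume "t : Pair x -` GN N"
    then obtain k where k: "k < N" "(x, t) : G k" by (auto simp: GN)
    define i where "i = \<lceil>(t - t0) / (len k)^2\<rceil>"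
    have L: "(len k)^2 > 0" using len(1)[of k] by simp
    have i: "(real_of_int i - 1) * (len k)^2 < t - t0" "t - t0 <= real_of_int i * (len k)^2"
     using ceiling_correct[of "(t - t0) / (len k)^2"] L unfolding i_def[symmetric] by (simp_all add: pos_less_divide_eq pos_divide_le_eq)
    have Q: "t0 < t" "t - t0 <= l^2" using k(2) by (auto simp: G_def D_def Q0_def)
    have "i >= 1" unfolding i_def using Q L by (simp add: le_ceiling_iff)
    moreover have "(t - t0) / (len k)^2 <= 4^k"
    proof -
     have "(len k)^2 * 4^k = l^2" by (simp add: len_def power_divide power_mult[symmetric] mult.commute[of k]) (simp add: power_mult)
     thus ?thesis using Q L by (simp add: pos_divide_le_eq mult.commute)
    qed
    hence "i <= 4^k" unfolding i_def by (simp add: ceiling_le_iff)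
    hence "i <= 4^N" by (rule order_trans) (use k in \<open>auto intro: power_increasing\<close>)
    moreover have "(x, t0 + real_of_int i * (len k)^2) : G k"
    proof (rule Ginv[OF k(2)])
     show "(x, t0 + real_of_int i * (len k)^2) : cell k (x, t)" using len(1)[of k] by (simp add: cell_def idx_def i_def)
    qed
    ultimately have "(k, i) : F" using k by (simp add: F_def)
    moreover have "t : {s (k, i)<..s (k, i) + (m + 1) * tau (k, i)}"
    proof -
     have "real_of_int i * (len k)^2 <= (real_of_int i + m) * (len k)^2" using m L by (intro mult_right_mono) auto
     thus ?thesis using i by (simp add: s_def tau_def algebra_simps)
    qed
    ultimately show "t : ?U" by blast
   qed
   have JB: "?J <= Pair x -` B"
   proof
    fix t assume "t : ?J"
    then obtain k i where ki: "(k, i) : F" "s (k, i) + tau (k, i) < t" "t <= s (k, i) + (m + 1) * tau (k, i)" by auto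
    let ?z = "(x, t0 + real_of_int i * (len k)^2)"
    have "D k ?z" using ki(1) by (auto simp: F_def G_def)
    then obtain w where w: "?z : Q0" "w : cell k ?z" "(1 - mu) * vol (Suc k) < meas (A \<inter> cell (Suc k) w)" unfolding D_def by blast
    have "ct k ?z = s (k, i)" using len(1)[of k] by (simp add: ct_def idx_def s_def)
    thus "t : Pair x -` B" using stack[OF w, of t] ki by (simp add: tau_def)
   qed
   have Uf: "?U : fmeasurable lborel" "?J : fmeasurable lborel" using F by (auto intro!: bounded_fmeasurable)
   \<comment> \<open>Any time below all the intervals can serve as the start of the walk in
     \<open>stack_measure\<close>.\<close>
   have st: "t0 - 1 < s p" if "p : F" for p
   proof -
    have "0 <= (real_of_int (snd p) - 1) * (len (fst p))^2" using that by (intro mult_nonneg_nonneg) (auto simp: F_def)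
    thus ?thesis by (simp add: s_def)
   qed
   have U1: "?U <= {t0 - 1<..}"
   proof
    fix y assume "y : ?U"
    then obtain p where "p : F" "s p < y" by auto
    thus "y : {t0 - 1<..}" using st[of p] by simp
   qed
   have "?J <= ?U"
   proof (intro UN_mono order_refl subsetI)
    fix p y assume "y : {s p + tau p<..s p + (m + 1) * tau p}"
    thus "y : {s p<..s p + (m + 1) * tau p}" using tau[of p] by simp
   qed
   hence "?U \<inter> {t0 - 1<..} = ?U" "?J \<inter> {t0 - 1<..} = ?J" using U1 by blast+
   hence "theta * meas ?U <= meas ?J" using stack_measure[where tau=tau and s=s and t="t0 - 1", OF F tau m] unfolding theta_def by simp
   hence "ennreal theta * emeas ?U <= emeas ?J"
    using Uf theta by (simp add: emeasure_eq_measure2 ennreal_mult[symmetric] ennreal_leI)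
   moreover have "ennreal theta * emeas (Pair x -` GN N) <= ennreal theta * emeas ?U"
    using GU Uf by (intro mult_left_mono emeasure_mono) (auto simp: fmeasurableD)
   moreover have "emeas ?J <= emeas (Pair x -` B)" using JB by (intro emeasure_mono) (auto simp: slice_borel)
   ultimately show ?thesis by (meson order_trans)
  qed
  have "ennreal theta * emeas (GN N) = (NL x. ennreal theta * emeas (Pair x -` GN N))"
  proof -
   have "GN N : sets (lborel \<Otimes>\<^sub>M lborel)" unfolding lborel_prod using GNb by simp
   from lborel.measurable_emeasure_Pair[OF this] show ?thesis
    unfolding emeasure_slices[OF GNb] by (intro nn_integral_cmult[symmetric]) simp
  qed
  also have "... <= emeas B" unfolding emeasure_slices[OF AB(2)] by (intro nn_integral_mono sl)
  finally show ?thesis .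
 qed
 have fin: "theta * meas (A \<inter> GN N) <= (1 - mu) * meas B" for N
 proof -
  have f: "A \<inter> GN N : fmeasurable lborel" using Af by (intro fmeasurable_Int_fmeasurable) auto
  have "ennreal theta * emeas (A \<inter> GN N) <= ennreal theta * (ennreal (1 - mu) * emeas (GN N))" by (intro mult_left_mono AG) simp
  also have "... = ennreal (1 - mu) * (ennreal theta * emeas (GN N))" by (simp add: mult_ac)
  also have "... <= ennreal (1 - mu) * emeas B" by (intro mult_left_mono GB) simp
  finally show ?thesis using f Bf theta mu by (simp add: emeasure_eq_measure2 ennreal_mult[symmetric])
 qed
 \<comment> \<open>A cell contained in \<open>A\<close> is dense, so by \<open>op\<close> every
   point of \<open>A\<close> has a level at which it is selected.\<close>
 have AU: "A <= (UN N. GN N)"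
 proof
  fix z assume z: "z : A"
  obtain k where k: "cell k z <= A" using op[OF z] by blast
  hence e: "A \<inter> cell k z = cell k z" by blast
  have dk: "(1 - mu) * vol k < meas (A \<inter> cell k z)" unfolding e cell_measure using mu vol_pos[of k] by simp
  have "k ~= 0"
  proof
   assume "k = 0"
   have "meas (A \<inter> cell k z) <= meas A" using Af cell_borel by (intro measure_mono_fmeasurable) auto
   thus False using dk sparse \<open>k = 0\<close> by simp
  qed
  then obtain k' where "k = Suc k'" by (cases k) auto
  hence "D k' z" using dk z A self_cell[of z k'] unfolding D_def by blast
  hence "z : G (LEAST k. D k z)" unfolding G_def by (auto intro: LeastI dest: not_less_Least)
  thus "z : (UN N. GN N)" using GN[of z "Suc (LEAST k. D k z)"] by blast
 qed
 have "(%N. meas (A \<inter> GN N)) ----> meas (UN N. A \<inter> GN N)"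
 proof (rule Lim_measure_incseq)
  show "incseq (%N. A \<inter> GN N)" by (auto simp: incseq_def GN) (meson less_le_trans)
  have "emeas (UN N. A \<inter> GN N) <= emeas A" by (intro emeasure_mono) auto
  thus "emeas (UN N. A \<inter> GN N) ~= \<infinity>" using Af by (auto simp: fmeasurable_def top_unique)
 qed auto
 moreover have "(UN N. A \<inter> GN N) = A" using AU by blast
 ultimately have "(%N. theta * meas (A \<inter> GN N)) ----> theta * meas A" by (intro tendsto_mult_left) simp
 hence "theta * meas A <= (1 - mu) * meas B" by (rule LIMSEQ_le_const2) (use fin in blast)
 thus ?thesis by (simp add: theta_def)
qed

end

text \<open>The box is centred at \<open>c0\<close>, hence the shifted corner. The factor
  \<open>2 ^ CARD('n)\<close> reconciles the volume of a cell with \<open>len k ^ hdim\<close>, and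
  the bound on \<open>l^2\<close> leaves time for the stacks.\<close>

locale ink = growing g et ls omega u + cells "c0 - vec l" t0 l
 for g :: nat and et ls omega :: real and u :: "(real^'n::finite) \<times> real => real" and c0 :: "real^'n" and t0 l +
 fixes mu :: real and m g0 :: nat
 assumes lls: "l <= ls" "l <= 1/4" and c0: "!!i. abs (c0 $ i) <= 3" and t0: "0 <= t0" "t0 <= 1" "(4 * real m + 5) * l^2 <= 1"
  and mu: "0 < mu" "mu < 1" "mu * 2 ^ CARD('n) <= et" and m: "m > 0"
begin

definition big :: "real => ((real^'n)*real) set" where "big H = {z : Q0. H < u z}"
definition dense :: "real => nat => (real^'n)*real => bool" where
 "dense H k w \<longleftrightarrow> (1 - mu) * vol k < meas (big H \<inter> cell k w)"

lemma in_Q0: "z : Q0 \<longleftrightarrow> (ALL a. c0 $ a - l < fst z $ a & fst z $ a <= c0 $ a + l) & t0 < snd z & snd z <= t0 + l^2"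
 by (simp add: Q0_def algebra_simps)

lemma lsq: "0 < l^2" "l^2 <= 1/16" using l lls power_mono[of l "1/4" 2] by (auto simp: power2_eq_square)

lemma Q0_closure: "Q0 <= closure Q_dom"
proof
 fix z assume z: "z : Q0"
 have "abs (fst z $ i) <= 10" for i using z[unfolded in_Q0, THEN conjunct1, THEN spec, of i] c0[of i] lls by linarith
 thus "z : closure Q_dom" using z t0 lsq by (auto simp: closure_Q_dom slab_def in_Q0)
qed

lemma cu: "continuous_on (closure Q_dom) u" using gr by (simp add: grow_def)

lemma Q0_f: "Q0 : fmeasurable lborel" "meas Q0 = vol 0" unfolding Q0_cell by (rule cell_measure)+

lemma big_borel: "big H : sets borel" "big H : fmeasurable lborel"
proof -
 have "{z : Q0. - u z < - H} : sets borel"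
  by (intro borel_sublevel continuous_on_minus continuous_on_subset[OF cu Q0_closure]) (use Q0_f in \<open>auto simp: fmeasurable_def\<close>)
 thus b: "big H : sets borel" by (simp add: big_def)
 show "big H : fmeasurable lborel" by (rule fmeasurableI2[OF Q0_f(1)]) (use b in \<open>auto simp: big_def\<close>)
qed

text \<open>Superlevel sets are relatively open, and the diameters of the cells tend to
  zero.\<close>

lemma big_cell:
 assumes z: "z : big H" shows "EX k. cell k z <= big H"
proof -
 have zQ: "z : Q0" and "u z > H" using z by (auto simp: big_def)
 then obtain d where d: "d > 0" "ALL w:closure Q_dom. dist w z < d --> dist (u w) (u z) < u z - H"
  using cu[unfolded continuous_on_iff, rule_format, of z "u z - H"] Q0_closure by auto
 define C where "C = 2 * real CARD('n) + 1"
 have C: "C > 0" by (simp add: C_def add_nonneg_pos)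
 obtain k where "(1/2::real)^k < d / C" using real_arch_pow_inv[of "d / C" "1/2"] d C by auto
 hence "C * (1/2)^k < d" using C by (simp add: pos_less_divide_eq mult.commute)
 moreover have "len k <= (1/2)^k" using lls by (simp add: len_def power_divide divide_right_mono)
 ultimately have kd: "C * len k < d" using C mult_left_mono[of "len k" "(1/2)^k" C] by linarith
 have "w : big H" if w: "w : cell k z" for w
 proof -
  have 1: "cx k z $ a - len k < fst w $ a & fst w $ a <= cx k z $ a + len k" "cx k z $ a - len k < fst z $ a & fst z $ a <= cx k z $ a + len k" for a
   using w self_cell[of z k] unfolding cell_iff by blast+
  have 2: "abs (snd w - snd z) <= (len k)^2" using w self_cell[of z k] unfolding cell_iff by linarith
  have "len k <= 1" using len(3)[of k] lls by linarith
  hence "(len k)^2 <= len k" using len(1)[of k] by (simp add: power2_eq_square mult_left_le)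
  moreover have "norm (fst w - fst z) <= (SUM a:(UNIV :: 'n set). 2 * len k)"
   by (rule order_trans[OF norm_le_l1_cart sum_mono]) (use 1 in \<open>smt (verit) vector_minus_component\<close>)
  moreover have "norm (w - z) <= norm (fst w - fst z) + norm (snd w - snd z)"
   using norm_Pair_le[of "fst (w - z)" "snd (w - z)"] by (cases w; cases z) simp
  ultimately have "dist w z <= C * len k" using 2 by (simp add: dist_norm C_def algebra_simps)
  hence "dist w z < d" using kd by linarith
  moreover have wQ: "w : Q0" using cell_Q0(1)[OF zQ] w by blast
  ultimately have "dist (u w) (u z) < u z - H" using d(2) Q0_closure by blast
  thus ?thesis using wQ by (simp add: big_def dist_real_def)
 qed
 thus ?thesis by blast
qed

text \<open>Everything is read off from the top centre point of the cell, which lies in the cell and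
  hence in \<open>Q0\<close>.\<close>

lemma center:
 assumes w: "w : Q0"
 shows "(cx k w, ct k w + (len k)^2) : cell k w" "abs (cx k w $ a - c0 $ a) <= l" "t0 <= ct k w" "ct k w + (len k)^2 <= t0 + l^2" "(len k)^2 <= l^2"
proof -
 show c: "(cx k w, ct k w + (len k)^2) : cell k w" using len(1)[of k] by (simp add: cell_iff)
 hence Q: "(cx k w, ct k w + (len k)^2) : Q0" using cell_Q0(1)[OF w] by blast
 show "abs (cx k w $ a - c0 $ a) <= l" using Q[unfolded in_Q0, THEN conjunct1, THEN spec, of a] by (simp add: abs_le_iff)
 show "ct k w + (len k)^2 <= t0 + l^2" using Q unfolding in_Q0 by simp
 have "0 < real_of_int (snd (idx k w)) * (len k)^2" using Q unfolding in_Q0 by (simp add: ct_def algebra_simps)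
 hence "snd (idx k w) >= 1" by (simp add: zero_less_mult_iff)
 hence "0 <= (real_of_int (snd (idx k w)) - 1) * (len k)^2" by simp
 thus "t0 <= ct k w" by (simp add: ct_def)
 show "(len k)^2 <= l^2" using len(1,3)[of k] by (intro power_mono) auto
qed

text \<open>In a dense cell the complement of the superlevel set has measure below
  \<open>mu * vol k\<close>, which is the smallness that \<open>grow\<close> asks for.\<close>

lemma dense_grow:
 assumes w: "w : Q0" and d: "dense H k w" and K: "2^g * K1 <= H" "omega <= K1" "0 <= K1"
  and z: "z : slab (cx k w) (5 * len k) (ct k w + (len k)^2) (ct k w + 5 * (len k)^2)"
 shows "K1 <= u z"
proof -
 note c = center[OF w, of k]
 have f: "big H \<inter> cell k w : fmeasurable lborel" by (intro fmeasurable_Int_fmeasurable big_borel) (use cell_borel in auto)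
 have "{y : qbox (cx k w) (ct k w) (len k). u y < 2^g * K1} <= cell k w - big H \<inter> cell k w"
 proof
  fix y assume y: "y : {y : qbox (cx k w) (ct k w) (len k). u y < 2^g * K1}"
  hence a: "abs (fst y $ a - cx k w $ a) < len k" for a by (simp add: qbox_def)
  have "cx k w $ a - len k < fst y $ a & fst y $ a <= cx k w $ a + len k" for a using a[of a] by linarith
  hence "y : cell k w" using y by (auto simp: cell_iff qbox_def)
  thus "y : cell k w - big H \<inter> cell k w" using y K(1) by (auto simp: big_def)
 qed
 hence "meas {y : qbox (cx k w) (ct k w) (len k). u y < 2^g * K1} <= meas (cell k w - big H \<inter> cell k w)"
 proof (rule measure_mono_fmeasurable)
  have "qbox (cx k w) (ct k w) (len k) <= closure Q_dom"
  proof
   fix y assume y: "y : qbox (cx k w) (ct k w) (len k)"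
   have "abs (fst y $ i) <= 10" for i
   proof -
    have "abs (fst y $ i - cx k w $ i) < len k" using y by (simp add: qbox_def)
    thus ?thesis using c(2)[of i] c0[of i] lls len(3)[of k] by linarith
   qed
   thus "y : closure Q_dom" using y c(3,4) t0 lsq by (auto simp: closure_Q_dom slab_def qbox_def)
  qed
  thus "{y : qbox (cx k w) (ct k w) (len k). u y < 2^g * K1} : sets lborel"
   using borel_sublevel[OF qbox_borel continuous_on_subset[OF cu]] by simp
 qed (use f cell_measure(2)[of k w] in \<open>auto intro!: fmeasurable_Diff simp: fmeasurableD\<close>)
 also have "... = vol k - meas (big H \<inter> cell k w)"
  unfolding cell_measure(1)[of k w, symmetric] using f cell_measure(2)[of k w] by (intro measure_Diff) (auto simp: fmeasurable_def)
 also have "... <= mu * vol k" using d by (simp add: dense_def algebra_simps)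
 also have "... = (mu * 2 ^ CARD('n)) * len k ^ hdim TYPE('n)" by (simp add: vol_def)
 also have "... <= et * len k ^ hdim TYPE('n)" using mu len(1)[of k] by (intro mult_right_mono) auto
 finally have "meas {y : qbox (cx k w) (ct k w) (len k). u y < 2^g * K1} <= et * len k ^ hdim TYPE('n)" .
 moreover have "abs (cx k w $ i) <= 8" for i using c(2)[of i] c0[of i] lls by linarith
 moreover have "ct k w + 5 * (len k)^2 <= 10" using c(4,5) t0 lsq by linarith
 moreover have "0 <= ct k w" "len k <= ls" using c(3) t0 len(3)[of k] lls by linarith+
 ultimately show ?thesis using gr K z len(1)[of k] unfolding grow_def by blast
qed

text \<open>Stacks over selected cells leave \<open>Q0\<close> only through the top. Since no cell
  of level up to \<open>g0\<close> is dense, they overshoot by at most \<open>m\<close> durations of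
  level \<open>g0\<close>; this overshoot is the set \<open>Tp\<close> and the term with
  \<open>4^g0\<close>.\<close>

lemma ink_step:
 assumes K: "omega <= K0" "0 < K0" and H: "H = 2^g * ((2^g)^(4 * m) * K0)" and nd: "!!k w. k <= g0 ==> w : Q0 ==> ~ dense H k w"
 shows "real m / (real m + 1) * meas (big H) <= (1 - mu) * (meas (big (K0 / 2)) + vol 0 * (real m / 4^g0))"
proof -
 define Tp where "Tp = cbox (c0 - vec l, t0 + l^2) (c0 + vec l, t0 + l^2 + real m * (len g0)^2)"
 define B where "B = big (K0 / 2) \<union> Tp"
 have pw: "(2::real)^g >= 1" by simp
 have sub: "big H' <= cbox (c0 - vec l, t0) (c0 + vec l, t0 + l^2)" for H'
  by (auto simp: big_def in_Q0 mem_box_Pair mem_box_cart less_imp_le)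
 have B: "B : sets borel" "bounded B" unfolding B_def Tp_def using big_borel(1) bounded_subset[OF bounded_cbox sub[of "K0/2"]] by auto
 have pt: "(c0, t0 + l^2) : Q0" using l by (simp add: in_Q0)
 have sparse: "meas (big H) <= (1 - mu) * vol 0"
 proof -
  have "big H \<inter> cell 0 (c0, t0 + l^2) = big H" unfolding cell_Q0(2)[OF pt] by (auto simp: big_def)
  thus ?thesis using nd[of 0, OF _ pt] by (simp add: dense_def)
 qed
 have "real m / (real m + 1) * meas (big H) <= (1 - mu) * meas B"
 proof (rule ink_inequality[OF big_borel(1) _ B mu(1,2) _ big_cell sparse])
  fix k z w t
  assume z: "z : Q0" and w: "w : cell k z" and d: "(1 - mu) * vol (Suc k) < meas (big H \<inter> cell (Suc k) w)"
   and t: "ct k z + (len k)^2 < t" "t <= ct k z + (real m + 1) * (len k)^2"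
  have wQ: "w : Q0" using cell_Q0(1)[OF z] w by blast
  have d': "dense H (Suc k) w" using d by (simp add: dense_def)
  have "k >= g0"
  proof (rule ccontr)
   assume "~ k >= g0"
   thus False using nd[of "Suc k" w] wQ d' by simp
  qed
  hence lk: "len k <= len g0" using l by (simp add: len_def frac_le)
  note c = center[OF wQ, of "Suc k"] and cz = center[OF z, of k]
  define L where "L = len (Suc k)"
  have L: "len k = 2 * L" "L > 0" "(len k)^2 = 4 * L^2" unfolding L_def len(2) using len(1)[of k] by (simp_all add: power_divide)
  have "y : cell k z" if "y : cell (Suc k) w" for y
   using cell_coarser[OF le_SucI[OF order_refl] that] w by (simp add: cell_def)
  hence "(cx (Suc k) w, ct (Suc k) w + L^2) : cell k z" using c(1) unfolding L_def by blast
  hence t1: "ct (Suc k) w + L^2 <= ct k z + (len k)^2" unfolding cell_iff by simp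
  have t2: "ct k z < ct (Suc k) w + L^2" using w self_cell[of w "Suc k"] unfolding cell_iff L_def by linarith
  have "K0 <= u (fst z, t)"
  \<comment> \<open>The dense child has half the radius of its parent, so \<open>m\<close> parent
    durations are \<open>4 * m\<close> child durations.\<close>
  proof (rule stack[of K0 L "cx (Suc k) w" "ct (Suc k) w" "4 * m"])
   show "L <= ls" using len(3)[of "Suc k"] lls unfolding L_def by linarith
   show "abs (cx (Suc k) w $ i) <= 8" for i using c(2)[of i] c0[of i] lls by linarith
   show "0 <= ct (Suc k) w" using c(3) t0 by linarith
   have "(4 * real m + 5) * L^2 <= (4 * real m + 5) * l^2" using c(5) unfolding L_def by (intro mult_left_mono) auto
   hence "(4 * real m + 5) * L^2 <= 1" using t0 by linarith
   moreover have "5 + real (4 * m) = 4 * real m + 5" by simp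
   moreover have "ct (Suc k) w <= t0 + l^2" using c(4) zero_le_power2[of "len (Suc k)"] by linarith
   ultimately show "ct (Suc k) w + (5 + real (4 * m)) * L^2 <= 10" using t0 lsq by (simp only:)
   show "(2^g)^(4 * m) * K0 <= u y" if "y : slab (cx (Suc k) w) (5 * L) (ct (Suc k) w + L^2) (ct (Suc k) w + 5 * L^2)" for y
   proof (rule dense_grow[OF wQ d' _ _ _ that[unfolded L_def]])
    have "1 * K0 <= (2^g)^(4 * m) * K0" using K pw by (intro mult_right_mono one_le_power) auto
    thus "omega <= (2^g)^(4 * m) * K0" "0 <= (2^g)^(4 * m) * K0" using K by linarith+
   qed (simp add: H)
   have "abs (fst z $ i - cx (Suc k) w $ i) <= 5 * L" for i
   proof -
    have "cx k z $ i - len k < fst w $ i & fst w $ i <= cx k z $ i + len k" "cx k z $ i - len k < fst z $ i & fst z $ i <= cx k z $ i + len k"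
     "cx (Suc k) w $ i - L < fst w $ i & fst w $ i <= cx (Suc k) w $ i + L"
     using w self_cell[of z k] self_cell[of w "Suc k"] unfolding cell_iff L_def by blast+
    thus ?thesis using L(1) by linarith
   qed
   moreover have "t <= ct (Suc k) w + (5 + real (4 * m)) * L^2" using t(2) t2 unfolding L(3) by (simp add: algebra_simps)
   ultimately show "(fst z, t) : slab (cx (Suc k) w) (5 * L) (ct (Suc k) w + L^2) (ct (Suc k) w + (5 + real (4 * m)) * L^2)"
    using t(1) t1 by (simp add: slab_def)
  qed (use K L in auto)
  \<comment> \<open>The level is halved because \<open>big\<close> is defined by a strict
    inequality.\<close>
  hence "u (fst z, t) > K0 / 2" using K by simp
  moreover have "t0 < t" using t(1) cz(3) zero_le_power2[of "len k"] by linarith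
  moreover have "t <= t0 + l^2 + real m * (len g0)^2"
  proof -
   have "real m * (len k)^2 <= real m * (len g0)^2" using lk len(1)[of k] by (intro mult_left_mono power_mono) auto
   thus ?thesis using t(2) cz(4) by (simp add: algebra_simps)
  qed
  ultimately show "(fst z, t) : B" using z unfolding B_def Tp_def big_def in_Q0
   by (cases "t <= t0 + l^2") (auto simp: mem_box_Pair mem_box_cart less_imp_le)
 qed (use m in \<open>auto simp: big_def\<close>)
 also have "... <= (1 - mu) * (meas (big (K0 / 2)) + vol 0 * (real m / 4^g0))"
 proof (rule mult_left_mono)
  have ne: "cbox (c0 - vec l) (c0 + vec l) ~= {}"
  proof -
   have "c0 : cbox (c0 - vec l) (c0 + vec l)" using l by (simp add: mem_box_cart)
   thus ?thesis by blast
  qed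
  have "(len g0)^2 = l^2 / 4^g0" by (simp add: len_def power_divide power_mult[symmetric] mult.commute[of g0]) (simp add: power_mult)
  hence "meas Tp = vol 0 * (real m / 4^g0)" unfolding Tp_def content_Pair content_cbox_cart[OF ne]
   using len_0 by (simp add: vol_def hdim_def power_mult_distrib power_add power2_eq_square)
  moreover have "meas B <= meas (big (K0 / 2)) + meas Tp" unfolding B_def
   using big_borel(1) by (intro measure_Un_le) (auto simp: Tp_def)
  ultimately show "meas B <= meas (big (K0 / 2)) + vol 0 * (real m / 4^g0)" by simp
 qed (use mu in simp)
 finally show ?thesis .
qed

text \<open>Since \<open>(1 - mu) * (1 + mu/2) <= 1 - mu/2 <= m / (m + 1)\<close>, the superlevel
  set gains a factor \<open>1 + mu/2\<close>, of which the overshoot consumes at most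
  \<open>mu/4\<close>.\<close>

lemma ink_increase:
 assumes K: "omega <= K0" "0 < K0" and H: "H = 2^g * ((2^g)^(4 * m) * K0)" and nd: "!!k w. k <= g0 ==> w : Q0 ==> ~ dense H k w"
  and m1: "1 / (real m + 1) <= mu / 2" and g1: "real m / 4^g0 <= mu / 4 * nu" and nu: "nu * vol 0 <= meas (big H)"
 shows "(1 + mu / 4) * meas (big H) <= meas (big (K0 / 2))"
proof -
 define A where "A = meas (big H)"
 have A: "A >= 0" by (simp add: A_def)
 have "vol 0 * (real m / 4^g0) <= vol 0 * (mu / 4 * nu)" using g1 vol_pos[of 0] by (intro mult_left_mono) auto
 also have "... <= mu / 4 * A" using mult_left_mono[OF nu, of "mu / 4"] mu by (simp add: A_def mult_ac)
 finally have "(1 - mu) * (meas (big (K0 / 2)) + vol 0 * (real m / 4^g0)) <= (1 - mu) * (meas (big (K0 / 2)) + mu / 4 * A)"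
  using mu by (intro mult_left_mono) auto
 moreover have "(1 - mu) * (1 + mu / 2) * A <= real m / (real m + 1) * A"
 proof (rule mult_right_mono[OF _ A])
  have "real m / (real m + 1) = 1 - 1 / (real m + 1)" by (simp add: field_simps)
  moreover have "(1 - mu) * (1 + mu / 2) <= 1 - mu / 2" using mu by (simp add: algebra_simps)
  ultimately show "(1 - mu) * (1 + mu / 2) <= real m / (real m + 1)" using m1 by linarith
 qed
 moreover have "real m / (real m + 1) * A <= (1 - mu) * (meas (big (K0 / 2)) + vol 0 * (real m / 4^g0))"
  unfolding A_def by (rule ink_step[OF K H nd])
 ultimately have "(1 - mu) * ((1 + mu / 2) * A) <= (1 - mu) * (meas (big (K0 / 2)) + mu / 4 * A)"
  by (simp only: mult.assoc)
 hence "(1 + mu / 2) * A <= meas (big (K0 / 2)) + mu / 4 * A" using mu by simp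
 thus ?thesis by (simp add: A_def algebra_simps)
qed

end

text \<open>Suppose no cell of level up to \<open>g0\<close> is dense at any height considered. Then
  each lowering of the height by the factor \<open>Lb\<close> enlarges the superlevel set by
  \<open>1 + mu/4\<close>, and \<open>K\<close> rounds would exceed the volume of the box. So some
  cell of comparable size is dense, and \<open>grow\<close> gives the lower bound just above
  it.\<close>

theorem ink_density:
 fixes g :: nat and et nu :: real
 assumes et: "0 < et" and nu: "0 < nu"
 shows "EX c>0. EX kappa>0. EX T>0. kappa <= 1 & c <= 1 & (ALL (u :: (real^'n::finite) \<times> real => real) omega ls c0 t0 l H.
  grow g et ls omega u --> 0 < l --> l <= ls --> l <= 1/4 --> (ALL i. abs (c0 $ i) <= 3) --> 0 <= t0 --> t0 <= 1 --> T * l^2 <= 1 -->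
  omega <= c * H --> 0 < H --> nu * l ^ hdim TYPE('n) <= meas {z : qbox c0 t0 l. H < u z} -->
  (EX x t l'. kappa * l <= l' & l' <= l & (ALL i. abs (x $ i - c0 $ i) <= l) & t0 <= t & t <= t0 + l^2 & (ALL z:qbox x t l'. c * H <= u z)))"
proof -
 define nu0 where "nu0 = nu / 2 ^ CARD('n)"
 have nu0: "nu0 > 0" using nu by (simp add: nu0_def)
 define mu where "mu = min (et / 2 ^ CARD('n)) (1/2)"
 have mu: "0 < mu" "mu < 1" "mu <= et / 2 ^ CARD('n)" using et by (auto simp: mu_def)
 hence muet: "mu * 2 ^ CARD('n) <= et" by (simp add: pos_le_divide_eq)
 \<comment> \<open>Order of choice: \<open>m\<close> makes the loss in \<open>stack_measure\<close>
   smaller than the gain from \<open>mu\<close>, \<open>g0\<close> makes the overshoot small for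
   sets of density \<open>nu0\<close>, and \<open>K\<close> rounds take that density beyond
   one.\<close>
 define m where "m = nat \<lceil>2 / mu\<rceil>"
 have m2: "2 / mu <= real m" by (simp add: m_def real_nat_ceiling_ge)
 hence m: "m > 0" and m1: "1 / (real m + 1) <= mu / 2" using mu by (auto simp: pos_divide_le_eq field_simps intro: Nat.gr0I)
 obtain g0 where "(1/4::real)^g0 < (mu / 4 * nu0) / real m" using real_arch_pow_inv[of "(mu / 4 * nu0) / real m" "1/4"] mu nu0 m by auto
 hence g0: "real m / 4^g0 <= mu / 4 * nu0" using m by (simp add: pos_less_divide_eq power_divide mult.commute less_imp_le)
 obtain K where K: "1 / nu0 < (1 + mu / 4)^K" using real_arch_pow[of "1 + mu / 4" "1 / nu0"] mu by auto
 \<comment> \<open>Loss of height in one round: one step from a dense cell, a stack of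
   \<open>4 * m\<close> steps, and the halving for strictness.\<close>
 define Lb where "Lb = 2 * (2^g * (2^g)^(4 * m) :: real)"
 have p1: "(2::real)^g >= 1" "(2^g)^(4 * m) >= (1::real)" by (simp_all add: one_le_power)
 have Lbg: "2^g <= Lb"
 proof -
  have "2^g * 1 <= 2^g * (2 * (2^g)^(4 * m) :: real)" using p1 by (intro mult_left_mono) linarith+
  thus ?thesis by (simp add: Lb_def mult_ac)
 qed
 have Lb: "Lb >= 1" using p1 Lbg by linarith
 define c where "c = 1 / Lb^(K+1)"
 have c: "c > 0" "c <= 1" using Lb by (simp_all add: c_def one_le_power del: power_Suc)
 have main: "EX x t l'. 1 / 2^g0 * l <= l' & l' <= l & (ALL i. abs (x $ i - c0 $ i) <= l) & t0 <= t & t <= t0 + l^2 & (ALL z:qbox x t l'. c * H <= u z)"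
  if gr: "grow g et ls omega u" and l: "0 < l" "l <= ls" "l <= 1/4" and c0: "ALL i. abs (c0 $ i) <= 3" and t0: "0 <= t0" "t0 <= 1" "(4 * real m + 5) * l^2 <= 1"
   and H: "omega <= c * H" "0 < H" and den: "nu * l ^ hdim TYPE('n) <= meas {z : qbox c0 t0 l. H < u z}"
  for u :: "(real^'n)*real => real" and omega ls c0 t0 l H
 proof (rule ccontr)
  assume no: "~ (EX x t l'. 1 / 2^g0 * l <= l' & l' <= l & (ALL i. abs (x $ i - c0 $ i) <= l) & t0 <= t & t <= t0 + l^2 & (ALL z:qbox x t l'. c * H <= u z))"
  interpret ink g et ls omega u c0 t0 l mu m g0
   by unfold_locales (use gr et l c0 t0 mu muet m in auto)
  have v0: "vol 0 = 2 ^ CARD('n) * l ^ hdim TYPE('n)" by (simp add: vol_def len_0)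
  have lev: "c * H <= H / Lb^Suc j" if "j <= K" for j
  proof -
   have "1 / Lb^(K+1) <= 1 / Lb^Suc j" using Lb that by (intro divide_left_mono power_increasing) (auto simp del: power_Suc)
   from mult_right_mono[OF this less_imp_le[OF H(2)]] show ?thesis by (simp add: c_def del: power_Suc)
  qed
  \<comment> \<open>A dense cell of an early level would provide, directly above it, a box of the
    kind whose existence is denied.\<close>
  have nd: "~ dense (H / Lb^j) k w" if j: "j <= K" and k: "k <= g0" and w: "w : Q0" for j k w
  proof
   assume d: "dense (H / Lb^j) k w"
   define K1 where "K1 = H / Lb^j / 2^g"
   have "H / Lb^Suc j <= K1" using Lb Lbg H(2) by (simp add: K1_def frac_le mult.commute[of Lb] mult_left_mono)
   hence cK: "c * H <= K1" using lev[OF j] by linarith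
   have "c * H <= u z" if z: "z : qbox (cx k w) (ct k w + (len k)^2) (len k)" for z
   proof -
    have "K1 <= u z"
    proof (rule dense_grow[OF w d])
     show "2 ^ g * K1 <= H / Lb ^ j" by (simp add: K1_def)
     show "omega <= K1" "0 <= K1" using cK H(1) H(2) Lb by (auto simp: K1_def)
     have "abs (fst z $ i - cx k w $ i) <= 5 * len k" for i
     proof -
      have "abs (fst z $ i - cx k w $ i) < len k" using z by (simp add: qbox_def)
      thus ?thesis using len(1)[of k] by linarith
     qed
     thus "z : slab (cx k w) (5 * len k) (ct k w + (len k)^2) (ct k w + 5 * (len k)^2)"
      using z by (simp add: qbox_def slab_def)
    qed
    thus ?thesis using cK by linarith
   qed
   moreover have "1 / 2^g0 * l <= len k" unfolding len_def using k l by (simp add: frac_le)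
   moreover have "t0 <= ct k w + (len k)^2" using center(3)[OF w, of k] zero_le_power2[of "len k"] by linarith
   ultimately show False using no center(2,4)[OF w, of k] len(3)[of k] by blast
  qed
  have "j <= K ==> (1 + mu / 4)^j * (nu0 * vol 0) <= meas (big (H / Lb^j))" for j
  proof (induction j)
   case 0
   have "{z : qbox c0 t0 l. H < u z} <= big H"
   proof
    fix z assume z: "z : {z : qbox c0 t0 l. H < u z}"
    have "c0 $ a - l < fst z $ a & fst z $ a <= c0 $ a + l" for a
    proof -
     have "abs (fst z $ a - c0 $ a) < l" using z by (simp add: qbox_def)
     thus ?thesis by linarith
    qed
    thus "z : big H" using z by (simp add: big_def in_Q0 qbox_def)
   qed
   hence "meas {z : qbox c0 t0 l. H < u z} <= meas (big H)"
   proof (rule measure_mono_fmeasurable)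
    have "{z : qbox c0 t0 l. H < u z} = qbox c0 t0 l \<inter> big H" using \<open>_ <= big H\<close> by (auto simp: big_def)
    thus "{z : qbox c0 t0 l. H < u z} : sets lborel" using big_borel(1) qbox_borel[of c0 t0 l] by simp
   qed (rule big_borel)
   thus ?case using den by (simp add: v0 nu0_def)
  next
   case (Suc j)
   define K0 where "K0 = H / Lb^j / (2^g * (2^g)^(4 * m))"
   have K2: "K0 / 2 = H / Lb^Suc j" by (simp add: K0_def Lb_def)
   have K0: "K0 > 0" using H Lb by (simp add: K0_def)
   have IH: "(1 + mu / 4)^j * (nu0 * vol 0) <= meas (big (H / Lb^j))" using Suc by simp
   have "1 * (nu0 * vol 0) <= (1 + mu / 4)^j * (nu0 * vol 0)" using mu nu0 vol_pos[of 0] by (intro mult_right_mono one_le_power) auto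
   hence nub: "nu0 * vol 0 <= meas (big (H / Lb^j))" using IH by linarith
   have "(1 + mu / 4) * meas (big (H / Lb^j)) <= meas (big (K0 / 2))"
   proof (rule ink_increase[OF _ K0 _ _ m1 g0 nub])
    show "omega <= K0" using H(1) lev[of j] K0 Suc.prems unfolding K2[symmetric] by simp
    show "H / Lb^j = 2^g * ((2^g)^(4 * m) * K0)" by (simp add: K0_def)
    show "~ dense (H / Lb^j) k w" if "k <= g0" "w : Q0" for k w using nd that Suc.prems by simp
   qed
   moreover have "(1 + mu / 4) * ((1 + mu / 4)^j * (nu0 * vol 0)) <= (1 + mu / 4) * meas (big (H / Lb^j))"
    using IH mu by (intro mult_left_mono) auto
   ultimately show ?case unfolding K2 by (simp add: mult.assoc)
  qed
  from this[OF order_refl] have "(1 + mu / 4)^K * (nu0 * vol 0) <= meas (big (H / Lb^K))" .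
  also have "... <= meas Q0" using Q0_f(1) big_borel by (intro measure_mono_fmeasurable) (auto simp: big_def)
  also have "... = vol 0" by (rule Q0_f)
  finally have "(1 + mu / 4)^K * nu0 <= 1" using vol_pos[of 0] by (simp add: mult.assoc[symmetric])
  thus False using K nu0 by (simp add: pos_divide_less_eq)
 qed
 show ?thesis
  by (intro exI[of _ c] exI[of _ "1 / 2^g0"] exI[of _ "4 * real m + 5"] conjI allI impI) (use c main in auto)
qed

section \<open>Harnack inequality\<close>

lemma infnorm_le: "(!!i. abs (x $ i) <= r) ==> infnorm (x :: real^'n) <= r"
 unfolding infnorm_cart by (rule cSup_least) auto

text \<open>Dividing by \<open>H\<close> normalises the height, and the p-th power integral of
  \<open>f / H\<close> stays below \<open>delta\<close> because \<open>H >= omega\<close>.\<close>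

lemma supers_grow:
 fixes u :: "(real^'n::finite) \<times> real => real"
 assumes G: "grows TYPE('n) lam Lam p q W 5 4 M et ls delta R"
  and R: "5 <= R" "R * ls <= 1" and M: "M <= 2^g" and lam: "0 < lam" "lam <= Lam" and p: "p > 0"
  and s: "supers lam Lam p mu f u" and w: "wfun q W mu" "wfun p N f" and N: "N <= delta * omega powr p" and omega: "omega > 0"
  and u0: "!!z. z : closure Q_dom ==> 0 <= u z" and ls': "ls' <= ls"
 shows "grow g et ls' omega u"
 unfolding grow_def
proof (intro conjI allI impI)
 show cu: "continuous_on (closure Q_dom) u" using s by (simp add: supers_def)
 fix x0 :: "real^'n" and t0 l H
 assume H: "omega <= H" "0 <= H" and l: "0 < l" "l <= ls'" and x0: "ALL i. abs (x0 $ i) <= 8" and t0: "0 <= t0" "t0 + 5 * l^2 <= 10"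
  and me: "meas {z : qbox x0 t0 l. u z < 2^g * H} <= et * l ^ hdim TYPE('n)"
 have five: "1 + 4 = (5::real)" by simp
 have H0: "H > 0" using H omega by linarith
 have Rl: "R * l <= 1" "l <= 1"
 proof -
  have "R * l <= R * ls" using R l ls' by (intro mult_left_mono) auto
  thus "R * l <= 1" using R by linarith
  moreover have "1 * l <= R * l" using R l by (intro mult_right_mono) auto
  ultimately show "l <= 1" by linarith
 qed
 have sub: "slab x0 r t0 (t0 + 5 * l^2) <= closure Q_dom" if "r <= 1" for r
 proof
  fix z assume z: "z : slab x0 r t0 (t0 + 5 * l^2)"
  have "abs (fst z $ i) <= 10" for i
  proof -
   have "abs (fst z $ i - x0 $ i) <= r" using z by (simp add: slab_def)
   thus ?thesis using x0[rule_format, of i] that by linarith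
  qed
  thus "z : closure Q_dom" using z t0 by (auto simp: closure_Q_dom slab_def)
 qed
 have qs: "qbox x0 t0 l <= slab x0 l t0 (t0 + 5 * l^2)" by (auto simp: qbox_def slab_def less_imp_le)
 have qc: "qbox x0 t0 l <= closure Q_dom" using qs sub[OF Rl(2)] by blast
 have qb: "{z : qbox x0 t0 l. v z < c} : fmeasurable lborel" if "continuous_on (closure Q_dom) v" for v :: "(real^'n)*real => real" and c
  by (intro bounded_fmeasurable borel_sublevel[OF qbox_borel continuous_on_subset[OF that qc]]
    bounded_subset[OF compact_imp_bounded[OF compact_slab[of x0 l t0 "t0 + 5 * l^2"]]]) (use qs in auto)
 have "wfun p delta (%z. 1 / H * f z)"
 proof -
  note f = wfunD[OF w(2)]
  have e: "(1 / H * f z) powr p = (1 / H) powr p * f z powr p" for z by (rule powr_mult)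
  have "omega powr p <= H powr p" using H omega p by (intro powr_mono2) auto
  moreover have "delta * omega powr p >= 0"
  proof -
   have "0 <= (LI z. f z powr p)" by (rule int_nonneg) simp
   thus ?thesis using f(4) N by linarith
  qed
  hence "delta >= 0" using omega by (simp add: zero_le_mult_iff)
  ultimately have "delta * omega powr p <= delta * H powr p" by (intro mult_left_mono)
  hence "(1 / H) powr p * (LI z. f z powr p) <= (1 / H) powr p * (delta * H powr p)"
   using f(4) N by (intro mult_left_mono) auto
  also have "... = delta" using H0 by (simp add: powr_divide)
  finally show ?thesis using f H0 unfolding wfun_def e by (auto intro!: borel_measurable_times)
 qed
 moreover have "supers lam Lam p mu (%z. 1 / H * f z) (%z. 1 / H * u z)" using H0 by (intro supers_scale[OF s _ lam]) simp
 moreover have "ALL z:slab x0 (R * l) t0 (t0 + (1 + 4) * l^2). 0 <= 1 / H * u z"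
 proof
  fix z assume "z : slab x0 (R * l) t0 (t0 + (1 + 4) * l^2)"
  hence "0 <= u z" using sub[OF Rl(1)] by (intro u0) auto
  thus "0 <= 1 / H * u z" using H0 by simp
 qed
 moreover have "meas {z : qbox x0 t0 l. 1 / H * u z < M} <= et * l ^ hdim TYPE('n)"
 proof -
  have "{z : qbox x0 t0 l. 1 / H * u z < M} <= {z : qbox x0 t0 l. u z < 2^g * H}"
  proof
   fix z assume z: "z : {z : qbox x0 t0 l. 1 / H * u z < M}"
   hence "u z < M * H" using H0 by (simp add: pos_divide_less_eq)
   also have "... <= 2^g * H" using M H0 by (intro mult_right_mono) auto
   finally show "z : {z : qbox x0 t0 l. u z < 2^g * H}" using z by simp
  qed
  hence "meas {z : qbox x0 t0 l. 1 / H * u z < M} <= meas {z : qbox x0 t0 l. u z < 2^g * H}"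
   by (rule measure_mono_fmeasurable[OF _ fmeasurableD[OF qb] qb[OF cu]]) (intro continuous_intros cu)
  thus ?thesis using me by linarith
 qed
 ultimately have one: "ALL z:slab x0 (5 * l) (t0 + l^2) (t0 + (1 + 4) * l^2). 1 <= 1 / H * u z"
  using G[unfolded grows_def, THEN spec[of _ mu], THEN spec[of _ "%z. 1 / H * f z"], THEN spec[of _ "%z. 1 / H * u z"], THEN spec[of _ x0], THEN spec[of _ t0], THEN spec[of _ l]]
   w(1) l(1) order_trans[OF l(2) ls'] x0 t0(1) t0(2)[folded five] by blast
 show "ALL z:slab x0 (5 * l) (t0 + l^2) (t0 + 5 * l^2). H <= u z"
 proof
  fix z assume "z : slab x0 (5 * l) (t0 + l^2) (t0 + 5 * l^2)"
  hence "1 <= 1 / H * u z" using one by simp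
  thus "H <= u z" using H0 by (simp add: pos_le_divide_eq)
 qed
qed

definition harnack_const :: "'n::finite itself => real => real => real => real => real => real => bool" where
 "harnack_const n lam Lam p q W C \<longleftrightarrow> (ALL mu f (u :: (real^'n)*real => real) N. wfun q W mu --> wfun p (N powr p) f --> 0 <= N --> supers lam Lam p mu f u -->
  (ALL K. supers lam Lam p mu f (%z. K - u z)) --> (ALL z:closure Q_dom. 0 <= u z) --> (ALL z:J3. ALL y:J2. u z <= C * (u y + N)))"

text \<open>At a maximum point \<open>m\<close> of \<open>u * psi^g\<close> the value of
  \<open>u\<close> is nearly maximal on a box around \<open>m\<close> of size comparable to
  \<open>psi m\<close>. Growth applied to the deficit below that maximum shows that \<open>u\<close>
  is not small on almost all of the box before \<open>m\<close>; \<open>ink_density\<close> and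
  \<open>spread\<close> then carry a lower bound to \<open>J2\<close>. The power \<open>g\<close> in
  the weight equals the power lost by \<open>spread\<close>, so the unknown distance
  cancels.\<close>

theorem harnack:
 fixes lam Lam p q W :: real
 assumes abp: "ABP_solvable TYPE('n::finite) lam Lam p" and pq: "1 <= p" "p <= q" "real (hdim TYPE('n)) < q" "real (hdim TYPE('n)) < 2 * p"
  and lam: "0 < lam" "lam <= Lam" and W: "0 <= W"
 shows "EX C>0. harnack_const TYPE('n) lam Lam p q W C"
proof -
 let ?h = "hdim TYPE('n)"
 have p: "p > 0" using pq by simp
 obtain M et ls0 delta R where M: "M > 1" and et: "et > 0" and ls0: "ls0 > 0" and delta: "delta > 0" and R: "R >= 5" "R * ls0 <= 1"
  and G: "grows TYPE('n) lam Lam p q W 5 4 M et ls0 delta R"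
  using growth[OF abp pq lam _ _ W, of 5 4] by auto
 define ls where "ls = min ls0 (1/4)"
 have ls: "ls > 0" "ls <= ls0" "ls <= 1/4" using ls0 by (auto simp: ls_def)
 obtain g where "M < 2^g" using real_arch_pow[of 2 M] by auto
 hence g: "M <= 2^g" "g > 0" using M by (auto intro: Nat.gr0I)
 obtain c kappa T where c: "c > 0" "c <= 1" and kappa: "kappa > 0" "kappa <= 1" and T: "T > 0" and ink: "ALL (u :: (real^'n)*real => real) omega ls c0 t0 l H.
  grow g et ls omega u --> 0 < l --> l <= ls --> l <= 1/4 --> (ALL i. abs (c0 $ i) <= 3) --> 0 <= t0 --> t0 <= 1 --> T * l^2 <= 1 -->
  omega <= c * H --> 0 < H --> et * l ^ ?h <= meas {z : qbox c0 t0 l. H < u z} -->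
  (EX x t l'. kappa * l <= l' & l' <= l & (ALL i. abs (x $ i - c0 $ i) <= l) & t0 <= t & t <= t0 + l^2 & (ALL z:qbox x t l'. c * H <= u z))"
 proof -
  note * = ink_density[OF et et, where g=g and 'n='n]
  show thesis by (rule exE[OF *], elim conjE exE, rule that) assumption+
 qed
 define c2 where "c2 = 1 / ((2::real)^g)^(nat \<lceil>40 / ls^2\<rceil> + 1)"
 have c2: "c2 > 0" "c2 <= 1" by (simp_all add: c2_def one_le_power del: power_Suc)
 \<comment> \<open>With this value a deficit function below \<open>2^g\<close> means
   \<open>u > H / 2\<close>, while at \<open>m\<close> the deficit function equals 1/2.\<close>
 define d' where "d' = 1 / (4 * 2^g :: real)"
 have d': "d' > 0" "d' <= 1/4" "2 * (2^g * d') = 1/2" by (simp_all add: d'_def one_le_power)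
 \<comment> \<open>The loss of distance that the weight tolerates: where \<open>psi\<close> drops at
   most by the factor \<open>1 - e0\<close>, \<open>u\<close> exceeds \<open>H\<close> at most by
   the factor \<open>1 + d'\<close>.\<close>
 define e0 where "e0 = d' / (2 * real g)"
 have e0: "e0 > 0" "e0 < 1" "1 <= (1 - e0)^g * (1 + d')"
 proof -
  show "e0 > 0" using d' g by (simp add: e0_def)
  have "real g >= 1" using g by simp
  hence "d' / (2 * real g) <= d' / 2" using d' by (intro divide_left_mono) auto
  thus "e0 < 1" using d' by (simp add: e0_def)
  have "real g * e0 = d' / 2" using g by (simp add: e0_def)
  hence "1 - d' / 2 <= (1 - e0)^g" using Bernoulli_inequality[of "- e0" g] \<open>e0 < 1\<close> by simp
  hence "(1 - d' / 2) * (1 + d') <= (1 - e0)^g * (1 + d')" using d' by (intro mult_right_mono) auto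
  moreover have "d' * d' <= d' * 1" using d' by (intro mult_left_mono) auto
  hence "1 <= (1 - d' / 2) * (1 + d')" by (simp add: algebra_simps)
  ultimately show "1 <= (1 - e0)^g * (1 + d')" by linarith
 qed
 \<comment> \<open>Ratio of the box radius to the distance \<open>d\<close>: the comparison slab may
   use up only the fraction \<open>e0\<close> of that distance, and \<open>ink_density\<close> asks
   for \<open>T * l^2 <= 1\<close>.\<close>
 define k0 where "k0 = min (min (e0 / (5 * R)) ls) (min (1/5) (1 / (T + 1)))"
 have k0: "k0 > 0" "k0 <= e0 / (5 * R)" "k0 <= ls" "k0 <= 1/5" "k0 <= 1 / (T + 1)" using e0 R ls T by (auto simp: k0_def)
 have k1: "R * k0 <= e0" "5 * k0^2 <= e0" "T * k0^2 <= 1"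
 proof -
  have "5 * (k0 * R) <= e0" if "k0 * (5 * R) <= e0" using that by (simp add: mult_ac)
  moreover have "k0 * (5 * R) <= e0" using k0(2) R by (subst (asm) pos_le_divide_eq) auto
  moreover have "0 <= k0 * R" "k0 * 5 <= k0 * R" using k0 R by (simp_all add: mult_left_mono)
  ultimately have "k0 * R <= e0" "k0 * 5 <= e0" by linarith+
  hence a: "R * k0 <= e0" "5 * k0 <= e0" by (simp_all add: mult.commute)
  thus "R * k0 <= e0" by simp
  have sq: "k0^2 <= k0" using k0 by (simp add: power2_eq_square mult_left_le)
  thus "5 * k0^2 <= e0" using a by linarith
  have "k0 * (T + 1) <= 1" using k0(5) T by (subst (asm) pos_le_divide_eq) auto
  moreover have "T * k0^2 <= T * k0" using sq T by (intro mult_left_mono) auto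
  ultimately show "T * k0^2 <= 1" using k0 by (simp add: algebra_simps)
 qed
 \<comment> \<open>The second entry keeps the threshold below \<open>2 * d' * H\<close>, the height
   by which the deficit function is normalised.\<close>
 define c3 where "c3 = min (c2 * (c / 2) * (kappa * k0)^g) (2 * d')"
 have c3: "c3 > 0" "c3 <= c2 * (c / 2) * (kappa * k0)^g" "c3 <= 2 * d'" using c c2 kappa k0 d' by (auto simp: c3_def)
 have c3': "c3 <= c / 2"
 proof -
  have "(kappa * k0)^g <= 1" using kappa k0 by (intro power_le_one) (auto intro: mult_le_one)
  hence "c2 * (c / 2) * (kappa * k0)^g <= 1 * (c / 2) * 1" using c c2 kappa k0 by (intro mult_mono) auto
  thus ?thesis using c3 by linarith
 qed
 define D where "D = delta powr (1/p)"
 have D: "D > 0" "D powr p = delta" using delta p by (simp_all add: D_def powr_powr)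
 \<comment> \<open>\<open>4^g\<close> appears because the weight is at least 1/4 on
   \<open>J3\<close>; \<open>1 / D\<close> converts the norm of \<open>f\<close> into a
   height.\<close>
 define C where "C = 4^g / c3 * (1 + 1 / D)"
 have C: "C > 0" using c3 D by (simp add: C_def add_pos_pos)
 have main: "u z <= C * (u y + N)"
  if mu: "wfun q W mu" and f: "wfun p (N powr p) f" and N: "0 <= N" and s: "supers lam Lam p mu f u"
   and sK: "!!K. supers lam Lam p mu f (%z. K - u z)" and u0: "!!z. z : closure Q_dom ==> 0 <= u z" and z: "z : J3" and y: "y : J2"
  for mu f N z y and u :: "(real^'n)*real => real"
 proof -
  \<comment> \<open>The square root makes the time part a parabolic distance to the base at time
    1/8.\<close>
  define psi where "psi z = min (1 - infnorm (fst z)) (sqrt (snd z - 1/8))" for z :: "(real^'n)*real"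
  let ?K = "slab (0::real^'n) 1 (1/8) (1/2)"
  have KQ: "?K <= closure Q_dom" unfolding closure_Q_dom by (auto simp: slab_def) (meson order_trans one_le_numeral)
  have psi0: "psi z >= 0" if "z : ?K" for z using that infnorm_le[of "fst z" 1] by (auto simp: psi_def slab_def)
  have J3: "z : ?K" "1/4 <= psi z"
  proof -
   have zz: "abs (fst z $ i) <= 1/2" "1/4 < snd z" "snd z <= 1/2" for i
   proof -
    have "- (1/2) < fst z $ i & fst z $ i < 1/2 & 1/4 < snd z & snd z <= 1/2" using z by (cases z) (simp add: J3_def cube_def mem_box_cart)
    thus "abs (fst z $ i) <= 1/2" "1/4 < snd z" "snd z <= 1/2" by linarith+
   qed
   have "abs (fst z $ i) <= 1" for i using zz(1)[of i] by linarith
   thus "z : ?K" using zz by (simp add: slab_def)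
   have "infnorm (fst z) <= 1/2" using zz(1) by (rule infnorm_le)
   moreover have "1/4 <= sqrt (snd z - 1/8)" using zz(2) by (intro real_le_rsqrt) (simp add: power2_eq_square)
   ultimately show "1/4 <= psi z" by (simp add: psi_def)
  qed
  have yQ: "y : closure Q_dom"
  proof -
   have "abs (fst y $ i) <= 10" "0 <= snd y" "snd y <= 10" for i
   proof -
    have "abs (fst y $ i) < 1 & 9 < snd y & snd y <= 10" using y by (cases y) (auto simp: J2_def cube_def mem_box_cart abs_less_between)
    thus "abs (fst y $ i) <= 10" "0 <= snd y" "snd y <= 10" by linarith+
   qed
   thus ?thesis by (simp add: closure_Q_dom slab_def)
  qed
  have cu: "continuous_on (closure Q_dom) u" using s by (simp add: supers_def)
  have "continuous_on ?K (%z. u z * psi z ^ g)" unfolding psi_def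
   by (intro continuous_intros continuous_on_subset[OF cu KQ])
  from continuous_attains_sup[OF compact_slab _ this] J3(1)
  obtain m where m: "m : ?K" "!!z. z : ?K ==> u z * psi z ^ g <= u m * psi m ^ g" by blast
  define S where "S = u m * psi m ^ g"
  have uK: "u x >= 0" if "x : ?K" for x by (rule u0) (use that KQ in blast)
  have S0: "S >= 0" unfolding S_def by (intro mult_nonneg_nonneg zero_le_power uK psi0 m(1))
  have uS: "u z <= 4^g * S"
  proof -
   have "u z * (1/4)^g <= u z * psi z ^ g" by (intro mult_left_mono power_mono uK J3) simp
   also have "... <= S" using m(2)[OF J3(1)] by (simp add: S_def)
   finally show ?thesis by (simp add: power_divide pos_divide_le_eq mult.commute)
  qed
  have fin: "c3 * S <= u y" if small: "N <= D * (c3 * S)" and S: "S > 0"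
  proof -
   define H where "H = u m"
   define d where "d = psi m"
   have SH: "S = H * d^g" by (simp add: S_def H_def d_def)
   have d: "d > 0" "d <= 1" "infnorm (fst m) <= 1 - d" "d^2 <= snd m - 1/8"
   proof -
    have "d ~= 0" using S g(2) by (auto simp: SH power_0_left)
    thus d0: "d > 0" using psi0[OF m(1)] by (simp add: d_def)
    show "infnorm (fst m) <= 1 - d" by (simp add: d_def psi_def)
    thus "d <= 1" using infnorm_pos_le[of "fst m"] by linarith
    have "d <= sqrt (snd m - 1/8)" by (simp add: d_def psi_def)
    hence "d^2 <= (sqrt (snd m - 1/8))^2" using d0 by (intro power_mono) auto
    thus "d^2 <= snd m - 1/8" using m(1) by (simp add: slab_def)
   qed
   have H: "H > 0" using S d by (simp add: SH zero_less_mult_iff)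
   have HS: "S <= H" using H d by (simp add: SH mult_left_le power_le_one)
   define w where "w = c3 * S"
   have w: "w > 0" "w <= 2 * d' * H" "w <= c * (H / 2)"
   proof -
    show "w > 0" using c3 S by (simp add: w_def)
    have "w <= c3 * H" using HS c3 by (simp add: w_def)
    moreover have "c3 * H <= 2 * d' * H" "c3 * H <= c / 2 * H" using c3 c3' H by (intro mult_right_mono; simp)+
    ultimately show "w <= 2 * d' * H" "w <= c * (H / 2)" by simp_all
   qed
   have Nw: "N powr p <= delta * v powr p" if "w <= v" for v
   proof -
    have "D * (c3 * S) <= D * v" using that D by (intro mult_left_mono) (auto simp: w_def)
    hence "N <= D * v" using small by linarith
    hence "N powr p <= (D * v) powr p" using N p by (intro powr_mono2) auto
    thus ?thesis using D by (simp add: powr_mult)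
   qed
   have gr: "grow g et ls w u" by (rule supers_grow[OF G R g(1) lam p s mu f Nw[OF order_refl] w(1) u0 ls(2)])
   define l where "l = k0 * d"
   have l: "l > 0" "l <= ls" "l <= 1/4" "R * l <= e0 * d" "5 * l^2 <= e0 * d^2" "T * l^2 <= 1" "l <= ls0" "l <= 1"
   proof -
    show "l > 0" using k0 d by (simp add: l_def)
    have lk: "l <= k0" using k0 d by (simp add: l_def mult_left_le)
    thus "l <= ls" "l <= 1/4" "l <= ls0" "l <= 1" using k0 ls by linarith+
    show "R * l <= e0 * d" using mult_right_mono[OF k1(1), of d] d by (simp add: l_def mult.assoc)
    show "5 * l^2 <= e0 * d^2" using mult_right_mono[OF k1(2), of "d^2"] by (simp add: l_def power_mult_distrib)
    have "T * l^2 <= T * k0^2" using T lk \<open>l > 0\<close> by (intro mult_left_mono power_mono) auto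
    thus "T * l^2 <= 1" using k1 by linarith
   qed
   \<comment> \<open>Chosen so that \<open>m\<close> lies on the top face of the slab where growth
     would give the lower bound 1.\<close>
   define t0 where "t0 = snd m - 5 * l^2"
   have d2: "e0 * d^2 <= d^2" using e0 by (simp add: mult_left_le_one_le)
   have t0: "1/8 <= t0" "t0 + 5 * l^2 = snd m" "snd m <= 1/2" using d(4) l(5) d2 m(1) by (auto simp: t0_def slab_def)
   have am: "x : ?K & u x <= (1 + d') * H" if x: "x : slab (fst m) (R * l) t0 (snd m)" for x
   proof -
    have "infnorm (fst x - fst m) <= R * l" using x by (intro infnorm_le) (simp add: slab_def)
    hence i: "infnorm (fst x) <= 1 - d + e0 * d" using infnorm_triangle[of "fst m" "fst x - fst m"] d(3) l(4) by simp
    have "e0 * d <= d" using e0 d by (simp add: mult_left_le_one_le)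
    hence "abs (fst x $ i) <= 1" for i using component_le_infnorm_cart[of "fst x" i] i by linarith
    hence xK: "x : ?K" using x t0 by (auto simp: slab_def)
    have "(1 - e0) * d <= psi x"
    proof -
     have "((1 - e0) * d)^2 <= (1 - e0) * d^2"
      using e0 d by (simp add: power2_eq_square mult_left_le mult_ac mult_left_le_one_le)
     also have "... <= snd x - 1/8" using x d(4) l(5) by (simp add: slab_def t0_def algebra_simps)
     finally have "(1 - e0) * d <= sqrt (snd x - 1/8)" by (rule real_le_rsqrt)
     thus ?thesis using i by (simp add: psi_def algebra_simps)
    qed
    hence "((1 - e0) * d)^g <= psi x ^ g" using e0 d by (intro power_mono) auto
    hence "u x * ((1 - e0) * d)^g <= u x * psi x ^ g" by (intro mult_left_mono uK xK)
    also have "... <= H * d^g" using m(2)[OF xK] by (simp add: H_def d_def)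
    finally have "(u x * (1 - e0)^g) * d^g <= H * d^g" by (simp add: power_mult_distrib mult_ac)
    hence a: "u x * (1 - e0)^g <= H" using d by simp
    have "u x * 1 <= u x * ((1 - e0)^g * (1 + d'))" by (intro mult_left_mono uK xK e0)
    also have "... = (u x * (1 - e0)^g) * (1 + d')" by simp
    also have "... <= H * (1 + d')" using a d' by (intro mult_right_mono) auto
    finally show ?thesis using xK by (simp add: mult.commute)
   qed
   have bx: "abs (fst m $ i) <= 1" for i using m(1) by (simp add: slab_def)
   have qK: "qbox (fst m) t0 l <= closure Q_dom"
   proof
    fix x assume x: "x : qbox (fst m) t0 l"
    have "abs (fst x $ i) <= 10" for i
    proof -
     have "abs (fst x $ i - fst m $ i) < l" using x by (simp add: qbox_def)
     thus ?thesis using bx[of i] l(8) by linarith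
    qed
    moreover have "l^2 <= 5 * l^2" by simp
    hence "0 <= snd x" "snd x <= 10" using x t0 unfolding qbox_def mem_Collect_eq by linarith+
    ultimately show "x : closure Q_dom" by (simp add: closure_Q_dom slab_def)
   qed
   define b where "b = 1 / (2 * d' * H)"
   have b: "b > 0" using d' H by (simp add: b_def)
   define v where "v x = b * ((1 + d') * H - u x)" for x
   \<comment> \<open>Otherwise growth would give \<open>v m >= 1\<close>, although
     \<open>v m = 1/2\<close>.\<close>
   have "~ meas {x : qbox (fst m) t0 l. v x < M} <= et * l ^ ?h"
   proof
    assume me: "meas {x : qbox (fst m) t0 l. v x < M} <= et * l ^ ?h"
    have sv: "supers lam Lam p mu (%x. b * f x) v" unfolding v_def[abs_def] by (rule supers_scale[OF sK b lam])
    have "wfun p delta (%x. b * f x)"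
    proof -
     note f' = wfunD[OF f]
     have e: "(b * f z) powr p = b powr p * f z powr p" for z by (rule powr_mult)
     have "b powr p * (LI z. f z powr p) <= b powr p * (delta * (2 * d' * H) powr p)"
      using f'(4) Nw[OF w(2)] by (intro mult_left_mono) auto
     also have "... = delta" using d' H by (simp add: b_def powr_divide)
     finally show ?thesis using f' b unfolding wfun_def e by (auto intro!: borel_measurable_times)
    qed
    moreover have "ALL x:slab (fst m) (R * l) t0 (t0 + (1 + 4) * l^2). 0 <= v x"
     using am b t0 by (auto simp: v_def simp del: split_paired_All)
    moreover have "ALL i. abs (fst m $ i) <= 8" using bx by (meson order_trans one_le_numeral)
    moreover have "0 <= t0" "t0 + (1 + 4) * l^2 <= 10" using t0 by simp_all
    ultimately have "ALL x:slab (fst m) (5 * l) (t0 + l^2) (t0 + (1 + 4) * l^2). 1 <= v x"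
     using G[unfolded grows_def, THEN spec[of _ mu], THEN spec[of _ "%x. b * f x"], THEN spec[of _ v], THEN spec[of _ "fst m"], THEN spec[of _ t0], THEN spec[of _ l]]
      mu sv l(1,7) me by blast
    moreover have "t0 + l^2 <= snd m" using t0(2) zero_le_power2[of l] by linarith
    hence "m : slab (fst m) (5 * l) (t0 + l^2) (t0 + (1 + 4) * l^2)" using t0(2) l(1) by (simp add: slab_def)
    ultimately have "1 <= v m" by blast
    moreover have "v m = 1/2" using d' H by (simp add: v_def H_def[symmetric] b_def field_simps)
    ultimately show False by simp
   qed
   hence "et * l ^ ?h <= meas {x : qbox (fst m) t0 l. v x < M}" by simp
   also have "... <= meas {x : qbox (fst m) t0 l. H / 2 < u x}"
   proof (rule measure_mono_fmeasurable)
    show "{x : qbox (fst m) t0 l. v x < M} <= {x : qbox (fst m) t0 l. H / 2 < u x}"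
    proof
     fix x assume x: "x : {x : qbox (fst m) t0 l. v x < M}"
     hence "v x < 2^g" using g by simp
     hence "(1 + d') * H - u x < 2^g * (2 * d' * H)" using d' H by (simp add: v_def b_def pos_divide_less_eq)
     also have "... = (2 * (2^g * d')) * H" by simp
     also have "... = H / 2" unfolding d'(3) by simp
     finally have "H + d' * H - u x < H / 2" by (simp add: algebra_simps)
     moreover have "d' * H > 0" using d' H by simp
     ultimately have "H / 2 < u x" by linarith
     thus "x : {x : qbox (fst m) t0 l. H / 2 < u x}" using x by simp
    qed
    have cv: "continuous_on (qbox (fst m) t0 l) u" by (rule continuous_on_subset[OF cu qK])
    show "{x : qbox (fst m) t0 l. v x < M} : sets lborel" unfolding v_def
     using borel_sublevel[OF qbox_borel, of "fst m" t0 l "%x. b * ((1 + d') * H - u x)" M] cv by (simp add: continuous_intros)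
    have "{x : qbox (fst m) t0 l. - u x < - (H / 2)} : sets borel" by (intro borel_sublevel qbox_borel continuous_intros cv)
    hence "{x : qbox (fst m) t0 l. H / 2 < u x} : sets borel" by simp
    moreover have "bounded {x : qbox (fst m) t0 l. H / 2 < u x}"
     by (rule bounded_subset[OF compact_imp_bounded[OF compact_slab[of "fst m" l t0 "t0 + l^2"]]]) (auto simp: qbox_def slab_def less_imp_le)
    ultimately show "{x : qbox (fst m) t0 l. H / 2 < u x} : fmeasurable lborel" by (rule bounded_fmeasurable)
   qed
   finally have den: "et * l ^ ?h <= meas {x : qbox (fst m) t0 l. H / 2 < u x}" .
   have "ALL i. abs (fst m $ i) <= 3" using bx by (meson order_trans one_le_numeral)
   moreover have "0 <= t0" "t0 <= 1" using t0 zero_le_power2[of l] by linarith+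
   moreover have "0 < H / 2" using H by simp
   ultimately have "EX x t l'. kappa * l <= l' & l' <= l & (ALL i. abs (x $ i - fst m $ i) <= l) & t0 <= t & t <= t0 + l^2 & (ALL z:qbox x t l'. c * (H / 2) <= u z)"
    using ink gr l(1-3,6) w(3) den by blast
   then obtain x t l' where x: "kappa * l <= l'" "l' <= l" "!!i. abs (x $ i - fst m $ i) <= l" "t0 <= t" "t <= t0 + l^2" "!!z. z : qbox x t l' ==> c * (H / 2) <= u z"
    by blast
   interpret growing g et ls w u by unfold_locales (use gr et in auto)
   have l': "l' > 0" using x(1) kappa l(1) by (smt (verit) mult_pos_pos)
   have "c3 * S <= c2 * (c * (H / 2)) * l'^g"
   proof -
    have "(kappa * k0 * d)^g <= l'^g" using x(1) kappa k0 d by (intro power_mono) (auto simp: l_def mult.assoc)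
    hence "c2 * (c * (H / 2)) * (kappa * k0 * d)^g <= c2 * (c * (H / 2)) * l'^g" using c2 c H by (intro mult_left_mono) auto
    moreover have "c2 * (c * (H / 2)) * (kappa * k0 * d)^g = (c2 * (c / 2) * (kappa * k0)^g) * S" by (simp add: SH power_mult_distrib)
    moreover have "c3 * S <= (c2 * (c / 2) * (kappa * k0)^g) * S" using c3 S by (intro mult_right_mono) auto
    ultimately show ?thesis by linarith
   qed
   moreover have "c2 * (c * (H / 2)) * l'^g <= u y" unfolding c2_def
   proof (rule spread[OF _ _ _ l' _ ls(3) _ _ x(6) y])
    show "abs (x $ i) <= 2" for i using x(3)[of i] bx[of i] l(8) by linarith
    show "0 <= t" using x(4) t0 by linarith
    have "l^2 <= 5 * l^2" by simp
    thus "t <= 1" using x(5) t0 by linarith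
    show "l' <= ls" using x(2) l by linarith
    show "w <= 1 / (2^g)^(nat \<lceil>40 / ls^2\<rceil> + 1) * (c * (H / 2)) * l'^g" using calculation by (simp only: w_def c2_def)
   qed (use c H in auto)
   ultimately show ?thesis by linarith
  qed
  \<comment> \<open>If the norm of \<open>f\<close> dominates the height, nonnegativity of
    \<open>u\<close> suffices; otherwise the threshold condition holds and \<open>fin\<close>
    applies.\<close>
  have "S <= (u y + N / D) / c3"
  proof (cases "N <= D * (c3 * S) & S > 0")
   case True
   hence "c3 * S <= u y" using fin by blast
   moreover have "0 <= N / D" using N D by simp
   ultimately have "c3 * S <= u y + N / D" by linarith
   thus ?thesis using c3 by (simp add: pos_le_divide_eq mult.commute)
  next
   case False
   hence "D * (c3 * S) <= N" using S0 N by auto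
   hence "c3 * S <= N / D" using D by (simp add: pos_le_divide_eq mult.commute)
   hence "c3 * S <= u y + N / D" using u0[OF yQ] by linarith
   thus ?thesis using c3 by (simp add: pos_le_divide_eq mult.commute)
  qed
  hence "4^g * S <= 4^g * ((u y + N / D) / c3)" by (intro mult_left_mono) auto
  also have "... = 4^g / c3 * (u y + N / D)" by simp
  also have "... <= 4^g / c3 * ((1 + 1 / D) * (u y + N))"
  proof (rule mult_left_mono)
   have "0 <= u y / D" "0 <= N" using u0[OF yQ] N D by simp_all
   thus "u y + N / D <= (1 + 1 / D) * (u y + N)" by (simp add: algebra_simps)
  qed (use c3 in simp)
  also have "... = C * (u y + N)" by (simp add: C_def)
  finally show ?thesis using uS by linarith
 qed
 show ?thesis unfolding harnack_const_def by (rule exI[of _ C], intro conjI allI impI ballI C main) auto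
qed

section \<open>Passage to Borel data and conclusion\<close>

lemma Q_dom_borel: "(Q_dom :: ((real^'n)*real) set) : sets borel"
 unfolding Q_dom_def cyl_def cube_def by (simp add: borel_Times)

text \<open>The absolute value is extended by zero and replaced by a Borel representative. The norm
  is preserved exactly, so the constant depends on the norm that appears in the statement.\<close>

lemma Lp_wfun:
 fixes h :: "(real^'n)*real => real"
 assumes h: "h : Lp r Q_dom" and r: "r > 0"
 obtains H where "wfun r (Lp_norm r Q_dom h powr r) H" "AEL z. z : Q_dom --> H z = abs (h z)"
proof -
 let ?k = "%z. indicator Q_dom z * abs (h z)"
 have Q: "(Q_dom :: ((real^'n)*real) set) : sets lebesgue" using Q_dom_borel by (intro sets_completionI_sets) simp
 have hm: "h : borel_measurable (lebesgue_on Q_dom)" and hi: "integrable (lebesgue_on Q_dom) (%z. abs (h z) powr r)"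
  using h by (auto simp: Lp_def)
 have "(%z. abs (h z)) : borel_measurable (lebesgue_on Q_dom)" using hm by simp
 hence "?k : borel_measurable lebesgue"
  using Q borel_measurable_restrict_space_iff[of Q_dom lebesgue "%z. abs (h z)"] by (simp add: mult.commute)
 from completion_ex_borel_measurable_real[OF this] obtain g where
  g: "g : borel_measurable lborel" "AEL z. ?k z = g z" by auto
 have kp: "?k z powr r = indicator Q_dom z *R (abs (h z)) powr r" for z by (simp add: indicator_def)
 have ik: "integrable lebesgue (%z. ?k z powr r)" "(LINT z|lebesgue. ?k z powr r) = (LINT z|lebesgue_on Q_dom. abs (h z) powr r)"
  unfolding kp using hi Q integrable_restrict_space[of Q_dom lebesgue "%z. abs (h z) powr r"] integral_restrict_space[of Q_dom lebesgue "%z. abs (h z) powr r"] by simp_all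
 have gk: "AE z in lebesgue. abs (g z) powr r = ?k z powr r"
  using AE_completion[OF g(2)]
 proof eventually_elim
  case (elim z)
  have "0 <= ?k z" by simp
  thus ?case unfolding elim by simp
 qed
 have gm: "(%z. abs (g z) powr r) : borel_measurable lborel" using g(1) by simp
 have gm': "(%z. abs (g z) powr r) : borel_measurable lebesgue" using gm by (rule measurable_completion)
 have "integrable lebesgue (%z. abs (g z) powr r)" by (rule integrable_cong_AE_imp[OF ik(1) gm']) (use gk in auto)
 hence ig: "intl (%z. abs (g z) powr r)" using gm by (simp add: integrable_completion)
 have "(LI z. abs (g z) powr r) = (LINT z|lebesgue. abs (g z) powr r)" using gm by (simp add: integral_completion)
 also have "... = (LINT z|lebesgue. ?k z powr r)" using ik(1) gm' gk by (intro integral_cong_AE) auto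
 also have "... = Lp_norm r Q_dom h powr r"
 proof -
  have "0 <= (LINT z|lebesgue_on Q_dom. abs (h z) powr r)" by (rule int_nonneg) simp
  thus ?thesis using r unfolding ik(2) by (simp add: Lp_norm_def powr_powr)
 qed
 finally have "wfun r (Lp_norm r Q_dom h powr r) (%z. abs (g z))" using g(1) ig by (simp add: wfun_def)
 moreover have "AEL z. z : Q_dom --> abs (g z) = abs (h z)" using g(2) by eventually_elim (auto simp: indicator_def)
 ultimately show ?thesis by (rule that)
qed

theorem corollary4p6:
  fixes lam Lam p1 p q :: real
  assumes "0 < lam" and "lam \<le> Lam"
    and "ABP_threshold TYPE('n::finite) lam Lam p1"
    and "q > real CARD('n) + 2" and "p1 < p" and "p \<le> q"
  shows "\<exists>C4 :: real \<Rightarrow> real. (\<forall>m. C4 m > 0) \<and>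
    (\<forall>f \<mu> (G :: (real^'n) \<times> real \<Rightarrow> real^'n \<Rightarrow> real^'n^'n \<Rightarrow> real) u.
       f \<in> Lp p Q_dom \<and> \<mu> \<in> Lp q Q_dom \<and>
       measurable_nonlinearity Q_dom G \<and> structure_conditions lam Lam Q_dom \<mu> G \<and>
       continuous_on (closure Q_dom) u \<and> (\<forall>z\<in>closure Q_dom. 0 \<le> u z) \<and>
       Lp_visc_solution p (cube 10) 10 (\<lambda>z \<xi> X. G z \<xi> X - f z) u \<longrightarrow>
       (SUP z\<in>J3. u z)
         \<le> C4 (Lp_norm q Q_dom \<mu>) * ((INF z\<in>J2. u z) + Lp_norm p Q_dom f))"
proof -
 have abp: "ABP_solvable TYPE('n) lam Lam p" and p1: "(real CARD('n) + 2) / 2 <= p1" using assms unfolding ABP_threshold_def by auto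
 have n: "real CARD('n) >= 1" by (simp add: Suc_leI)
 have pq: "1 <= p" "p <= q" "real (hdim TYPE('n)) < q" "real (hdim TYPE('n)) < 2 * p" using p1 assms n by (simp_all add: hdim_def)
 \<comment> \<open>A constant is chosen for every real \<open>m\<close> in place of the norm of the
   drift; \<open>m powr q\<close> is the matching bound for the q-th power integral and is
   nonnegative for every \<open>m\<close>.\<close>
 have "ALL m. EX C>0. harnack_const TYPE('n) lam Lam p q (m powr q) C"
  using harnack[OF abp pq assms(1,2)] by simp
 from choice[OF this] obtain C4 where C4': "ALL m. 0 < C4 m & harnack_const TYPE('n) lam Lam p q (m powr q) (C4 m)" by (rule exE)
 note C4 = C4'[THEN spec, THEN conjunct1]
 note har = C4'[THEN spec, THEN conjunct2, unfolded harnack_const_def, THEN spec, THEN spec, THEN spec, THEN spec, THEN mp, THEN mp, THEN mp, THEN mp, THEN mp, THEN mp]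
 show ?thesis
 proof (intro exI[of _ C4] conjI allI impI C4)
  fix f mu and G :: "(real^'n)*real => real^'n => real^'n^'n => real" and u
  assume A: "f : Lp p Q_dom & mu : Lp q Q_dom &
   measurable_nonlinearity Q_dom G & structure_conditions lam Lam Q_dom mu G &
   continuous_on (closure Q_dom) u & (ALL z:closure Q_dom. 0 <= u z) &
   Lp_visc_solution p (cube 10) 10 (%z xi X. G z xi X - f z) u"
  hence sc: "structure_conditions lam Lam Q_dom mu G" and cu: "continuous_on (closure Q_dom) u" and u0: "ALL z:closure Q_dom. 0 <= u z"
   and vs: "Lp_visc_solution p (cube 10) 10 (%z xi X. G z xi X - f z) u" and fL: "f : Lp p Q_dom" and mL: "mu : Lp q Q_dom" by blast+
  have p0: "p > 0" "q > 0" using pq by auto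
  obtain F where F: "wfun p (Lp_norm p Q_dom f powr p) F" "AEL z. z : Q_dom --> F z = abs (f z)" using Lp_wfun[OF fL p0(1)] .
  obtain M where M: "wfun q (Lp_norm q Q_dom mu powr q) M" "AEL z. z : Q_dom --> M z = abs (mu z)" using Lp_wfun[OF mL p0(2)] .
  \<comment> \<open>Nonnegativity of the drift coefficient is forced by the structure condition at a
    vector of norm one.\<close>
  have mu0: "mu z >= 0" if "z : Q_dom" for z
  proof -
   have "abs (G z (axis undefined 1) 0) <= mu z * norm (axis undefined (1::real) :: real^'n)" using sc that unfolding structure_conditions_def by blast
   thus ?thesis by simp
  qed
  have ae: "AEL w. w : Q_dom --> M w = mu w & F w = abs (f w)"
   using F(2) M(2) by eventually_elim (use mu0 in auto)
  define N where "N = Lp_norm p Q_dom f"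
  define C where "C = C4 (Lp_norm q Q_dom mu)"
  have C: "C > 0" using C4 by (simp add: C_def)
  have N: "N >= 0" by (simp add: N_def Lp_norm_def)
  have all: "ALL z:J3. ALL y:J2. u z <= C * (u y + N)" unfolding C_def N_def
  proof (rule har[OF M(1) F(1)])
   show "0 <= Lp_norm p Q_dom f" using N by (simp add: N_def)
   show "supers lam Lam p M F u" "ALL K. supers lam Lam p M F (%z. K - u z)"
    by (rule visc_supers[OF vs sc cu p0(1) ae], rule allI, rule visc_supers[OF vs sc cu p0(1) ae])
  qed (rule u0)
  have ne: "(0, 1/2) : (J3 :: ((real^'n)*real) set)" "(0, 10) : (J2 :: ((real^'n)*real) set)"
   by (simp_all add: J3_def J2_def cube_def mem_box_cart)
  have "(SUP z\<in>J3. u z) <= C * ((INF z\<in>J2. u z) + N)"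
  proof (rule cSUP_least)
   fix z assume z: "z : (J3 :: ((real^'n)*real) set)"
   have "u z / C - N <= (INF z\<in>J2. u z)"
   proof (rule cINF_greatest)
    fix y assume "y : (J2 :: ((real^'n)*real) set)"
    hence "u z <= C * (u y + N)" using all z by blast
    hence "u z / C <= u y + N" using C by (simp add: pos_divide_le_eq mult.commute)
    thus "u z / C - N <= u y" by simp
   qed (use ne in blast)
   hence "u z / C <= (INF z\<in>J2. u z) + N" by simp
   thus "u z <= C * ((INF z\<in>J2. u z) + N)" using C by (simp add: pos_divide_le_eq mult.commute)
  qed (use ne in blast)
  thus "(SUP z\<in>J3. u z) <= C4 (Lp_norm q Q_dom mu) * ((INF z\<in>J2. u z) + Lp_norm p Q_dom f)" by (simp add: C_def N_def)
 qed
qed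

end
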